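(* Let $W$ be a spetsial reflection group, let $\chi$ be a (complex-valued) class function on $W$, and let $f$ be the truncated Lusztig Fourier transform on class functions of $W$. Then $\chi\equiv f(\chi)$, that is, $\chi$ and $f(\chi)$ are tower equivalent.
   Context: $W\subset\mathrm{GL}(V)$ is a finite complex reflection group on a finite-dimensional complex vector space $V$; $\mathrm{refl}(W)$ is its set of reflections. Tower equivalence. A flat is an intersection of reflecting hyperplanes of $W$; a parabolic subgroup is the fixator (pointwise stabilizer) in $W$ of a flat, and it is a reflection subgroup. A tower is a maximal chain $T=(\{1\}=W_0\subsetneq W_1\subsetneq\cdots\subsetneq W_n=W)$ of parabolic subgroups of $W$ (so $W_i$ is the fixator of a flat of codimension $i$). To $T$ associate $J_T^i=\sum_{s\in\mathrm{refl}(W_i)-\mathrm{refl}(W_{i-1})}s\in\mathbb C[W]$ for $i=1,\dots,n$, and the commutative subalgebra $\mathbb C[J_T]\subset\mathbb C[W]$ generated by $J_T^1,\dots,J_T^n$. Two class functions, extended linearly to $\mathbb C[W]$, are $T$-equivalent if they have the same restriction to $\mathbb C[J_T]$; they are tower equivalent, written $\equiv$, if they are $T$-equivalent for all towers $T$. Spetsial groups. Let $\zeta_e=\exp(2i\pi/e)$. The spetsial Hecke algebra $\mathcal H$ of $W$ is the quotient of the group algebra over $\mathbb C[q^{\pm1}]$ of the braid group of $W$ by the relations $(\mathbf s-q)(\mathbf s-\zeta_e)\cdots(\mathbf s-\zeta_e^{e-1})=0$ for every braid reflection $\mathbf s$ around a reflecting hyperplane $H$, where $e$ is the order of the pointwise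 stabilizer of $H$ in $W$. Standing assumption (trace conjecture of Broué–Malle–Michel): the generic Hecke algebra of $W$ (with indeterminate parameters) has a symmetrizing trace $\tau$ specializing to the canonical trace $w\mapsto\delta_{w,1}$ of the group algebra and with $\tau(T_{b^{-1}})^\vee=\tau(T_{b\boldsymbol\pi})/\tau(T_{\boldsymbol\pi})$ for all $b$ in the braid group ($T_b$ the image of $b$, $\boldsymbol\pi$ the full twist, $^\vee$ inverting the parameters); $\mathcal H$ carries its specialization, also denoted $\tau$. $\mathcal H$ splits over $\mathbb C[t^{\pm1}]$ with $t^m=q$ for some $m\ge 1$, and $t\mapsto1$ gives a bijection $\chi_t\mapsto\chi$ from irreducible characters of the split algebra to $\mathrm{Irr}(W)$; the Schur elements $S_\chi$ are defined by $\tau=\sum_\chi\chi_t/S_\chi$. $W$ is called spetsial if $S_{\mathbf 1}/S_\chi\in\mathbb C[q]$ for all $\chi\in\mathrm{Irr}(W)$, where $\mathbf 1$ is the trivial character. Parabolic subgroups of spetsial groups are spetsial. Rouquier families. Let $K$ be the field generated by the traces of the elements of $W$ on $V$, with ring of integers $\mathbb Z_K$. The Rouquier families are the classes of the partition of $\mathrm{Irr}(W)$ (identified with the irreducible characters of the split Hecke algebra) into blocks of the spetsial Hecke algebra taken over the ring $\mathbb Z_K[q^{\pm1},(q^n-1)^{-1}_{n\ge1}]$. Unipotent characters. To a spetsial group $W$ (the split spets $\mathbb G=(V,W)$) is attached a finite set $\mathrm{Uch}(\mathbb G)$ of unipotent characters, a basis of $\mathbb Z\mathrm{Uch}(\mathbb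 G)$ taken orthonormal for a pairing $\langle\ ,\ \rangle_{\mathbb G}$; there is a subset, the principal series $\{U_\chi\}_{\chi\in\mathrm{Irr}(W)}$ (indexed injectively); and there are elements $R^{\mathbb G}_{\mathbb T_w}(\mathbf 1)\in\mathbb Z\mathrm{Uch}(\mathbb G)$ for $w\in W$, depending only on the conjugacy class of $w$. If $W$ is a Weyl group, these are the unipotent characters of a split finite reductive group $\mathbf G^F$ with Weyl group $W$, with $U_\chi$ the principal series unipotent character indexed by $\chi$, $R^{\mathbb G}_{\mathbb T_w}(\mathbf 1)$ the Deligne–Lusztig character induced from the trivial character of a torus of type $w$, and the usual scalar product. Otherwise, for irreducible $W$, the data are those constructed by Malle ("Unipotente Grade imprimitiver komplexer Spiegelungsgruppen", J. Algebra 177 (1995), and "Spetses", Doc. Math. ICM 1998) for the imprimitive groups $G(e,1,n)$ and $G(e,e,n)$, and by Broué–Malle–Michel ("Split spetses for primitive reflection groups", Astérisque 359 (2014)) for primitive groups; for reducible $W$ they are obtained as products (external tensor products) over the irreducible factors. For a character $\theta=\sum_\psi n_\psi\psi$ of $W$ put $U_\theta=\sum_\psi n_\psi U_\psi$. Axioms of spetses. These data are taken to satisfy the axioms of spetses, in particular: (1) the matrix $F_{\chi,\psi}=\langle U_\chi,|W|^{-1}\sum_{w\in W}\psi(w)R^{\mathbb G}_{\mathbb T_w}(\mathbf 1)\rangle_{\mathbb G}$, for $\chi,\psi\in\mathrm{Irr}(W)$, is symmetric. (2) The blocks of the Fourier matrix (the Lusztig families) coincide with the Rouquier families; in particular $F_{\chi,\psi}=0$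 unless $\chi$ and $\psi$ lie in the same Rouquier family. (3) For every parabolic subgroup $W'$ of $W$, with corresponding split Levi $\mathbb G'=(V,W')$, there is a Lusztig induction $R^{\mathbb G}_{\mathbb G'}:\mathbb Z\mathrm{Uch}(\mathbb G')\to\mathbb Z\mathrm{Uch}(\mathbb G)$ with adjoint ${}^*R^{\mathbb G}_{\mathbb G'}$ (Lusztig restriction); transitivity holds, $R^{\mathbb G}_{\mathbb G'}(R^{\mathbb G'}_{\mathbb T_w}(\mathbf 1))=R^{\mathbb G}_{\mathbb T_w}(\mathbf 1)$ for $w\in W'$; and ${}^*R^{\mathbb G}_{\mathbb G'}U_\chi=U_{\mathrm{Res}^W_{W'}\chi}$ for $\chi\in\mathrm{Irr}(W)$. Truncated Lusztig Fourier transform. $f$ is the linear operator on complex class functions on $W$ determined by $f(\chi)(w)=\langle U_\chi,R^{\mathbb G}_{\mathbb T_w}(\mathbf 1)\rangle_{\mathbb G}$ for $\chi\in\mathrm{Irr}(W)$, $w\in W$. *)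

theory Defs
  imports
    "HOL-Analysis.Analysis"
    "HOL-Algebra.QuotRing"
    "HOL-Algebra.Generated_Groups"
    "HOL-Library.Poly_Mapping"
    "HOL-Computational_Algebra.Computational_Algebra"
    "Jordan_Normal_Form.Matrix"
begin

section \<open>Complex reflection groups, flats, parabolic subgroups\<close>

text \<open>\<open>V\<close> is the space \<open>complex ^ 'n\<close>, and elements of \<open>GL(V)\<close> are square matrices of type
  \<open>complex ^ 'n ^ 'n\<close>. The name \<open>mat\<close> is qualified because the theory of matrices over
  \<open>nat\<close>-indexed dimensions uses it as well.\<close>

type_synonym 'n cmat = "complex ^ 'n ^ 'n"

abbreviation I1 :: "('n::finite) cmat" where
  "I1 \<equiv> Finite_Cartesian_Product.mat 1"

definition mat_group :: "('n::finite) cmat set \<Rightarrow> 'n cmat monoid" where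
  "mat_group W = \<lparr>carrier = W, monoid.mult = (**), one = I1\<rparr>"

definition fixspace :: "('n::finite) cmat \<Rightarrow> (complex ^ 'n) set" where
  "fixspace s = {x. s *v x = x}"

definition refl :: "('n::finite) cmat set \<Rightarrow> 'n cmat set" where
  "refl W = {s \<in> W. vec.dim (fixspace s) + 1 = CARD('n)}"

definition complex_reflection_group :: "('n::finite) cmat set \<Rightarrow> bool" where
  "complex_reflection_group W \<longleftrightarrow>
     finite W \<and> group (mat_group W) \<and> generate (mat_group W) (refl W) = W"

definition hyperplanes :: "('n::finite) cmat set \<Rightarrow> (complex ^ 'n) set set" where
  "hyperplanes W = fixspace ` refl W"

definition flats :: "('n::finite) cmat set \<Rightarrow> (complex ^ 'n) set set" where
  "flats W = {\<Inter>S | S. S \<subseteq> hyperplanes W}"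

definition fixator :: "('n::finite) cmat set \<Rightarrow> (complex ^ 'n) set \<Rightarrow> 'n cmat set" where
  "fixator W X = {w \<in> W. \<forall>x\<in>X. w *v x = x}"

definition parabolics :: "('n::finite) cmat set \<Rightarrow> 'n cmat set set" where
  "parabolics W = fixator W ` flats W"

section \<open>Characters and class functions\<close>

text \<open>A set \<open>S\<close> of \<open>d\<close> by \<open>d\<close> matrices acts irreducibly on column vectors.\<close>

definition irreducible_mats :: "nat \<Rightarrow> 'k::field mat set \<Rightarrow> bool" where
  "irreducible_mats d S \<longleftrightarrow> d > 0 \<and>
     (\<forall>U. U \<subseteq> carrier_vec d \<and> 0\<^sub>v d \<in> U \<and> (\<forall>u\<in>U. \<forall>v\<in>U. u + v \<in> U) \<and>
          (\<forall>c. \<forall>u\<in>U. c \<cdot>\<^sub>v u \<in> U) \<and> (\<forall>A\<in>S. \<forall>u\<in>U. A *\<^sub>v u \<in> U)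
        \<longrightarrow> U = {0\<^sub>v d} \<or> U = carrier_vec d)"

definition mat_trace :: "'k::comm_monoid_add mat \<Rightarrow> 'k" where
  "mat_trace A = (\<Sum>i<dim_row A. A $$ (i, i))"

definition group_rep :: "('b, 'z) monoid_scheme \<Rightarrow> nat \<Rightarrow> ('b \<Rightarrow> 'k::field mat) \<Rightarrow> bool" where
  "group_rep G d \<rho> \<longleftrightarrow>
     (\<forall>g\<in>carrier G. \<rho> g \<in> carrier_mat d d) \<and> \<rho> \<one>\<^bsub>G\<^esub> = 1\<^sub>m d \<and>
     (\<forall>g\<in>carrier G. \<forall>h\<in>carrier G. \<rho> (g \<otimes>\<^bsub>G\<^esub> h) = \<rho> g * \<rho> h)"

text \<open>Functions on \<open>W\<close> are extended by \<open>0\<close> to all matrices, so that equality of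
  functions on \<open>W\<close> is equality in HOL.\<close>

definition Irr :: "('n::finite) cmat set \<Rightarrow> ('n cmat \<Rightarrow> complex) set" where
  "Irr W = {\<lambda>w. if w \<in> W then mat_trace (\<rho> w) else 0 | d \<rho>.
              group_rep (mat_group W) d \<rho> \<and> irreducible_mats d (\<rho> ` W)}"

definition triv_char :: "('n::finite) cmat set \<Rightarrow> 'n cmat \<Rightarrow> complex" where
  "triv_char W = (\<lambda>w. if w \<in> W then 1 else 0)"

definition class_functions :: "('n::finite) cmat set \<Rightarrow> ('n cmat \<Rightarrow> complex) set" where
  "class_functions W = {\<theta>. (\<forall>w. w \<notin> W \<longrightarrow> \<theta> w = 0) \<and>
     (\<forall>g\<in>W. \<forall>w\<in>W. \<theta> (g ** w ** matrix_inv g) = \<theta> w)}"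

section \<open>Group algebras and tower equivalence\<close>

text \<open>The group algebra of \<open>G\<close> over a subring \<open>R\<close> of the type \<open>'k\<close>.\<close>

definition group_algebra ::
  "'k::comm_ring_1 set \<Rightarrow> ('b, 'z) monoid_scheme \<Rightarrow> ('b \<Rightarrow> 'k) ring" where
  "group_algebra R G =
     \<lparr>carrier = {f. finite {b. f b \<noteq> 0} \<and> {b. f b \<noteq> 0} \<subseteq> carrier G \<and> range f \<subseteq> R},
      monoid.mult = (\<lambda>f g z. \<Sum>(x, y) | f x \<noteq> 0 \<and> g y \<noteq> 0 \<and> x \<otimes>\<^bsub>G\<^esub> y = z. f x * g y),
      one = (\<lambda>z. if z = \<one>\<^bsub>G\<^esub> then 1 else 0),
      zero = (\<lambda>z. 0),
      add = (\<lambda>f g z. f z + g z)\<rparr>"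

definition single_elt :: "'k::zero \<Rightarrow> 'b \<Rightarrow> 'b \<Rightarrow> 'k" where
  "single_elt c b = (\<lambda>z. if z = b then c else 0)"

text \<open>The linear extension of a function on the group to the group algebra.\<close>

definition lin_ext :: "('b \<Rightarrow> 'k::comm_ring_1) \<Rightarrow> ('b \<Rightarrow> 'k) \<Rightarrow> 'k" where
  "lin_ext \<theta> a = (\<Sum>b | a b \<noteq> 0. a b * \<theta> b)"

definition tower :: "('n::finite) cmat set \<Rightarrow> nat \<Rightarrow> (nat \<Rightarrow> 'n cmat set) \<Rightarrow> bool" where
  "tower W n T \<longleftrightarrow> T 0 = {I1} \<and> T n = W \<and> (\<forall>i<n. T i \<subset> T (Suc i)) \<and>
     subset.maxchain (parabolics W) (T ` {..n})"

definition tower_J :: "(nat \<Rightarrow> ('n::finite) cmat set) \<Rightarrow> nat \<Rightarrow> 'n cmat \<Rightarrow> complex" where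
  "tower_J T i = (\<lambda>w. if w \<in> refl (T i) - refl (T (i - 1)) then 1 else 0)"

inductive_set tower_algebra ::
  "('n::finite) cmat set \<Rightarrow> nat \<Rightarrow> (nat \<Rightarrow> 'n cmat set) \<Rightarrow> ('n cmat \<Rightarrow> complex) set"
  for W n T where
    gen: "i \<in> {1..n} \<Longrightarrow> tower_J T i \<in> tower_algebra W n T"
  | unit: "\<one>\<^bsub>group_algebra UNIV (mat_group W)\<^esub> \<in> tower_algebra W n T"
  | scale: "a \<in> tower_algebra W n T \<Longrightarrow> (\<lambda>w. c * a w) \<in> tower_algebra W n T"
  | add: "a \<in> tower_algebra W n T \<Longrightarrow> b \<in> tower_algebra W n T \<Longrightarrow>
      a \<oplus>\<^bsub>group_algebra UNIV (mat_group W)\<^esub> b \<in> tower_algebra W n T"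
  | mult: "a \<in> tower_algebra W n T \<Longrightarrow> b \<in> tower_algebra W n T \<Longrightarrow>
      a \<otimes>\<^bsub>group_algebra UNIV (mat_group W)\<^esub> b \<in> tower_algebra W n T"

definition T_equivalent ::
  "('n::finite) cmat set \<Rightarrow> nat \<Rightarrow> (nat \<Rightarrow> 'n cmat set) \<Rightarrow>
     ('n cmat \<Rightarrow> complex) \<Rightarrow> ('n cmat \<Rightarrow> complex) \<Rightarrow> bool" where
  "T_equivalent W n T \<theta> \<psi> \<longleftrightarrow> (\<forall>a\<in>tower_algebra W n T. lin_ext \<theta> a = lin_ext \<psi> a)"

definition tower_equivalent ::
  "('n::finite) cmat set \<Rightarrow> ('n cmat \<Rightarrow> complex) \<Rightarrow> ('n cmat \<Rightarrow> complex) \<Rightarrow> bool" where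
  "tower_equivalent W \<theta> \<psi> \<longleftrightarrow> (\<forall>n T. tower W n T \<longrightarrow> T_equivalent W n T \<theta> \<psi>)"

section \<open>The braid group\<close>

definition regular :: "('n::finite) cmat set \<Rightarrow> (complex ^ 'n) set" where
  "regular W = UNIV - \<Union>(hyperplanes W)"

text \<open>\<open>W\<close> acts freely on the regular vectors, so a loop based at the image of \<open>x0\<close> in the
  orbit space of \<open>regular W\<close> lifts uniquely to a path from \<open>x0\<close> to some \<open>w x0\<close>. An element of
  the braid group (the fundamental group of the orbit space) is thus a pair \<open>(w, c)\<close> with \<open>c\<close> a
  homotopy class, with fixed end points, of paths from \<open>x0\<close> to \<open>w x0\<close> in \<open>regular W\<close>. The
  first component is the projection of the braid group to \<open>W\<close>.\<close>

type_synonym 'n braid = "'n cmat \<times> (real \<Rightarrow> complex ^ 'n) set"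

definition path_class ::
  "('n::finite) cmat set \<Rightarrow> (real \<Rightarrow> complex ^ 'n) \<Rightarrow> (real \<Rightarrow> complex ^ 'n) set" where
  "path_class W \<gamma> = {\<delta>. homotopic_paths (regular W) \<gamma> \<delta>}"

definition braid_group ::
  "('n::finite) cmat set \<Rightarrow> complex ^ 'n \<Rightarrow> 'n braid monoid" where
  "braid_group W x0 =
     \<lparr>carrier = {(w, path_class W \<gamma>) | w \<gamma>. w \<in> W \<and> path \<gamma> \<and> path_image \<gamma> \<subseteq> regular W \<and>
                    pathstart \<gamma> = x0 \<and> pathfinish \<gamma> = w *v x0},
      monoid.mult = (\<lambda>(w, c) (w', c').
        (w ** w', {\<delta>. \<exists>\<gamma>\<in>c. \<exists>\<gamma>'\<in>c'. homotopic_paths (regular W) (\<gamma> +++ (\<lambda>t. w *v \<gamma>' t)) \<delta>})),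
      one = (I1, path_class W (\<lambda>t. x0))\<rparr>"

definition full_twist :: "('n::finite) cmat set \<Rightarrow> complex ^ 'n \<Rightarrow> 'n braid" where
  "full_twist W x0 = (I1, path_class W (\<lambda>t. cis (2 * pi * t) *s x0))"

text \<open>The order \<open>e\<close> of the pointwise stabilizer of a hyperplane, and \<open>\<zeta>\<^sub>e\<close>.\<close>

definition hyp_order :: "('n::finite) cmat set \<Rightarrow> (complex ^ 'n) set \<Rightarrow> nat" where
  "hyp_order W H = card (fixator W H)"

definition zeta :: "nat \<Rightarrow> complex" where
  "zeta e = exp (2 * \<i> * of_real pi / of_nat e)"

text \<open>Braid reflections around \<open>H\<close>: follow \<open>\<gamma>\<close> from \<open>x0\<close> to a point \<open>y + v\<close> close to a generic
  point \<open>y\<close> of \<open>H\<close>, turn by the angle \<open>2\<pi>/e\<close> around \<open>H\<close> in the direction of the \<open>\<zeta>\<^sub>e\<close>-eigenline of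
  the distinguished reflection \<open>s\<close>, and go back along the image of \<open>\<gamma>\<close> under \<open>s\<close>. The point
  \<open>y + v\<close> is close enough to \<open>y\<close> in that the disc of centre \<open>y\<close> through it in the direction
  of \<open>v\<close> meets the hyperplanes only at \<open>y\<close>, which lies on \<open>H\<close> only.\<close>

definition braid_reflection ::
  "('n::finite) cmat set \<Rightarrow> complex ^ 'n \<Rightarrow> (complex ^ 'n) set \<Rightarrow> 'n braid \<Rightarrow> bool" where
  "braid_reflection W x0 H b \<longleftrightarrow> H \<in> hyperplanes W \<and>
     (\<exists>s \<gamma> y v. s \<in> fixator W H \<and> v \<noteq> 0 \<and> s *v v = zeta (hyp_order W H) *s v \<and>
        y \<in> H \<and> (\<forall>H'\<in>hyperplanes W. H' \<noteq> H \<longrightarrow> y \<notin> H') \<and>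
        (\<forall>z. 0 < cmod z \<and> cmod z \<le> 1 \<longrightarrow> y + z *s v \<in> regular W) \<and>
        path \<gamma> \<and> path_image \<gamma> \<subseteq> regular W \<and> pathstart \<gamma> = x0 \<and> pathfinish \<gamma> = y + v \<and>
        b = (s, path_class W
          (\<gamma> +++ (\<lambda>t. y + cis (2 * pi * t / of_nat (hyp_order W H)) *s v) +++
           reversepath (\<lambda>t. s *v \<gamma> t))))"

section \<open>Hecke algebras\<close>

text \<open>Parameters \<open>u (C, j)\<close> are indexed by the orbits \<open>C\<close> of hyperplanes and by \<open>j < e\<close>.\<close>

type_synonym 'n hidx = "(complex ^ 'n) set set \<times> nat"

definition hyp_orbit :: "('n::finite) cmat set \<Rightarrow> (complex ^ 'n) set \<Rightarrow> (complex ^ 'n) set set" where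
  "hyp_orbit W H = (\<lambda>w. (*v) w ` H) ` W"

definition hidx_set :: "('n::finite) cmat set \<Rightarrow> 'n hidx set" where
  "hidx_set W = {(hyp_orbit W H, j) | H j. H \<in> hyperplanes W \<and> j < hyp_order W H}"

definition orbit_order :: "('n::finite) cmat set \<Rightarrow> (complex ^ 'n) set set \<Rightarrow> nat" where
  "orbit_order W C = the_elem (hyp_order W ` C)"

text \<open>\<open>(b - u 0) (b - u 1) \<cdots> (b - u (e - 1))\<close> in the group algebra of the braid group.\<close>

definition hecke_relator ::
  "'k::comm_ring_1 set \<Rightarrow> ('n hidx \<Rightarrow> 'k) \<Rightarrow> ('n::finite) cmat set \<Rightarrow> complex ^ 'n \<Rightarrow>
     (complex ^ 'n) set \<Rightarrow> 'n braid \<Rightarrow> 'n braid \<Rightarrow> 'k" where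
  "hecke_relator R u W x0 H b =
     (let B = braid_group W x0; A = group_algebra R B in
      foldr (\<lambda>j a. (single_elt 1 b \<ominus>\<^bsub>A\<^esub> single_elt (u (hyp_orbit W H, j)) \<one>\<^bsub>B\<^esub>) \<otimes>\<^bsub>A\<^esub> a)
        [0..<hyp_order W H] \<one>\<^bsub>A\<^esub>)"

definition hecke_ideal ::
  "'k::comm_ring_1 set \<Rightarrow> ('n hidx \<Rightarrow> 'k) \<Rightarrow> ('n::finite) cmat set \<Rightarrow> complex ^ 'n \<Rightarrow>
     ('n braid \<Rightarrow> 'k) set" where
  "hecke_ideal R u W x0 =
     Idl\<^bsub>group_algebra R (braid_group W x0)\<^esub>
       {hecke_relator R u W x0 H b | H b. braid_reflection W x0 H b}"

definition hecke ::
  "'k::comm_ring_1 set \<Rightarrow> ('n hidx \<Rightarrow> 'k) \<Rightarrow> ('n::finite) cmat set \<Rightarrow> complex ^ 'n \<Rightarrow>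
     ('n braid \<Rightarrow> 'k) set ring" where
  "hecke R u W x0 = group_algebra R (braid_group W x0) Quot hecke_ideal R u W x0"

definition hecke_class ::
  "'k::comm_ring_1 set \<Rightarrow> ('n hidx \<Rightarrow> 'k) \<Rightarrow> ('n::finite) cmat set \<Rightarrow> complex ^ 'n \<Rightarrow>
     ('n braid \<Rightarrow> 'k) \<Rightarrow> ('n braid \<Rightarrow> 'k) set" where
  "hecke_class R u W x0 a = hecke_ideal R u W x0 +>\<^bsub>group_algebra R (braid_group W x0)\<^esub> a"

text \<open>The image \<open>T\<^sub>b\<close> of a braid \<open>b\<close>, and the structure map of the algebra.\<close>

definition hecke_T ::
  "'k::comm_ring_1 set \<Rightarrow> ('n hidx \<Rightarrow> 'k) \<Rightarrow> ('n::finite) cmat set \<Rightarrow> complex ^ 'n \<Rightarrow>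
     'n braid \<Rightarrow> ('n braid \<Rightarrow> 'k) set" where
  "hecke_T R u W x0 b = hecke_class R u W x0 (single_elt 1 b)"

definition hecke_scal ::
  "'k::comm_ring_1 set \<Rightarrow> ('n hidx \<Rightarrow> 'k) \<Rightarrow> ('n::finite) cmat set \<Rightarrow> complex ^ 'n \<Rightarrow>
     'k \<Rightarrow> ('n braid \<Rightarrow> 'k) set" where
  "hecke_scal R u W x0 c = hecke_class R u W x0 (single_elt c \<one>\<^bsub>braid_group W x0\<^esub>)"

section \<open>Symmetrizing traces and the trace conjecture\<close>

text \<open>\<open>A\<close> is an algebra over the subring \<open>R\<close> of \<open>'k\<close> with structure map \<open>sc\<close>.\<close>

definition linear_form ::
  "'k::comm_ring_1 set \<Rightarrow> ('a, 'z) ring_scheme \<Rightarrow> ('k \<Rightarrow> 'a) \<Rightarrow> ('a \<Rightarrow> 'k) \<Rightarrow> bool" where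
  "linear_form R A sc l \<longleftrightarrow> l ` carrier A \<subseteq> R \<and>
     (\<forall>x\<in>carrier A. \<forall>y\<in>carrier A. l (x \<oplus>\<^bsub>A\<^esub> y) = l x + l y) \<and>
     (\<forall>c\<in>R. \<forall>x\<in>carrier A. l (sc c \<otimes>\<^bsub>A\<^esub> x) = c * l x)"

definition free_fg ::
  "'k::comm_ring_1 set \<Rightarrow> ('a, 'z) ring_scheme \<Rightarrow> ('k \<Rightarrow> 'a) \<Rightarrow> bool" where
  "free_fg R A sc \<longleftrightarrow> (\<exists>E. finite E \<and> E \<subseteq> carrier A \<and>
     (\<forall>x\<in>carrier A. \<exists>!c. c \<in> E \<rightarrow>\<^sub>E R \<and> x = (\<Oplus>\<^bsub>A\<^esub>e\<in>E. sc (c e) \<otimes>\<^bsub>A\<^esub> e)))"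

definition symmetrizing_trace ::
  "'k::comm_ring_1 set \<Rightarrow> ('a, 'z) ring_scheme \<Rightarrow> ('k \<Rightarrow> 'a) \<Rightarrow> ('a \<Rightarrow> 'k) \<Rightarrow> bool" where
  "symmetrizing_trace R A sc \<tau> \<longleftrightarrow> free_fg R A sc \<and> linear_form R A sc \<tau> \<and>
     (\<forall>x\<in>carrier A. \<forall>y\<in>carrier A. \<tau> (x \<otimes>\<^bsub>A\<^esub> y) = \<tau> (y \<otimes>\<^bsub>A\<^esub> x)) \<and>
     (\<forall>l. linear_form R A sc l \<longrightarrow>
        (\<exists>!x. x \<in> carrier A \<and> (\<forall>y\<in>carrier A. l y = \<tau> (x \<otimes>\<^bsub>A\<^esub> y))))"

text \<open>Laurent polynomials over the integers: monomials are finitely supported integer exponent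
  vectors.\<close>

type_synonym 'i laurent = "('i \<Rightarrow>\<^sub>0 int) \<Rightarrow>\<^sub>0 int"

definition laurent_ring :: "'i set \<Rightarrow> 'i laurent set" where
  "laurent_ring S = {p. \<forall>k\<in>Poly_Mapping.keys p. Poly_Mapping.keys k \<subseteq> S}"

definition laurent_var :: "'i \<Rightarrow> 'i laurent" where
  "laurent_var i = Poly_Mapping.single (Poly_Mapping.single i 1) 1"

text \<open>The ring involution inverting all variables.\<close>

definition laurent_dual :: "'i laurent \<Rightarrow> 'i laurent" where
  "laurent_dual p = Poly_Mapping.map_key uminus p"

definition laurent_eval :: "('i \<Rightarrow> 'k::field) \<Rightarrow> 'i laurent \<Rightarrow> 'k" where
  "laurent_eval v p =
     (\<Sum>k\<in>Poly_Mapping.keys p. of_int (Poly_Mapping.lookup p k) * (\<Prod>i\<in>Poly_Mapping.keys k. v i powi Poly_Mapping.lookup k i))"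

definition group_param :: "('n::finite) cmat set \<Rightarrow> 'n hidx \<Rightarrow> complex" where
  "group_param W = (\<lambda>(C, j). zeta (orbit_order W C) ^ j)"

text \<open>The trace \<open>\<tau>\<close> is a function on the generic Hecke algebra over the ring of integral Laurent
  polynomials in the parameters.\<close>

abbreviation generic_hecke ::
  "('n::finite) cmat set \<Rightarrow> complex ^ 'n \<Rightarrow> ('n braid \<Rightarrow> 'n hidx laurent) set ring" where
  "generic_hecke W x0 \<equiv> hecke (laurent_ring (hidx_set W)) laurent_var W x0"

abbreviation generic_T ::
  "('n::finite) cmat set \<Rightarrow> complex ^ 'n \<Rightarrow> 'n braid \<Rightarrow> ('n braid \<Rightarrow> 'n hidx laurent) set" where
  "generic_T W x0 \<equiv> hecke_T (laurent_ring (hidx_set W)) laurent_var W x0"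

definition bmm_trace ::
  "('n::finite) cmat set \<Rightarrow> complex ^ 'n \<Rightarrow>
     (('n braid \<Rightarrow> 'n hidx laurent) set \<Rightarrow> 'n hidx laurent) \<Rightarrow> bool" where
  "bmm_trace W x0 \<tau> \<longleftrightarrow>
     (let B = braid_group W x0; \<pi> = full_twist W x0; T = generic_T W x0 in
      symmetrizing_trace (laurent_ring (hidx_set W)) (generic_hecke W x0)
        (hecke_scal (laurent_ring (hidx_set W)) laurent_var W x0) \<tau> \<and>
      (\<forall>b\<in>carrier B. laurent_eval (group_param W) (\<tau> (T b)) = (if fst b = I1 then 1 else 0)) \<and>
      \<tau> (T \<pi>) \<noteq> 0 \<and>
      (\<forall>b\<in>carrier B.
         laurent_dual (\<tau> (T (inv\<^bsub>B\<^esub> b))) * \<tau> (T \<pi>) = \<tau> (T (b \<otimes>\<^bsub>B\<^esub> \<pi>))))"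

section \<open>The spetsial Hecke algebra\<close>

text \<open>All rings of coefficients of the spetsial algebra are subrings of the field \<open>\<complex>(t)\<close>,
  with \<open>q = t ^ m\<close>.\<close>

type_synonym Ct = "complex poly fract"

definition Ct_const :: "complex \<Rightarrow> Ct" where
  "Ct_const c = to_fract [:c:]"

definition Ct_q :: "nat \<Rightarrow> Ct" where
  "Ct_q m = to_fract (monom 1 m)"

definition spetsial_param :: "nat \<Rightarrow> ('n::finite) cmat set \<Rightarrow> 'n hidx \<Rightarrow> Ct" where
  "spetsial_param m W =
     (\<lambda>(C, j). if j = 0 then Ct_q m else Ct_const (zeta (orbit_order W C) ^ j))"

abbreviation spetsial_hecke ::
  "Ct set \<Rightarrow> nat \<Rightarrow> ('n::finite) cmat set \<Rightarrow> complex ^ 'n \<Rightarrow> ('n braid \<Rightarrow> Ct) set ring" where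
  "spetsial_hecke R m W x0 \<equiv> hecke R (spetsial_param m W) W x0"

abbreviation spetsial_T ::
  "Ct set \<Rightarrow> nat \<Rightarrow> ('n::finite) cmat set \<Rightarrow> complex ^ 'n \<Rightarrow> 'n braid \<Rightarrow> ('n braid \<Rightarrow> Ct) set" where
  "spetsial_T R m W x0 \<equiv> hecke_T R (spetsial_param m W) W x0"

definition algebra_rep ::
  "('a, 'z) ring_scheme \<Rightarrow> ('k::field \<Rightarrow> 'a) \<Rightarrow> nat \<Rightarrow> ('a \<Rightarrow> 'k mat) \<Rightarrow> bool" where
  "algebra_rep A sc d \<phi> \<longleftrightarrow>
     (\<forall>x\<in>carrier A. \<phi> x \<in> carrier_mat d d) \<and> \<phi> \<one>\<^bsub>A\<^esub> = 1\<^sub>m d \<and>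
     (\<forall>x\<in>carrier A. \<forall>y\<in>carrier A. \<phi> (x \<oplus>\<^bsub>A\<^esub> y) = \<phi> x + \<phi> y) \<and>
     (\<forall>x\<in>carrier A. \<forall>y\<in>carrier A. \<phi> (x \<otimes>\<^bsub>A\<^esub> y) = \<phi> x * \<phi> y) \<and>
     (\<forall>c. \<phi> (sc c) = c \<cdot>\<^sub>m 1\<^sub>m d)"

definition spetsial_irrep ::
  "nat \<Rightarrow> ('n::finite) cmat set \<Rightarrow> complex ^ 'n \<Rightarrow> nat \<Rightarrow> (('n braid \<Rightarrow> Ct) set \<Rightarrow> Ct mat) \<Rightarrow> bool"
  where
  "spetsial_irrep m W x0 d \<phi> \<longleftrightarrow>
     algebra_rep (spetsial_hecke UNIV m W x0) (hecke_scal UNIV (spetsial_param m W) W x0) d \<phi> \<and>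
     irreducible_mats d (\<phi> ` carrier (spetsial_hecke UNIV m W x0))"

text \<open>Characters of the spetsial algebra over \<open>\<complex>(t)\<close> are given by their values on the \<open>T\<^sub>b\<close>; the
  value on the image of an element \<open>a\<close> of the group algebra is then \<open>lin_ext \<theta>t a\<close>.\<close>

definition spetsial_Irr ::
  "nat \<Rightarrow> ('n::finite) cmat set \<Rightarrow> complex ^ 'n \<Rightarrow> ('n braid \<Rightarrow> Ct) set" where
  "spetsial_Irr m W x0 =
     {\<lambda>b. if b \<in> carrier (braid_group W x0) then mat_trace (\<phi> (spetsial_T UNIV m W x0 b)) else 0
        | d \<phi>. spetsial_irrep m W x0 d \<phi>}"

text \<open>The values of \<open>\<theta>t\<close> are Laurent polynomials in \<open>t\<close>, and \<open>t \<mapsto> 1\<close> maps \<open>\<theta>t\<close> to \<open>\<theta>\<close>.\<close>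

definition specializes ::
  "('n::finite) cmat set \<Rightarrow> complex ^ 'n \<Rightarrow> ('n braid \<Rightarrow> Ct) \<Rightarrow> ('n cmat \<Rightarrow> complex) \<Rightarrow> bool" where
  "specializes W x0 \<theta>t \<theta> \<longleftrightarrow>
     (\<forall>b\<in>carrier (braid_group W x0).
        \<exists>p k. \<theta>t b = to_fract p / to_fract (monom 1 k) \<and> poly p 1 = \<theta> (fst b))"

definition spetsial_splits ::
  "nat \<Rightarrow> ('n::finite) cmat set \<Rightarrow> complex ^ 'n \<Rightarrow> bool" where
  "spetsial_splits m W x0 \<longleftrightarrow>
     (\<forall>d \<phi>. spetsial_irrep m W x0 d \<phi> \<longrightarrow>
        (\<forall>X\<in>carrier_mat d d.
           (\<forall>x\<in>carrier (spetsial_hecke UNIV m W x0). X * \<phi> x = \<phi> x * X) \<longrightarrow>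
           (\<exists>c. X = c \<cdot>\<^sub>m 1\<^sub>m d))) \<and>
     (\<forall>\<theta>t\<in>spetsial_Irr m W x0. \<exists>!\<theta>. \<theta> \<in> Irr W \<and> specializes W x0 \<theta>t \<theta>) \<and>
     (\<forall>\<theta>\<in>Irr W. \<exists>!\<theta>t. \<theta>t \<in> spetsial_Irr m W x0 \<and> specializes W x0 \<theta>t \<theta>)"

definition char_t ::
  "nat \<Rightarrow> ('n::finite) cmat set \<Rightarrow> complex ^ 'n \<Rightarrow> ('n cmat \<Rightarrow> complex) \<Rightarrow> 'n braid \<Rightarrow> Ct" where
  "char_t m W x0 \<theta> = (THE \<theta>t. \<theta>t \<in> spetsial_Irr m W x0 \<and> specializes W x0 \<theta>t \<theta>)"

definition schur_elements ::
  "nat \<Rightarrow> ('n::finite) cmat set \<Rightarrow> complex ^ 'n \<Rightarrow>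
     (('n braid \<Rightarrow> 'n hidx laurent) set \<Rightarrow> 'n hidx laurent) \<Rightarrow>
     (('n cmat \<Rightarrow> complex) \<Rightarrow> Ct) \<Rightarrow> bool" where
  "schur_elements m W x0 \<tau> S \<longleftrightarrow> (\<forall>\<theta>\<in>Irr W. S \<theta> \<noteq> 0) \<and>
     (\<forall>b\<in>carrier (braid_group W x0).
        laurent_eval (spetsial_param m W) (\<tau> (generic_T W x0 b)) =
          (\<Sum>\<theta>\<in>Irr W. char_t m W x0 \<theta> b / S \<theta>))"

definition spetsial ::
  "nat \<Rightarrow> ('n::finite) cmat set \<Rightarrow> complex ^ 'n \<Rightarrow>
     (('n braid \<Rightarrow> 'n hidx laurent) set \<Rightarrow> 'n hidx laurent) \<Rightarrow> bool" where
  "spetsial m W x0 \<tau> \<longleftrightarrow> complex_reflection_group W \<and>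
     (\<exists>S. schur_elements m W x0 \<tau> S \<and>
       (\<forall>\<theta>\<in>Irr W. \<exists>p. S (triv_char W) / S \<theta> = to_fract (pcompose p (monom 1 m))))"

section \<open>Rouquier families\<close>

definition is_subring :: "'k::comm_ring_1 set \<Rightarrow> bool" where
  "is_subring F \<longleftrightarrow> 1 \<in> F \<and> (\<forall>x\<in>F. \<forall>y\<in>F. x - y \<in> F \<and> x * y \<in> F)"

definition is_subfield :: "'k::field set \<Rightarrow> bool" where
  "is_subfield F \<longleftrightarrow> is_subring F \<and> (\<forall>x\<in>F. inverse x \<in> F)"

definition trace_field :: "('n::finite) cmat set \<Rightarrow> complex set" where
  "trace_field W = \<Inter>{F. is_subfield F \<and> trace ` W \<subseteq> F}"

definition ring_of_integers :: "complex set \<Rightarrow> complex set" where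
  "ring_of_integers K = {x \<in> K. algebraic_int x}"

definition rouquier_ring :: "nat \<Rightarrow> ('n::finite) cmat set \<Rightarrow> Ct set" where
  "rouquier_ring m W = \<Inter>{F. is_subring F \<and>
     Ct_const ` ring_of_integers (trace_field W) \<subseteq> F \<and> Ct_q m \<in> F \<and> inverse (Ct_q m) \<in> F \<and>
     (\<forall>n\<ge>1. inverse (Ct_q m ^ n - 1) \<in> F)}"

definition central_idempotent :: "('a, 'z) ring_scheme \<Rightarrow> 'a \<Rightarrow> bool" where
  "central_idempotent A e \<longleftrightarrow> e \<in> carrier A \<and> e \<otimes>\<^bsub>A\<^esub> e = e \<and>
     (\<forall>x\<in>carrier A. e \<otimes>\<^bsub>A\<^esub> x = x \<otimes>\<^bsub>A\<^esub> e)"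

text \<open>Block idempotents are the primitive central idempotents.\<close>

definition block_idempotent :: "('a, 'z) ring_scheme \<Rightarrow> 'a \<Rightarrow> bool" where
  "block_idempotent A e \<longleftrightarrow> central_idempotent A e \<and> e \<noteq> \<zero>\<^bsub>A\<^esub> \<and>
     (\<forall>e1 e2. central_idempotent A e1 \<and> central_idempotent A e2 \<and>
        e1 \<otimes>\<^bsub>A\<^esub> e2 = \<zero>\<^bsub>A\<^esub> \<and> e = e1 \<oplus>\<^bsub>A\<^esub> e2 \<longrightarrow> e1 = \<zero>\<^bsub>A\<^esub> \<or> e2 = \<zero>\<^bsub>A\<^esub>)"

text \<open>A character belongs to a block if it does not vanish on the block idempotent. An element of
  the Hecke algebra is a coset in the group algebra, and the value does not depend on the chosen
  representative.\<close>

definition in_block ::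
  "nat \<Rightarrow> ('n::finite) cmat set \<Rightarrow> complex ^ 'n \<Rightarrow> ('n braid \<Rightarrow> Ct) set \<Rightarrow>
     ('n cmat \<Rightarrow> complex) \<Rightarrow> bool" where
  "in_block m W x0 e \<theta> \<longleftrightarrow> (\<exists>a\<in>e. lin_ext (char_t m W x0 \<theta>) a \<noteq> 0)"

definition rouquier_families ::
  "nat \<Rightarrow> ('n::finite) cmat set \<Rightarrow> complex ^ 'n \<Rightarrow> ('n cmat \<Rightarrow> complex) set set" where
  "rouquier_families m W x0 =
     {{\<theta> \<in> Irr W. in_block m W x0 e \<theta>} | e.
        block_idempotent (spetsial_hecke (rouquier_ring m W) m W x0) e}"

section \<open>Unipotent characters and the axioms of spetses\<close>

text \<open>Unipotent data for reflection groups on \<open>V\<close>. Elements of \<open>\<int>Uch\<close> are integer functions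
  on the type \<open>'u\<close> that vanish outside \<open>Uch P\<close>. Here \<open>princ P \<theta>\<close> is \<open>U\<^sub>\<theta>\<close>; \<open>DL P w\<close> is the element
  induced from the trivial character of a torus of type \<open>w\<close>; \<open>Lind P P'\<close> and \<open>Lres P P'\<close> are
  Lusztig induction from \<open>P'\<close> to \<open>P\<close> and its adjoint.\<close>

record ('n, 'u) unipotent_data =
  Uch :: "(complex ^ 'n::finite ^ 'n) set \<Rightarrow> 'u set"
  princ :: "(complex ^ 'n ^ 'n) set \<Rightarrow> (complex ^ 'n ^ 'n \<Rightarrow> complex) \<Rightarrow> 'u"
  DL :: "(complex ^ 'n ^ 'n) set \<Rightarrow> complex ^ 'n ^ 'n \<Rightarrow> 'u \<Rightarrow> int"
  Lind :: "(complex ^ 'n ^ 'n) set \<Rightarrow> (complex ^ 'n ^ 'n) set \<Rightarrow> ('u \<Rightarrow> int) \<Rightarrow> 'u \<Rightarrow> int"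
  Lres :: "(complex ^ 'n ^ 'n) set \<Rightarrow> (complex ^ 'n ^ 'n) set \<Rightarrow> ('u \<Rightarrow> int) \<Rightarrow> 'u \<Rightarrow> int"

definition ZUch ::
  "('n::finite, 'u) unipotent_data \<Rightarrow> 'n cmat set \<Rightarrow> ('u \<Rightarrow> int) set" where
  "ZUch D P = {a. \<forall>\<rho>. \<rho> \<notin> Uch D P \<longrightarrow> a \<rho> = 0}"

definition pairing ::
  "('n::finite, 'u) unipotent_data \<Rightarrow> 'n cmat set \<Rightarrow> ('u \<Rightarrow> int) \<Rightarrow> ('u \<Rightarrow> int) \<Rightarrow> int" where
  "pairing D P a b = (\<Sum>\<rho>\<in>Uch D P. a \<rho> * b \<rho>)"

definition U_elt ::
  "('n::finite, 'u) unipotent_data \<Rightarrow> 'n cmat set \<Rightarrow> ('n cmat \<Rightarrow> complex) \<Rightarrow> 'u \<Rightarrow> int" where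
  "U_elt D P \<theta> = single_elt 1 (princ D P \<theta>)"

definition unipotent_data_for ::
  "('n::finite, 'u) unipotent_data \<Rightarrow> 'n cmat set \<Rightarrow> bool" where
  "unipotent_data_for D P \<longleftrightarrow> finite (Uch D P) \<and>
     inj_on (princ D P) (Irr P) \<and> princ D P ` Irr P \<subseteq> Uch D P \<and>
     (\<forall>w\<in>P. DL D P w \<in> ZUch D P) \<and>
     (\<forall>g\<in>P. \<forall>w\<in>P. DL D P (g ** w ** matrix_inv g) = DL D P w)"

text \<open>The group attached to the trivial Weyl group is a torus: its only unipotent character is the
  trivial one, and induction from the torus to itself is the identity.\<close>

definition trivial_normalization :: "('n::finite, 'u) unipotent_data \<Rightarrow> bool" where
  "trivial_normalization D \<longleftrightarrow>
     Uch D {I1} = {princ D {I1} (triv_char {I1})} \<and>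
     DL D {I1} I1 = U_elt D {I1} (triv_char {I1})"

text \<open>The pairing is extended bilinearly to complex coefficients.\<close>

definition fourier_matrix ::
  "('n::finite, 'u) unipotent_data \<Rightarrow> 'n cmat set \<Rightarrow>
     ('n cmat \<Rightarrow> complex) \<Rightarrow> ('n cmat \<Rightarrow> complex) \<Rightarrow> complex" where
  "fourier_matrix D P \<theta> \<psi> =
     (\<Sum>w\<in>P. \<psi> w * of_int (pairing D P (U_elt D P \<theta>) (DL D P w))) / of_nat (card P)"

text \<open>The first axiom is the symmetry of the matrix. The second is that it is block diagonal with
  respect to the Rouquier families; this is all that is needed of the equality of Lusztig and
  Rouquier families, so it is all that is assumed.\<close>

definition fourier_axioms ::
  "('n::finite, 'u) unipotent_data \<Rightarrow> nat \<Rightarrow> 'n cmat set \<Rightarrow> complex ^ 'n \<Rightarrow> bool" where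
  "fourier_axioms D m P x0 \<longleftrightarrow>
     (\<forall>\<theta>\<in>Irr P. \<forall>\<psi>\<in>Irr P. fourier_matrix D P \<theta> \<psi> = fourier_matrix D P \<psi> \<theta>) \<and>
     (\<forall>\<theta>\<in>Irr P. \<forall>\<psi>\<in>Irr P. fourier_matrix D P \<theta> \<psi> \<noteq> 0 \<longrightarrow>
        (\<exists>F\<in>rouquier_families m P x0. \<theta> \<in> F \<and> \<psi> \<in> F))"

definition lusztig_axioms ::
  "('n::finite, 'u) unipotent_data \<Rightarrow> 'n cmat set \<Rightarrow> 'n cmat set \<Rightarrow> bool" where
  "lusztig_axioms D P P' \<longleftrightarrow>
     (\<forall>a\<in>ZUch D P'. Lind D P P' a \<in> ZUch D P) \<and>
     (\<forall>a\<in>ZUch D P'. \<forall>b\<in>ZUch D P'.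
        Lind D P P' (\<lambda>\<rho>. a \<rho> + b \<rho>) = (\<lambda>\<rho>. Lind D P P' a \<rho> + Lind D P P' b \<rho>)) \<and>
     (\<forall>a\<in>ZUch D P. Lres D P P' a \<in> ZUch D P') \<and>
     (\<forall>a\<in>ZUch D P. \<forall>b\<in>ZUch D P'.
        pairing D P a (Lind D P P' b) = pairing D P' (Lres D P P' a) b) \<and>
     (\<forall>w\<in>P'. Lind D P P' (DL D P' w) = DL D P w) \<and>
     (\<forall>\<theta>\<in>Irr P. \<forall>k :: ('n cmat \<Rightarrow> complex) \<Rightarrow> nat.
        (\<forall>w\<in>P'. \<theta> w = (\<Sum>\<psi>\<in>Irr P'. of_nat (k \<psi>) * \<psi> w)) \<longrightarrow>
        Lres D P P' (U_elt D P \<theta>) = (\<lambda>\<rho>. \<Sum>\<psi>\<in>Irr P'. int (k \<psi>) * U_elt D P' \<psi> \<rho>))"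

text \<open>The axioms hold for \<open>W\<close> and for its parabolic subgroups, which are again spetsial. The
  parabolic subgroups of \<open>P\<close> are the parabolic subgroups of \<open>W\<close> contained in \<open>P\<close>.\<close>

definition spetses_axioms ::
  "('n::finite, 'u) unipotent_data \<Rightarrow> nat \<Rightarrow> 'n cmat set \<Rightarrow> complex ^ 'n \<Rightarrow> bool" where
  "spetses_axioms D m W x0 \<longleftrightarrow> trivial_normalization D \<and>
     (\<forall>P\<in>parabolics W. unipotent_data_for D P \<and> fourier_axioms D m P x0) \<and>
     (\<forall>P\<in>parabolics W. \<forall>P'\<in>parabolics W. P' \<subseteq> P \<longrightarrow> lusztig_axioms D P P')"

text \<open>The operator is determined by these conditions because \<open>Irr W\<close> is a basis of the space
  of class functions.\<close>

definition truncated_fourier ::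
  "('n::finite, 'u) unipotent_data \<Rightarrow> 'n cmat set \<Rightarrow>
     (('n cmat \<Rightarrow> complex) \<Rightarrow> 'n cmat \<Rightarrow> complex) \<Rightarrow> bool" where
  "truncated_fourier D W f \<longleftrightarrow>
     f ` class_functions W \<subseteq> class_functions W \<and>
     (\<forall>\<theta>\<in>class_functions W. \<forall>\<psi>\<in>class_functions W.
        f (\<lambda>w. \<theta> w + \<psi> w) = (\<lambda>w. f \<theta> w + f \<psi> w)) \<and>
     (\<forall>c. \<forall>\<theta>\<in>class_functions W. f (\<lambda>w. c * \<theta> w) = (\<lambda>w. c * f \<theta> w)) \<and>
     (\<forall>\<theta>\<in>Irr W. \<forall>w\<in>W. f \<theta> w = of_int (pairing D W (U_elt D W \<theta>) (DL D W w)))"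

end

theory Submission
 imports
  Defs
  "HOL-Complex_Analysis.Riemann_Mapping"
  "HOL-Algebra.Multiplicative_Group"
  "HOL-Algebra.Subrings"
  "Jordan_Normal_Form.Spectral_Radius"
begin

text \<open>
The proof compares eigenvalues of sums of reflections. For a parabolic subgroup \<open>P\<close> and \<open>\<chi> \<in> Irr P\<close>, the
element \<open>z = \<Sum>s\<in>refl P. s\<close> is central in the group algebra and acts in \<open>\<chi>\<close> by the scalar
\<open>c \<chi> = (\<Sum>s\<in>refl P. \<chi> s) / \<chi> I1\<close>. Let \<open>g w = \<langle>U \<chi>, R w\<rangle>\<close> be the transform of \<open>\<chi>\<close>. By the block form of the Fourier matrix,
the sum \<open>\<Sum>w\<in>P. \<psi> w * g w\<close> vanishes unless \<open>\<psi>\<close> lies in the Rouquier family of \<open>\<chi>\<close>. The main point is that \<open>c\<close> is constant on Rouquier families (\<open>same_family_same_ratio\<close>).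
Granting this, multiplication by \<open>z\<close> acts on \<open>g\<close> by the same scalar \<open>c \<chi>\<close> as on \<open>\<chi>\<close> (\<open>transform_translate\<close>).

Now climb a tower. On the difference \<open>\<Delta> = \<chi> - g\<close>, the top generator \<open>J\<close> of the tower algebra of \<open>P = T (Suc k)\<close> equals \<open>z\<close> minus the lower
generators, and \<open>z\<close> is a scalar; so every element of the algebra can be replaced by one from the
tower algebra of \<open>Q = T k\<close> (\<open>tower_algebra_step\<close>). There only the restriction of \<open>\<Delta>\<close> to \<open>Q\<close> matters. By
the compatibility of Lusztig restriction with the principal series, and by adjunction and transitivity of
induction, that restriction is a combination of the differences for \<open>Irr Q\<close> (\<open>transform_restrict\<close>), on which induction applies.

Why is \<open>c\<close> constant on families? The full twist \<open>\<pi>\<close> is central in the braid group, so it acts in an irreducible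
representation of degree \<open>d\<close> of the spetsial algebra over \<open>\<complex>(t)\<close> by a scalar \<open>\<omega>\<close>, and \<open>\<omega> ^ d\<close> is a determinant. Any
homomorphism from the braid group to the units of a field sends \<open>\<pi>\<close> to the product, over all hyperplanes \<open>H\<close>, of the values at
\<open>b\<^sub>H ^ e\<^sub>H\<close>, with \<open>b\<^sub>H\<close> a braid reflection and \<open>e\<^sub>H\<close> the order of the fixator of \<open>H\<close> (\<open>full_twist_product\<close>). For the determinant these values are powers
of \<open>q\<close>, and the multiplicity of the eigenvalue \<open>q\<close> of \<open>b\<^sub>H\<close> can be read off at \<open>t = 1\<close>. One gets
\<open>\<omega> ^ d = q ^ (N * d + \<Sum>s. \<chi> s)\<close> with \<open>N\<close> the number of hyperplanes (\<open>full_twist_scalar\<close>). So \<open>\<pi> ^ K\<close>, with \<open>K\<close> the product of all degrees,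
acts by \<open>q ^ ((N + c \<chi>) * K)\<close>.

On the other hand, let \<open>a\<close> run over these exponents. The product of the central elements \<open>\<pi> ^ K - q ^ a\<close> is killed by all irreducible
representations, so it is nilpotent. The differences \<open>q ^ b - q ^ a\<close> are units in the ring over which families are defined, so the
factors are pairwise comaximal. A primitive central idempotent therefore kills a power of one of the factors
(\<open>block_idempotent_annihilates_factor\<close>), and only one exponent occurs in each block. To pass from the algebra over the field to
the algebra over the ring, both are embedded in one and the same matrix ring; this uses that the generic Hecke algebra is free over its ground ring (\<open>ideal_iff\<close>).
\<close>

section \<open>Multiplicative functionals on paths\<close>

text \<open>A field-valued functional on paths that sees only their homotopy class and turns concatenation into a product: a local system of rank one. Values of one-dimensional characters of fundamental groups are computed with it, without base points.\<close>

definition path_character :: "'a::real_normed_vector set => ((real => 'a) => 'k::field) => bool" where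
 "path_character S D \<longleftrightarrow>
  (\<forall>p q. path p & path q & path_image p \<subseteq> S & path_image q \<subseteq> S & pathfinish p = pathstart q -->
  D (p +++ q) = D p * D q) &
  (\<forall>p q. homotopic_paths S p q --> D p = D q) &
  (\<forall>p. path p & path_image p \<subseteq> S --> D p ~= 0)"

lemma path_character_join:
 assumes "path_character S D" "path p" "path q" "path_image p \<subseteq> S" "path_image q \<subseteq> S"
  "pathfinish p = pathstart q"
 shows "D (p +++ q) = D p * D q"
 using assms unfolding path_character_def by blast

lemma path_character_homotopic:
 assumes "path_character S D" "homotopic_paths S p q"
 shows "D p = D q"
 using assms unfolding path_character_def by blast

lemma path_character_nonzero:
 assumes "path_character S D" "path p" "path_image p \<subseteq> S"
 shows "D p ~= 0"
 using assms unfolding path_character_def by blast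

lemma path_character_const:
 assumes "path_character S D" "a : S"
 shows "D (linepath a a) = 1"
proof -
 let ?l = "linepath a a"
 have "D (?l +++ ?l) = D ?l * D ?l"
  by (rule path_character_join[OF assms(1)]) (use assms in auto)
 moreover have "homotopic_paths S (?l +++ ?l) ?l"
  using homotopic_paths_rid[of ?l S] assms by auto
 then have "D (?l +++ ?l) = D ?l"
  using path_character_homotopic[OF assms(1)] by blast
 moreover have "D ?l ~= 0"
  by (rule path_character_nonzero[OF assms(1)]) (use assms in auto)
 ultimately show ?thesis by simp
qed

lemma path_character_reverse:
 assumes "path_character S D" "path p" "path_image p \<subseteq> S"
 shows "D p * D (reversepath p) = 1"
proof -
 have s: "pathstart p : S" using assms by (auto simp: path_image_def pathstart_def)
 have "D (p +++ reversepath p) = D p * D (reversepath p)"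
  by (rule path_character_join[OF assms(1)]) (use assms in auto)
 moreover have "homotopic_paths S (p +++ reversepath p) (linepath (pathstart p) (pathstart p))"
  by (rule homotopic_paths_rinv) (use assms in auto)
 ultimately show ?thesis
  using path_character_homotopic[OF assms(1)] path_character_const[OF assms(1) s] by metis
qed

text \<open>The loop is contractible, and the value at a constant path is idempotent and nonzero.\<close>

lemma path_character_convex_loop:
 assumes D: "path_character S D" and C: "convex C" "C \<subseteq> S"
  and p: "path p" "path_image p \<subseteq> C" "pathfinish p = pathstart p"
 shows "D p = 1"
proof -
 have s: "pathstart p : C" using p by (auto simp: path_image_def pathstart_def)
 have "homotopic_paths C p (linepath (pathstart p) (pathstart p))"
  using convex_imp_simply_connected[OF C(1)] p s
  by (simp add: simply_connected_eq_homotopic_paths)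
 then have "homotopic_paths S p (linepath (pathstart p) (pathstart p))"
  using C(2) homotopic_paths_subset by blast
 then show ?thesis
  using path_character_homotopic[OF D] path_character_const[OF D] s C(2) by (metis subsetD)
qed

lemma path_character_compose:
 assumes D: "path_character S D" and f: "continuous_on T f" "f ` T \<subseteq> S"
 shows "path_character T (%p. D (f \<circ> p))"
 unfolding path_character_def
proof (intro conjI allI impI)
 fix p q assume *: "path p & path q & path_image p \<subseteq> T & path_image q \<subseteq> T & pathfinish p = pathstart q"
 have "f \<circ> (p +++ q) = (f \<circ> p) +++ (f \<circ> q)" by (rule path_compose_join)
 moreover have "D ((f \<circ> p) +++ (f \<circ> q)) = D (f \<circ> p) * D (f \<circ> q)"
  by (rule path_character_join[OF D])
  (use * f in \<open>auto intro!: path_continuous_image intro: continuous_on_subset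
  simp: path_image_compose pathstart_compose pathfinish_compose\<close>)
 ultimately show "D (f \<circ> (p +++ q)) = D (f \<circ> p) * D (f \<circ> q)" by simp
next
 fix p q assume "homotopic_paths T p q"
 then have "homotopic_paths S (f \<circ> p) (f \<circ> q)"
  by (rule homotopic_paths_continuous_image) (use f in auto)
 then show "D (f \<circ> p) = D (f \<circ> q)" by (rule path_character_homotopic[OF D])
next
 fix p assume "path p & path_image p \<subseteq> T"
 then show "D (f \<circ> p) ~= 0"
  by (intro path_character_nonzero[OF D])
  (use f in \<open>auto intro!: path_continuous_image intro: continuous_on_subset simp: path_image_compose\<close>)
qed

text \<open>A free homotopy of loops, seen as a map of the unit square, turns one side of the square into the path along the other three.\<close>

lemma square_boundary_homotopic:
 fixes h :: "real \<times> real => 'a::real_normed_vector"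
 assumes h: "continuous_on ({0..1} \<times> {0..1}) h" "h ` ({0..1} \<times> {0..1}) \<subseteq> S"
 shows "homotopic_paths S (%t. h (0, t)) ((%t. h (t, 0)) +++ (%t. h (1, t)) +++ reversepath (%t. h (t, 1)))"
proof -
 let ?Q = "{0..1} \<times> {0..1} :: (real \<times> real) set"
 have cQ: "convex ?Q" by (intro convex_Times) auto
 let ?l = "%a b. linepath a b :: real => real \<times> real"
 have seg: "path_image (?l a b) \<subseteq> ?Q" if "a : ?Q" "b : ?Q" for a b
  using that cQ by (simp add: closed_segment_subset)
 have "homotopic_paths ?Q (?l (0,0) (0,1)) (?l (0,0) (1,0) +++ ?l (1,0) (1,1) +++ ?l (1,1) (0,1))"
  using convex_imp_simply_connected[OF cQ] seg
  by (auto simp add: simply_connected_eq_homotopic_paths path_image_join subset_path_image_join)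
 then have "homotopic_paths S (h \<circ> ?l (0,0) (0,1)) (h \<circ> (?l (0,0) (1,0) +++ ?l (1,0) (1,1) +++ ?l (1,1) (0,1)))"
  by (rule homotopic_paths_continuous_image) (use h in auto)
 moreover have "h \<circ> ?l (0,0) (0,1) = (%t. h (0, t))" "h \<circ> ?l (0,0) (1,0) = (%t. h (t, 0))"
  "h \<circ> ?l (1,0) (1,1) = (%t. h (1, t))" "h \<circ> ?l (1,1) (0,1) = reversepath (%t. h (t, 1))"
  by (auto simp: linepath_def reversepath_def fun_eq_iff)
 ultimately show ?thesis by (simp add: path_compose_join)
qed

text \<open>The values lie in a commutative group, so the two legs of the square cancel and free homotopy is enough.\<close>

lemma path_character_loops:
 assumes D: "path_character S D" and pq: "homotopic_loops S p q"
 shows "D p = D q"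
proof -
 obtain h :: "real \<times> real => 'a" where *: "continuous_on ({0..1} \<times> {0..1}) h" "h : {0..1} \<times> {0..1} \<rightarrow> S"
  "\<forall>x\<in>{0..1}. h (0, x) = p x" "\<forall>x\<in>{0..1}. h (1, x) = q x"
  "\<forall>t\<in>{0..1}. pathfinish (h \<circ> Pair t) = pathstart (h \<circ> Pair t)"
  using pq unfolding homotopic_loops by blast
 note h = *(1) funcset_image[OF *(2)]
 have p: "h (0, x) = p x" if "x : {0..1}" for x using * that by blast
 have q: "h (1, x) = q x" if "x : {0..1}" for x using * that by blast
 have l: "pathfinish (h \<circ> Pair t) = pathstart (h \<circ> Pair t)" if "t : {0..1}" for t using * that by blast
 let ?r = "%t. h (t, 0)" and ?r' = "%t. h (t, 1)"
 have pth: "path (%t. h (f t))" "path_image (%t. h (f t)) \<subseteq> S"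
  if "continuous_on {0..1} f" "f ` {0..1} \<subseteq> {0..1} \<times> {0..1}" for f
 proof -
  show "path (%t. h (f t))" unfolding path_def
  using continuous_on_compose[OF that(1) continuous_on_subset[OF h(1) that(2)]] by (simp add: o_def)
  show "path_image (%t. h (f t)) \<subseteq> S" using that(2) h(2) by (force simp: path_image_def)
 qed
 have P: "path ?r" "path ?r'" "path (%t. h (0, t))" "path (%t. h (1, t))"
  "path_image ?r \<subseteq> S" "path_image ?r' \<subseteq> S" "path_image (%t. h (0, t)) \<subseteq> S" "path_image (%t. h (1, t)) \<subseteq> S"
  by (intro pth; force intro!: continuous_intros)+
 have rr: "?r t = ?r' t" if "t : {0..1}" for t
  using l[OF that] by (simp add: pathstart_def pathfinish_def)
 have ends: "pathfinish ?r = pathstart (%t. h (1, t))" "pathfinish (%t. h (1, t)) = pathstart (reversepath ?r')"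
  by (simp_all add: pathstart_def pathfinish_def reversepath_def)
 have 1: "D ?r = D ?r'"
  by (rule path_character_homotopic[OF D], rule homotopic_paths_eq) (use P rr in auto)
 have 2: "D ?r' * D (reversepath ?r') = 1"
  by (rule path_character_reverse[OF D P(2) P(6)])
 have 3: "D (%t. h (0, t)) = D p"
  by (rule path_character_homotopic[OF D], rule homotopic_paths_eq) (use P p in auto)
 have 4: "D (%t. h (1, t)) = D q"
  by (rule path_character_homotopic[OF D], rule homotopic_paths_eq) (use P q in auto)
 have 5: "path (reversepath ?r')" "path_image (reversepath ?r') \<subseteq> S" using P by simp_all
 have 6: "D ((%t. h (1, t)) +++ reversepath ?r') = D (%t. h (1, t)) * D (reversepath ?r')"
  by (rule path_character_join[OF D P(4) 5(1) P(8) 5(2) ends(2)])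
 have 7: "D (?r +++ (%t. h (1, t)) +++ reversepath ?r') = D ?r * D ((%t. h (1, t)) +++ reversepath ?r')"
 proof (rule path_character_join[OF D P(1) _ P(5)])
  show "path ((%t. h (1, t)) +++ reversepath ?r')" by (rule path_join_imp[OF P(4) 5(1) ends(2)])
  show "path_image ((%t. h (1, t)) +++ reversepath ?r') \<subseteq> S" by (rule subset_path_image_join[OF P(8) 5(2)])
  show "pathfinish ?r = pathstart ((%t. h (1, t)) +++ reversepath ?r')" using ends(1) by simp
 qed
 have "D p = D (?r +++ (%t. h (1, t)) +++ reversepath ?r')"
  unfolding 3[symmetric] by (rule path_character_homotopic[OF D square_boundary_homotopic[OF h]])
 also have "... = D q * (D ?r' * D (reversepath ?r'))" unfolding 7 6 1 4 by (simp only: ac_simps)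
 finally show ?thesis unfolding 2 by simp
qed

lemma path_character_linepath_split:
 assumes D: "path_character S D" and c: "c : closed_segment a b" and S: "closed_segment a b \<subseteq> S"
 shows "D (linepath a b) = D (linepath a c) * D (linepath c b)"
proof -
 have sub: "closed_segment a c \<subseteq> closed_segment a b" "closed_segment c b \<subseteq> closed_segment a b"
  using c by (auto simp: subset_closed_segment)
 let ?C = "closed_segment a b"
 have "homotopic_paths ?C (linepath a b) (linepath a c +++ linepath c b)"
  using convex_imp_simply_connected[OF convex_closed_segment[of a b]] sub
  by (auto simp: simply_connected_eq_homotopic_paths subset_path_image_join)
 then have "D (linepath a b) = D (linepath a c +++ linepath c b)"
  using S by (intro path_character_homotopic[OF D]) (rule homotopic_paths_subset)
 also have "... = D (linepath a c) * D (linepath c b)"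
  by (rule path_character_join[OF D]) (use sub S in auto)
 finally show ?thesis .
qed

section \<open>Loops around finitely many points of the plane\<close>

text \<open>Pushing both loops radially onto a small circle around \<open>\<zeta>\<close> reduces the claim to loops in a punctured plane, which are classified by the winding number.\<close>

lemma radial_homotopy:
 fixes p q :: "real => complex"
 assumes r: "r > 0" "sphere \<zeta> r \<subseteq> S"
  and p: "path p" "pathfinish p = pathstart p" "\<zeta> ~: path_image p"
  and q: "path q" "pathfinish q = pathstart q" "\<zeta> ~: path_image q"
  and w: "winding_number p \<zeta> = winding_number q \<zeta>"
  and Sp: "!!x. x : path_image p \<union> path_image q ==> closed_segment x (\<zeta> + of_real (r / cmod (x - \<zeta>)) * (x - \<zeta>)) \<subseteq> S"
 shows "homotopic_loops S p q"
proof -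
 let ?\<rho> = "%x. \<zeta> + of_real (r / cmod (x - \<zeta>)) * (x - \<zeta>)"
 have cont: "continuous_on (- {\<zeta>}) ?\<rho>" by (intro continuous_intros) auto
 have to_sphere: "?\<rho> ` (- {\<zeta>}) \<subseteq> sphere \<zeta> r"
  using r by (auto simp: dist_norm norm_mult norm_divide split: if_splits)
 have lin: "homotopic_loops S g (?\<rho> \<circ> g)"
  if g: "path g" "pathfinish g = pathstart g" "\<zeta> ~: path_image g" "path_image g \<subseteq> path_image p \<union> path_image q" for g
 proof (rule homotopic_loops_linear)
  show "path (?\<rho> \<circ> g)" using g by (intro path_continuous_image continuous_on_subset[OF cont]) auto
  show "pathfinish (?\<rho> \<circ> g) = pathstart (?\<rho> \<circ> g)" using g by (simp add: pathfinish_compose pathstart_compose)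
  fix t :: real assume "t : {0..1}"
  then have "g t : path_image g" by (simp add: path_image_def)
  then have "g t : path_image p \<union> path_image q" using g(4) by blast
  from Sp[OF this] show "closed_segment (g t) ((?\<rho> \<circ> g) t) \<subseteq> S" by simp
 qed (use g in auto)
 have "homotopic_loops (- {\<zeta>}) p q"
  using winding_number_homotopic_loops_eq[OF p(1) p(3) q(1) q(3) p(2) q(2)] w by blast
 then have "homotopic_loops S (?\<rho> \<circ> p) (?\<rho> \<circ> q)"
  by (rule homotopic_loops_continuous_image[OF _ cont]) (use to_sphere r in auto)
 with lin[of p] lin[of q] p q show ?thesis
  by (meson Un_upper1 Un_upper2 homotopic_loops_sym homotopic_loops_trans)
qed

lemma mem_radial_segment:
 fixes x :: complex
 assumes y: "y : closed_segment x (\<zeta> + of_real c * (x - \<zeta>))" and c: "c > 0" and x: "x ~= \<zeta>"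
 obtains l where "l > 0" "min 1 c \<le> l" "l \<le> max 1 c" "y = \<zeta> + of_real l * (x - \<zeta>)"
proof -
 obtain u where u: "0 \<le> u" "u \<le> 1" "y = (1 - u) *\<^sub>R x + u *\<^sub>R (\<zeta> + of_real c * (x - \<zeta>))"
  using y by (auto simp: in_segment)
 let ?l = "(1 - u) + u * c"
 have "y = \<zeta> + of_real ?l * (x - \<zeta>)"
  using u(3) by (simp add: scaleR_conv_of_real algebra_simps)
 moreover have "min 1 c \<le> ?l" "?l \<le> max 1 c"
  using convex_bound_le[of 1 "max 1 c" c "1 - u" u] convex_bound_le[of "-1" "- min 1 c" "- c" "1 - u" u] u
  by (auto simp: algebra_simps)
 moreover from this(1) have "?l > 0" using c by (auto simp: min_def split: if_splits)
 ultimately show ?thesis using that by blast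
qed

lemma vertical_segment:
 assumes "c ~: Re ` Z"
 shows "closed_segment (Complex c y) (Complex c y') \<subseteq> - Z"
proof -
 have "Re w = c" if "w : closed_segment (Complex c y) (Complex c y')" for w
 proof -
  obtain u where "Re w = (1 - u) * c + u * c" using \<open>w : _\<close> by (auto simp: in_segment)
  then show ?thesis by (simp add: left_diff_distrib)
 qed
 then show ?thesis using assms by blast
qed

lemma horizontal_segment:
 assumes "y ~: Im ` Z"
 shows "closed_segment (Complex c y) (Complex d y) \<subseteq> - Z"
proof -
 have "Im w = y" if "w : closed_segment (Complex c y) (Complex d y)" for w
 proof -
  obtain u where "Im w = (1 - u) * y + u * y" using \<open>w : _\<close> by (auto simp: in_segment)
  then show ?thesis by (simp add: left_diff_distrib)
 qed
 then show ?thesis using assms by blast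
qed

lemma rectangle_character:
 assumes G: "path_character (- Z) G" and h: "h ~: Im ` Z" "- h ~: Im ` Z"
  and ab: "a ~: Re ` Z" "b ~: Re ` Z"
 shows "G (rectpath (Complex a (- h)) (Complex b h)) =
  G (linepath (Complex a (- h)) (Complex b (- h))) * (G (linepath (Complex b (- h)) (Complex b h)) *
  (G (linepath (Complex b h) (Complex a h)) * G (linepath (Complex a h) (Complex a (- h)))))"
 unfolding rectpath_def Let_def
 using vertical_segment[OF ab(1)] vertical_segment[OF ab(2)] horizontal_segment[OF h(1)] horizontal_segment[OF h(2)]
 by (simp add: path_character_join[OF G] subset_path_image_join)

text \<open>The common vertical side is traversed in both directions and cancels.\<close>

lemma rectangle_character_split:
 assumes G: "path_character (- Z) G" and h: "h ~: Im ` Z" "- h ~: Im ` Z"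
  and ab: "a ~: Re ` Z" "b ~: Re ` Z" "c ~: Re ` Z" "a \<le> c" "c \<le> b"
 shows "G (rectpath (Complex a (- h)) (Complex b h)) =
  G (rectpath (Complex a (- h)) (Complex c h)) * G (rectpath (Complex c (- h)) (Complex b h))"
proof -
 have mem: "Complex c y : closed_segment (Complex a y) (Complex b y)" for y
 proof (cases "a = b")
  case True then show ?thesis using ab by simp
 next
  case False
  define t where "t = (c - a) / (b - a)"
  have "t * (b - a) = c - a" using False by (simp add: t_def)
  then have "Complex c y = (1 - t) *\<^sub>R Complex a y + t *\<^sub>R Complex b y"
  by (simp add: complex_eq_iff algebra_simps)
  moreover have "0 \<le> t" "t \<le> 1" using False ab by (auto simp: t_def field_simps)
  ultimately show ?thesis unfolding in_segment by blast
 qed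
 have 1: "G (linepath (Complex a (-h)) (Complex b (-h))) =
  G (linepath (Complex a (-h)) (Complex c (-h))) * G (linepath (Complex c (-h)) (Complex b (-h)))"
  by (rule path_character_linepath_split[OF G mem horizontal_segment[OF h(2)]])
 have 2: "G (linepath (Complex b h) (Complex a h)) =
  G (linepath (Complex b h) (Complex c h)) * G (linepath (Complex c h) (Complex a h))"
  by (rule path_character_linepath_split[OF G _ horizontal_segment[OF h(1)]]) (metis mem closed_segment_commute)
 have 3: "G (linepath (Complex c (-h)) (Complex c h)) * G (linepath (Complex c h) (Complex c (-h))) = 1"
  using path_character_reverse[OF G, of "linepath (Complex c (-h)) (Complex c h)"] vertical_segment[OF ab(3)]
  by simp
 show ?thesis
  unfolding rectangle_character[OF G h ab(1,2)] rectangle_character[OF G h ab(1,3)] rectangle_character[OF G h ab(3,2)] 1 2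
  using 3 by (simp add: algebra_simps)
qed

lemma rectangle_character_single:
 assumes G: "path_character (- Z) G"
  and Z: "cbox (Complex a (-h)) (Complex b h) \<inter> Z = {\<zeta>}" "\<zeta> : box (Complex a (-h)) (Complex b h)"
  and r: "r > 0" "cball \<zeta> r \<inter> Z \<subseteq> {\<zeta>}"
 shows "G (rectpath (Complex a (- h)) (Complex b h)) = G (circlepath \<zeta> r)"
proof (rule path_character_loops[OF G], rule radial_homotopy[where \<zeta> = \<zeta> and r = r])
 let ?R = "rectpath (Complex a (- h)) (Complex b h)"
 have le: "a < b" "-h < h" using Z(2) by (auto simp: in_box_complex_iff)
 have im: "path_image ?R = cbox (Complex a (- h)) (Complex b h) - box (Complex a (- h)) (Complex b h)"
  by (rule path_image_rectpath_cbox_minus_box) (use le in auto)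
 show "sphere \<zeta> r \<subseteq> - Z" using r by (auto simp: disjoint_iff)
 show "\<zeta> ~: path_image ?R" unfolding im using Z(2) by auto
 show "\<zeta> ~: path_image (circlepath \<zeta> r)" using r by simp
 show "winding_number ?R \<zeta> = winding_number (circlepath \<zeta> r) \<zeta>"
  using winding_number_rectpath[OF Z(2)] winding_number_circlepath_centre[OF r(1)] by simp
 fix x assume x: "x : path_image ?R \<union> path_image (circlepath \<zeta> r)"
 then have xn: "x ~= \<zeta>" using \<open>\<zeta> ~: path_image ?R\<close> \<open>\<zeta> ~: path_image (circlepath \<zeta> r)\<close> by blast
 let ?c = "r / cmod (x - \<zeta>)"
 have c: "?c > 0" using r xn by simp
 show "closed_segment x (\<zeta> + of_real ?c * (x - \<zeta>)) \<subseteq> - Z"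
 proof
  fix y assume "y : closed_segment x (\<zeta> + of_real ?c * (x - \<zeta>))"
  then obtain l where l: "l > 0" "min 1 ?c \<le> l" "l \<le> max 1 ?c" "y = \<zeta> + of_real l * (x - \<zeta>)"
  by (rule mem_radial_segment[OF _ c xn])
  have yn: "y ~= \<zeta>" using l xn by simp
  have "y : cball \<zeta> r \<or> y : cbox (Complex a (- h)) (Complex b h)"
  proof (cases "l \<le> ?c")
  case True
  have "y - \<zeta> = of_real l * (x - \<zeta>)" unfolding l(4) by simp
  then have "cmod (y - \<zeta>) = \<bar>l\<bar> * cmod (x - \<zeta>)" by (metis norm_mult norm_of_real)
  also have "... \<le> ?c * cmod (x - \<zeta>)" using True l(1) by (intro mult_right_mono) auto
  also have "... = r" using xn by simp
  finally have "cmod (y - \<zeta>) \<le> r" .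
  then show ?thesis by (simp add: dist_norm norm_minus_commute)
  next
  case False
  then have l1: "l \<le> 1" using l by linarith
  have "x : cbox (Complex a (- h)) (Complex b h)"
  proof (cases "x : path_image ?R")
  case True then show ?thesis unfolding im by blast
  next
  case False
  then have "cmod (x - \<zeta>) = r" using x r by (auto simp: dist_norm norm_minus_commute)
  then show ?thesis using \<open>\<not> l \<le> ?c\<close> l1 r by simp
  qed
  moreover have "\<zeta> : cbox (Complex a (- h)) (Complex b h)" using Z by blast
  moreover have "y = (1 - l) *\<^sub>R \<zeta> + l *\<^sub>R x"
  using l(4) by (simp add: scaleR_conv_of_real algebra_simps)
  ultimately show ?thesis
  using convexD[OF convex_box(1), of \<zeta> "Complex a (- h)" "Complex b h" x "1 - l" l] l(1) l1 by simp
  qed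
  then show "y : - Z" using yn Z r by blast
 qed
qed (use r(1) in simp_all)

text \<open>Induction on the number of points inside: a vertical line at a real part between those of two points splits the rectangle. This is why the points need distinct real parts.\<close>

lemma strip_character:
 assumes G: "path_character (- Z) G" and Z: "finite Z" "inj_on Re Z" "!!z. z : Z ==> \<bar>Im z\<bar> < h"
  and e: "!!z. z : Z ==> e z > 0" "!!z. z : Z ==> cball z (e z) \<inter> Z \<subseteq> {z}" and h: "h > 0"
  and ab: "a < b" "a ~: Re ` Z" "b ~: Re ` Z"
 shows "G (rectpath (Complex a (- h)) (Complex b h)) = (\<Prod>z | z : Z & a < Re z & Re z < b. G (circlepath z (e z)))"
 using ab
proof (induction "card {z : Z. a < Re z & Re z < b}" arbitrary: a b rule: less_induct)
 case (less a b)
 let ?Z = "%a b. {z : Z. a < Re z & Re z < b}"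
 have fin: "finite (?Z a b)" for a b using Z(1) by (rule rev_finite_subset) blast
 have him: "h ~: Im ` Z" "- h ~: Im ` Z" using Z(3) h by (auto dest!: Z(3))
 have cb: "cbox (Complex a (- h)) (Complex b h) \<inter> Z = ?Z a b"
 proof (intro equalityI subsetI)
  fix z assume z: "z : cbox (Complex a (- h)) (Complex b h) \<inter> Z"
  then have "Re z ~= a" "Re z ~= b" using less.prems by blast+
  then show "z : ?Z a b" using z by (auto simp: in_cbox_complex_iff)
 next
  fix z assume z: "z : ?Z a b"
  then have "\<bar>Im z\<bar> < h" using Z(3) by blast
  then show "z : cbox (Complex a (- h)) (Complex b h) \<inter> Z" using z by (auto simp: in_cbox_complex_iff)
 qed
 consider "?Z a b = {}" | \<zeta> where "?Z a b = {\<zeta>}" | z1 z2 where "z1 : ?Z a b" "z2 : ?Z a b" "Re z1 < Re z2"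
 proof (cases "\<exists>z1\<in>?Z a b. \<exists>z2\<in>?Z a b. Re z1 < Re z2")
  case True then show ?thesis using that(3) by blast
 next
  case False
  have "z1 = z2" if "z1 : ?Z a b" "z2 : ?Z a b" for z1 z2
  proof (rule inj_onD[OF Z(2)])
  have "\<not> Re z1 < Re z2" "\<not> Re z2 < Re z1" using False that by blast+
  then show "Re z1 = Re z2" by linarith
  qed (use that in blast)+
  then show ?thesis using that(1,2) by blast
 qed
 then show ?case
 proof cases
  case 1
  have sub: "cbox (Complex a (- h)) (Complex b h) \<subseteq> - Z" using cb unfolding 1 by blast
  have im: "path_image (rectpath (Complex a (- h)) (Complex b h)) \<subseteq> cbox (Complex a (- h)) (Complex b h)"
  by (rule path_image_rectpath_subset_cbox) (use less.prems h in auto)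
  have "G (rectpath (Complex a (- h)) (Complex b h)) = 1"
  by (rule path_character_convex_loop[OF G convex_box(1) sub path_rectpath im]) simp
  then show ?thesis unfolding 1 by simp
 next
  case (2 \<zeta>)
  then have "\<zeta> : Z" "a < Re \<zeta>" "Re \<zeta> < b" by auto
  then have "G (rectpath (Complex a (- h)) (Complex b h)) = G (circlepath \<zeta> (e \<zeta>))"
  using cb 2 Z(3)[of \<zeta>] e by (intro rectangle_character_single[OF G]) (auto simp: in_box_complex_iff)
  then show ?thesis unfolding 2 by simp
 next
  case (3 z1 z2)
  have "infinite {Re z1<..<Re z2}" using 3 by (simp add: infinite_Ioo)
  then have "\<not> {Re z1<..<Re z2} \<subseteq> Re ` Z" using Z(1) finite_subset by blast
  then obtain c where "c : {Re z1<..<Re z2}" and c3: "c ~: Re ` Z" by blast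
  then have c: "Re z1 < c" "c < Re z2" "c ~: Re ` Z" by simp_all
  have ac: "a < c" "c < b" using c 3 by auto
  have dec: "?Z a b = ?Z a c \<union> ?Z c b" "?Z a c \<inter> ?Z c b = {}"
  proof -
  have "Re z ~= c" if "z : Z" for z using c(3) that by blast
  then show "?Z a b = ?Z a c \<union> ?Z c b" using ac by (force simp: neq_iff)
  qed auto
  have "?Z a c \<subseteq> ?Z a b" "z2 : ?Z a b" "z2 ~: ?Z a c" "?Z c b \<subseteq> ?Z a b" "z1 : ?Z a b" "z1 ~: ?Z c b"
  using 3 c ac by auto
  then have "?Z a c \<subset> ?Z a b" "?Z c b \<subset> ?Z a b" by blast+
  then have "card (?Z a c) < card (?Z a b)" "card (?Z c b) < card (?Z a b)"
  by (auto intro!: psubset_card_mono fin)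
  then have "G (rectpath (Complex a (- h)) (Complex c h)) = (\<Prod>z\<in>?Z a c. G (circlepath z (e z)))"
  "G (rectpath (Complex c (- h)) (Complex b h)) = (\<Prod>z\<in>?Z c b. G (circlepath z (e z)))"
  using less.hyps[of a c] less.hyps[of c b] ac c(3) less.prems by simp_all
  moreover have "G (rectpath (Complex a (- h)) (Complex b h)) =
  G (rectpath (Complex a (- h)) (Complex c h)) * G (rectpath (Complex c (- h)) (Complex b h))"
  by (rule rectangle_character_split[OF G him]) (use less.prems c ac in auto)
  ultimately show ?thesis unfolding dec(1) by (subst prod.union_disjoint) (use dec(2) fin in auto)
 qed
qed

text \<open>The plane analogue of the decomposition of the full twist: a large circle is, up to commutators, the product of small circles around the points that it encloses.\<close>

lemma circle_character:
 assumes G: "path_character (- Z) G" and Z: "finite Z" "inj_on Re Z" "Z \<subseteq> ball 0 R" and R: "R > 0"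
  and e: "!!z. z : Z ==> e z > 0" "!!z. z : Z ==> cball z (e z) \<inter> Z \<subseteq> {z}"
 shows "G (circlepath 0 R) = (\<Prod>z\<in>Z. G (circlepath z (e z)))"
proof -
 let ?P = "rectpath (Complex (-R) (- R)) (Complex R R)"
 have small: "\<bar>Re z\<bar> < R" "\<bar>Im z\<bar> < R" if "z : Z" for z
  using that Z(3) abs_Re_le_cmod[of z] abs_Im_le_cmod[of z] by fastforce+
 have im: "cmod x \<ge> R" if "x : path_image ?P" for x
  using that R abs_Re_le_cmod[of x] abs_Im_le_cmod[of x] by (auto simp: path_image_rectpath)
 have "homotopic_loops (- Z) (circlepath 0 R) ?P"
 proof (rule radial_homotopy[where \<zeta> = 0 and r = R])
  show "sphere 0 R \<subseteq> - Z" using Z(3) by auto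
  show "0 ~: path_image (circlepath 0 R)" "0 ~: path_image ?P" using im[of 0] R by auto
  have "0 : box (Complex (-R) (- R)) (Complex R R)" using R by (simp add: in_box_complex_iff)
  then show "winding_number (circlepath 0 R) 0 = winding_number ?P 0"
  using winding_number_rectpath winding_number_circlepath_centre[OF R] by simp
  fix x assume "x : path_image (circlepath 0 R) \<union> path_image ?P"
  then have x: "cmod x \<ge> R" using im R by auto
  then have xn: "x ~= 0" using R by auto
  then have c: "R / cmod (x - 0) > 0" using R by simp
  show "closed_segment x (0 + of_real (R / cmod (x - 0)) * (x - 0)) \<subseteq> - Z"
  proof
  fix y assume "y : closed_segment x (0 + of_real (R / cmod (x - 0)) * (x - 0))"
  then obtain l where l: "l > 0" "min 1 (R / cmod (x - 0)) \<le> l" "y = 0 + of_real l * (x - 0)"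
  using mem_radial_segment[OF _ c xn] by metis
  have "R / cmod x \<le> 1" using x xn by simp
  then have "R / cmod x \<le> l" using l(2) by (simp add: min_def split: if_splits)
  then have "R / cmod x * cmod x \<le> l * cmod x" by (rule mult_right_mono) simp
  also have "... = cmod y" using l(1) unfolding l(3) by (simp add: norm_mult)
  finally have "R \<le> cmod y" using xn by simp
  then show "y : - Z" using Z(3) by auto
  qed
 qed (use R in auto)
 then have "G (circlepath 0 R) = G ?P" by (rule path_character_loops[OF G])
 also have "... = (\<Prod>z | z : Z & - R < Re z & Re z < R. G (circlepath z (e z)))"
  by (rule strip_character[OF G Z(1,2) _ e]) (use small R in fastforce)+
 also have "{z. z : Z & - R < Re z & Re z < R} = Z" using small by fastforce
 finally show ?thesis .
qed

section \<open>Reflecting hyperplanes of a finite linear group\<close>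

lemma fixspace_subspace: "vec.subspace (fixspace (s::('n::finite) cmat))"
 unfolding vec.subspace_def fixspace_def
 by (auto simp: matrix_vector_right_distrib vec.linear_scale matrix_vector_mult_scaleR vector_scalar_commute)

lemma reflection_fixspace:
 fixes P :: "('n::finite) cmat set"
 assumes "s : refl P"
 shows "s : P" "vec.dim (fixspace s) + 1 = CARD('n)" 
 using assms unfolding refl_def by auto

lemma fixspace_insert_span:
 fixes s :: "('n::finite) cmat"
 assumes s: "vec.dim (fixspace s) + 1 = CARD('n)" and x0: "x0 ~: fixspace s"
 shows "\<exists>!k. x - k *s x0 : fixspace s"
proof -
 have sp: "vec.span (fixspace s) = fixspace s"
  using fixspace_subspace by (rule vec.span_eq_iff[THEN iffD2])
 have "vec.dim (insert x0 (fixspace s)) = CARD('n)"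
  using s x0 by (simp add: vec.dim_insert sp)
 then have "vec.span (insert x0 (fixspace s)) = UNIV"
  using vec.dim_eq_full vec_dim_card by (metis vec.dim_span vec.dim_UNIV vec.dimension_def)
 then have "x : vec.span (insert x0 (fixspace s))" by simp
 then obtain k where k: "x - k *s x0 : fixspace s"
  unfolding vec.span_breakdown_eq sp by blast
 show ?thesis
 proof (rule ex1I[where a = k], fact k)
  fix l assume l: "x - l *s x0 : fixspace s"
  show "l = k"
  proof (rule ccontr)
  assume "l ~= k"
  have "(x - k *s x0) - (x - l *s x0) : fixspace s"
  by (rule vec.subspace_diff[OF fixspace_subspace k l])
  then have "(l - k) *s x0 : fixspace s" by (simp add: vector_sub_rdistrib vector_ssub_ldistrib)
  then have "inverse (l - k) *s ((l - k) *s x0) : fixspace s"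
  by (rule vec.subspace_scale[OF fixspace_subspace])
  moreover have "inverse (l - k) *s ((l - k) *s x0) = x0" using \<open>l ~= k\<close> by (simp only: vec.scale_scale) simp
  ultimately show False using x0 by simp
  qed
 qed
qed

text \<open>The linear form with kernel \<open>H\<close> normalized to be \<open>1\<close> at the regular vector \<open>x0\<close>.\<close>

definition height :: "complex ^ 'n => (complex ^ 'n::finite) set => complex ^ 'n => complex" where
 "height x0 H x = (THE k. x - k *s x0 : H)"

lemma scaleR_vec_complex: "r *\<^sub>R (x :: complex ^ ('n::finite)) = of_real r *s x"
 by (rule Finite_Cartesian_Product.vec_eq_iff[THEN iffD2], intro allI, simp only: vector_scaleR_component vector_smult_component scaleR_conv_of_real[where 'a = complex])

locale reflection_arrangement =
 fixes P :: "('n::finite) cmat set" and x0 :: "complex ^ 'n"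
 assumes fin: "finite P" and grp: "group (mat_group P)" and x0: "x0 : regular P"
begin

lemma mat_group_simps [simp]: "carrier (mat_group P) = P" "x \<otimes>\<^bsub>mat_group P\<^esub> y = x ** y" "\<one>\<^bsub>mat_group P\<^esub> = I1"
 by (simp_all add: mat_group_def)

lemma one_in: "I1 : P" using group.is_monoid[OF grp, THEN monoid.one_closed] by simp

lemma mult_in: "g : P ==> h : P ==> g ** h : P"
 using monoid.m_closed[OF group.is_monoid[OF grp]] by simp

lemma inv_props:
 assumes "g : P"
 shows "matrix_inv g : P" "matrix_inv g ** g = I1" "g ** matrix_inv g = I1"
  "inv\<^bsub>mat_group P\<^esub> g = matrix_inv g"
proof -
 have h: "inv\<^bsub>mat_group P\<^esub> g : P" "inv\<^bsub>mat_group P\<^esub> g ** g = I1" "g ** inv\<^bsub>mat_group P\<^esub> g = I1"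
  using group.inv_closed[OF grp, of g] group.l_inv[OF grp, of g] group.r_inv[OF grp, of g] assms by simp_all
 have i: "g ** matrix_inv g = I1 & matrix_inv g ** g = I1"
  unfolding matrix_inv_def by (rule someI) (use h in blast)
 have "inv\<^bsub>mat_group P\<^esub> g = inv\<^bsub>mat_group P\<^esub> g ** (g ** matrix_inv g)" using i by simp
 also have "... = matrix_inv g" using h by (simp add: matrix_mul_assoc)
 finally show "inv\<^bsub>mat_group P\<^esub> g = matrix_inv g" .
 with h i show "matrix_inv g : P" "matrix_inv g ** g = I1" "g ** matrix_inv g = I1" by simp_all
qed

lemma finite_hyperplanes: "finite (hyperplanes P)"
 unfolding hyperplanes_def refl_def using fin by simp

lemma x0_notin: "H : hyperplanes P ==> x0 ~: H"
 using x0 unfolding regular_def by blast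

lemma height_ex1: "H : hyperplanes P ==> \<exists>!k. x - k *s x0 : H"
 using fixspace_insert_span reflection_fixspace(2) x0_notin unfolding hyperplanes_def by fastforce

lemma height_mem: "H : hyperplanes P ==> x - height x0 H x *s x0 : H"
 unfolding height_def by (rule theI'[OF height_ex1])

lemma height_eqI: "H : hyperplanes P ==> x - k *s x0 : H ==> height x0 H x = k"
 unfolding height_def by (rule the1_equality[OF height_ex1])

lemma hyperplane_subspace: "H : hyperplanes P ==> vec.subspace H"
 unfolding hyperplanes_def using fixspace_subspace by auto

lemma height_add: assumes "H : hyperplanes P" shows "height x0 H (x + y) = height x0 H x + height x0 H y"
proof (rule height_eqI[OF assms])
 have "(x - height x0 H x *s x0) + (y - height x0 H y *s x0) : H"
  by (rule vec.subspace_add[OF hyperplane_subspace[OF assms]]) (use height_mem[OF assms] in auto)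
 then show "x + y - (height x0 H x + height x0 H y) *s x0 : H"
  by (simp add: vector_sadd_rdistrib algebra_simps)
qed

lemma height_scale: assumes "H : hyperplanes P" shows "height x0 H (c *s x) = c * height x0 H x"
proof (rule height_eqI[OF assms])
 have "c *s (x - height x0 H x *s x0) : H"
  by (rule vec.subspace_scale[OF hyperplane_subspace[OF assms]]) (use height_mem[OF assms] in auto)
 then show "c *s x - (c * height x0 H x) *s x0 : H"
  by (simp add: vector_ssub_ldistrib vector_smult_assoc)
qed

lemma height_x0: "H : hyperplanes P ==> height x0 H x0 = 1"
 by (rule height_eqI) (auto intro: vec.subspace_0 hyperplane_subspace)

lemma height_diff: assumes "H : hyperplanes P" shows "height x0 H (x - y) = height x0 H x - height x0 H y"
 using height_add[OF assms, of "x - y" y] by simp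

lemma hyperplane_height: "H : hyperplanes P ==> x : H \<longleftrightarrow> height x0 H x = 0"
 using height_mem[of H x] height_eqI[of H x 0] by auto

lemma regular_height: "x : regular P \<longleftrightarrow> (\<forall>H\<in>hyperplanes P. height x0 H x ~= 0)"
 unfolding regular_def using hyperplane_height by auto

lemma height_linear: assumes "H : hyperplanes P" shows "linear (height x0 H)"
 by (rule linearI) (simp_all add: height_add height_scale assms scaleR_vec_complex scaleR_conv_of_real)

lemma height_separates:
 assumes "H : hyperplanes P" "H' : hyperplanes P" "H ~= H'"
 shows "\<exists>v. height x0 H v ~= height x0 H' v"
 using assms hyperplane_height by fastforce

lemma fixspace_conj:
 assumes g: "g : P"
 shows "fixspace (g ** s ** matrix_inv g) = (*v) g ` fixspace s"
proof (intro equalityI subsetI)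
 fix x assume "x : fixspace (g ** s ** matrix_inv g)"
 then have "g *v (s *v (matrix_inv g *v x)) = x" by (simp add: fixspace_def flip: matrix_vector_mul_assoc)
 then have "(matrix_inv g ** g) *v (s *v (matrix_inv g *v x)) = matrix_inv g *v x"
  by (metis matrix_vector_mul_assoc)
 then have "matrix_inv g *v x : fixspace s" using inv_props[OF g] by (simp add: fixspace_def)
 moreover have "x = g *v (matrix_inv g *v x)" using inv_props[OF g] by (simp add: matrix_vector_mul_assoc)
 ultimately show "x : (*v) g ` fixspace s" by blast
next
 fix x assume "x : (*v) g ` fixspace s"
 then obtain y where y: "x = g *v y" "s *v y = y" by (auto simp: fixspace_def)
 have "matrix_inv g *v x = y" using inv_props[OF g] by (simp add: matrix_vector_mul_assoc y)
 then show "x : fixspace (g ** s ** matrix_inv g)"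
  using y by (simp add: fixspace_def matrix_vector_mul_assoc[symmetric])
qed

lemma matrix_cancel: "g : P ==> matrix_inv g *v (g *v x) = x" "g : P ==> g *v (matrix_inv g *v x) = x"
 using inv_props by (simp_all add: matrix_vector_mul_assoc)

lemma refl_conj:
 assumes g: "g : P" and s: "s : refl P"
 shows "g ** s ** matrix_inv g : refl P"
proof -
 have "inj ((*v) g)" by (rule inj_on_inverseI[where g = "(*v) (matrix_inv g)"]) (simp add: matrix_cancel g)
 then have "vec.dim ((*v) g ` fixspace s) = vec.dim (fixspace s)"
  by (intro vec.dim_image_eq matrix_vector_mul_linear_gen) (auto intro: inj_on_subset)
 then show ?thesis
  using s mult_in inv_props(1)[OF g] g unfolding refl_def by (auto simp: fixspace_conj[OF g])
qed

lemma fixspace_inv: assumes g: "g : P" shows "fixspace (matrix_inv g) = fixspace g"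
 using matrix_cancel[OF g] unfolding fixspace_def by (metis (lifting))

lemma refl_inv: "s : refl P ==> matrix_inv s : refl P"
 unfolding refl_def by (auto simp: inv_props fixspace_inv)

lemma hyperplane_image:
 assumes g: "g : P" and H: "H : hyperplanes P"
 shows "(*v) g ` H : hyperplanes P"
 using H refl_conj[OF g] fixspace_conj[OF g] unfolding hyperplanes_def by (metis (no_types, lifting) imageE imageI)

lemma regular_invariant: assumes g: "g : P" and x: "x : regular P" shows "g *v x : regular P"
proof -
 have "g *v x ~: H" if H: "H : hyperplanes P" for H
 proof
  assume "g *v x : H"
  then have "matrix_inv g *v (g *v x) : (*v) (matrix_inv g) ` H" by blast
  then have "x : (*v) (matrix_inv g) ` H" by (simp add: matrix_cancel g)
  then show False using x hyperplane_image[OF inv_props(1)[OF g] H] unfolding regular_def by blast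
 qed
 then show ?thesis unfolding regular_def by blast
qed

lemma regular_scale: "x : regular P ==> c ~= 0 ==> c *s x : regular P"
 unfolding regular_height by (simp add: height_scale)

lemma fixator_I1: "I1 : fixator P X" unfolding fixator_def using one_in by simp

lemma fixator_mult: "g : fixator P X ==> h : fixator P X ==> g ** h : fixator P X"
 unfolding fixator_def using mult_in by (auto simp flip: matrix_vector_mul_assoc)

lemma fixator_formula:
 assumes H: "H : hyperplanes P" and w: "w : fixator P H"
 shows "w *v x = x + height x0 H x *s (w *v x0 - x0)"
proof -
 have "w *v (x - height x0 H x *s x0) = x - height x0 H x *s x0"
  using w height_mem[OF H] unfolding fixator_def by blast
 then show ?thesis
  by (simp add: matrix_vector_mult_diff_distrib vec.linear_scale matrix_vector_mul_linear_gen
  vector_ssub_ldistrib algebra_simps vector_scalar_commute)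
qed

text \<open>An element of the fixator of \<open>H\<close> acts on \<open>V / H\<close> by this scalar, because \<open>x0\<close> spans a complement of \<open>H\<close>.\<close>

definition normal_eigenvalue :: "(complex ^ 'n) set => 'n cmat => complex" where
 "normal_eigenvalue H w = height x0 H (w *v x0)"

lemma height_fixator:
 assumes H: "H : hyperplanes P" and w: "w : fixator P H"
 shows "height x0 H (w *v x) = height x0 H x * normal_eigenvalue H w"
 unfolding normal_eigenvalue_def
 by (subst fixator_formula[OF H w]) (simp add: height_add height_scale height_diff height_x0 H algebra_simps)

lemma normal_eigenvalue_mult:
 assumes H: "H : hyperplanes P" and w: "w : fixator P H" "w' : fixator P H"
 shows "normal_eigenvalue H (w ** w') = normal_eigenvalue H w * normal_eigenvalue H w'"
 using height_fixator[OF H w(1), of "w' *v x0"]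
 by (simp add: normal_eigenvalue_def matrix_vector_mul_assoc)

lemma normal_eigenvalue_I1: "H : hyperplanes P ==> normal_eigenvalue H I1 = 1"
 by (simp add: normal_eigenvalue_def height_x0)

lemma fixator_pow:
 assumes w: "w : fixator P X"
 shows "w [^]\<^bsub>mat_group P\<^esub> (n::nat) : fixator P X"
 by (induction n) (use w fixator_I1 fixator_mult in auto)

lemma normal_eigenvalue_pow:
 assumes H: "H : hyperplanes P" and w: "w : fixator P H"
 shows "normal_eigenvalue H (w [^]\<^bsub>mat_group P\<^esub> (n::nat)) = normal_eigenvalue H w ^ n"
 by (induction n)
  (simp_all add: normal_eigenvalue_I1[OF H] normal_eigenvalue_mult[OF H fixator_pow[OF w] w])

text \<open>An element acting trivially on \<open>H\<close> and on \<open>V / H\<close> is a transvection; as it has finite order, it is the identity.\<close>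

lemma normal_eigenvalue_eq_1:
 assumes H: "H : hyperplanes P" and w: "w : fixator P H" and 1: "normal_eigenvalue H w = 1"
 shows "w = I1"
proof -
 let ?u = "w *v x0 - x0"
 have wP: "w : P" using w unfolding fixator_def by blast
 have "height x0 H ?u = 0" using 1 by (simp add: height_diff H height_x0 normal_eigenvalue_def)
 then have wu: "w *v ?u = ?u" using fixator_formula[OF H w, of ?u] by simp
 \<comment> \<open>otherwise the orbit of \<open>x0\<close> would be infinite\<close>
 have iter: "(w [^]\<^bsub>mat_group P\<^esub> n) *v x0 = x0 + of_nat n *s ?u" for n :: nat
 proof (induction n)
  case (Suc n)
  have wn: "(w [^]\<^bsub>mat_group P\<^esub> n) *v ?u = ?u"
  proof (induction n)
  case (Suc n)
  then show ?case using wu by (simp flip: matrix_vector_mul_assoc)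
  qed simp
  have "(w [^]\<^bsub>mat_group P\<^esub> Suc n) *v x0 = (w [^]\<^bsub>mat_group P\<^esub> n) *v (x0 + ?u)"
  by (simp flip: matrix_vector_mul_assoc)
  also have "... = x0 + of_nat n *s ?u + ?u"
  using Suc wn by (simp only: matrix_vector_right_distrib)
  also have "... = x0 + of_nat (Suc n) *s ?u" by (simp add: vec_eq_iff algebra_simps)
  finally show ?case .
 qed simp
 have "w [^]\<^bsub>mat_group P\<^esub> card P = I1"
  using group.pow_order_eq_1[OF grp, of w] wP by (simp add: order_def)
 then have "of_nat (card P) *s ?u = 0" using iter[of "card P"] by simp
 moreover have "card P ~= 0" using fin one_in by auto
 ultimately have "?u = 0" by (simp add: vec.scale_eq_0_iff)
 then have "w *v x = x" for x using fixator_formula[OF H w, of x] by simp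
 then show ?thesis by (simp add: matrix_eq)
qed

lemma normal_eigenvalue_inj: assumes H: "H : hyperplanes P" shows "inj_on (normal_eigenvalue H) (fixator P H)"
proof (rule inj_onI)
 fix g h assume g: "g : fixator P H" and h: "h : fixator P H" and e: "normal_eigenvalue H g = normal_eigenvalue H h"
 have hP: "h : P" using h unfolding fixator_def by blast
 have hi: "matrix_inv h : fixator P H"
  unfolding fixator_def
 proof (intro CollectI conjI ballI)
  fix x assume "x : H"
  then have "h *v x = x" using h unfolding fixator_def by blast
  then show "matrix_inv h *v x = x" using matrix_cancel(1)[OF hP, of x] by simp
 qed (simp add: inv_props hP)
 have "normal_eigenvalue H (matrix_inv h ** g) = normal_eigenvalue H (matrix_inv h ** h)"
  by (simp only: normal_eigenvalue_mult[OF H hi g] normal_eigenvalue_mult[OF H hi h] e)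
 then have "matrix_inv h ** g = I1"
  using normal_eigenvalue_eq_1[OF H fixator_mult[OF hi g]] inv_props[OF hP] normal_eigenvalue_I1[OF H] by simp
 then have "h ** (matrix_inv h ** g) = h" by simp
 then show "g = h" by (simp add: matrix_mul_assoc inv_props hP)
qed

lemma finite_fixator: "finite (fixator P X)" unfolding fixator_def using fin by simp

lemma normal_eigenvalue_nonzero:
 assumes H: "H : hyperplanes P" and w: "w : fixator P H" shows "normal_eigenvalue H w ~= 0"
proof -
 have "w [^]\<^bsub>mat_group P\<^esub> card P = I1"
  using group.pow_order_eq_1[OF grp, of w] w by (simp add: order_def fixator_def)
 then have "normal_eigenvalue H w ^ card P = 1"
  using normal_eigenvalue_pow[OF H w, of "card P"] normal_eigenvalue_I1[OF H] by simp
 moreover have "card P ~= 0" using fin one_in by auto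
 ultimately show ?thesis by (metis power_eq_0_iff zero_power zero_neq_one gr0I)
qed

lemma refl_fixator: "s : refl P ==> s : fixator P (fixspace s)"
 unfolding refl_def fixator_def fixspace_def by auto

lemma I1_not_refl: "I1 ~: refl P"
proof
 assume "I1 : refl P"
 then have "vec.dim (UNIV :: (complex ^ 'n) set) + 1 = CARD('n)" unfolding refl_def fixspace_def by simp
 then show False by (simp only: vec_dim_card)
qed

lemma hyp_order_ge_2: assumes "H : hyperplanes P" shows "hyp_order P H \<ge> 2"
proof -
 obtain s where s: "s : refl P" "H = fixspace s" using assms unfolding hyperplanes_def by blast
 then have "card {I1, s} \<le> card (fixator P H)"
  by (intro card_mono finite_fixator) (use refl_fixator fixator_I1 in auto)
 moreover have "s ~= I1" using I1_not_refl s by blast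
 ultimately show ?thesis unfolding hyp_order_def by simp
qed

text \<open>The fixator embeds into the roots of unity by the normal eigenvalue, and a finite group of \<open>e\<close> such numbers consists of all \<open>e\<close>-th roots.\<close>

lemma normal_eigenvalue_image:
 assumes H: "H : hyperplanes P"
 shows "normal_eigenvalue H ` fixator P H = {z. z ^ hyp_order P H = 1}"
proof (rule card_subset_eq)
 let ?L = "normal_eigenvalue H ` fixator P H" and ?e = "hyp_order P H"
 have e: "?e > 0" using hyp_order_ge_2[OF H] by simp
 have cL: "card ?L = ?e" using card_image[OF normal_eigenvalue_inj[OF H]] unfolding hyp_order_def .
 show "finite {z::complex. z ^ ?e = 1}" by (rule finite_roots_unity) (use e in auto)
 show "card ?L = card {z::complex. z ^ ?e = 1}" using cL card_roots_unity_eq[of ?e] e by simp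
 show "?L \<subseteq> {z. z ^ ?e = 1}"
 proof
  fix z assume z: "z : ?L"
  have nz: "y ~= 0" if "y : ?L" for y using that normal_eigenvalue_nonzero[OF H] by auto
  have "(*) z ` ?L \<subseteq> ?L"
  using z normal_eigenvalue_mult[OF H] fixator_mult by (auto simp: image_iff) (metis)
  moreover have inj: "inj_on ((*) z) ?L" using nz[OF z] by (auto intro: inj_onI)
  ultimately have "(*) z ` ?L = ?L" by (simp add: finite_fixator endo_inj_surj)
  then have "(\<Prod>y\<in>?L. y) = (\<Prod>y\<in>?L. z * y)"
  using prod.reindex[OF inj, of "%y. y"] by (simp add: o_def)
  also have "... = z ^ ?e * (\<Prod>y\<in>?L. y)" by (simp add: prod.distrib cL)
  finally show "z : {z. z ^ ?e = 1}" using nz finite_fixator by auto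
 qed
qed

lemma zeta_power_eq_1: "zeta e ^ i = 1 \<longleftrightarrow> e dvd i" if "e > 0"
proof -
 have "zeta e ^ i = exp (2 * of_real pi * \<i> * of_nat i / of_nat e)"
  unfolding zeta_def by (simp add: exp_of_nat_mult[symmetric] mult_ac)
 also have "... = 1 \<longleftrightarrow> i mod e = 0 mod e"
  using complex_root_unity_eq[of e i 0] that by simp
 finally show ?thesis by (simp add: dvd_eq_mod_eq_0)
qed

lemma distinguished_reflection:
 assumes H: "H : hyperplanes P"
 obtains s where "s : fixator P H" "normal_eigenvalue H s = zeta (hyp_order P H)"
proof -
 have "zeta (hyp_order P H) ^ hyp_order P H = 1"
  using zeta_power_eq_1 hyp_order_ge_2[OF H] by simp
 then show ?thesis using normal_eigenvalue_image[OF H] that by (metis (mono_tags, lifting) imageE mem_Collect_eq)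
qed

lemma zeta_power_inj: assumes "e > 0" shows "inj_on (%i. zeta e ^ i) {..<e}"
proof -
 have "i = j" if ij: "i \<le> j" "j < e" and eq: "zeta e ^ i = zeta e ^ j" for i j
 proof -
  have nz: "zeta e ~= 0" by (simp add: zeta_def)
  have "zeta e ^ i * zeta e ^ (j - i) = zeta e ^ i" using ij eq by (metis le_add_diff_inverse power_add)
  then have "zeta e ^ (j - i) = 1" using nz by simp
  then have "e dvd (j - i)" using zeta_power_eq_1[OF assms] by simp
  then show ?thesis using ij by (auto dest: dvd_imp_le)
 qed
 then show ?thesis unfolding inj_on_def by (metis lessThan_iff linear)
qed

lemma fixator_powers:
 assumes H: "H : hyperplanes P" and s: "s : fixator P H" "normal_eigenvalue H s = zeta (hyp_order P H)"
 shows "bij_betw (%i. s [^]\<^bsub>mat_group P\<^esub> i) {..<hyp_order P H} (fixator P H)"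
proof -
 let ?e = "hyp_order P H" and ?f = "%i::nat. s [^]\<^bsub>mat_group P\<^esub> i"
 have e: "?e > 0" using hyp_order_ge_2[OF H] by simp
 have inj: "inj_on ?f {..<?e}"
 proof (rule inj_onI)
  fix i j assume ij: "i : {..<?e}" "j : {..<?e}" "?f i = ?f j"
  then have "zeta ?e ^ i = zeta ?e ^ j" using normal_eigenvalue_pow[OF H s(1)] s(2) by metis
  then show "i = j" using zeta_power_inj[OF e] ij unfolding inj_on_def by blast
 qed
 have "?f ` {..<?e} = fixator P H"
  by (rule card_subset_eq[OF finite_fixator])
  (use fixator_pow[OF s(1)] card_image[OF inj] in \<open>auto simp: hyp_order_def\<close>)
 then show ?thesis using inj unfolding bij_betw_def by blast
qed

lemma fixator_eq_refl:
 assumes H: "H : hyperplanes P"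
 shows "fixator P H = insert I1 {s : refl P. fixspace s = H}"
proof (intro equalityI subsetI)
 fix w assume w: "w : fixator P H"
 obtain s where s: "s : refl P" "H = fixspace s" using H unfolding hyperplanes_def by blast
 show "w : insert I1 {s : refl P. fixspace s = H}"
 proof (cases "w = I1")
  case False
  have sub: "H \<subseteq> fixspace w" using w unfolding fixator_def fixspace_def by auto
  have "fixspace w ~= UNIV" using False unfolding fixspace_def by (auto simp: matrix_eq)
  then have "vec.dim (fixspace w) ~= CARD('n)"
  using vec.subspace_dim_equal[OF fixspace_subspace vec.subspace_UNIV] by (metis order_refl subset_UNIV vec_dim_card)
  moreover have "vec.dim (fixspace w) \<le> CARD('n)" by (metis vec.dim_subset subset_UNIV vec_dim_card)
  ultimately have le: "vec.dim (fixspace w) \<le> vec.dim H" using reflection_fixspace(2)[OF s(1)] s(2) by simp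
  have "H = fixspace w"
  by (rule vec.subspace_dim_equal[OF hyperplane_subspace[OF H] fixspace_subspace sub le])
  then show ?thesis using w s unfolding refl_def fixator_def by auto
 qed simp
qed (use refl_fixator fixator_I1 in auto)

text \<open>Every reflection lies in the fixator of exactly one hyperplane, and the identity lies in all of them.\<close>

lemma sum_over_fixators:
 fixes g :: "'n cmat => 'b::semiring_1"
 shows "(\<Sum>H\<in>hyperplanes P. \<Sum>w\<in>fixator P H. g w) = of_nat (card (hyperplanes P)) * g I1 + (\<Sum>s\<in>refl P. g s)"
proof -
 have fr: "finite (refl P)" unfolding refl_def using fin by simp
 have "(\<Sum>w\<in>fixator P H. g w) = g I1 + (\<Sum>s | s : refl P & fixspace s = H. g s)" if "H : hyperplanes P" for H
  unfolding fixator_eq_refl[OF that] by (subst sum.insert) (use fr I1_not_refl in auto)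
 then have "(\<Sum>H\<in>hyperplanes P. \<Sum>w\<in>fixator P H. g w) =
  (\<Sum>H\<in>hyperplanes P. g I1 + (\<Sum>s | s : refl P & fixspace s = H. g s))" by simp
 also have "... = of_nat (card (hyperplanes P)) * g I1 + (\<Sum>H\<in>fixspace ` refl P. \<Sum>s | s : refl P & fixspace s = H. g s)"
  by (simp add: sum.distrib hyperplanes_def)
 also have "(\<Sum>H\<in>fixspace ` refl P. \<Sum>s | s : refl P & fixspace s = H. g s) = (\<Sum>s\<in>refl P. g s)"
  by (rule sum.image_gen[symmetric, OF fr])
 finally show ?thesis .
qed

lemma hyp_order_image:
 assumes g: "g : P"
 shows "hyp_order P ((*v) g ` H) = hyp_order P H"
proof -
 have "bij_betw (%w. g ** w ** matrix_inv g) (fixator P H) (fixator P ((*v) g ` H))"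
 proof (rule bij_betw_byWitness[where f' = "%w. matrix_inv g ** w ** g"])
  show "\<forall>a\<in>fixator P H. matrix_inv g ** (g ** a ** matrix_inv g) ** g = a"
  using inv_props[OF g] by (simp add: matrix_mul_assoc) (simp add: inv_props[OF g] flip: matrix_mul_assoc)
  show "\<forall>a\<in>fixator P ((*v) g ` H). g ** (matrix_inv g ** a ** g) ** matrix_inv g = a"
  using inv_props[OF g] by (simp add: matrix_mul_assoc) (simp add: inv_props[OF g] flip: matrix_mul_assoc)
  show "(%w. g ** w ** matrix_inv g) ` fixator P H \<subseteq> fixator P ((*v) g ` H)"
  unfolding fixator_def using g mult_in inv_props[OF g]
  by (auto simp: matrix_cancel[OF g] simp flip: matrix_vector_mul_assoc)
  show "(%w. matrix_inv g ** w ** g) ` fixator P ((*v) g ` H) \<subseteq> fixator P H"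
  unfolding fixator_def using g mult_in inv_props[OF g]
  by (auto simp: matrix_cancel[OF g] simp flip: matrix_vector_mul_assoc)
 qed
 then show ?thesis unfolding hyp_order_def using bij_betw_same_card by metis
qed

lemma orbit_order_hyp_orbit: "orbit_order P (hyp_orbit P H) = hyp_order P H"
proof -
 have "hyp_order P ` hyp_orbit P H = {hyp_order P H}"
  unfolding hyp_orbit_def using hyp_order_image one_in by (auto simp: image_iff)
 then show ?thesis unfolding orbit_order_def by simp
qed

end

text \<open>A complex space is not a finite union of zero sets of nonzero real-linear forms.\<close>

lemma generic_vector:
 fixes F :: "('a::real_vector => real) set"
 assumes "finite F" "!!f. f : F ==> linear f" "!!f. f : F ==> \<exists>x. f x ~= 0"
 shows "\<exists>v. \<forall>f\<in>F. f v ~= 0"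
 using assms
proof (induction F)
 case (insert f F)
 then obtain v where v: "\<forall>g\<in>F. g v ~= 0" by blast
 obtain w where w: "f w ~= 0" using insert.prems by blast
 have "finite ((%g. - g v / g w) ` insert f F)" using insert by simp
 then obtain t where t: "t ~: (%g. - g v / g w) ` insert f F"
  using ex_new_if_finite infinite_UNIV_char_0 by blast
 have "g (v + t *\<^sub>R w) ~= 0" if g: "g : insert f F" for g
 proof
  assume "g (v + t *\<^sub>R w) = 0"
  then have *: "g v + t * g w = 0" using insert.prems(1)[OF g] by (simp add: linear_add linear_scale)
  show False
  proof (cases "g w = 0")
  case True then show False using * v w g by auto
  next
  case False
  then have "t = - g v / g w" using * by (simp add: field_simps)
  then show False using t g by blast
  qed
 qed
 then show ?case by blast
qed simp

section \<open>The braid group and the full twist\<close>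

context reflection_arrangement
begin

lemma action_path:
 assumes "w : P" "path \<gamma>" "path_image \<gamma> \<subseteq> regular P"
 shows "path (%t. w *v \<gamma> t)" "path_image (%t. w *v \<gamma> t) \<subseteq> regular P"
proof -
 have "path ((*v) w \<circ> \<gamma>)"
  by (rule path_continuous_image[OF assms(2)]) (rule linear_continuous_on[OF matrix_vector_mul_bounded_linear])
 then show "path (%t. w *v \<gamma> t)" by (simp add: o_def)
 show "path_image (%t. w *v \<gamma> t) \<subseteq> regular P"
  using assms regular_invariant unfolding path_image_def by auto
qed

lemma action_homotopic:
 assumes "w : P" "homotopic_paths (regular P) \<gamma> \<delta>"
 shows "homotopic_paths (regular P) (%t. w *v \<gamma> t) (%t. w *v \<delta> t)"
proof -
 have "homotopic_paths (regular P) ((*v) w \<circ> \<gamma>) ((*v) w \<circ> \<delta>)"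
  by (rule homotopic_paths_continuous_image[OF assms(2)])
  (use regular_invariant[OF assms(1)] in \<open>auto intro: linear_continuous_on[OF matrix_vector_mul_bounded_linear]\<close>)
 then show ?thesis by (simp add: o_def)
qed

lemma action_join: "(%t. w *v (\<gamma> +++ \<delta>) t) = (%t. w *v \<gamma> t) +++ (%t. w *v \<delta> t)"
 by (auto simp: joinpaths_def fun_eq_iff)

lemma action_ends [simp]: "pathstart (%t. w *v \<gamma> t) = w *v pathstart \<gamma>" "pathfinish (%t. w *v \<gamma> t) = w *v pathfinish \<gamma>"
 by (simp_all add: pathstart_def pathfinish_def)

lemma path_class_eqI: "homotopic_paths (regular P) \<gamma> \<delta> ==> path_class P \<gamma> = path_class P \<delta>"
 unfolding path_class_def using homotopic_paths_trans homotopic_paths_sym by blast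

definition braid_path :: "'n cmat => (real => complex ^ 'n) => bool" where
 "braid_path w \<gamma> \<longleftrightarrow> w : P & path \<gamma> & path_image \<gamma> \<subseteq> regular P & pathstart \<gamma> = x0 & pathfinish \<gamma> = w *v x0"

lemma braid_carrier: "b : carrier (braid_group P x0) \<longleftrightarrow> (\<exists>w \<gamma>. b = (w, path_class P \<gamma>) & braid_path w \<gamma>)"
 unfolding braid_group_def braid_path_def by auto

lemma braid_pathD:
 assumes "braid_path w \<gamma>"
 shows "w : P" "path \<gamma>" "path_image \<gamma> \<subseteq> regular P" "pathstart \<gamma> = x0" "pathfinish \<gamma> = w *v x0"
  "(w, path_class P \<gamma>) : carrier (braid_group P x0)"
 using assms braid_carrier unfolding braid_path_def by auto

lemma braid_path_mult:
 assumes "braid_path w \<gamma>" "braid_path w' \<gamma>'"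
 shows "braid_path (w ** w') (\<gamma> +++ (%t. w *v \<gamma>' t))"
 using assms action_path[of w \<gamma>'] mult_in unfolding braid_path_def
 by (auto simp: matrix_vector_mul_assoc subset_path_image_join)

lemma braid_mult:
 assumes "braid_path w \<gamma>" "braid_path w' \<gamma>'"
 shows "(w, path_class P \<gamma>) \<otimes>\<^bsub>braid_group P x0\<^esub> (w', path_class P \<gamma>') =
  (w ** w', path_class P (\<gamma> +++ (%t. w *v \<gamma>' t)))"
proof -
 note a = braid_pathD[OF assms(1)] and b = braid_pathD[OF assms(2)]
 let ?j = "\<gamma> +++ (%t. w *v \<gamma>' t)"
 have eq: "homotopic_paths (regular P) (g +++ (%t. w *v g' t)) ?j"
  if "g : path_class P \<gamma>" "g' : path_class P \<gamma>'" for g g'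
 proof (rule homotopic_paths_sym, rule homotopic_paths_join)
  show "homotopic_paths (regular P) \<gamma> g" using that unfolding path_class_def by blast
  show "homotopic_paths (regular P) (%t. w *v \<gamma>' t) (%t. w *v g' t)"
  by (rule action_homotopic[OF a(1)]) (use that in \<open>simp add: path_class_def\<close>)
 qed (use a b in simp)
 have self: "\<gamma> : path_class P \<gamma>" "\<gamma>' : path_class P \<gamma>'"
  using a b unfolding path_class_def by auto
 have "{\<delta>. \<exists>g\<in>path_class P \<gamma>. \<exists>g'\<in>path_class P \<gamma>'. homotopic_paths (regular P) (g +++ (%t. w *v g' t)) \<delta>} = path_class P ?j"
 proof (intro equalityI subsetI)
  fix \<delta> assume "\<delta> : {\<delta>. \<exists>g\<in>path_class P \<gamma>. \<exists>g'\<in>path_class P \<gamma>'. homotopic_paths (regular P) (g +++ (%t. w *v g' t)) \<delta>}"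
  then obtain g g' where g: "g : path_class P \<gamma>" "g' : path_class P \<gamma>'"
  "homotopic_paths (regular P) (g +++ (%t. w *v g' t)) \<delta>" by blast
  then have "homotopic_paths (regular P) ?j \<delta>"
  using eq[OF g(1,2)] homotopic_paths_trans homotopic_paths_sym by blast
  then show "\<delta> : path_class P ?j" unfolding path_class_def by blast
 next
  fix \<delta> assume "\<delta> : path_class P ?j"
  then show "\<delta> : {\<delta>. \<exists>g\<in>path_class P \<gamma>. \<exists>g'\<in>path_class P \<gamma>'. homotopic_paths (regular P) (g +++ (%t. w *v g' t)) \<delta>}"
  using self unfolding path_class_def[of P ?j] by blast
 qed
 then show ?thesis unfolding braid_group_def by simp
qed

lemma braid_one: "\<one>\<^bsub>braid_group P x0\<^esub> = (I1, path_class P (linepath x0 x0))"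
 unfolding braid_group_def by (simp add: linepath_refl)

lemma braid_path_one: "braid_path I1 (linepath x0 x0)"
 unfolding braid_path_def using one_in x0 by simp

lemma braid_path_inv:
 assumes "braid_path w \<gamma>"
 shows "braid_path (matrix_inv w) (%t. matrix_inv w *v reversepath \<gamma> t)"
 using braid_pathD[OF assms] action_path[of "matrix_inv w" "reversepath \<gamma>"] inv_props[of w]
 unfolding braid_path_def by (simp add: matrix_cancel)

lemma braid_group_is_group: "group (braid_group P x0)"
proof (rule groupI)
 fix a b assume "a : carrier (braid_group P x0)" "b : carrier (braid_group P x0)"
 then obtain w \<gamma> w' \<gamma>' where 1: "a = (w, path_class P \<gamma>)" "braid_path w \<gamma>" "b = (w', path_class P \<gamma>')" "braid_path w' \<gamma>'"
  unfolding braid_carrier by blast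
 show "a \<otimes>\<^bsub>braid_group P x0\<^esub> b : carrier (braid_group P x0)"
  unfolding 1 braid_mult[OF 1(2,4)] by (rule braid_pathD[OF braid_path_mult[OF 1(2,4)]])
next
 show "\<one>\<^bsub>braid_group P x0\<^esub> : carrier (braid_group P x0)"
  unfolding braid_one by (rule braid_pathD[OF braid_path_one])
next
 fix a b c assume "a : carrier (braid_group P x0)" "b : carrier (braid_group P x0)" "c : carrier (braid_group P x0)"
 then obtain w \<gamma> w' \<gamma>' w'' \<gamma>'' where 1: "a = (w, path_class P \<gamma>)" "braid_path w \<gamma>"
  "b = (w', path_class P \<gamma>')" "braid_path w' \<gamma>'" "c = (w'', path_class P \<gamma>'')" "braid_path w'' \<gamma>''"
  unfolding braid_carrier by (elim exE conjE) (rule that; assumption)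
 note A = braid_pathD[OF 1(2)] and B = braid_pathD[OF 1(4)] and C = braid_pathD[OF 1(6)]
 have "path_class P ((\<gamma> +++ (%t. w *v \<gamma>' t)) +++ (%t. (w ** w') *v \<gamma>'' t)) =
  path_class P (\<gamma> +++ (%t. w *v (\<gamma>' +++ (%t. w' *v \<gamma>'' t)) t))"
  unfolding action_join matrix_vector_mul_assoc
  by (rule path_class_eqI[OF homotopic_paths_sym[OF homotopic_paths_assoc]])
  (use A B C action_path[of w \<gamma>'] action_path[of "w ** w'" \<gamma>''] mult_in in
  \<open>auto simp: matrix_vector_mul_assoc\<close>)
 then show "a \<otimes>\<^bsub>braid_group P x0\<^esub> b \<otimes>\<^bsub>braid_group P x0\<^esub> c = a \<otimes>\<^bsub>braid_group P x0\<^esub> (b \<otimes>\<^bsub>braid_group P x0\<^esub> c)"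
  unfolding 1 braid_mult[OF 1(2,4)] braid_mult[OF 1(4,6)] braid_mult[OF braid_path_mult[OF 1(2,4)] 1(6)]
  braid_mult[OF 1(2) braid_path_mult[OF 1(4,6)]] by (simp add: matrix_mul_assoc)
next
 fix a assume "a : carrier (braid_group P x0)"
 then obtain w \<gamma> where 1: "a = (w, path_class P \<gamma>)" "braid_path w \<gamma>" unfolding braid_carrier by blast
 note A = braid_pathD[OF 1(2)]
 have "path_class P (linepath x0 x0 +++ (%t. I1 *v \<gamma> t)) = path_class P \<gamma>"
  by (rule path_class_eqI) (use homotopic_paths_lid[of \<gamma> "regular P"] A in simp)
 then show "\<one>\<^bsub>braid_group P x0\<^esub> \<otimes>\<^bsub>braid_group P x0\<^esub> a = a"
  unfolding braid_one 1 braid_mult[OF braid_path_one 1(2)] by simp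
 let ?i = "matrix_inv w"
 have "homotopic_paths (regular P) (reversepath \<gamma> +++ \<gamma>) (linepath (w *v x0) (w *v x0))"
  using homotopic_paths_linv[of \<gamma> "regular P"] A by simp
 from action_homotopic[OF inv_props(1)[OF A(1)] this]
 have "path_class P ((%t. ?i *v reversepath \<gamma> t) +++ (%t. ?i *v \<gamma> t)) = path_class P (linepath x0 x0)"
  unfolding action_join[symmetric] by (intro path_class_eqI) (simp add: linepath_refl matrix_cancel A)
 then show "\<exists>b\<in>carrier (braid_group P x0). b \<otimes>\<^bsub>braid_group P x0\<^esub> a = \<one>\<^bsub>braid_group P x0\<^esub>"
  unfolding 1 braid_one
  using braid_mult[OF braid_path_inv[OF 1(2)] 1(2)] braid_pathD(6)[OF braid_path_inv[OF 1(2)]] inv_props[OF A(1)]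
  by (intro bexI[of _ "(?i, path_class P (%t. ?i *v reversepath \<gamma> t))"]) auto
qed

lemma braid_fst_mult: "fst (a \<otimes>\<^bsub>braid_group P x0\<^esub> b) = fst a ** fst b"
 unfolding braid_group_def by (simp add: case_prod_beta)

abbreviation twist_path :: "complex ^ 'n => real => complex ^ 'n" where
 "twist_path x \<equiv> (%t. cis (2 * pi * t) *s x)"

lemma continuous_vector_scale [continuous_intros]:
 fixes f :: "'a::topological_space => complex" and g :: "'a => complex ^ 'm::finite"
 assumes "continuous_on S f" "continuous_on S g"
 shows "continuous_on S (%t. f t *s g t)"
 unfolding vector_scalar_mult_def using assms by (intro continuous_intros)

lemma twist_path_path:
 assumes "x : regular P"
 shows "path (twist_path x)" "path_image (twist_path x) \<subseteq> regular P" "pathstart (twist_path x) = x" "pathfinish (twist_path x) = x"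
 unfolding path_def path_image_def pathstart_def pathfinish_def
 using regular_scale[OF assms] by (auto intro!: continuous_intros simp: cis_mult)

lemma full_twist_braid_path: "braid_path I1 (twist_path x0)"
 unfolding braid_path_def using twist_path_path[OF x0] one_in by simp

lemma full_twist_carrier: "full_twist P x0 : carrier (braid_group P x0)"
 unfolding full_twist_def by (rule braid_pathD[OF full_twist_braid_path])

text \<open>Rotating a braid path by the angle \<open>2 \<pi> s\<close> is a homotopy from the path followed by the twist to the twist followed by the path.\<close>

lemma full_twist_central:
 assumes "b : carrier (braid_group P x0)"
 shows "full_twist P x0 \<otimes>\<^bsub>braid_group P x0\<^esub> b = b \<otimes>\<^bsub>braid_group P x0\<^esub> full_twist P x0"
proof -
 obtain w \<gamma> where 1: "b = (w, path_class P \<gamma>)" "braid_path w \<gamma>" using assms unfolding braid_carrier by blast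
 note A = braid_pathD[OF 1(2)]
 let ?h = "%(s, t). cis (2 * pi * s) *s \<gamma> t"
 let ?Q = "{0..1} \<times> {0..1} :: (real \<times> real) set"
 have wx: "w *v (c *s x0) = c *s (w *v x0)" for c by (simp add: vector_scalar_commute)
 have cont: "continuous_on ?Q ?h"
 proof -
  have "continuous_on {0..1} \<gamma>" using A(2) unfolding path_def .
  then have "continuous_on ?Q (%x. \<gamma> (snd x))"
  by (rule continuous_on_compose2) (auto intro: continuous_intros)
  then show ?thesis unfolding case_prod_beta by (intro continuous_intros)
 qed
 have img: "?h ` ?Q \<subseteq> regular P"
  using regular_scale A(3) unfolding path_image_def by auto
 have "homotopic_paths ?Q (linepath (0,0) (1,0) +++ linepath (1,0) (1,1)) (linepath (0,0) (0,1) +++ linepath (0,1) (1,1))"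
 proof -
  have c: "convex ?Q" by (intro convex_Times) auto
  have "path_image (linepath a b) \<subseteq> ?Q" if "a : ?Q" "b : ?Q" for a b
  using that c by (simp add: closed_segment_subset)
  then show ?thesis using convex_imp_simply_connected[OF c]
  by (simp add: simply_connected_eq_homotopic_paths subset_path_image_join)
 qed
 then have "homotopic_paths (regular P) (?h \<circ> (linepath (0,0) (1,0) +++ linepath (1,0) (1,1)))
  (?h \<circ> (linepath (0,0) (0,1) +++ linepath (0,1) (1,1)))"
  by (rule homotopic_paths_continuous_image) (use cont img in auto)
 moreover have "?h \<circ> linepath (0,0) (1,0) = twist_path x0" "?h \<circ> linepath (1,0) (1,1) = \<gamma>" 
  "?h \<circ> linepath (0,0) (0,1) = \<gamma>" "?h \<circ> linepath (0,1) (1,1) = (%t. w *v (twist_path x0) t)"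
  using A(4,5) by (auto simp: linepath_def fun_eq_iff pathstart_def pathfinish_def wx)
 ultimately have "homotopic_paths (regular P) (twist_path x0 +++ \<gamma>) (\<gamma> +++ (%t. w *v (twist_path x0) t))"
  by (simp only: path_compose_join)
 then have "path_class P (twist_path x0 +++ (%t. I1 *v \<gamma> t)) = path_class P (\<gamma> +++ (%t. w *v (twist_path x0) t))"
  using path_class_eqI by simp
 then show ?thesis
  unfolding 1 full_twist_def braid_mult[OF full_twist_braid_path 1(2)] braid_mult[OF 1(2) full_twist_braid_path] by simp
qed

end

section \<open>One-dimensional characters of the braid group at the full twist\<close>

lemma homotopic_cancel_middle:
 fixes a p g q r :: "real => 'a::real_normed_vector"
 assumes "path a" "path p" "path g" "path q" "path r"
  "path_image a \<subseteq> S" "path_image p \<subseteq> S" "path_image g \<subseteq> S" "path_image q \<subseteq> S" "path_image r \<subseteq> S"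
  and e: "pathfinish a = pathstart p" "pathfinish g = pathfinish p" "pathfinish p = pathstart q"
  "pathfinish q = pathstart r"
 shows "homotopic_paths S ((a +++ p +++ reversepath g) +++ (g +++ q +++ r)) (a +++ (p +++ q) +++ r)"
proof -
 note [simp] = assms subset_path_image_join
 let ?c = "linepath (pathfinish p) (pathfinish p)"
 have pc: "pathfinish p : S" using assms(7) pathfinish_in_path_image by blast
 note t [trans] = homotopic_paths_trans
 have "homotopic_paths S ((a +++ p +++ reversepath g) +++ (g +++ q +++ r)) (a +++ (p +++ reversepath g) +++ (g +++ q +++ r))"
  by (rule homotopic_paths_sym, rule homotopic_paths_assoc) auto
 also have "homotopic_paths S ... (a +++ (p +++ (reversepath g +++ (g +++ q +++ r))))"
  by (rule homotopic_paths_join[OF _ homotopic_paths_sym[OF homotopic_paths_assoc]]) auto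
 also have "homotopic_paths S ... (a +++ (p +++ ((reversepath g +++ g) +++ (q +++ r))))"
  by (intro homotopic_paths_join homotopic_paths_assoc) auto
 also have "homotopic_paths S ... (a +++ (p +++ (?c +++ (q +++ r))))"
  using homotopic_paths_linv[of g S] pc
  by (intro homotopic_paths_join) auto
 also have "homotopic_paths S ... (a +++ (p +++ (q +++ r)))"
 proof -
  have "homotopic_paths S (?c +++ (q +++ r)) (q +++ r)"
  using homotopic_paths_lid[of "q +++ r" S] by auto
  then have "homotopic_paths S (p +++ (?c +++ (q +++ r))) (p +++ (q +++ r))"
  by (intro homotopic_paths_join[of S p p]) auto
  then show ?thesis by (intro homotopic_paths_join[of S a a]) auto
 qed
 also have "homotopic_paths S ... (a +++ ((p +++ q) +++ r))"
  by (intro homotopic_paths_join homotopic_paths_assoc) auto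
 finally show ?thesis .
qed

context reflection_arrangement
begin

abbreviation chamber :: "(complex ^ 'n) set" where
 "chamber \<equiv> path_component_set (regular P) x0"

text \<open>At \<open>x0\<close> itself the constant path is chosen, so that loops at \<open>x0\<close> need no correction.\<close>

definition base_path :: "complex ^ 'n => real => complex ^ 'n" where
 "base_path y = (if y = x0 then linepath x0 x0 else
  SOME \<gamma>. path \<gamma> & path_image \<gamma> \<subseteq> regular P & pathstart \<gamma> = x0 & pathfinish \<gamma> = y)"

lemma base_path:
 assumes "y : chamber"
 shows "path (base_path y)" "path_image (base_path y) \<subseteq> regular P" "pathstart (base_path y) = x0" "pathfinish (base_path y) = y"
proof -
 have ex: "\<exists>\<gamma>. path \<gamma> & path_image \<gamma> \<subseteq> regular P & pathstart \<gamma> = x0 & pathfinish \<gamma> = y"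
  using assms unfolding path_component_def by auto
 have "path (base_path y) & path_image (base_path y) \<subseteq> regular P & pathstart (base_path y) = x0 & pathfinish (base_path y) = y"
  unfolding base_path_def using someI_ex[OF ex] x0 by auto
 then show "path (base_path y)" "path_image (base_path y) \<subseteq> regular P" "pathstart (base_path y) = x0" "pathfinish (base_path y) = y" by auto
qed

lemma chamber_subset: "chamber \<subseteq> regular P" by (rule path_component_subset)

lemma chamberI:
 assumes "path_connected T" "T \<subseteq> regular P" "a : T" "a : chamber"
 shows "T \<subseteq> chamber"
 using path_component_maximal[OF assms(3,1,2)] path_component_eq[OF assms(4)] by simp

lemma x0_chamber: "x0 : chamber" using path_component_refl[OF x0] by simp

text \<open>Pure braids are loops at \<open>x0\<close>; closing up an arbitrary path by fixed paths to \<open>x0\<close> extends a character of the braid group to a functional on all paths in the component of \<open>x0\<close>.\<close>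

definition holonomy :: "('n braid => 'k) => (real => complex ^ 'n) => 'k" where
 "holonomy \<delta> p = \<delta> (I1, path_class P (base_path (pathstart p) +++ p +++ reversepath (base_path (pathfinish p))))"

definition braid_character :: "('n braid => 'k::field) => bool" where
 "braid_character \<delta> \<longleftrightarrow> (\<forall>a\<in>carrier (braid_group P x0). \<delta> a ~= 0 &
  (\<forall>b\<in>carrier (braid_group P x0). \<delta> (a \<otimes>\<^bsub>braid_group P x0\<^esub> b) = \<delta> a * \<delta> b))"

lemma based_loop:
 assumes "path p" "path_image p \<subseteq> chamber"
 shows "braid_path I1 (base_path (pathstart p) +++ p +++ reversepath (base_path (pathfinish p)))"
proof -
 have "pathstart p : chamber" "pathfinish p : chamber" using assms(2) by auto
 note b = base_path[OF this(1)] base_path[OF this(2)]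
 show ?thesis unfolding braid_path_def using b assms one_in chamber_subset
  by (auto simp: subset_path_image_join)
qed

lemma holonomy_character:
 assumes "braid_character \<delta>"
 shows "path_character chamber (holonomy \<delta>)"
 unfolding path_character_def
proof (intro conjI allI impI)
 fix p q assume *: "path p & path q & path_image p \<subseteq> chamber & path_image q \<subseteq> chamber & pathfinish p = pathstart q"
 then have ends: "pathstart p : chamber" "pathfinish p : chamber" "pathfinish q : chamber"  by auto
 note b = base_path[OF ends(1)] base_path[OF ends(2)] base_path[OF ends(3)]
 have lp: "braid_path I1 (base_path (pathstart p) +++ p +++ reversepath (base_path (pathfinish p)))" (is "braid_path I1 ?p")
  and lq: "braid_path I1 (base_path (pathfinish p) +++ q +++ reversepath (base_path (pathfinish q)))" (is "braid_path I1 ?q")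
  using based_loop[of p] based_loop[of q] * by auto
 have "homotopic_paths (regular P) (?p +++ ?q) (base_path (pathstart p) +++ (p +++ q) +++ reversepath (base_path (pathfinish q)))"
  by (rule homotopic_cancel_middle) (use * b chamber_subset in auto)
 then have "path_class P (base_path (pathstart p) +++ (p +++ q) +++ reversepath (base_path (pathfinish q))) = path_class P (?p +++ ?q)"
  by (intro path_class_eqI[OF homotopic_paths_sym])
 then have "holonomy \<delta> (p +++ q) = \<delta> (I1, path_class P (?p +++ ?q))"
  unfolding holonomy_def by simp
 also have "(I1, path_class P (?p +++ ?q)) = (I1, path_class P ?p) \<otimes>\<^bsub>braid_group P x0\<^esub> (I1, path_class P ?q)"
  using braid_mult[OF lp lq] by simp
 also have "\<delta> ... = \<delta> (I1, path_class P ?p) * \<delta> (I1, path_class P ?q)"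
  using assms braid_pathD(6)[OF lp] braid_pathD(6)[OF lq] unfolding braid_character_def by blast
 finally show "holonomy \<delta> (p +++ q) = holonomy \<delta> p * holonomy \<delta> q"
  using * by (simp add: holonomy_def)
next
 fix p q assume h: "homotopic_paths chamber p q"
 have e: "pathstart p = pathstart q" "pathfinish p = pathfinish q"
  using homotopic_paths_imp_pathstart[OF h] homotopic_paths_imp_pathfinish[OF h] by auto
 have "path_image p \<subseteq> chamber" using homotopic_paths_imp_subset[OF h] by blast
 then have "pathstart p : chamber" "pathfinish p : chamber" by auto
 note b = base_path[OF this(1)] base_path[OF this(2)]
 have "homotopic_paths (regular P) (base_path (pathstart p) +++ p +++ reversepath (base_path (pathfinish p)))
  (base_path (pathstart p) +++ q +++ reversepath (base_path (pathfinish p)))"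
  using homotopic_paths_subset[OF h chamber_subset] b
  by (intro homotopic_paths_join) auto
 then show "holonomy \<delta> p = holonomy \<delta> q"
  unfolding holonomy_def e using path_class_eqI e by metis
next
 fix p assume "path p & path_image p \<subseteq> chamber"
 then show "holonomy \<delta> p ~= 0"
  using braid_pathD(6)[OF based_loop] assms unfolding holonomy_def braid_character_def by blast
qed

lemma path_in_chamber:
 assumes "path p" "path_image p \<subseteq> regular P" "pathstart p = x0"
 shows "path_image p \<subseteq> chamber"
 by (rule chamberI[OF path_connected_path_image[OF assms(1)] assms(2), of x0])
  (use assms x0_chamber pathstart_in_path_image[of p] in auto)

lemma holonomy_based_loop:
 assumes "braid_path I1 \<gamma>"
 shows "holonomy \<delta> \<gamma> = \<delta> (I1, path_class P \<gamma>)"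
proof -
 note A = braid_pathD[OF assms]
 have "homotopic_paths (regular P) (linepath x0 x0 +++ \<gamma> +++ reversepath (linepath x0 x0)) (linepath x0 x0 +++ \<gamma>)"
  using homotopic_paths_rid[of \<gamma> "regular P"] A x0 by (intro homotopic_paths_join) auto
 also have "homotopic_paths (regular P) ... \<gamma>"
  using homotopic_paths_lid[of \<gamma> "regular P"] A by simp
 finally show ?thesis using path_class_eqI A unfolding holonomy_def base_path_def by simp
qed

lemma holonomy_conjugate_loop:
 assumes \<delta>: "braid_character \<delta>" and \<gamma>: "path \<gamma>" "path_image \<gamma> \<subseteq> regular P" "pathstart \<gamma> = x0"
  and l: "path l" "path_image l \<subseteq> regular P" "pathstart l = pathfinish \<gamma>" "pathfinish l = pathfinish \<gamma>"
 shows "\<delta> (I1, path_class P (\<gamma> +++ l +++ reversepath \<gamma>)) = holonomy \<delta> l"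
proof -
 have bp: "braid_path I1 (\<gamma> +++ l +++ reversepath \<gamma>)"
  unfolding braid_path_def using \<gamma> l one_in by (auto simp: subset_path_image_join)
 have gc: "path_image \<gamma> \<subseteq> chamber" by (rule path_in_chamber[OF \<gamma>])
 then have fc: "pathfinish \<gamma> : chamber" by auto
 have lc: "path_image l \<subseteq> chamber"
  by (rule chamberI[OF path_connected_path_image[OF l(1)] l(2) _ fc]) (use l pathstart_in_path_image[of l] in auto)
 note D = holonomy_character[OF \<delta>]
 have "holonomy \<delta> (\<gamma> +++ l +++ reversepath \<gamma>) = holonomy \<delta> \<gamma> * (holonomy \<delta> l * holonomy \<delta> (reversepath \<gamma>))"
  using \<gamma> l gc lc by (simp add: path_character_join[OF D] subset_path_image_join)
 also have "... = holonomy \<delta> l * (holonomy \<delta> \<gamma> * holonomy \<delta> (reversepath \<gamma>))" by (simp only: ac_simps)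
 also have "... = holonomy \<delta> l" using path_character_reverse[OF D \<gamma>(1) gc] by simp
 finally show ?thesis unfolding holonomy_based_loop[OF bp] .
qed

lemma eigen_power:
 assumes "s : P" "s *v v = c *s v"
 shows "(s [^]\<^bsub>mat_group P\<^esub> (k::nat)) *v v = c ^ k *s v"
 by (induction k) (simp_all add: assms vector_scalar_commute vector_smult_assoc mult.commute flip: matrix_vector_mul_assoc)

lemma pow_in: "s : P ==> s [^]\<^bsub>mat_group P\<^esub> (k::nat) : P"
 by (induction k) (simp_all add: one_in mult_in)

text \<open>The \<open>e\<close>-th power of a braid reflection around \<open>H\<close> consists of \<open>e\<close> consecutive arcs, which together form one full turn around \<open>H\<close>.\<close>

lemma braid_reflection_power:
 assumes \<delta>: "braid_character \<delta>" and H: "H : hyperplanes P"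
  and s: "s : fixator P H" "normal_eigenvalue H s = zeta e" "s *v v = zeta e *s v" and e: "e = hyp_order P H"
  and y: "y : H" "!!z. 0 < cmod z ==> cmod z \<le> 1 ==> y + z *s v : regular P"
  and \<gamma>: "path \<gamma>" "path_image \<gamma> \<subseteq> regular P" "pathstart \<gamma> = x0" "pathfinish \<gamma> = y + v"
  and b: "b = (s, path_class P (\<gamma> +++ (%t. y + cis (2 * pi * t / of_nat e) *s v) +++ reversepath (%t. s *v \<gamma> t)))"
 shows "b : carrier (braid_group P x0)" "\<delta> b ^ e = holonomy \<delta> (%t. y + cis (2 * pi * t) *s v)"
proof -
 have e2: "e \<ge> 2" unfolding e by (rule hyp_order_ge_2[OF H])
 have sP: "s : P" using s(1) unfolding fixator_def by blast
 let ?s = "%k::nat. s [^]\<^bsub>mat_group P\<^esub> k"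
 have sk: "?s k : P" for k by (rule pow_in[OF sP])
 have sky: "?s k *v y = y" for k using fixator_pow[OF s(1), of k] y(1) unfolding fixator_def by blast
 have skv: "?s k *v v = zeta e ^ k *s v" for k by (rule eigen_power[OF sP s(3)])
 have zk: "zeta e ^ k = cis (2 * pi * real k / real e)" for k
 proof -
  have "zeta e = cis (2 * pi / real e)" unfolding zeta_def cis_conv_exp by (simp add: mult_ac)
  then have "zeta e ^ k = cis (real k * (2 * pi / real e))" by (simp only: Complex.DeMoivre)
  then show ?thesis by (simp add: mult.commute mult.left_commute)
 qed
 define c where "c \<theta> = y + cis (2 * pi * \<theta> / real e) *s v" for \<theta> :: real
 have creg: "c \<theta> : regular P" for \<theta> unfolding c_def by (rule y(2)) auto
 have ccont: "continuous_on UNIV c" unfolding c_def divide_inverse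
  by (intro continuous_intros)
 have carc: "path (c \<circ> linepath a b)" "path_image (c \<circ> linepath a b) \<subseteq> regular P" 
  "pathstart (c \<circ> linepath a b) = c a" "pathfinish (c \<circ> linepath a b) = c b" for a b
  using creg path_continuous_image[OF path_linepath continuous_on_subset[OF ccont subset_UNIV]]
  by (auto simp: path_image_def pathstart_def pathfinish_def linepath_def)
 have ck: "c (real k) = ?s k *v (y + v)" for k
  unfolding matrix_vector_right_distrib sky skv zk c_def ..
 have sc: "?s k *v c \<theta> = c (real k + \<theta>)" for k \<theta>
  unfolding c_def matrix_vector_right_distrib sky vector_scalar_commute skv zk
  by (simp add: vector_smult_assoc cis_mult ring_distribs add_divide_distrib add.commute)
 define p where "p k = \<gamma> +++ (c \<circ> linepath 0 (real k)) +++ reversepath (%t. ?s k *v \<gamma> t)" for k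
 have ends: "pathstart (%t. ?s k *v \<gamma> t) = ?s k *v x0" "pathfinish (%t. ?s k *v \<gamma> t) = c (real k)" for k
  using \<gamma> by (simp_all add: ck)
 have c0: "c 0 = y + v" by (simp add: c_def)
 have bp: "braid_path (?s k) (p k)" for k
  unfolding braid_path_def p_def using sk \<gamma> carc action_path[OF sk[of k] \<gamma>(1,2)] ends
  by (auto simp: subset_path_image_join c0)
 have step: "(?s k, path_class P (p k)) \<otimes>\<^bsub>braid_group P x0\<^esub> (?s 1, path_class P (p 1)) = (?s (Suc k), path_class P (p (Suc k)))" for k
 proof -
  have 1: "(%t. ?s k *v (%t. ?s 1 *v \<gamma> t) t) = (%t. ?s (Suc k) *v \<gamma> t)"
  using sP by (simp add: matrix_vector_mul_assoc)
  have 2: "(%t. ?s k *v (c \<circ> linepath 0 (real 1)) t) = c \<circ> linepath (real k) (real (Suc k))"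
  by (auto simp: sc linepath_def fun_eq_iff algebra_simps)
  have 3: "(%t. ?s k *v p 1 t) = (%t. ?s k *v \<gamma> t) +++ (c \<circ> linepath (real k) (real (Suc k))) +++ reversepath (%t. ?s (Suc k) *v \<gamma> t)"
  unfolding p_def action_join 2 1[symmetric] by (simp add: reversepath_def)
  have "homotopic_paths (regular P) (p k +++ (%t. ?s k *v p 1 t))
  (\<gamma> +++ ((c \<circ> linepath 0 (real k)) +++ (c \<circ> linepath (real k) (real (Suc k)))) +++ reversepath (%t. ?s (Suc k) *v \<gamma> t))"
  unfolding 3 unfolding p_def 
  by (rule homotopic_cancel_middle)
  (use \<gamma> carc action_path[OF sk \<gamma>(1,2)] ends c0 in \<open>simp_all del: nat_pow_Suc of_nat_Suc\<close>)
  also have "homotopic_paths (regular P) ... (p (Suc k))"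
  proof -
  have "homotopic_paths UNIV (linepath 0 (real k) +++ linepath (real k) (real (Suc k))) (linepath 0 (real (Suc k)))"
  using convex_imp_simply_connected[of "UNIV :: real set"] by (simp add: simply_connected_eq_homotopic_paths)
  then have "homotopic_paths (regular P) (c \<circ> (linepath 0 (real k) +++ linepath (real k) (real (Suc k)))) (c \<circ> linepath 0 (real (Suc k)))"
  by (rule homotopic_paths_continuous_image) (use ccont creg in auto)
  then show ?thesis unfolding p_def path_compose_join
  by (intro homotopic_paths_join)
  (use \<gamma> carc action_path[OF sk \<gamma>(1,2)] ends c0 in \<open>simp_all del: nat_pow_Suc of_nat_Suc\<close>)
  qed
  finally have cls: "path_class P (p k +++ (%t. ?s k *v p 1 t)) = path_class P (p (Suc k))"
  by (rule path_class_eqI)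
  show ?thesis unfolding braid_mult[OF bp bp] cls using sP by simp
 qed
 have b1: "b = (?s 1, path_class P (p 1))"
  unfolding b p_def using sP by (simp add: c_def o_def linepath_def)
 have car: "(?s k, path_class P (p k)) : carrier (braid_group P x0)" for k by (rule braid_pathD(6)[OF bp])
 show "b : carrier (braid_group P x0)" unfolding b1 by (rule car)
 have "\<delta> (?s (Suc k), path_class P (p (Suc k))) = \<delta> b ^ Suc k" for k
 proof (induction k)
  case (Suc k)
  have "\<delta> ((?s (Suc k), path_class P (p (Suc k))) \<otimes>\<^bsub>braid_group P x0\<^esub> (?s 1, path_class P (p 1))) =
  \<delta> (?s (Suc k), path_class P (p (Suc k))) * \<delta> (?s 1, path_class P (p 1))"
  using \<delta> car[of "Suc k"] car[of 1] unfolding braid_character_def by blast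
  then show ?case unfolding step Suc unfolding b1[symmetric] by (simp only: power_Suc2)
 qed (simp only: b1 One_nat_def power_Suc power_0 mult_1_right)
 from this[of "e - 1"] have "\<delta> b ^ e = \<delta> (?s e, path_class P (p e))" using e2 by simp
 moreover have se: "?s e = I1"
 proof -
  have "normal_eigenvalue H (?s e) = 1"
  using normal_eigenvalue_pow[OF H s(1), of e] s(2) zeta_power_eq_1[of e e] e2 by simp
  then show ?thesis by (rule normal_eigenvalue_eq_1[OF H fixator_pow[OF s(1)]])
 qed
 moreover have "c \<circ> linepath 0 (real e) = (%t. y + cis (2 * pi * t) *s v)"
  using e2 by (auto simp: c_def linepath_def fun_eq_iff mult.assoc)
 moreover have "\<delta> (I1, path_class P (\<gamma> +++ (c \<circ> linepath 0 (real e)) +++ reversepath \<gamma>)) = holonomy \<delta> (c \<circ> linepath 0 (real e))"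
 proof (rule holonomy_conjugate_loop[OF \<delta> \<gamma>(1-3)])
  show "pathfinish (c \<circ> linepath 0 (real e)) = pathfinish \<gamma>"
  unfolding carc ck se using \<gamma>(4) by simp
 qed (use carc \<gamma>(4) c0 in auto)
 ultimately show "\<delta> b ^ e = holonomy \<delta> (%t. y + cis (2 * pi * t) *s v)"
  unfolding p_def by simp
qed

text \<open>The points at which the line \<open>v + \<complex> x0\<close> meets the hyperplanes are the negatives of the heights of \<open>v\<close>; for a generic small \<open>v\<close> they have distinct real parts and small modulus.\<close>

lemma generic_slice:
 obtains v where "inj_on (%H. Re (height x0 H v)) (hyperplanes P)" "!!H. H : hyperplanes P ==> cmod (height x0 H v) < 1"
proof -
 let ?F = "(%(H, H') v. Re (height x0 H v) - Re (height x0 H' v)) ` {(H, H'). H : hyperplanes P & H' : hyperplanes P & H ~= H'}"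
 have "finite {(H, H'). H : hyperplanes P & H' : hyperplanes P & H ~= H'}"
  by (rule finite_subset[of _ "hyperplanes P \<times> hyperplanes P"]) (use finite_hyperplanes in auto)
 then have "finite ?F" by simp
 moreover have "linear f & (\<exists>x. f x ~= 0)" if "f : ?F" for f
 proof -
  obtain H H' where H: "H : hyperplanes P" "H' : hyperplanes P" "H ~= H'"
  and f: "f = (%v. Re (height x0 H v) - Re (height x0 H' v))" using \<open>f : ?F\<close> by auto
  have "linear f" unfolding f
  by (rule linearI) (simp_all add: height_add height_scale H scaleR_vec_complex algebra_simps)
  moreover obtain v where v: "height x0 H v ~= height x0 H' v" using height_separates[OF H] by blast
  have "f v ~= 0 \<or> f (\<i> *s v) ~= 0"
  using v by (auto simp: f height_scale H complex_eq_iff)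
  ultimately show ?thesis by blast
 qed
 ultimately obtain w where w: "\<forall>f\<in>?F. f w ~= 0" using generic_vector[of ?F] by blast
 define M where "M = 1 + (\<Sum>H\<in>hyperplanes P. cmod (height x0 H w))"
 have M: "M > 0" "cmod (height x0 H w) < M" if "H : hyperplanes P" for H
 proof -
  have "cmod (height x0 H w) \<le> (\<Sum>H\<in>hyperplanes P. cmod (height x0 H w))"
  using member_le_sum[OF that, of "%H. cmod (height x0 H w)"] finite_hyperplanes by simp
  moreover have "0 \<le> (\<Sum>H\<in>hyperplanes P. cmod (height x0 H w))" by (rule sum_nonneg) simp
  ultimately show "M > 0" "cmod (height x0 H w) < M" unfolding M_def by simp_all
 qed
 let ?v = "of_real (1 / M) *s w"
 show ?thesis
 proof (rule that[of ?v])
  show "inj_on (%H. Re (height x0 H ?v)) (hyperplanes P)"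
  proof (rule inj_onI, rule ccontr)
  fix H H' assume H: "H : hyperplanes P" "H' : hyperplanes P" "H ~= H'" "Re (height x0 H ?v) = Re (height x0 H' ?v)"
  then have "Re (height x0 H w) = Re (height x0 H' w)" using M[OF H(1)] by (simp add: height_scale)
  moreover have "(%v. Re (height x0 H v) - Re (height x0 H' v)) : ?F" using H by auto
  from bspec[OF w this] have "Re (height x0 H w) - Re (height x0 H' w) ~= 0" .
  ultimately show False by simp
  qed
  fix H assume H: "H : hyperplanes P"
  show "cmod (height x0 H ?v) < 1"
  using M[OF H] by (simp add: height_scale H norm_mult norm_divide)
 qed
qed

lemma positive_lower_bound:
 assumes "finite S" "!!x. x : S ==> f x > (0::real)"
 shows "\<exists>\<epsilon>>0. \<forall>x\<in>S. \<epsilon> < f x"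
 using assms
proof (induction S)
 case (insert a S)
 then obtain \<epsilon> where \<epsilon>: "\<epsilon> > 0" "\<forall>x\<in>S. \<epsilon> < f x" by blast
 have "min \<epsilon> (f a / 2) > 0" "\<forall>x\<in>insert a S. min \<epsilon> (f a / 2) < f x"
  using \<epsilon> insert.prems[of a] by auto
 then show ?case by blast
qed (auto intro: exI[of _ 1])

text \<open>Move the full twist, the circle of radius one in the line \<open>\<complex> x0\<close>, to the parallel affine line through a generic small \<open>v\<close>. That line meets each hyperplane in one point, all inside the circle, so \<open>circle_character\<close> applies; the small circle around the point on \<open>H\<close> is the power \<open>e\<^sub>H\<close> of a braid reflection.\<close>

lemma full_twist_product:
 "\<exists>s b. (\<forall>H\<in>hyperplanes P. s H : fixator P H & normal_eigenvalue H (s H) = zeta (hyp_order P H) &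
  fst (b H) = s H & braid_reflection P x0 H (b H) & b H : carrier (braid_group P x0)) &
  (\<forall>\<delta> :: 'n braid => 'k::field. braid_character \<delta> -->
  \<delta> (full_twist P x0) = (\<Prod>H\<in>hyperplanes P. \<delta> (b H) ^ hyp_order P H))"
proof -
 let ?A = "hyperplanes P"
 obtain v where inj: "inj_on (%H. Re (height x0 H v)) ?A" and small: "!!H. H : ?A ==> cmod (height x0 H v) < 1"
  using generic_slice by blast
 \<comment> \<open>the parameters of the points at which the line meets the hyperplanes\<close>
 define \<zeta> where "\<zeta> H = - height x0 H v" for H
 define \<sigma> where "\<sigma> z = v + z *s x0" for z
 define Z where "Z = \<zeta> ` ?A"
 define y where "y H = \<sigma> (\<zeta> H)" for H
 have inj\<zeta>: "inj_on \<zeta> ?A" using inj unfolding inj_on_def \<zeta>_def by auto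
 have h\<sigma>: "height x0 H (\<sigma> z) = z - \<zeta> H" if "H : ?A" for H z
  unfolding \<sigma>_def \<zeta>_def by (simp add: that height_add height_scale height_x0)
 have finZ: "finite Z" unfolding Z_def using finite_hyperplanes by simp
 have \<sigma>reg: "\<sigma> z : regular P \<longleftrightarrow> z ~: Z" for z
  unfolding regular_height Z_def using h\<sigma> by auto
 have \<sigma>cont: "continuous_on S \<sigma>" for S unfolding \<sigma>_def by (intro continuous_intros)
 have Zball: "Z \<subseteq> ball 0 1" unfolding Z_def \<zeta>_def using small by auto
 have \<sigma>ch: "\<sigma> ` (- Z) \<subseteq> chamber"
 proof -
  have one: "1 ~: Z" using Zball by auto
  have "closed_segment x0 (\<sigma> 1) \<subseteq> regular P"
  proof
  fix x assume "x : closed_segment x0 (\<sigma> 1)"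
  then obtain r where r: "0 \<le> r" "r \<le> 1" "x = (1 - r) *\<^sub>R x0 + r *\<^sub>R \<sigma> 1" unfolding in_segment by blast
  have "x = x0 + of_real r *s v" unfolding r(3) \<sigma>_def scaleR_vec_complex
  by (simp add: vec_eq_iff algebra_simps)
  moreover have "cmod (of_real r * height x0 H v) < 1" if "H : ?A" for H
  proof -
  have "r * cmod (height x0 H v) \<le> 1 * cmod (height x0 H v)" by (rule mult_right_mono) (use r in auto)
  then show ?thesis using small[OF that] r by (simp add: norm_mult)
  qed
  then have "1 + of_real r * height x0 H v ~= 0" if "H : ?A" for H
  using that by (metis add_eq_0_iff norm_minus_cancel norm_one order_less_irrefl)
  ultimately show "x : regular P" unfolding regular_height
  by (simp add: height_add height_scale height_x0)
  qed
  then have "closed_segment x0 (\<sigma> 1) \<subseteq> chamber"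
  by (intro chamberI[OF convex_imp_path_connected, of _ x0]) (use x0_chamber in auto)
  then have "\<sigma> 1 : chamber" by auto
  moreover have "path_connected (- Z)"
  by (rule path_connected_complement_countable) (use finZ in \<open>auto intro: countable_finite\<close>)
  then have "path_connected (\<sigma> ` (- Z))" by (rule path_connected_continuous_image[OF \<sigma>cont])
  ultimately show ?thesis using one \<sigma>reg by (intro chamberI[of _ "\<sigma> 1"]) auto
 qed
 have hy: "height x0 H' (y H) = \<zeta> H - \<zeta> H'" if "H' : ?A" for H H' unfolding y_def using h\<sigma>[OF that] .
 have "\<forall>H\<in>?A. \<exists>p. fst p : fixator P H & normal_eigenvalue H (fst p) = zeta (hyp_order P H) &
  fst p *v snd p = zeta (hyp_order P H) *s snd p & height x0 H (snd p) = 1"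
 proof
  fix H assume H: "H : ?A"
  obtain s where s: "s : fixator P H" "normal_eigenvalue H s = zeta (hyp_order P H)" by (rule distinguished_reflection[OF H])
  let ?z = "zeta (hyp_order P H)"
  have "?z ~= 1" using zeta_power_eq_1[of "hyp_order P H" 1] hyp_order_ge_2[OF H] by auto
  then have z: "?z - 1 ~= 0" by simp
  let ?u = "s *v x0 - x0"
  have hu: "height x0 H ?u = ?z - 1" using s by (simp add: height_diff H height_x0 normal_eigenvalue_def)
  have su: "s *v ?u = ?z *s ?u"
  unfolding fixator_formula[OF H s(1), of ?u] hu by (simp add: vec_eq_iff algebra_simps)
  have "s *v (inverse (?z - 1) *s ?u) = ?z *s (inverse (?z - 1) *s ?u)"
  unfolding vector_scalar_commute su by (simp add: vector_smult_assoc mult.commute)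
  moreover have "height x0 H (inverse (?z - 1) *s ?u) = 1" unfolding height_scale[OF H] hu using z by simp
  ultimately show "\<exists>p. fst p : fixator P H & normal_eigenvalue H (fst p) = zeta (hyp_order P H) &
  fst p *v snd p = zeta (hyp_order P H) *s snd p & height x0 H (snd p) = 1"
  using s by (intro exI[of _ "(s, inverse (?z - 1) *s ?u)"]) (simp only: fst_conv snd_conv simp_thms)
 qed
 from bchoice[OF this] obtain p where p: "\<forall>H\<in>?A. fst (p H) : fixator P H & normal_eigenvalue H (fst (p H)) = zeta (hyp_order P H) &
  fst (p H) *v snd (p H) = zeta (hyp_order P H) *s snd (p H) & height x0 H (snd (p H)) = 1" ..
 define s u where "s H = fst (p H)" and "u H = snd (p H)" for H
 have su: "s H : fixator P H & normal_eigenvalue H (s H) = zeta (hyp_order P H) &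
  s H *v u H = zeta (hyp_order P H) *s u H & height x0 H (u H) = 1" if "H : ?A" for H
  using bspec[OF p that] unfolding s_def u_def .
 have pos: "1 + cmod c > 0" for c by (simp add: add_pos_nonneg)
 \<comment> \<open>the radius has to work for all directions between \<open>x0\<close> and the eigenvector \<open>u H\<close>\<close>
 have "\<forall>H\<in>?A. \<exists>\<epsilon>>0. \<forall>H'\<in>?A - {H}. \<epsilon> < cmod (\<zeta> H - \<zeta> H') / (1 + cmod (height x0 H' (u H)))"
 proof
  fix H assume H: "H : ?A"
  show "\<exists>\<epsilon>>0. \<forall>H'\<in>?A - {H}. \<epsilon> < cmod (\<zeta> H - \<zeta> H') / (1 + cmod (height x0 H' (u H)))"
  proof (rule positive_lower_bound)
  show "finite (?A - {H})" using finite_hyperplanes by simp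
  fix H' assume "H' : ?A - {H}"
  then have "\<zeta> H ~= \<zeta> H'" using inj_onD[OF inj\<zeta>, of H H'] H by blast
  then show "cmod (\<zeta> H - \<zeta> H') / (1 + cmod (height x0 H' (u H))) > 0"
  using pos by (intro divide_pos_pos) simp_all
  qed
 qed
 from bchoice[OF this] obtain \<epsilon> where
  \<epsilon>0: "\<forall>H\<in>?A. \<epsilon> H > 0 & (\<forall>H'\<in>?A - {H}. \<epsilon> H < cmod (\<zeta> H - \<zeta> H') / (1 + cmod (height x0 H' (u H))))" ..
 have \<epsilon>: "\<epsilon> H > 0" if "H : ?A" for H using bspec[OF \<epsilon>0 that] by blast
 have \<epsilon>': "\<epsilon> H < cmod (\<zeta> H - \<zeta> H') / (1 + cmod (height x0 H' (u H)))" if "H : ?A" "H' : ?A" "H' ~= H" for H H'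
  using bspec[OF \<epsilon>0 that(1)] that(2,3) by blast
 have disc: "y H + z *s ((1 - of_real r) *s x0 + of_real r *s u H) : regular P"
  if H: "H : ?A" and z: "0 < cmod z" "cmod z \<le> \<epsilon> H" and r: "0 \<le> r" "r \<le> 1" for H z r
  unfolding regular_height
 proof
  fix H' assume H': "H' : ?A"
  have eq: "height x0 H' (y H + z *s ((1 - of_real r) *s x0 + of_real r *s u H)) =
  (\<zeta> H - \<zeta> H') + z * ((1 - of_real r) + of_real r * height x0 H' (u H))"
  by (simp only: height_add[OF H'] height_scale[OF H'] height_x0[OF H'] hy[OF H']) simp
  show "height x0 H' (y H + z *s ((1 - of_real r) *s x0 + of_real r *s u H)) ~= 0"
  proof (cases "H' = H")
  case True then show ?thesis unfolding eq using su[OF H] z by auto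
  next
  case False
  let ?c = "height x0 H' (u H)"
  have "cmod ((1 - of_real r) + of_real r * ?c) \<le> cmod (1 - of_real r) + cmod (of_real r * ?c)" by (rule norm_triangle_ineq)
  also have "cmod (1 - of_real r) = 1 - r" using r by (metis abs_of_nonneg diff_ge_0_iff_ge norm_of_real of_real_1 of_real_diff)
  also have "1 - r + cmod (of_real r * ?c) \<le> 1 + cmod ?c"
  using r mult_right_mono[of r 1 "cmod ?c"] by (simp add: norm_mult)
  finally have "cmod (z * ((1 - of_real r) + of_real r * ?c)) \<le> \<epsilon> H * (1 + cmod ?c)"
  unfolding norm_mult by (intro mult_mono z(2) norm_ge_zero less_imp_le[OF \<epsilon>[OF H]])
  also have "... < cmod (\<zeta> H - \<zeta> H')" using \<epsilon>'[OF H H' False] pos[of ?c] by (simp add: field_simps)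
  finally show ?thesis unfolding eq by (metis add_eq_0_iff norm_minus_cancel order_less_irrefl)
  qed
 qed
 define vv where "vv H = of_real (\<epsilon> H) *s u H" for H
 have disc': "y H + z *s vv H : regular P" if "H : ?A" "0 < cmod z" "cmod z \<le> 1" for H z
 proof -
  have "cmod (z * of_real (\<epsilon> H)) \<le> \<epsilon> H" "cmod (z * of_real (\<epsilon> H)) > 0"
  using that \<epsilon>[OF that(1)] mult_right_mono[of "cmod z" 1 "\<epsilon> H"] by (auto simp: norm_mult)
  from disc[OF that(1) this(2,1), of 1] show ?thesis unfolding vv_def by (simp add: vector_smult_assoc)
 qed
 have circ: "\<sigma> (\<zeta> H + z) = y H + z *s x0" for H z unfolding y_def \<sigma>_def by (simp add: vec_eq_iff algebra_simps)
 \<comment> \<open>tilt the small circles from the direction \<open>x0\<close> to the eigenlines, in which braid reflections turn\<close>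
 have seg: "closed_segment (y H + (of_real (\<epsilon> H) * z) *s x0) (y H + z *s vv H) \<subseteq> chamber" if H: "H : ?A" and z: "cmod z = 1" for H z
 proof (rule chamberI[OF convex_imp_path_connected])
  show "y H + (of_real (\<epsilon> H) * z) *s x0 : chamber"
  proof -
  have "y H + (of_real (\<epsilon> H) * z) *s ((1 - of_real 0) *s x0 + of_real 0 *s u H) : regular P"
  by (rule disc[OF H]) (use \<epsilon>[OF H] z in \<open>auto simp: norm_mult\<close>)
  then have "\<sigma> (\<zeta> H + of_real (\<epsilon> H) * z) : regular P" unfolding circ by simp
  then have "\<sigma> (\<zeta> H + of_real (\<epsilon> H) * z) : chamber" using \<sigma>reg \<sigma>ch by blast
  then show ?thesis unfolding circ .
  qed
  show "closed_segment (y H + (of_real (\<epsilon> H) * z) *s x0) (y H + z *s vv H) \<subseteq> regular P"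
  proof
  fix x assume "x : closed_segment (y H + (of_real (\<epsilon> H) * z) *s x0) (y H + z *s vv H)"
  then obtain r where r: "0 \<le> r" "r \<le> 1" 
  "x = (1 - r) *\<^sub>R (y H + (of_real (\<epsilon> H) * z) *s x0) + r *\<^sub>R (y H + z *s vv H)" unfolding in_segment by blast
  have "x = y H + (of_real (\<epsilon> H) * z) *s ((1 - of_real r) *s x0 + of_real r *s u H)"
  unfolding r(3) vv_def scaleR_vec_complex by (simp add: vec_eq_iff algebra_simps)
  then show "x : regular P" using disc[OF H, of "of_real (\<epsilon> H) * z" r] \<epsilon>[OF H] z r by (simp add: norm_mult)
  qed
 qed auto
 define \<gamma> where "\<gamma> H = base_path (y H + vv H)" for H
 have \<gamma>: "path (\<gamma> H) & path_image (\<gamma> H) \<subseteq> regular P & pathstart (\<gamma> H) = x0 & pathfinish (\<gamma> H) = y H + vv H"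
  if H: "H : ?A" for H
 proof -
  have "y H + 1 *s vv H : chamber" by (rule subsetD[OF seg[OF H, of 1]]) auto
  then have "y H + vv H : chamber" by (simp only: vector_smult_lid)
  from base_path[OF this] show ?thesis unfolding \<gamma>_def by blast
 qed
 define b where "b H = (s H, path_class P (\<gamma> H +++ (%t. y H + cis (2 * pi * t / of_nat (hyp_order P H)) *s vv H) +++
  reversepath (%t. s H *v \<gamma> H t)))" for H
 have yH: "y H : H" "\<forall>H'\<in>?A. H' ~= H --> y H ~: H'" if "H : ?A" for H
  using that hy inj\<zeta> by (auto simp: hyperplane_height inj_on_def)
 have vvn: "vv H ~= 0" "s H *v vv H = zeta (hyp_order P H) *s vv H" if H: "H : ?A" for H
 proof -
  have "height x0 H (vv H) = of_real (\<epsilon> H)" unfolding vv_def using su[OF H] by (simp add: height_scale H)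
  then show "vv H ~= 0" using \<epsilon>[OF H] height_scale[OF H, of 0 x0] by auto
  show "s H *v vv H = zeta (hyp_order P H) *s vv H"
  unfolding vv_def vector_scalar_commute using su[OF H] by (simp add: vector_smult_assoc mult.commute)
 qed
 have br: "braid_reflection P x0 H (b H)" if H: "H : ?A" for H
  unfolding braid_reflection_def b_def
  using H su[OF H] vvn[OF H] yH[OF H] disc'[OF H] \<gamma>[OF H] by blast
 have pw: "b H : carrier (braid_group P x0) & \<delta> (b H) ^ hyp_order P H = holonomy \<delta> (%t. y H + cis (2 * pi * t) *s vv H)"
  if H: "H : ?A" and \<delta>: "braid_character \<delta>" for H and \<delta> :: "'n braid => 'k"
  using braid_reflection_power[OF \<delta> H _ _ vvn(2)[OF H] HOL.refl yH(1)[OF H] disc'[OF H], of "\<gamma> H" "b H"]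
  su[OF H] \<gamma>[OF H] b_def[of H] by blast
 have triv: "braid_character (%_. 1 :: 'k)" unfolding braid_character_def by simp
 have main: "\<delta> (full_twist P x0) = (\<Prod>H\<in>?A. \<delta> (b H) ^ hyp_order P H)" if \<delta>: "braid_character \<delta>" for \<delta> :: "'n braid => 'k"
 proof -
  note D = holonomy_character[OF \<delta>]
  define G where "G = (%p. holonomy \<delta> (\<sigma> \<circ> p))"
  have G: "path_character (- Z) G" unfolding G_def by (rule path_character_compose[OF D \<sigma>cont \<sigma>ch])
  define e where "e z = \<epsilon> (inv_into ?A \<zeta> z)" for z
  have e\<zeta>: "e (\<zeta> H) = \<epsilon> H" if "H : ?A" for H unfolding e_def using inv_into_f_f[OF inj\<zeta> that] by simp
  have circleeq: "circlepath z r t = z + of_real r * cis (2 * pi * t)" for z r t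
  unfolding circlepath cis_conv_exp by (simp add: mult_ac)
  have "G (circlepath 0 1) = (\<Prod>z\<in>Z. G (circlepath z (e z)))"
  proof (rule circle_character[OF G finZ _ Zball])
  show "inj_on Re Z" using inj unfolding Z_def \<zeta>_def inj_on_def by auto
  fix z assume "z : Z"
  then obtain H where H: "H : ?A" "z = \<zeta> H" unfolding Z_def by blast
  show "e z > 0" using \<epsilon> H e\<zeta> by simp
  show "cball z (e z) \<inter> Z \<subseteq> {z}"
  proof
  fix w assume w: "w : cball z (e z) \<inter> Z"
  then obtain H' where H': "H' : ?A" "w = \<zeta> H'" unfolding Z_def by blast
  have "H' = H"
  proof (rule ccontr)
  assume "H' ~= H"
  let ?c = "cmod (height x0 H' (u H))"
  have "\<epsilon> H * (1 + ?c) < cmod (\<zeta> H - \<zeta> H')" using \<epsilon>'[OF H(1) H'(1) \<open>H' ~= H\<close>] pos[of "height x0 H' (u H)"] by (simp add: field_simps)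
  moreover have "\<epsilon> H * 1 \<le> \<epsilon> H * (1 + ?c)" using \<epsilon>[OF H(1)] by (intro mult_left_mono) auto
  ultimately have "\<epsilon> H < cmod (\<zeta> H - \<zeta> H')" by simp
  then show False using w H H' e\<zeta> by (auto simp: dist_norm)
  qed
  then show "w : {z}" using H H' by simp
  qed
  qed simp
  also have "... = (\<Prod>H\<in>?A. G (circlepath (\<zeta> H) (\<epsilon> H)))"
  unfolding Z_def by (subst prod.reindex[OF inj\<zeta>]) (simp add: e\<zeta>)
  also have "... = (\<Prod>H\<in>?A. \<delta> (b H) ^ hyp_order P H)"
  proof (rule prod.cong[OF HOL.refl])
  fix H assume H: "H : ?A"
  have "homotopic_loops chamber (\<sigma> \<circ> circlepath (\<zeta> H) (\<epsilon> H)) (%t. y H + cis (2 * pi * t) *s vv H)"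
  proof (rule homotopic_loops_linear)
  show "path (\<sigma> \<circ> circlepath (\<zeta> H) (\<epsilon> H))" by (rule path_continuous_image[OF _ \<sigma>cont]) simp
  show "path (%t. y H + cis (2 * pi * t) *s vv H)" unfolding path_def by (intro continuous_intros)
  show "pathfinish (%t. y H + cis (2 * pi * t) *s vv H) = pathstart (%t. y H + cis (2 * pi * t) *s vv H)"
  by (simp add: pathfinish_def pathstart_def)
  fix t :: real
  show "closed_segment ((\<sigma> \<circ> circlepath (\<zeta> H) (\<epsilon> H)) t) (y H + cis (2 * pi * t) *s vv H) \<subseteq> chamber"
  using seg[OF H, of "cis (2 * pi * t)"] by (simp add: circleeq circ)
  qed (simp add: pathfinish_compose pathstart_compose)
  then have "G (circlepath (\<zeta> H) (\<epsilon> H)) = holonomy \<delta> (%t. y H + cis (2 * pi * t) *s vv H)"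
  unfolding G_def by (rule path_character_loops[OF D])
  then show "G (circlepath (\<zeta> H) (\<epsilon> H)) = \<delta> (b H) ^ hyp_order P H" using pw[OF H \<delta>] by simp
  qed
  \<comment> \<open>move the unit circle back to the line through the origin\<close>
  also have "G (circlepath 0 1) = holonomy \<delta> (twist_path x0)"
  proof -
  have "homotopic_loops chamber (\<sigma> \<circ> circlepath 0 1) (twist_path x0)"
  proof (rule homotopic_loops_linear)
  show "path (\<sigma> \<circ> circlepath 0 1)" by (rule path_continuous_image[OF _ \<sigma>cont]) simp
  fix t :: real
  let ?c = "cis (2 * pi * t)"
  have eq: "(\<sigma> \<circ> circlepath 0 1) t = v + ?c *s x0" by (simp add: circleeq \<sigma>_def)
  have "cmod ?c = 1" by simp
  then have "?c ~: Z" using Zball by (metis dist_0_norm less_irrefl mem_ball subsetD)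
  then have "v + ?c *s x0 : chamber" using \<sigma>ch unfolding \<sigma>_def by blast
  moreover have "closed_segment (v + ?c *s x0) (?c *s x0) \<subseteq> regular P"
  proof
  fix x assume "x : closed_segment (v + ?c *s x0) (?c *s x0)"
  then obtain r where r: "0 \<le> r" "r \<le> 1" "x = (1 - r) *\<^sub>R (v + ?c *s x0) + r *\<^sub>R (?c *s x0)" unfolding in_segment by blast
  have xe: "x = ?c *s x0 + of_real (1 - r) *s v" unfolding r(3) scaleR_vec_complex
  by (simp add: vec_eq_iff algebra_simps)
  have nz: "?c + of_real (1 - r) * height x0 H v ~= 0" if "H : ?A" for H
  proof -
  have "(1 - r) * cmod (height x0 H v) \<le> 1 * cmod (height x0 H v)" by (rule mult_right_mono) (use r in auto)
  then have "cmod (of_real (1 - r) * height x0 H v) < 1"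
  using small[OF that] r by (simp only: norm_mult norm_of_real)
  then show ?thesis by (metis add_eq_0_iff norm_minus_cancel norm_cis order_less_irrefl)
  qed
  show "x : regular P" unfolding regular_height
  proof
  fix H assume H: "H : ?A"
  show "height x0 H x ~= 0"
  unfolding xe height_add[OF H] height_scale[OF H] height_x0[OF H] using nz[OF H] by simp
  qed
  qed
  ultimately show "closed_segment ((\<sigma> \<circ> circlepath 0 1) t) (?c *s x0) \<subseteq> chamber"
  unfolding eq by (intro chamberI[OF convex_imp_path_connected, of _ "v + ?c *s x0"]) auto
  qed (use twist_path_path[OF x0] in \<open>auto simp: pathfinish_compose pathstart_compose\<close>)
  then show ?thesis unfolding G_def by (rule path_character_loops[OF D])
  qed
  also have "... = \<delta> (full_twist P x0)"
  unfolding holonomy_based_loop[OF full_twist_braid_path] full_twist_def ..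
  finally show ?thesis .
 qed
 have good: "\<forall>H\<in>?A. s H : fixator P H & normal_eigenvalue H (s H) = zeta (hyp_order P H) &
  fst (b H) = s H & braid_reflection P x0 H (b H) & b H : carrier (braid_group P x0)"
 proof (intro ballI conjI)
  fix H assume H: "H : ?A"
  show "s H : fixator P H" "normal_eigenvalue H (s H) = zeta (hyp_order P H)" using su[OF H] by simp_all
  show "fst (b H) = s H" by (simp add: b_def)
  show "braid_reflection P x0 H (b H)" by (rule br[OF H])
  show "b H : carrier (braid_group P x0)" using pw[OF H triv] by simp
 qed
 have prod: "\<forall>\<delta> :: 'n braid => 'k. braid_character \<delta> -->
  \<delta> (full_twist P x0) = (\<Prod>H\<in>?A. \<delta> (b H) ^ hyp_order P H)"
  by (intro allI impI main)
 show ?thesis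
 proof (rule exI[where x = s], rule exI[where x = b], rule conjI)
 qed (fact good, fact prod)
qed

end

section \<open>Matrix families and block triangular form\<close>

no_notation fps_nth (infixl \<open>$\<close> 75)
no_notation vec_nth (infixl \<open>$\<close> 90)

lemma mat_inverse_swap:
 assumes "(A :: 'k::field mat) : carrier_mat d d" "B : carrier_mat d d" "A * B = 1\<^sub>m d"
 shows "B * A = 1\<^sub>m d"
 by (rule mat_mult_left_right_inverse[OF assms])

lemma identity_with_column:
 fixes w :: "'k::field vec"
 assumes w: "w : carrier_vec d" "j < d" "w $ j ~= 0"
 defines "E \<equiv> mat d d (%(i, k). if k = j then w $ i else if i = k then 1 else 0)"
 obtains F where "F : carrier_mat d d" "E * F = 1\<^sub>m d"
proof
 let ?F = "mat d d (%(i, k). if k = j then (if i = j then 1 / w $ j else - w $ i / w $ j) else if i = k then 1 else 0)"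
 show "?F : carrier_mat d d" by simp
 show "E * ?F = 1\<^sub>m d"
 proof (rule eq_matI)
  fix i k assume "i < dim_row (1\<^sub>m d :: 'k mat)" "k < dim_col (1\<^sub>m d :: 'k mat)"
  then have ik: "i < d" "k < d" by auto
  have "(E * ?F) $$ (i, k) = (\<Sum>l<d. E $$ (i, l) * ?F $$ (l, k))"
  using ik by (simp add: E_def scalar_prod_def atLeast0LessThan)
  also have "... = E $$ (i, j) * ?F $$ (j, k) + (\<Sum>l\<in>{..<d} - {j}. E $$ (i, l) * ?F $$ (l, k))"
  by (rule sum.remove) (use w in auto)
  also have "(\<Sum>l\<in>{..<d} - {j}. E $$ (i, l) * ?F $$ (l, k)) = (\<Sum>l\<in>{..<d} - {j}. if l = i then ?F $$ (i, k) else 0)"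
  by (rule sum.cong) (use ik in \<open>auto simp: E_def\<close>)
  also have "... = (if i = j then 0 else ?F $$ (i, k))" using ik by simp
  finally show "(E * ?F) $$ (i, k) = 1\<^sub>m d $$ (i, k)"
  using ik w by (auto simp: E_def)
 qed (auto simp: E_def)
qed

lemma mult_mat_unit_vec:
 assumes "(P :: 'k::comm_ring_1 mat) : carrier_mat n d" "i < d"
 shows "P *\<^sub>v unit_vec d i = col P i"
 using assms by (intro eq_vecI) auto

lemma col_identity_with_column:
 assumes "w : carrier_vec d" "j < d"
 shows "col (mat d d (%(i, k). if k = j then w $ i else if i = k then 1 else 0)) j = (w :: 'k::field vec)"
 using assms by (intro eq_vecI) auto

definition vec_subspace :: "nat => 'k::field vec set => bool" where
 "vec_subspace d U \<longleftrightarrow> U \<subseteq> carrier_vec d & 0\<^sub>v d : U & (\<forall>u\<in>U. \<forall>v\<in>U. u + v : U) & (\<forall>c. \<forall>u\<in>U. c \<cdot>\<^sub>v u : U)"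

lemma mult_mat_vec_in_subspace:
 fixes P :: "'k::field mat"
 assumes U: "vec_subspace d U" and P: "P : carrier_mat d d" and w: "w : carrier_vec d"
  and c: "!!i. i < d ==> w $ i ~= 0 ==> col P i : U"
 shows "P *\<^sub>v w : U"
proof -
 let ?w = "%n. vec d (%i. if i < n then w $ i else 0)"
 have "P *\<^sub>v ?w n : U" if "n \<le> d" for n
  using that
 proof (induction n)
  case 0
  have "P *\<^sub>v ?w 0 = 0\<^sub>v d" using P by (intro eq_vecI) (auto simp: scalar_prod_def)
  then show ?case using U unfolding vec_subspace_def by simp
 next
  case (Suc n)
  have "?w (Suc n) = ?w n + w $ n \<cdot>\<^sub>v unit_vec d n" using Suc.prems by (intro eq_vecI) (auto simp: unit_vec_def less_Suc_eq)
  then have "P *\<^sub>v ?w (Suc n) = P *\<^sub>v ?w n + P *\<^sub>v (w $ n \<cdot>\<^sub>v unit_vec d n)"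
  by (simp add: mult_add_distrib_mat_vec[OF P])
  also have "P *\<^sub>v (w $ n \<cdot>\<^sub>v unit_vec d n) = w $ n \<cdot>\<^sub>v (P *\<^sub>v unit_vec d n)"
  by (rule mult_mat_vec[OF P]) simp
  also have "P *\<^sub>v unit_vec d n = col P n"
  using P Suc.prems by (simp add: mult_mat_unit_vec)
  finally have *: "P *\<^sub>v ?w (Suc n) = P *\<^sub>v ?w n + w $ n \<cdot>\<^sub>v col P n" .
  show ?case
  proof (cases "w $ n = 0")
  case True
  then have "?w (Suc n) = ?w n" by (auto simp: less_Suc_eq)
  then show ?thesis using Suc by simp
  next
  case False
  then show ?thesis unfolding * using Suc c[of n] U unfolding vec_subspace_def by simp
  qed
 qed
 from this[of d] have "P *\<^sub>v ?w d : U" by simp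
 moreover have "?w d = w" using w by auto
 ultimately show ?thesis by simp
qed

text \<open>A maximal set of indices at which the columns of an invertible matrix can be chosen in \<open>U\<close>; maximality makes these columns span \<open>U\<close>.\<close>

lemma adapted_basis:
 fixes U :: "'k::field vec set"
 assumes U: "vec_subspace d U"
 shows "\<exists>r P Q. r \<le> d & P : carrier_mat d d & Q : carrier_mat d d & P * Q = 1\<^sub>m d & Q * P = 1\<^sub>m d &
  (\<forall>u\<in>carrier_vec d. u : U \<longleftrightarrow> (\<forall>i. r \<le> i & i < d --> (Q *\<^sub>v u) $ i = 0))"
proof -
 define good where "good I \<longleftrightarrow> I \<subseteq> {..<d} & (\<exists>P Q. P : carrier_mat d d & Q : carrier_mat d d & P * Q = 1\<^sub>m d & (\<forall>i\<in>I. col P i : U))" for I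
 have "(1\<^sub>m d :: 'k mat) : carrier_mat d d & 1\<^sub>m d : carrier_mat d d & 1\<^sub>m d * 1\<^sub>m d = (1\<^sub>m d :: 'k mat) & (\<forall>i\<in>{}. col (1\<^sub>m d :: 'k mat) i : U)"
  by simp
 then have "good {}" unfolding good_def by blast
 moreover have bound: "card I \<le> d" if "good I" for I
 proof -
  have "I \<subseteq> {..<d}" using that unfolding good_def by blast
  from card_mono[OF finite_lessThan this] show ?thesis by simp
 qed
 ultimately have "\<exists>I. good I & (\<forall>J. good J --> card J \<le> card I)"
  by (intro ex_has_greatest_nat[of good "{}" card "Suc d"]) (simp_all add: less_Suc_eq_le)
 then obtain I where I: "good I" "!!J. good J ==> card J \<le> card I" by (elim exE conjE) simp
 then obtain P Q where PQ: "I \<subseteq> {..<d}" "P : carrier_mat d d" "Q : carrier_mat d d" "P * Q = 1\<^sub>m d" "\<forall>i\<in>I. col P i : U"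
  unfolding good_def by blast
 have QP: "Q * P = 1\<^sub>m d" by (rule mat_inverse_swap[OF PQ(2,3,4)])
 have finI: "finite I" using PQ(1) finite_subset by blast
 have iff: "u : U \<longleftrightarrow> (\<forall>i. i ~: I & i < d --> (Q *\<^sub>v u) $ i = 0)" if u: "u : carrier_vec d" for u
 proof
  let ?w = "Q *\<^sub>v u"
  have w: "?w : carrier_vec d" using PQ u by auto
  have Pw: "P *\<^sub>v ?w = u" using PQ u by (metis assoc_mult_mat_vec one_mult_mat_vec)
  show "u : U" if "\<forall>i. i ~: I & i < d --> ?w $ i = 0"
  using mult_mat_vec_in_subspace[OF U PQ(2) w] that PQ(5) Pw by metis
  show "\<forall>i. i ~: I & i < d --> ?w $ i = 0" if uU: "u : U"
  proof (rule ccontr)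
  assume "\<not> ?thesis"
  then obtain j where j: "j ~: I" "j < d" "?w $ j ~= 0" by blast
  let ?E = "mat d d (%(i, k). if k = j then ?w $ i else if i = k then 1 else 0)"
  obtain F where F: "F : carrier_mat d d" "?E * F = 1\<^sub>m d" using identity_with_column[OF w j(2,3)] by blast
  have E: "?E : carrier_mat d d" by simp
  have colE: "col (P * ?E) i = P *\<^sub>v col ?E i" if "i < d" for i
  using PQ(2) that by (intro eq_vecI) auto
  have cols: "col (P * ?E) i = col P i" if i: "i < d" "i ~= j" for i
  proof -
  have "col ?E i = unit_vec d i" using i by (auto simp: unit_vec_def)
  then show ?thesis using colE[OF i(1)] mult_mat_unit_vec[OF PQ(2) i(1)] by simp
  qed
  have "\<forall>i\<in>insert j I. col (P * ?E) i : U"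
  proof
  fix i assume i: "i : insert j I"
  show "col (P * ?E) i : U"
  proof (cases "i = j")
  case True
  have "col (P * ?E) j = u" using colE[OF j(2)] Pw unfolding col_identity_with_column[OF w j(2)] by simp
  then show ?thesis using uU True by simp
  next
  case False
  then have iI: "i : I" "i < d" using i PQ(1) by auto
  then have "col (P * ?E) i = col P i" using False cols by simp
  then show ?thesis using PQ(5) iI by simp
  qed
  qed
  moreover have "(P * ?E) * (F * Q) = 1\<^sub>m d"
  proof -
  have "(P * ?E) * (F * Q) = P * (?E * F) * Q"
  using PQ(2,3) E F(1) by (simp add: assoc_mult_mat[of _ d d _ d _ d] mult_carrier_mat[of _ d d _ d])
  then show ?thesis using F PQ by simp
  qed
  moreover have "P * ?E : carrier_mat d d" "F * Q : carrier_mat d d"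
  by (rule mult_carrier_mat[OF PQ(2) E], rule mult_carrier_mat[OF F(1) PQ(3)])
  moreover have "insert j I \<subseteq> {..<d}" using PQ(1) j(2) by simp
  ultimately have "good (insert j I)" unfolding good_def by blast
  then have "card (insert j I) \<le> card I" by (rule I(2))
  then show False using j finI by simp
  qed
 qed
 let ?r = "card I"
 have r: "?r \<le> d" using bound I by blast
 obtain h1 where h1: "bij_betw h1 {..<?r} I"
  using finite_same_card_bij[of "{..<?r}" I] finI by auto
 have "card ({..<d} - I) = d - ?r" using card_Diff_subset[OF finI PQ(1)] by simp
 then obtain h2 where h2: "bij_betw h2 {?r..<d} ({..<d} - I)"
  using finite_same_card_bij[of "{?r..<d}" "{..<d} - I"] by auto
 define p where "p i = (if i < ?r then h1 i else h2 i)" for i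
 have "bij_betw p {..<?r} I" "bij_betw p {?r..<d} ({..<d} - I)"
 proof -
  have "bij_betw p {..<?r} I = bij_betw h1 {..<?r} I" by (rule bij_betw_cong) (simp add: p_def)
  then show "bij_betw p {..<?r} I" using h1 by simp
  have "bij_betw p {?r..<d} ({..<d} - I) = bij_betw h2 {?r..<d} ({..<d} - I)" by (rule bij_betw_cong) (simp add: p_def)
  then show "bij_betw p {?r..<d} ({..<d} - I)" using h2 by simp
 qed
 then have "bij_betw p ({..<?r} \<union> {?r..<d}) (I \<union> ({..<d} - I))"
  by (rule bij_betw_combine) auto
 moreover have "{..<?r} \<union> {?r..<d} = {..<d}" "I \<union> ({..<d} - I) = {..<d}" using r PQ(1) by auto
 ultimately have p: "bij_betw p {..<d} {..<d}" by simp
 have pI: "p i : I \<longleftrightarrow> i < ?r" if "i < d" for i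
  using that \<open>bij_betw p {..<?r} I\<close> \<open>bij_betw p {?r..<d} ({..<d} - I)\<close> unfolding bij_betw_def by force
 have pd: "p i < d" if "i < d" for i using p that unfolding bij_betw_def by auto
 have pinj: "p i = p k \<longleftrightarrow> i = k" if "i < d" "k < d" for i k using p that unfolding bij_betw_def inj_on_def by auto
 define P' where "P' = mat d d (%(i, k). P $$ (i, p k))"
 define Q' where "Q' = mat d d (%(i, k). Q $$ (p i, k))"
 have P': "P' : carrier_mat d d" and Q': "Q' : carrier_mat d d" unfolding P'_def Q'_def by auto
 have "Q' * P' = 1\<^sub>m d"
 proof (rule eq_matI)
  fix i k assume "i < dim_row (1\<^sub>m d :: 'k mat)" "k < dim_col (1\<^sub>m d :: 'k mat)"
  then have ik: "i < d" "k < d" by auto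
  have "(Q' * P') $$ (i, k) = (Q * P) $$ (p i, p k)"
  using ik PQ(2,3) pd by (simp add: P'_def Q'_def scalar_prod_def)
  also have "... = 1\<^sub>m d $$ (i, k)" using ik pd pinj unfolding QP by simp
  finally show "(Q' * P') $$ (i, k) = 1\<^sub>m d $$ (i, k)" .
 qed (auto simp: P'_def Q'_def)
 note QP' = this mat_inverse_swap[OF Q' P' this]
 show ?thesis
 proof (intro exI conjI ballI)
  show "?r \<le> d" "P' : carrier_mat d d" "Q' : carrier_mat d d" "P' * Q' = 1\<^sub>m d" "Q' * P' = 1\<^sub>m d"
  by (fact r P' Q' QP')+
  fix u :: "'k vec" assume u: "u : carrier_vec d"
  have "(Q' *\<^sub>v u) $ i = (Q *\<^sub>v u) $ (p i)" if "i < d" for i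
  using that pd PQ(3) u by (simp add: Q'_def scalar_prod_def)
  moreover have "(\<forall>i. i ~: I & i < d --> (Q *\<^sub>v u) $ i = 0) \<longleftrightarrow> (\<forall>i. i < d & p i ~: I --> (Q *\<^sub>v u) $ (p i) = 0)"
  proof (intro iffI allI impI)
  fix i assume a: "\<forall>i. i < d & p i ~: I --> (Q *\<^sub>v u) $ (p i) = 0" and i: "i ~: I & i < d"
  then obtain k where "k < d" "p k = i" using p unfolding bij_betw_def by (metis (no_types, lifting) imageE lessThan_iff)
  then show "(Q *\<^sub>v u) $ i = 0" using a i by auto
  qed (use pd in auto)
  ultimately show "u : U \<longleftrightarrow> (\<forall>i. ?r \<le> i & i < d --> (Q' *\<^sub>v u) $ i = 0)"
  unfolding iff[OF u] using pI by (metis not_le)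
 qed
qed

text \<open>A simultaneous block triangular form, with one change of basis for the whole family. The index set is arbitrary, so the notion applies to representations of groups, of algebras and of commutants alike.\<close>

definition triangular_extension :: "'g set => nat => nat => ('g => 'k::field mat) => ('g => 'k mat) => ('g => 'k mat) => bool" where
 "triangular_extension G r s \<phi>1 \<phi>2 \<phi> \<longleftrightarrow>
  (\<forall>g\<in>G. \<phi>1 g : carrier_mat r r & \<phi>2 g : carrier_mat s s) &
  (\<exists>P Q B. \<forall>g\<in>G. B g : carrier_mat r s &
  similar_mat_wit (\<phi> g) (four_block_mat (\<phi>1 g) (B g) (0\<^sub>m s r) (\<phi>2 g)) P Q & P : carrier_mat (r + s) (r + s))"

lemma reducible_triangular:
 fixes \<phi> :: "'g => 'k::field mat"
 assumes \<phi>: "!!g. g : G ==> \<phi> g : carrier_mat d d" and d: "d > 0" and red: "\<not> irreducible_mats d (\<phi> ` G)"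
 obtains r s \<phi>1 \<phi>2 where "d = r + s" "r < d" "s < d" "triangular_extension G r s \<phi>1 \<phi>2 \<phi>"
proof -
 have "\<exists>U. vec_subspace d U & (\<forall>A\<in>\<phi> ` G. \<forall>u\<in>U. A *\<^sub>v u : U) & U ~= {0\<^sub>v d} & U ~= carrier_vec d"
 proof (rule ccontr)
  assume "\<not> ?thesis"
  then have "irreducible_mats d (\<phi> ` G)"
  unfolding irreducible_mats_def vec_subspace_def using d by blast
  then show False using red by blast
 qed
 then obtain U where U0: "vec_subspace d U & (\<forall>A\<in>\<phi> ` G. \<forall>u\<in>U. A *\<^sub>v u : U) & U ~= {0\<^sub>v d} & U ~= carrier_vec d" ..
 have inv: "\<phi> g *\<^sub>v u : U" if "g : G" "u : U" for g u using U0 that by blast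
 note U = conjunct1[OF U0] inv conjunct1[OF conjunct2[OF conjunct2[OF U0]]] conjunct2[OF conjunct2[OF conjunct2[OF U0]]]
 obtain r P Q where A: "r \<le> d & P : carrier_mat d d & Q : carrier_mat d d & P * Q = 1\<^sub>m d & Q * P = 1\<^sub>m d &
  (\<forall>u\<in>carrier_vec d. u : U \<longleftrightarrow> (\<forall>i. r \<le> i & i < d --> (Q *\<^sub>v u) $ i = 0))"
  using adapted_basis[OF U(1)] by (elim exE) (rule that)
 have r: "r \<le> d" using A by blast
 have P: "P : carrier_mat d d" using A by blast
 have Q: "Q : carrier_mat d d" using A by blast
 have PQ: "P * Q = 1\<^sub>m d" "Q * P = 1\<^sub>m d" using A by blast+
 have iff: "u : U \<longleftrightarrow> (\<forall>i. r \<le> i & i < d --> (Q *\<^sub>v u) $ i = 0)" if "u : carrier_vec d" for u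
  using A that by blast
 have Uc: "U \<subseteq> carrier_vec d" "0\<^sub>v d : U" using U(1) unfolding vec_subspace_def by blast+
 have "r ~= d"
 proof
  assume "r = d"
  then have "carrier_vec d \<subseteq> U" using iff by fastforce
  then show False using Uc U(4) by blast
 qed
 moreover have "r ~= 0"
 proof
  assume r0: "r = 0"
  have "u = 0\<^sub>v d" if uU: "u : U" for u
  proof -
  have u: "u : carrier_vec d" using uU Uc by blast
  have "\<forall>i. r \<le> i & i < d --> (Q *\<^sub>v u) $ i = 0" using iff[OF u] uU by (rule iffD1)
  then have "Q *\<^sub>v u = 0\<^sub>v d" using r0 Q by (intro eq_vecI) auto
  moreover have "P *\<^sub>v 0\<^sub>v d = 0\<^sub>v d" using P by (intro eq_vecI) (auto simp: scalar_prod_def)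
  ultimately have "(P * Q) *\<^sub>v u = 0\<^sub>v d" using assoc_mult_mat_vec[OF P Q u] by simp
  then show ?thesis using PQ u by simp
  qed
  then show False using Uc U(3) by blast
 qed
 ultimately have rd: "0 < r" "r < d" using r by auto
 define N where "N g = Q * \<phi> g * P" for g
 have N: "N g : carrier_mat d d" if "g : G" for g unfolding N_def using \<phi>[OF that] P Q by auto
 define \<phi>1 where "\<phi>1 g = mat r r (%(i, j). N g $$ (i, j))" for g
 define \<phi>2 where "\<phi>2 g = mat (d - r) (d - r) (%(i, j). N g $$ (i + r, j + r))" for g
 define B where "B g = mat r (d - r) (%(i, j). N g $$ (i, j + r))" for g
 have colU: "col P k : U" if "k < r" for k
 proof -
  have ck: "col P k : carrier_vec d" using P by auto
  have "Q *\<^sub>v col P k = col (Q * P) k" using P Q that rd by (intro eq_vecI) auto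
  also have "... = unit_vec d k" unfolding PQ using that rd by simp
  finally show ?thesis unfolding iff[OF ck] using that by simp
 qed
 have zero: "N g $$ (i, k) = 0" if g: "g : G" and ik: "r \<le> i" "i < d" "k < r" for g i k
 proof -
  have ck: "col P k : carrier_vec d" using P by auto
  have u: "\<phi> g *\<^sub>v col P k : U" by (rule U(2)[OF g colU[OF ik(3)]])
  have uc: "\<phi> g *\<^sub>v col P k : carrier_vec d" using \<phi>[OF g] ck by auto
  have kd: "k < d" using ik rd by simp
  have "N g $$ (i, k) = (Q * (\<phi> g * P)) $$ (i, k)" unfolding N_def using \<phi>[OF g] P Q by simp
  also have "... = row Q i \<bullet> col (\<phi> g * P) k" using Q \<phi>[OF g] P ik kd by auto
  also have "col (\<phi> g * P) k = \<phi> g *\<^sub>v col P k" using P \<phi>[OF g] kd by (intro eq_vecI) auto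
  also have "row Q i \<bullet> (\<phi> g *\<^sub>v col P k) = (Q *\<^sub>v (\<phi> g *\<^sub>v col P k)) $ i" using Q ik by simp
  also have "... = 0" using iff[OF uc] u ik by blast
  finally show ?thesis .
 qed
 have four: "four_block_mat (\<phi>1 g) (B g) (0\<^sub>m (d - r) r) (\<phi>2 g) = N g" if g: "g : G" for g
  using N[OF g] rd zero[OF g] by (intro eq_matI) (auto simp: \<phi>1_def \<phi>2_def B_def)
 have sim: "similar_mat_wit (\<phi> g) (N g) P Q" if g: "g : G" for g
 proof (rule similar_mat_witI[OF PQ _ \<phi>[OF g] N[OF g] P Q])
  have "P * N g * Q = (P * Q) * \<phi> g * (P * Q)"
  unfolding N_def using P Q \<phi>[OF g] by (simp add: assoc_mult_mat[of _ d d _ d _ d] mult_carrier_mat[of _ d d _ d])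
  then show "\<phi> g = P * N g * Q" using PQ \<phi>[OF g] by simp
 qed
 have "triangular_extension G r (d - r) \<phi>1 \<phi>2 \<phi>"
  unfolding triangular_extension_def
 proof (intro conjI ballI exI)
  fix g assume g: "g : G"
  show "\<phi>1 g : carrier_mat r r" "\<phi>2 g : carrier_mat (d - r) (d - r)" "B g : carrier_mat r (d - r)"
  unfolding \<phi>1_def \<phi>2_def B_def by auto
  show "similar_mat_wit (\<phi> g) (four_block_mat (\<phi>1 g) (B g) (0\<^sub>m (d - r) r) (\<phi>2 g)) P Q"
  unfolding four[OF g] by (rule sim[OF g])
  show "P : carrier_mat (r + (d - r)) (r + (d - r))" using P rd by simp
 qed
 then show ?thesis using that[of r "d - r"] rd by auto
qed

text \<open>Every matrix family is built from irreducible ones by extensions. This replaces composition series, and every identity between members of the family is inherited by the diagonal blocks.\<close>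

lemma matrix_family_induct:
 fixes \<phi> :: "'g => 'k::field mat"
 assumes "!!g. g : G ==> \<phi> g : carrier_mat d d"
  and zero: "!!\<phi>. (!!g. g : G ==> \<phi> g : carrier_mat 0 0) ==> R 0 \<phi>"
  and irr: "!!d \<phi>. (!!g. g : G ==> \<phi> g : carrier_mat d d) ==> irreducible_mats d (\<phi> ` G) ==> R d \<phi>"
  and ext: "!!r s \<phi>1 \<phi>2 \<phi>. (!!g. g : G ==> \<phi> g : carrier_mat (r + s) (r + s)) ==>
  triangular_extension G r s \<phi>1 \<phi>2 \<phi> ==> R r \<phi>1 ==> R s \<phi>2 ==> R (r + s) \<phi>"
 shows "R d \<phi>"
 using assms(1)
proof (induction d arbitrary: \<phi> rule: less_induct)
 case (less d)
 consider "d = 0" | "irreducible_mats d (\<phi> ` G)" | "d > 0" "\<not> irreducible_mats d (\<phi> ` G)" by blast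
 then show ?case
 proof cases
  case 1 then show ?thesis using zero less.prems by simp
 next
  case 2 then show ?thesis using irr less.prems by blast
 next
  case 3
  obtain r s \<phi>1 \<phi>2 where *: "d = r + s" "r < d" "s < d" "triangular_extension G r s \<phi>1 \<phi>2 \<phi>"
  by (rule reducible_triangular[OF less.prems 3])
  then have "R r \<phi>1" "R s \<phi>2" using less.IH unfolding triangular_extension_def by blast+
  then show ?thesis using ext * less.prems by blast
 qed
qed

lemma pow_mat_add:
 assumes A: "(A :: 'k::comm_ring_1 mat) : carrier_mat n n"
 shows "A ^\<^sub>m (a + b) = A ^\<^sub>m a * A ^\<^sub>m b"
proof (induction b)
 case 0
 then show ?case using A pow_carrier_mat[OF A, of a] by simp
next
 case (Suc b)
 then show ?case
  using assoc_mult_mat[OF pow_carrier_mat[OF A, of a] pow_carrier_mat[OF A, of b] A] by simp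
qed

lemma mat_trace_mult_comm:
 assumes "A : carrier_mat n m" "B : carrier_mat m n"
 shows "mat_trace (A * B) = mat_trace (B * (A :: 'k::comm_semiring_0 mat))"
proof -
 have "mat_trace (A * B) = (\<Sum>i<n. \<Sum>j<m. A $$ (i, j) * B $$ (j, i))"
  unfolding mat_trace_def using assms by (simp add: scalar_prod_def atLeast0LessThan)
 also have "... = (\<Sum>j<m. \<Sum>i<n. A $$ (i, j) * B $$ (j, i))" by (rule sum.swap)
 also have "... = mat_trace (B * A)"
  unfolding mat_trace_def using assms by (simp add: scalar_prod_def atLeast0LessThan mult.commute)
 finally show ?thesis .
qed

lemma mat_trace_similar:
 assumes "similar_mat_wit A B P Q" "A : carrier_mat n n"
 shows "mat_trace A = mat_trace (B :: 'k::comm_ring_1 mat)"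
proof -
 note s = similar_mat_witD2[OF assms(2,1)]
 have "mat_trace A = mat_trace (P * (B * Q))" using s by simp
 also have "... = mat_trace (B * Q * P)" by (rule mat_trace_mult_comm[of _ n n]) (use s in auto)
 also have "B * Q * P = B" using s by (simp add: assoc_mult_mat[of _ n n _ n _ n] mult_carrier_mat[of _ n n _ n])
 finally show ?thesis .
qed

lemma mat_trace_four_block:
 assumes "A : carrier_mat r r" "D : carrier_mat s s"
 shows "mat_trace (four_block_mat A B C D) = mat_trace A + mat_trace (D :: 'k::comm_monoid_add mat)"
proof -
 have "mat_trace (four_block_mat A B C D) = (\<Sum>i<r + s. (four_block_mat A B C D) $$ (i, i))"
  unfolding mat_trace_def using assms by simp
 also have "... = (\<Sum>i<r. (four_block_mat A B C D) $$ (i, i)) + (\<Sum>i<s. (four_block_mat A B C D) $$ (i + r, i + r))"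
  using sum.atLeastLessThan_concat[of 0 r "r + s" "%i. (four_block_mat A B C D) $$ (i, i)"]
  sum.shift_bounds_nat_ivl[of "%i. (four_block_mat A B C D) $$ (i, i)" 0 r s]
  by (simp add: atLeast0LessThan add.commute)
 also have "(\<Sum>i<r. (four_block_mat A B C D) $$ (i, i)) = mat_trace A"
  unfolding mat_trace_def using assms by (intro sum.cong) auto
 also have "(\<Sum>i<s. (four_block_mat A B C D) $$ (i + r, i + r)) = mat_trace D"
  unfolding mat_trace_def using assms by (intro sum.cong) auto
 finally show ?thesis .
qed

lemma four_block_inject:
 assumes "four_block_mat A B C D = four_block_mat A' B' C' D'"
  "A : carrier_mat r r" "A' : carrier_mat r r" "D : carrier_mat s s" "D' : carrier_mat s s"
 shows "A = A'" "D = D'"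
proof -
 show "A = A'"
 proof (rule eq_matI)
  fix i j assume "i < dim_row A'" "j < dim_col A'"
  then show "A $$ (i, j) = A' $$ (i, j)"
  using arg_cong[OF assms(1), of "%M. M $$ (i, j)"] assms(2-5) by auto
 qed (use assms in auto)
 show "D = D'"
 proof (rule eq_matI)
  fix i j assume "i < dim_row D'" "j < dim_col D'"
  then show "D $$ (i, j) = D' $$ (i, j)"
  using arg_cong[OF assms(1), of "%M. M $$ (i + r, j + r)"] assms(2-5) by auto
 qed (use assms in auto)
qed

context
 fixes G :: "'g set" and r s :: nat and \<phi>1 \<phi>2 \<phi> :: "'g => 'k::field mat"
 assumes ext: "triangular_extension G r s \<phi>1 \<phi>2 \<phi>"
begin

lemma extension_dims:
 assumes "g : G"
 shows "\<phi>1 g : carrier_mat r r" "\<phi>2 g : carrier_mat s s" "\<phi> g : carrier_mat (r + s) (r + s)"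
proof -
 show d: "\<phi>1 g : carrier_mat r r" "\<phi>2 g : carrier_mat s s" using ext assms unfolding triangular_extension_def by blast+
 obtain P Q B where *: "similar_mat_wit (\<phi> g) (four_block_mat (\<phi>1 g) (B g) (0\<^sub>m s r) (\<phi>2 g)) P Q"
  using ext assms unfolding triangular_extension_def by blast
 let ?n = "dim_row (\<phi> g)"
 have "four_block_mat (\<phi>1 g) (B g) (0\<^sub>m s r) (\<phi>2 g) : carrier_mat ?n ?n" "\<phi> g : carrier_mat ?n ?n"
  using similar_mat_witD(5,4)[OF HOL.refl *] .
 moreover have "dim_row (four_block_mat (\<phi>1 g) (B g) (0\<^sub>m s r) (\<phi>2 g)) = r + s" using d by simp
 ultimately show "\<phi> g : carrier_mat (r + s) (r + s)" by (metis carrier_matD(1))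
qed

lemma extension_trace: "g : G ==> mat_trace (\<phi> g) = mat_trace (\<phi>1 g) + mat_trace (\<phi>2 g)"
proof -
 assume g: "g : G"
 obtain P Q B where *: "similar_mat_wit (\<phi> g) (four_block_mat (\<phi>1 g) (B g) (0\<^sub>m s r) (\<phi>2 g)) P Q"
  using ext g unfolding triangular_extension_def by blast
 show ?thesis
  unfolding mat_trace_similar[OF * extension_dims(3)[OF g]] by (rule mat_trace_four_block[OF extension_dims(1,2)[OF g]])
qed

lemma extension_det: "g : G ==> det (\<phi> g) = det (\<phi>1 g) * det (\<phi>2 g)"
proof -
 assume g: "g : G"
 obtain P Q B where *: "B g : carrier_mat r s" "similar_mat_wit (\<phi> g) (four_block_mat (\<phi>1 g) (B g) (0\<^sub>m s r) (\<phi>2 g)) P Q"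
  using ext g unfolding triangular_extension_def by blast
 have "det (\<phi> g) = det (four_block_mat (\<phi>1 g) (B g) (0\<^sub>m s r) (\<phi>2 g))"
  by (rule det_similar) (use * in \<open>auto simp: similar_mat_def\<close>)
 then show ?thesis using det_four_block_mat_lower_left_zero[OF extension_dims(1)[OF g] *(1) HOL.refl extension_dims(2)[OF g]] by simp
qed

lemma extension_blocks:
 obtains P Q B where "P : carrier_mat (r + s) (r + s)" "Q : carrier_mat (r + s) (r + s)" "P * Q = 1\<^sub>m (r + s)" "Q * P = 1\<^sub>m (r + s)"
  "!!g. g : G ==> B g : carrier_mat r s" "!!g. g : G ==> Q * \<phi> g * P = four_block_mat (\<phi>1 g) (B g) (0\<^sub>m s r) (\<phi>2 g)"
proof (cases "G = {}")
 case True then show ?thesis using that[of "1\<^sub>m (r + s)" "1\<^sub>m (r + s)"] by auto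
next
 case False
 obtain P Q B where *: "!!g. g : G ==> B g : carrier_mat r s"
  "!!g. g : G ==> similar_mat_wit (\<phi> g) (four_block_mat (\<phi>1 g) (B g) (0\<^sub>m s r) (\<phi>2 g)) P Q"
  using ext unfolding triangular_extension_def by blast
 obtain g0 where "g0 : G" using False by blast
 note s0 = similar_mat_witD2[OF extension_dims(3)[OF this] *(2)[OF this]]
 show ?thesis
 proof (rule that[OF s0(6,7) s0(1,2) *(1)])
  fix g assume g: "g : G"
  note s = similar_mat_witD2[OF extension_dims(3)[OF g] *(2)[OF g]]
  let ?N = "four_block_mat (\<phi>1 g) (B g) (0\<^sub>m s r) (\<phi>2 g)"
  have "Q * (P * ?N * Q) * P = (Q * P) * ?N * (Q * P)"
  using s(5,6,7) by (simp add: assoc_mult_mat[of _ "r + s" "r + s" _ "r + s" _ "r + s"] mult_carrier_mat[of _ "r + s" "r + s" _ "r + s"])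
  also have "... = ?N" unfolding s(2) left_mult_one_mat[OF s(5)] right_mult_one_mat[OF s(5)] ..
  finally show "Q * \<phi> g * P = ?N" unfolding s(3)[symmetric] .
 qed
qed

lemma extension_mult:
 assumes "g : G" "h : G" "k : G" "\<phi> k = \<phi> g * \<phi> h"
 shows "\<phi>1 k = \<phi>1 g * \<phi>1 h" "\<phi>2 k = \<phi>2 g * \<phi>2 h"
proof -
 obtain P Q B where *: "P : carrier_mat (r + s) (r + s)" "Q : carrier_mat (r + s) (r + s)" "P * Q = 1\<^sub>m (r + s)" "Q * P = 1\<^sub>m (r + s)"
  "!!g. g : G ==> B g : carrier_mat r s" "!!g. g : G ==> Q * \<phi> g * P = four_block_mat (\<phi>1 g) (B g) (0\<^sub>m s r) (\<phi>2 g)"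
  using extension_blocks by metis
 note d = extension_dims[OF assms(1)] extension_dims[OF assms(2)] extension_dims[OF assms(3)]
 have m: "\<phi>1 g * \<phi>1 h : carrier_mat r r" "\<phi>2 g * \<phi>2 h : carrier_mat s s"
  by (rule mult_carrier_mat[OF d(1,4)], rule mult_carrier_mat[OF d(2,5)])
 have "Q * \<phi> k * P = Q * \<phi> g * (P * Q) * \<phi> h * P"
  unfolding assms(4) *(3) using *(1,2) d by (simp add: assoc_mult_mat[of _ "r + s" "r + s" _ "r + s" _ "r + s"] mult_carrier_mat[of _ "r + s" "r + s" _ "r + s"])
 also have "... = (Q * \<phi> g * P) * (Q * \<phi> h * P)"
  using *(1,2) d by (simp add: assoc_mult_mat[of _ "r + s" "r + s" _ "r + s" _ "r + s"] mult_carrier_mat[of _ "r + s" "r + s" _ "r + s"])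
 also have "... = four_block_mat (\<phi>1 g * \<phi>1 h + B g * 0\<^sub>m s r) (\<phi>1 g * B h + B g * \<phi>2 h) (0\<^sub>m s r * \<phi>1 h + \<phi>2 g * 0\<^sub>m s r) (0\<^sub>m s r * B h + \<phi>2 g * \<phi>2 h)"
  unfolding *(6)[OF assms(1)] *(6)[OF assms(2)]
  by (rule mult_four_block_mat) (use d *(5) assms in auto)
 also have "... = four_block_mat (\<phi>1 g * \<phi>1 h) (\<phi>1 g * B h + B g * \<phi>2 h) (0\<^sub>m s r) (\<phi>2 g * \<phi>2 h)"
  using d(1,2,4,5) *(5)[OF assms(1)] *(5)[OF assms(2)] m by simp
 finally have eq: "four_block_mat (\<phi>1 k) (B k) (0\<^sub>m s r) (\<phi>2 k) = ..." unfolding *(6)[OF assms(3)] .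
 show "\<phi>1 k = \<phi>1 g * \<phi>1 h" "\<phi>2 k = \<phi>2 g * \<phi>2 h"
  using four_block_inject[OF eq d(7) m(1) d(8) m(2)] by auto
qed

lemma extension_add:
 assumes "g : G" "h : G" "k : G" "\<phi> k = \<phi> g + \<phi> h"
 shows "\<phi>1 k = \<phi>1 g + \<phi>1 h" "\<phi>2 k = \<phi>2 g + \<phi>2 h"
proof -
 obtain P Q B where *: "P : carrier_mat (r + s) (r + s)" "Q : carrier_mat (r + s) (r + s)" "P * Q = 1\<^sub>m (r + s)" "Q * P = 1\<^sub>m (r + s)"
  "!!g. g : G ==> B g : carrier_mat r s" "!!g. g : G ==> Q * \<phi> g * P = four_block_mat (\<phi>1 g) (B g) (0\<^sub>m s r) (\<phi>2 g)"
  using extension_blocks by metis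
 note d = extension_dims[OF assms(1)] extension_dims[OF assms(2)] extension_dims[OF assms(3)]
 have "Q * \<phi> k * P = Q * \<phi> g * P + Q * \<phi> h * P"
  unfolding assms(4) using *(1,2) d
  by (simp add: mult_add_distrib_mat[of _ "r + s" "r + s" _ "r + s"] add_mult_distrib_mat[of _ "r + s" "r + s" _ _ "r + s"] mult_carrier_mat[of _ "r + s" "r + s" _ "r + s"])
 also have "... = four_block_mat (\<phi>1 g + \<phi>1 h) (B g + B h) (0\<^sub>m s r + 0\<^sub>m s r) (\<phi>2 g + \<phi>2 h)"
  unfolding *(6)[OF assms(1)] *(6)[OF assms(2)]
  by (rule add_four_block_mat) (use d *(5) assms in auto)
 finally have "four_block_mat (\<phi>1 k) (B k) (0\<^sub>m s r) (\<phi>2 k) = ..." unfolding *(6)[OF assms(3)] .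
 from four_block_inject[OF this, of r s] show "\<phi>1 k = \<phi>1 g + \<phi>1 h" "\<phi>2 k = \<phi>2 g + \<phi>2 h"
  using d *(5) assms by auto
qed

lemma extension_scalar:
 assumes "g : G" "\<phi> g = c \<cdot>\<^sub>m 1\<^sub>m (r + s)"
 shows "\<phi>1 g = c \<cdot>\<^sub>m 1\<^sub>m r" "\<phi>2 g = c \<cdot>\<^sub>m 1\<^sub>m s"
proof -
 obtain P Q B where *: "P : carrier_mat (r + s) (r + s)" "Q : carrier_mat (r + s) (r + s)" "P * Q = 1\<^sub>m (r + s)" "Q * P = 1\<^sub>m (r + s)"
  "!!g. g : G ==> B g : carrier_mat r s" "!!g. g : G ==> Q * \<phi> g * P = four_block_mat (\<phi>1 g) (B g) (0\<^sub>m s r) (\<phi>2 g)"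
  using extension_blocks by metis
 note d = extension_dims[OF assms(1)]
 have "Q * \<phi> g * P = c \<cdot>\<^sub>m (Q * P)"
  unfolding assms(2) mult_smult_distrib[OF *(2) one_carrier_mat] right_mult_one_mat[OF *(2)] mult_smult_assoc_mat[OF *(2,1)] ..
 also have "... = four_block_mat (c \<cdot>\<^sub>m 1\<^sub>m r) (c \<cdot>\<^sub>m 0\<^sub>m r s) (c \<cdot>\<^sub>m 0\<^sub>m s r) (c \<cdot>\<^sub>m 1\<^sub>m s)"
  unfolding *(4) by (intro eq_matI) auto
 finally have "four_block_mat (\<phi>1 g) (B g) (0\<^sub>m s r) (\<phi>2 g) = ..." unfolding *(6)[OF assms(1)] .
 from four_block_inject[OF this, of r s] show "\<phi>1 g = c \<cdot>\<^sub>m 1\<^sub>m r" "\<phi>2 g = c \<cdot>\<^sub>m 1\<^sub>m s"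
  using d by auto
qed

text \<open>The blocks become zero after \<open>n1\<close> and \<open>n2\<close> steps respectively, and a strictly triangular matrix remains.\<close>

lemma extension_nilpotent:
 assumes g: "g : G" and n: "\<phi>1 g ^\<^sub>m n1 = 0\<^sub>m r r" "\<phi>2 g ^\<^sub>m n2 = 0\<^sub>m s s"
 shows "\<phi> g ^\<^sub>m (n1 + n2) = 0\<^sub>m (r + s) (r + s)"
proof -
 obtain P Q B where *: "B g : carrier_mat r s" "similar_mat_wit (\<phi> g) (four_block_mat (\<phi>1 g) (B g) (0\<^sub>m s r) (\<phi>2 g)) P Q"
  using ext g unfolding triangular_extension_def by blast
 let ?N = "four_block_mat (\<phi>1 g) (B g) (0\<^sub>m s r) (\<phi>2 g)"
 note d = extension_dims[OF g]
 have N: "?N : carrier_mat (r + s) (r + s)" using d by auto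
 have pow: "\<exists>C\<in>carrier_mat r s. ?N ^\<^sub>m n = four_block_mat (\<phi>1 g ^\<^sub>m n) C (0\<^sub>m s r) (\<phi>2 g ^\<^sub>m n)" for n
 proof (induction n)
  case 0
  show ?case using d by (intro bexI[of _ "0\<^sub>m r s"] eq_matI) auto
 next
  case (Suc n)
  then obtain C where C: "C : carrier_mat r s" "?N ^\<^sub>m n = four_block_mat (\<phi>1 g ^\<^sub>m n) C (0\<^sub>m s r) (\<phi>2 g ^\<^sub>m n)" by blast
  have c: "\<phi>1 g ^\<^sub>m n : carrier_mat r r" "\<phi>2 g ^\<^sub>m n : carrier_mat s s" using d by auto
  have m: "\<phi>1 g ^\<^sub>m n * \<phi>1 g : carrier_mat r r" "\<phi>2 g ^\<^sub>m n * \<phi>2 g : carrier_mat s s"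
  by (rule mult_carrier_mat[OF c(1) d(1)], rule mult_carrier_mat[OF c(2) d(2)])
  have "?N ^\<^sub>m Suc n = four_block_mat (\<phi>1 g ^\<^sub>m n * \<phi>1 g + C * 0\<^sub>m s r) (\<phi>1 g ^\<^sub>m n * B g + C * \<phi>2 g)
  (0\<^sub>m s r * \<phi>1 g + \<phi>2 g ^\<^sub>m n * 0\<^sub>m s r) (0\<^sub>m s r * B g + \<phi>2 g ^\<^sub>m n * \<phi>2 g)"
  unfolding pow_mat.simps C(2) by (rule mult_four_block_mat) (use c C d * in auto)
  also have "... = four_block_mat (\<phi>1 g ^\<^sub>m Suc n) (\<phi>1 g ^\<^sub>m n * B g + C * \<phi>2 g) (0\<^sub>m s r) (\<phi>2 g ^\<^sub>m Suc n)"
  using c C(1) d(1,2) *(1) m by simp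
  finally show ?case
  by (rule bexI) (intro add_carrier_mat mult_carrier_mat[OF C(1) d(2)])
 qed
 obtain C1 where C1: "C1 : carrier_mat r s" "?N ^\<^sub>m n1 = four_block_mat (\<phi>1 g ^\<^sub>m n1) C1 (0\<^sub>m s r) (\<phi>2 g ^\<^sub>m n1)" using pow by blast
 obtain C2 where C2: "C2 : carrier_mat r s" "?N ^\<^sub>m n2 = four_block_mat (\<phi>1 g ^\<^sub>m n2) C2 (0\<^sub>m s r) (\<phi>2 g ^\<^sub>m n2)" using pow by blast
 have c: "\<phi>1 g ^\<^sub>m n2 : carrier_mat r r" "\<phi>2 g ^\<^sub>m n1 : carrier_mat s s" using d by auto
 have "?N ^\<^sub>m n1 * ?N ^\<^sub>m n2 = four_block_mat (0\<^sub>m r r * \<phi>1 g ^\<^sub>m n2 + C1 * 0\<^sub>m s r) (0\<^sub>m r r * C2 + C1 * 0\<^sub>m s s)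
  (0\<^sub>m s r * \<phi>1 g ^\<^sub>m n2 + \<phi>2 g ^\<^sub>m n1 * 0\<^sub>m s r) (0\<^sub>m s r * C2 + \<phi>2 g ^\<^sub>m n1 * 0\<^sub>m s s)"
  unfolding C1(2) C2(2) n by (rule mult_four_block_mat) (use c C1 C2 in auto)
 also have "... = 0\<^sub>m (r + s) (r + s)"
  unfolding left_mult_zero_mat[OF c(1)] left_mult_zero_mat[OF C2(1)] right_mult_zero_mat[OF C1(1)] right_mult_zero_mat[OF c(2)]
  by (intro eq_matI) auto
 finally have "?N ^\<^sub>m (n1 + n2) = 0\<^sub>m (r + s) (r + s)" using pow_mat_add[OF N, of n1 n2] by simp
 moreover have "similar_mat_wit (\<phi> g ^\<^sub>m (n1 + n2)) (?N ^\<^sub>m (n1 + n2)) P Q" by (rule similar_mat_wit_pow[OF *(2)])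
 ultimately have sw: "similar_mat_wit (\<phi> g ^\<^sub>m (n1 + n2)) (0\<^sub>m (r + s) (r + s)) P Q" by simp
 have "\<phi> g ^\<^sub>m (n1 + n2) : carrier_mat (r + s) (r + s)" using d by auto
 from similar_mat_witD2[OF this sw] show ?thesis by simp
qed

end

section \<open>Schur's lemma\<close>

lemma irreducibleD:
 assumes "irreducible_mats d S" "vec_subspace d U" "!!A u. A : S ==> u : U ==> A *\<^sub>v u : U"
 shows "U = {0\<^sub>v d} \<or> U = carrier_vec d"
 using assms unfolding irreducible_mats_def vec_subspace_def by blast

lemma mult_mat_zero_vec: "A : carrier_mat n m ==> A *\<^sub>v 0\<^sub>v m = (0\<^sub>v n :: 'k::comm_ring_1 vec)"
 by (intro eq_vecI) (auto simp: scalar_prod_def)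

lemma col_minus_one_mat:
 assumes "(A :: 'k::comm_ring_1 mat) : carrier_mat d d" "i < d"
 shows "col (A - 1\<^sub>m d) i = col A i - unit_vec d i"
 using assms by (intro eq_vecI) auto

lemma minus_one_mat_eq_zero:
 assumes A: "(A :: 'k::comm_ring_1 mat) : carrier_mat d d" and z: "A - 1\<^sub>m d = 0\<^sub>m d d"
 shows "A = 1\<^sub>m d"
proof (rule eq_matI)
 fix i j assume "i < dim_row (1\<^sub>m d :: 'k mat)" "j < dim_col (1\<^sub>m d :: 'k mat)"
 then have ij: "i < d" "j < d" by auto
 have "(A - 1\<^sub>m d) $$ (i, j) = 0" unfolding z using ij by simp
 then show "A $$ (i, j) = 1\<^sub>m d $$ (i, j)" using A ij by simp
qed (use A in auto)

text \<open>Kernel and image of an intertwiner are invariant subspaces.\<close>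

lemma intertwiner_zero_or_invertible:
 fixes X :: "'k::field mat"
 assumes irr: "irreducible_mats d1 (\<rho>1 ` S)" "irreducible_mats d2 (\<rho>2 ` S)"
  and car: "!!g. g : S ==> \<rho>1 g : carrier_mat d1 d1" "!!g. g : S ==> \<rho>2 g : carrier_mat d2 d2"
  and X: "X : carrier_mat d1 d2" and comm: "!!g. g : S ==> \<rho>1 g * X = X * \<rho>2 g" and nz: "X ~= 0\<^sub>m d1 d2"
 shows "\<exists>Y\<in>carrier_mat d2 d1. X * Y = 1\<^sub>m d1 & Y * X = 1\<^sub>m d2"
proof -
 let ?K = "{v : carrier_vec d2. X *\<^sub>v v = 0\<^sub>v d1}" and ?I = "(*\<^sub>v) X ` carrier_vec d2"
 have subK: "vec_subspace d2 ?K" unfolding vec_subspace_def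
  using X by (auto simp: mult_add_distrib_mat_vec[OF X] mult_mat_vec[OF X] mult_mat_zero_vec[OF X])
 have invK: "A *\<^sub>v v : ?K" if A: "A : \<rho>2 ` S" and v: "v : ?K" for A v
 proof -
  obtain g where g: "g : S" "A = \<rho>2 g" using A by blast
  have vc: "v : carrier_vec d2" and Xv: "X *\<^sub>v v = 0\<^sub>v d1" using v by auto
  have "X *\<^sub>v (\<rho>2 g *\<^sub>v v) = (X * \<rho>2 g) *\<^sub>v v" using assoc_mult_mat_vec[OF X car(2)[OF g(1)] vc] by simp
  also have "... = \<rho>1 g *\<^sub>v (X *\<^sub>v v)" unfolding comm[OF g(1), symmetric] by (rule assoc_mult_mat_vec[OF car(1)[OF g(1)] X vc])
  also have "... = 0\<^sub>v d1" unfolding Xv by (rule mult_mat_zero_vec[OF car(1)[OF g(1)]])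
  finally show ?thesis using mult_mat_vec_carrier[OF car(2)[OF g(1)] vc] g(2) by simp
 qed
 have subI: "vec_subspace d1 ?I"
 proof -
  have "0\<^sub>v d1 : ?I" using mult_mat_zero_vec[OF X] by (intro image_eqI[of _ _ "0\<^sub>v d2"]) auto
  moreover have "X *\<^sub>v u + X *\<^sub>v v : ?I" if "u : carrier_vec d2" "v : carrier_vec d2" for u v
  unfolding mult_add_distrib_mat_vec[OF X that, symmetric] using that by (intro imageI) simp
  moreover have "c \<cdot>\<^sub>v (X *\<^sub>v u) : ?I" if "u : carrier_vec d2" for u c
  unfolding mult_mat_vec[OF X that, symmetric] using that by (intro imageI) simp
  moreover have "?I \<subseteq> carrier_vec d1" using mult_mat_vec_carrier[OF X] by blast
  ultimately show ?thesis unfolding vec_subspace_def by blast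
 qed
 have invI: "A *\<^sub>v u : ?I" if A: "A : \<rho>1 ` S" and u: "u : ?I" for A u
 proof -
  obtain g where g: "g : S" "A = \<rho>1 g" using A by blast
  obtain v where v: "v : carrier_vec d2" "u = X *\<^sub>v v" using u by blast
  have "\<rho>1 g *\<^sub>v (X *\<^sub>v v) = (\<rho>1 g * X) *\<^sub>v v" using assoc_mult_mat_vec[OF car(1)[OF g(1)] X v(1)] by simp
  also have "... = X *\<^sub>v (\<rho>2 g *\<^sub>v v)" unfolding comm[OF g(1)] by (rule assoc_mult_mat_vec[OF X car(2)[OF g(1)] v(1)])
  finally show ?thesis unfolding g(2) v(2) using mult_mat_vec_carrier[OF car(2)[OF g(1)] v(1)] by simp
 qed
 have colz: "A = 0\<^sub>m d1 n" if A: "A : carrier_mat d1 n" and z: "!!i. i < n ==> col A i = 0\<^sub>v d1" for A :: "'k mat" and d1 n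
 proof (rule eq_matI)
  fix i j assume "i < dim_row (0\<^sub>m d1 n :: 'k mat)" "j < dim_col (0\<^sub>m d1 n :: 'k mat)"
  then have ij: "i < d1" "j < n" by auto
  have "A $$ (i, j) = col A j $ i" using A ij by simp
  then show "A $$ (i, j) = 0\<^sub>m d1 n $$ (i, j)" using z[OF ij(2)] ij by simp
 qed (use A in auto)
 have "?K ~= carrier_vec d2"
 proof
  assume K: "?K = carrier_vec d2"
  have "X = 0\<^sub>m d1 d2"
  proof (rule colz[OF X])
  fix i assume i: "i < d2"
  have "unit_vec d2 i : ?K" unfolding K by simp
  then show "col X i = 0\<^sub>v d1" using mult_mat_unit_vec[OF X i] by simp
  qed
  then show False using nz by simp
 qed
 then have K0: "?K = {0\<^sub>v d2}" using irreducibleD[OF irr(2) subK invK] by blast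
 have "?I ~= {0\<^sub>v d1}"
 proof
  assume I: "?I = {0\<^sub>v d1}"
  have "X = 0\<^sub>m d1 d2"
  proof (rule colz[OF X])
  fix i assume i: "i < d2"
  have "X *\<^sub>v unit_vec d2 i : ?I" by (rule imageI) simp
  then show "col X i = 0\<^sub>v d1" unfolding I using mult_mat_unit_vec[OF X i] by simp
  qed
  then show False using nz by simp
 qed
 then have I: "?I = carrier_vec d1" using irreducibleD[OF irr(1) subI invI] by blast
 have "\<forall>i\<in>{..<d1}. \<exists>y. y : carrier_vec d2 & X *\<^sub>v y = unit_vec d1 i"
 proof
  fix i assume "i : {..<d1}"
  have "unit_vec d1 i : ?I" unfolding I by simp
  then show "\<exists>y. y : carrier_vec d2 & X *\<^sub>v y = unit_vec d1 i" by (elim imageE) (metis)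
 qed
 from bchoice[OF this] obtain y where y: "\<forall>i\<in>{..<d1}. y i : carrier_vec d2 & X *\<^sub>v y i = unit_vec d1 i" ..
 define Y where "Y = mat d2 d1 (%(j, i). y i $ j)"
 have Y: "Y : carrier_mat d2 d1" unfolding Y_def by simp
 have colY: "col Y i = y i" if "i < d1" for i
 proof -
  have "y i : carrier_vec d2" using y that by blast
  then show ?thesis using that unfolding Y_def by (intro eq_vecI) auto
 qed
 have XY: "X * Y = 1\<^sub>m d1"
 proof (rule mat_col_eqI)
  fix i assume "i < dim_col (1\<^sub>m d1 :: 'k mat)"
  then have i: "i < d1" by simp
  have "col (X * Y) i = X *\<^sub>v col Y i" by (rule col_mult2[OF X Y i])
  then show "col (X * Y) i = col (1\<^sub>m d1) i" using colY[OF i] y i by simp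
 qed (use X Y in auto)
 have "Y * X = 1\<^sub>m d2"
 proof -
  have c: "Y * X : carrier_mat d2 d2" by (rule mult_carrier_mat[OF Y X])
  have "Y * X - 1\<^sub>m d2 = 0\<^sub>m d2 d2"
  proof (rule colz)
  fix i assume i: "i < d2"
  let ?v = "col (Y * X) i"
  have v: "?v : carrier_vec d2" using c i by auto
  have e: "?v = Y *\<^sub>v col X i" by (rule col_mult2[OF Y X i])
  have cX: "col X i : carrier_vec d1" using X i by auto
  have "X *\<^sub>v ?v = (X * Y) *\<^sub>v col X i" unfolding e using assoc_mult_mat_vec[OF X Y cX] by simp
  also have "... = X *\<^sub>v unit_vec d2 i" unfolding XY mult_mat_unit_vec[OF X i] using cX by simp
  finally have "X *\<^sub>v (?v - unit_vec d2 i) = 0\<^sub>v d1"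
  using mult_minus_distrib_mat_vec[OF X v, of "unit_vec d2 i"] mult_mat_vec_carrier[OF X, of "unit_vec d2 i"] by simp
  then have "?v - unit_vec d2 i : ?K" using v by simp
  then have "?v - unit_vec d2 i = 0\<^sub>v d2" unfolding K0 by simp
  moreover have "col (Y * X - 1\<^sub>m d2) i = ?v - unit_vec d2 i" by (rule col_minus_one_mat[OF c i])
  ultimately show "col (Y * X - 1\<^sub>m d2) i = 0\<^sub>v d2" by simp
  qed (use c in auto)
  then show ?thesis by (rule minus_one_mat_eq_zero[OF c])
 qed
 then show ?thesis using XY Y by blast
qed

lemma sum_list_count:
 fixes f :: "'b => 'k::comm_semiring_1"
 assumes "finite A" "set xs \<subseteq> A"
 shows "(\<Sum>x\<leftarrow>xs. f x) = (\<Sum>x\<in>A. of_nat (count_list xs x) * f x)"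
 using assms(2)
proof (induction xs)
 case (Cons a xs)
 have "(\<Sum>x\<in>A. of_nat (count_list (a # xs) x) * f x) = (\<Sum>x\<in>A. of_nat (count_list xs x) * f x + (if x = a then f a else 0))"
  by (rule sum.cong[OF HOL.refl]) (auto simp: algebra_simps)
 also have "... = (\<Sum>x\<in>A. of_nat (count_list xs x) * f x) + f a"
  using assms(1) Cons.prems by (simp add: sum.distrib)
 finally show ?case using Cons by (simp add: add.commute)
qed simp

text \<open>An intertwiner has an eigenvalue, and subtracting it leaves a singular intertwiner.\<close>

lemma complex_commutant_scalar:
 fixes X :: "complex mat"
 assumes irr: "irreducible_mats d (\<rho> ` S)" and car: "!!g. g : S ==> \<rho> g : carrier_mat d d"
  and X: "X : carrier_mat d d" and comm: "!!g. g : S ==> \<rho> g * X = X * \<rho> g"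
 shows "\<exists>c. X = c \<cdot>\<^sub>m 1\<^sub>m d"
proof -
 have "d > 0" using irr unfolding irreducible_mats_def by blast
 then obtain c where "eigenvalue X c" using spectrum_non_empty[OF X] unfolding spectrum_def by auto
 then obtain v where v: "v : carrier_vec d" "v ~= 0\<^sub>v d" "X *\<^sub>v v = c \<cdot>\<^sub>v v"
  using X unfolding eigenvalue_def eigenvector_def by auto
 define Z where "Z = X - c \<cdot>\<^sub>m 1\<^sub>m d"
 have Z: "Z : carrier_mat d d" unfolding Z_def using X by auto
 have cZ: "\<rho> g * Z = Z * \<rho> g" if g: "g : S" for g
 proof -
  have s: "c \<cdot>\<^sub>m 1\<^sub>m d : carrier_mat d d" by simp
  have "\<rho> g * Z = \<rho> g * X - c \<cdot>\<^sub>m \<rho> g"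
  unfolding Z_def mult_minus_distrib_mat[OF car[OF g] X s] mult_smult_distrib[OF car[OF g] one_carrier_mat] right_mult_one_mat[OF car[OF g]] ..
  moreover have "Z * \<rho> g = X * \<rho> g - c \<cdot>\<^sub>m \<rho> g"
  unfolding Z_def minus_mult_distrib_mat[OF X s car[OF g]] mult_smult_assoc_mat[OF one_carrier_mat car[OF g]] left_mult_one_mat[OF car[OF g]] ..
  ultimately show ?thesis using comm[OF g] by simp
 qed
 have Zv: "Z *\<^sub>v v = 0\<^sub>v d"
 proof -
  have "Z *\<^sub>v v = X *\<^sub>v v - (c \<cdot>\<^sub>m 1\<^sub>m d) *\<^sub>v v" unfolding Z_def by (rule minus_mult_distrib_mat_vec[OF X _ v(1)]) simp
  also have "(c \<cdot>\<^sub>m 1\<^sub>m d) *\<^sub>v v = c \<cdot>\<^sub>v v" using v(1) by (intro eq_vecI) auto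
  finally show ?thesis using v by simp
 qed
 have "Z = 0\<^sub>m d d"
 proof (rule ccontr)
  assume "Z ~= 0\<^sub>m d d"
  then obtain Y where Y: "Y : carrier_mat d d" "Y * Z = 1\<^sub>m d"
  using intertwiner_zero_or_invertible[OF irr irr car car Z cZ] by blast
  have "v = (Y * Z) *\<^sub>v v" using Y v by simp
  also have "... = Y *\<^sub>v (Z *\<^sub>v v)" by (rule assoc_mult_mat_vec[OF Y(1) Z v(1)])
  also have "... = 0\<^sub>v d" unfolding Zv by (rule mult_mat_zero_vec[OF Y(1)])
  finally show False using v by simp
 qed
 then have "X - c \<cdot>\<^sub>m 1\<^sub>m d = 0\<^sub>m d d" unfolding Z_def .
 then have "X $$ (i, j) = (c \<cdot>\<^sub>m 1\<^sub>m d) $$ (i, j)" if "i < d" "j < d" for i j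
 proof -
  have "(X - c \<cdot>\<^sub>m 1\<^sub>m d) $$ (i, j) = 0" unfolding \<open>X - c \<cdot>\<^sub>m 1\<^sub>m d = 0\<^sub>m d d\<close> using that by simp
  then show ?thesis using that X by simp
 qed
 then have "X = c \<cdot>\<^sub>m 1\<^sub>m d" using X by (intro eq_matI) auto
 then show ?thesis ..
qed

section \<open>Characters of finite matrix groups\<close>

lemma one_smult_one_mat: "(1 :: 'k::comm_ring_1) \<cdot>\<^sub>m 1\<^sub>m n = 1\<^sub>m n"
 by (intro eq_matI) auto

context reflection_arrangement
begin

definition irr_rep :: "nat => ('n cmat => complex mat) => bool" where
 "irr_rep d \<rho> \<longleftrightarrow> group_rep (mat_group P) d \<rho> & irreducible_mats d (\<rho> ` P)"

definition char_of :: "('n cmat => complex mat) => 'n cmat => complex" where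
 "char_of \<rho> = (%w. if w : P then mat_trace (\<rho> w) else 0)"

lemma Irr_iff: "\<psi> : Irr P \<longleftrightarrow> (\<exists>d \<rho>. irr_rep d \<rho> & \<psi> = char_of \<rho>)"
 unfolding Irr_def irr_rep_def char_of_def by blast

lemma group_repD:
 assumes "group_rep (mat_group P) d \<rho>"
 shows "g : P ==> \<rho> g : carrier_mat d d" "\<rho> I1 = 1\<^sub>m d" "g : P ==> h : P ==> \<rho> (g ** h) = \<rho> g * \<rho> h"
 using assms unfolding group_rep_def by simp_all

lemma irr_repD:
 assumes "irr_rep d \<rho>"
 shows "group_rep (mat_group P) d \<rho>" "irreducible_mats d (\<rho> ` P)" "d > 0" "char_of \<rho> : Irr P"
  "char_of \<rho> I1 = of_nat d"
proof -
 show g: "group_rep (mat_group P) d \<rho>" and "irreducible_mats d (\<rho> ` P)" using assms unfolding irr_rep_def by blast+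
 show "d > 0" using \<open>irreducible_mats d (\<rho> ` P)\<close> unfolding irreducible_mats_def by blast
 show "char_of \<rho> : Irr P" using assms Irr_iff by blast
 show "char_of \<rho> I1 = of_nat d" unfolding char_of_def using one_in by (simp add: group_repD(2)[OF g] mat_trace_def)
qed

lemma rep_constituents:
 assumes "group_rep (mat_group P) d \<rho>"
 shows "\<exists>xs. set xs \<subseteq> Irr P & (\<forall>w\<in>P. mat_trace (\<rho> w) = (\<Sum>\<psi>\<leftarrow>xs. \<psi> w))"
proof -
 let ?R = "%d \<rho>. (\<rho> I1 = 1\<^sub>m d & (\<forall>g\<in>P. \<forall>h\<in>P. \<rho> (g ** h) = \<rho> g * \<rho> h)) -->
  (\<exists>xs. set xs \<subseteq> Irr P & (\<forall>w\<in>P. mat_trace (\<rho> w) = (\<Sum>\<psi>\<leftarrow>xs. \<psi> w)))"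
 have "?R d \<rho>"
 proof (rule matrix_family_induct[where G = P and R = ?R])
  show "\<rho> g : carrier_mat d d" if "g : P" for g by (rule group_repD(1)[OF assms that])
 next
  fix \<phi> :: "'n cmat => complex mat" assume z: "!!g. g : P ==> \<phi> g : carrier_mat 0 0"
  have "\<forall>w\<in>P. mat_trace (\<phi> w) = (\<Sum>\<psi>\<leftarrow>[]. \<psi> w)"
  using carrier_matD(1)[OF z] by (simp add: mat_trace_def)
  then show "?R 0 \<phi>" by (intro impI exI[of _ "[]"]) simp
 next
  fix d and \<phi> :: "'n cmat => complex mat"
  assume c: "!!g. g : P ==> \<phi> g : carrier_mat d d" and i: "irreducible_mats d (\<phi> ` P)"
  show "?R d \<phi>"
  proof
  assume h: "\<phi> I1 = 1\<^sub>m d & (\<forall>g\<in>P. \<forall>h\<in>P. \<phi> (g ** h) = \<phi> g * \<phi> h)"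
  then have "irr_rep d \<phi>" unfolding irr_rep_def group_rep_def using c i by simp
  then have "char_of \<phi> : Irr P" using Irr_iff by blast
  then show "\<exists>xs. set xs \<subseteq> Irr P & (\<forall>w\<in>P. mat_trace (\<phi> w) = (\<Sum>\<psi>\<leftarrow>xs. \<psi> w))"
  by (intro exI[of _ "[char_of \<phi>]"]) (simp add: char_of_def)
  qed
 next
  fix r s and \<phi>1 \<phi>2 \<phi> :: "'n cmat => complex mat"
  assume e: "triangular_extension P r s \<phi>1 \<phi>2 \<phi>" and R: "?R r \<phi>1" "?R s \<phi>2"
  show "?R (r + s) \<phi>"
  proof
  assume h: "\<phi> I1 = 1\<^sub>m (r + s) & (\<forall>g\<in>P. \<forall>h\<in>P. \<phi> (g ** h) = \<phi> g * \<phi> h)"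
  have "\<phi>1 I1 = 1\<^sub>m r" "\<phi>2 I1 = 1\<^sub>m s"
  using extension_scalar[OF e one_in, of 1] h by (simp_all add: one_smult_one_mat)
  moreover have "\<phi>1 (g ** h) = \<phi>1 g * \<phi>1 h" "\<phi>2 (g ** h) = \<phi>2 g * \<phi>2 h" if "g : P" "h : P" for g h
  using extension_mult[OF e that mult_in[OF that]] h that by blast+
  ultimately obtain xs ys where xs: "set xs \<subseteq> Irr P" "\<forall>w\<in>P. mat_trace (\<phi>1 w) = (\<Sum>\<psi>\<leftarrow>xs. \<psi> w)"
  and ys: "set ys \<subseteq> Irr P" "\<forall>w\<in>P. mat_trace (\<phi>2 w) = (\<Sum>\<psi>\<leftarrow>ys. \<psi> w)"
  using R by blast
  have "\<forall>w\<in>P. mat_trace (\<phi> w) = (\<Sum>\<psi>\<leftarrow>xs @ ys. \<psi> w)"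
  using xs ys extension_trace[OF e] by simp
  then show "\<exists>xs. set xs \<subseteq> Irr P & (\<forall>w\<in>P. mat_trace (\<phi> w) = (\<Sum>\<psi>\<leftarrow>xs. \<psi> w))"
  using xs ys by (intro exI[of _ "xs @ ys"]) simp
  qed
 qed
 then show ?thesis using group_repD[OF assms] by blast
qed

lemma left_translation: "g : P ==> bij_betw (%w. g ** w) P P"
 by (rule bij_betw_byWitness[where f' = "%w. matrix_inv g ** w"])
  (auto simp: matrix_mul_assoc inv_props mult_in)

lemma conjugation: "g : P ==> bij_betw (%w. g ** w ** matrix_inv g) P P"
proof (rule bij_betw_byWitness[where f' = "%w. matrix_inv g ** w ** g"])
 assume g: "g : P"
 note i = inv_props[OF g]
 show "\<forall>a\<in>P. matrix_inv g ** (g ** a ** matrix_inv g) ** g = a"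
  using i by (simp add: matrix_mul_assoc) (simp add: i flip: matrix_mul_assoc)
 show "\<forall>a\<in>P. g ** (matrix_inv g ** a ** g) ** matrix_inv g = a"
  using i by (simp add: matrix_mul_assoc) (simp add: i flip: matrix_mul_assoc)
qed (use mult_in inv_props in auto)

lemma inverse_inverse: assumes "g : P" shows "matrix_inv (matrix_inv g) = g"
proof -
 have "matrix_inv (matrix_inv g) = matrix_inv (matrix_inv g) ** (matrix_inv g ** g)" using inv_props[OF assms] by simp
 also have "... = g" unfolding matrix_mul_assoc using inv_props[OF inv_props(1)[OF assms]] by simp
 finally show ?thesis .
qed

lemma inverse_mult: assumes "g : P" "h : P" shows "matrix_inv (g ** h) = matrix_inv h ** matrix_inv g"
proof -
 have "matrix_inv (g ** h) = matrix_inv (g ** h) ** (g ** (h ** matrix_inv h) ** matrix_inv g)"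
  using inv_props[OF assms(1)] inv_props[OF assms(2)] by simp
 also have "... = (matrix_inv (g ** h) ** (g ** h)) ** (matrix_inv h ** matrix_inv g)" by (simp only: matrix_mul_assoc)
 also have "... = matrix_inv h ** matrix_inv g" using inv_props[OF mult_in[OF assms]] by simp
 finally show ?thesis .
qed

lemma inverse_bij: "bij_betw matrix_inv P P"
 by (rule bij_betw_byWitness[where f' = matrix_inv]) (auto simp: inverse_inverse inv_props)

lemma Irr_class_function: "Irr P \<subseteq> class_functions P"
proof
 fix \<psi> assume "\<psi> : Irr P"
 then obtain d \<rho> where r: "irr_rep d \<rho>" "\<psi> = char_of \<rho>" using Irr_iff by blast
 note g = irr_repD(1)[OF r(1)]
 have "mat_trace (\<rho> (g ** w ** matrix_inv g)) = mat_trace (\<rho> w)" if gP: "g : P" and w: "w : P" for g w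
 proof -
  note i = inv_props(1)[OF gP]
  have "mat_trace (\<rho> (g ** w ** matrix_inv g)) = mat_trace (\<rho> (g ** w) * \<rho> (matrix_inv g))"
  using group_repD(3)[OF g mult_in[OF gP w] i] by simp
  also have "... = mat_trace (\<rho> (matrix_inv g) * \<rho> (g ** w))"
  by (rule mat_trace_mult_comm[OF group_repD(1)[OF g mult_in[OF gP w]] group_repD(1)[OF g i]])
  also have "\<rho> (matrix_inv g) * \<rho> (g ** w) = \<rho> (matrix_inv g ** (g ** w))"
  using group_repD(3)[OF g i mult_in[OF gP w]] by simp
  also have "matrix_inv g ** (g ** w) = w" using inv_props[OF gP] by (simp add: matrix_mul_assoc)
  finally show ?thesis .
 qed
 then show "\<psi> : class_functions P"
  unfolding class_functions_def r(2) char_of_def using mult_in inv_props(1) by simp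
qed

text \<open>Averaging any matrix over the group gives an intertwiner, which vanishes for different characters; elementary matrices give the relations between matrix entries.\<close>

lemma orthogonal_characters:
 assumes \<psi>: "\<psi> : Irr P" and \<eta>: "\<eta> : Irr P" and ne: "\<psi> ~= \<eta>"
 shows "(\<Sum>w\<in>P. \<psi> w * \<eta> (matrix_inv w)) = 0"
proof -
 obtain d \<rho> where r: "irr_rep d \<rho>" "\<psi> = char_of \<rho>" using \<psi> Irr_iff by blast
 obtain e \<sigma> where s: "irr_rep e \<sigma>" "\<eta> = char_of \<sigma>" using \<eta> Irr_iff by blast
 note R = irr_repD(1)[OF r(1)] and S = irr_repD(1)[OF s(1)]
 have entries: "(\<Sum>w\<in>P. \<rho> w $$ (k, i) * \<sigma> (matrix_inv w) $$ (j, l)) = 0" if ijkl: "i < d" "j < e" "k < d" "l < e" for i j k l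
 proof -
  define X where "X = mat d e (%(k, l). \<Sum>w\<in>P. \<rho> w $$ (k, i) * \<sigma> (matrix_inv w) $$ (j, l))"
  have X: "X : carrier_mat d e" unfolding X_def by simp
  have comm: "\<rho> g * X = X * \<sigma> g" if g: "g : P" for g
  proof (rule eq_matI)
  note cg = group_repD(1)[OF R g] group_repD(1)[OF S g]
  fix k l assume "k < dim_row (X * \<sigma> g)" "l < dim_col (X * \<sigma> g)"
  then have kl: "k < d" "l < e" using X cg by auto
  have "(\<rho> g * X) $$ (k, l) = (\<Sum>m<d. \<Sum>w\<in>P. \<rho> g $$ (k, m) * (\<rho> w $$ (m, i) * \<sigma> (matrix_inv w) $$ (j, l)))"
  using cg X kl by (simp add: X_def scalar_prod_def atLeast0LessThan sum_distrib_left)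
  also have "... = (\<Sum>w\<in>P. \<Sum>m<d. (\<rho> g $$ (k, m) * \<rho> w $$ (m, i)) * \<sigma> (matrix_inv w) $$ (j, l))"
  by (subst sum.swap) (simp add: mult.assoc)
  also have "... = (\<Sum>w\<in>P. \<rho> (g ** w) $$ (k, i) * \<sigma> (matrix_inv w) $$ (j, l))"
  proof (rule sum.cong[OF HOL.refl])
  fix w assume w: "w : P"
  have "\<rho> (g ** w) $$ (k, i) = (\<Sum>m<d. \<rho> g $$ (k, m) * \<rho> w $$ (m, i))"
  unfolding group_repD(3)[OF R g w] using cg group_repD(1)[OF R w] kl ijkl by (simp add: scalar_prod_def atLeast0LessThan)
  then show "(\<Sum>m<d. (\<rho> g $$ (k, m) * \<rho> w $$ (m, i)) * \<sigma> (matrix_inv w) $$ (j, l)) = \<rho> (g ** w) $$ (k, i) * \<sigma> (matrix_inv w) $$ (j, l)"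
  by (simp add: sum_distrib_right)
  qed
  also have "... = (\<Sum>w\<in>P. \<rho> (g ** w) $$ (k, i) * \<sigma> (matrix_inv (g ** w) ** g) $$ (j, l))"
  proof (rule sum.cong[OF HOL.refl])
  fix w assume w: "w : P"
  have "matrix_inv (g ** w) ** g = matrix_inv w ** (matrix_inv g ** g)" unfolding inverse_mult[OF g w] by (simp only: matrix_mul_assoc)
  then show "\<rho> (g ** w) $$ (k, i) * \<sigma> (matrix_inv w) $$ (j, l) = \<rho> (g ** w) $$ (k, i) * \<sigma> (matrix_inv (g ** w) ** g) $$ (j, l)"
  using inv_props[OF g] by simp
  qed
  also have "... = (\<Sum>w\<in>P. \<rho> w $$ (k, i) * \<sigma> (matrix_inv w ** g) $$ (j, l))"
  by (rule sum.reindex_bij_betw[OF left_translation[OF g], of "%w. \<rho> w $$ (k, i) * \<sigma> (matrix_inv w ** g) $$ (j, l)"])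
  also have "... = (\<Sum>w\<in>P. \<Sum>m<e. (\<rho> w $$ (k, i) * \<sigma> (matrix_inv w) $$ (j, m)) * \<sigma> g $$ (m, l))"
  proof (rule sum.cong[OF HOL.refl])
  fix w assume w: "w : P"
  have "\<sigma> (matrix_inv w ** g) $$ (j, l) = (\<Sum>m<e. \<sigma> (matrix_inv w) $$ (j, m) * \<sigma> g $$ (m, l))"
  unfolding group_repD(3)[OF S inv_props(1)[OF w] g] using cg group_repD(1)[OF S inv_props(1)[OF w]] kl ijkl
  by (simp add: scalar_prod_def atLeast0LessThan)
  then show "\<rho> w $$ (k, i) * \<sigma> (matrix_inv w ** g) $$ (j, l) = (\<Sum>m<e. (\<rho> w $$ (k, i) * \<sigma> (matrix_inv w) $$ (j, m)) * \<sigma> g $$ (m, l))"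
  by (simp add: sum_distrib_left mult.assoc)
  qed
  also have "... = (\<Sum>m<e. (\<Sum>w\<in>P. \<rho> w $$ (k, i) * \<sigma> (matrix_inv w) $$ (j, m)) * \<sigma> g $$ (m, l))"
  by (subst sum.swap) (simp add: sum_distrib_right)
  also have "... = (X * \<sigma> g) $$ (k, l)"
  using cg X kl by (simp add: X_def scalar_prod_def atLeast0LessThan)
  finally show "(\<rho> g * X) $$ (k, l) = (X * \<sigma> g) $$ (k, l)" .
  qed (use group_repD(1)[OF R] group_repD(1)[OF S] g X in auto)
  have "X = 0\<^sub>m d e"
  proof (rule ccontr)
  assume "X ~= 0\<^sub>m d e"
  from intertwiner_zero_or_invertible[OF irr_repD(2)[OF r(1)] irr_repD(2)[OF s(1)] group_repD(1)[OF R] group_repD(1)[OF S] X comm this]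
  obtain Y where Y: "Y : carrier_mat e d" "X * Y = 1\<^sub>m d" "Y * X = 1\<^sub>m e" by blast
  have "mat_trace (\<rho> g) = mat_trace (\<sigma> g)" if g: "g : P" for g
  proof -
  note cg = group_repD(1)[OF R g] group_repD(1)[OF S g]
  have "mat_trace (\<rho> g) = mat_trace ((\<rho> g * X) * Y)" using assoc_mult_mat[OF cg(1) X Y(1)] Y cg by simp
  also have "... = mat_trace (Y * (X * \<sigma> g))" unfolding comm[OF g]
  by (rule mat_trace_mult_comm[OF mult_carrier_mat[OF X cg(2)] Y(1)])
  also have "Y * (X * \<sigma> g) = \<sigma> g" using assoc_mult_mat[OF Y(1) X cg(2)] Y cg by simp
  finally show ?thesis .
  qed
  then have "\<psi> = \<eta>" unfolding r(2) s(2) char_of_def by auto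
  then show False using ne by simp
  qed
  then have "X $$ (k, l) = 0" using ijkl by simp
  then show ?thesis unfolding X_def using ijkl by simp
 qed
 have "(\<Sum>w\<in>P. \<psi> w * \<eta> (matrix_inv w)) = (\<Sum>w\<in>P. (\<Sum>i<d. \<rho> w $$ (i, i)) * (\<Sum>j<e. \<sigma> (matrix_inv w) $$ (j, j)))"
 proof (rule sum.cong[OF HOL.refl])
  fix w assume w: "w : P"
  show "\<psi> w * \<eta> (matrix_inv w) = (\<Sum>i<d. \<rho> w $$ (i, i)) * (\<Sum>j<e. \<sigma> (matrix_inv w) $$ (j, j))"
  unfolding r(2) s(2) char_of_def mat_trace_def
  using w inv_props(1)[OF w] group_repD(1)[OF R w] group_repD(1)[OF S inv_props(1)[OF w]] by simp
 qed
 also have "... = (\<Sum>i<d. \<Sum>j<e. \<Sum>w\<in>P. \<rho> w $$ (i, i) * \<sigma> (matrix_inv w) $$ (j, j))"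
  unfolding sum_product by (subst sum.swap, rule sum.cong[OF HOL.refl], rule sum.swap)
 also have "... = 0" using entries by simp
 finally show ?thesis .
qed

text \<open>The sum \<open>\<Sum>w. h w \<rho> w\<close> is central, hence a scalar by Schur's lemma; the scalar is found from the trace.\<close>

lemma class_function_convolution:
 assumes \<psi>: "\<psi> : Irr P" and h: "!!g w. g : P ==> w : P ==> h (g ** w ** matrix_inv g) = h w" and b: "b : P"
 shows "(\<Sum>w\<in>P. h w * \<psi> (w ** b)) * \<psi> I1 = (\<Sum>w\<in>P. h w * \<psi> w) * \<psi> b"
proof -
 obtain d \<rho> where r: "irr_rep d \<rho>" "\<psi> = char_of \<rho>" using \<psi> Irr_iff by blast
 note R = irr_repD(1)[OF r(1)]
 define M where "M = mat d d (%(k, l). \<Sum>w\<in>P. h w * \<rho> w $$ (k, l))"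
 have M: "M : carrier_mat d d" unfolding M_def by simp
 have M_mult: "(M * \<rho> g) $$ (k, l) = (\<Sum>w\<in>P. h w * \<rho> (w ** g) $$ (k, l))" if g: "g : P" and kl: "k < d" "l < d" for g k l
 proof -
  have "(M * \<rho> g) $$ (k, l) = (\<Sum>m<d. \<Sum>w\<in>P. h w * \<rho> w $$ (k, m) * \<rho> g $$ (m, l))"
  using M group_repD(1)[OF R g] kl by (simp add: M_def scalar_prod_def atLeast0LessThan sum_distrib_right)
  also have "... = (\<Sum>w\<in>P. h w * (\<Sum>m<d. \<rho> w $$ (k, m) * \<rho> g $$ (m, l)))"
  by (subst sum.swap) (simp add: sum_distrib_left mult.assoc)
  also have "... = (\<Sum>w\<in>P. h w * \<rho> (w ** g) $$ (k, l))"
  proof (rule sum.cong[OF HOL.refl])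
  fix w assume w: "w : P"
  have "\<rho> (w ** g) $$ (k, l) = (\<Sum>m<d. \<rho> w $$ (k, m) * \<rho> g $$ (m, l))"
  unfolding group_repD(3)[OF R w g] using group_repD(1)[OF R g] group_repD(1)[OF R w] kl
  by (simp add: scalar_prod_def atLeast0LessThan)
  then show "h w * (\<Sum>m<d. \<rho> w $$ (k, m) * \<rho> g $$ (m, l)) = h w * \<rho> (w ** g) $$ (k, l)" by simp
  qed
  finally show ?thesis .
 qed
 have mult_M: "(\<rho> g * M) $$ (k, l) = (\<Sum>w\<in>P. h w * \<rho> (g ** w) $$ (k, l))" if g: "g : P" and kl: "k < d" "l < d" for g k l
 proof -
  have "(\<rho> g * M) $$ (k, l) = (\<Sum>m<d. \<Sum>w\<in>P. \<rho> g $$ (k, m) * (h w * \<rho> w $$ (m, l)))"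
  using M group_repD(1)[OF R g] kl by (simp add: M_def scalar_prod_def atLeast0LessThan sum_distrib_left)
  also have "... = (\<Sum>w\<in>P. h w * (\<Sum>m<d. \<rho> g $$ (k, m) * \<rho> w $$ (m, l)))"
  by (subst sum.swap) (simp add: sum_distrib_left mult.left_commute)
  also have "... = (\<Sum>w\<in>P. h w * \<rho> (g ** w) $$ (k, l))"
  proof (rule sum.cong[OF HOL.refl])
  fix w assume w: "w : P"
  have "\<rho> (g ** w) $$ (k, l) = (\<Sum>m<d. \<rho> g $$ (k, m) * \<rho> w $$ (m, l))"
  unfolding group_repD(3)[OF R g w] using group_repD(1)[OF R g] group_repD(1)[OF R w] kl
  by (simp add: scalar_prod_def atLeast0LessThan)
  then show "h w * (\<Sum>m<d. \<rho> g $$ (k, m) * \<rho> w $$ (m, l)) = h w * \<rho> (g ** w) $$ (k, l)" by simp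
  qed
  finally show ?thesis .
 qed
 have comm: "\<rho> g * M = M * \<rho> g" if g: "g : P" for g
 proof (rule eq_matI)
  fix k l assume "k < dim_row (M * \<rho> g)" "l < dim_col (M * \<rho> g)"
  then have kl: "k < d" "l < d" using M group_repD(1)[OF R g] by auto
  have "(M * \<rho> g) $$ (k, l) = (\<Sum>w\<in>P. h (g ** w ** matrix_inv g) * \<rho> ((g ** w ** matrix_inv g) ** g) $$ (k, l))"
  unfolding M_mult[OF g kl] by (rule sum.reindex_bij_betw[OF conjugation[OF g], symmetric])
  also have "... = (\<Sum>w\<in>P. h w * \<rho> (g ** w) $$ (k, l))"
  proof (rule sum.cong[OF HOL.refl])
  fix w assume "w : P"
  have "(g ** w ** matrix_inv g) ** g = g ** w" using inv_props[OF g] by (simp flip: matrix_mul_assoc)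
  then show "h (g ** w ** matrix_inv g) * \<rho> ((g ** w ** matrix_inv g) ** g) $$ (k, l) = h w * \<rho> (g ** w) $$ (k, l)"
  using h[OF g \<open>w : P\<close>] by simp
  qed
  finally show "(\<rho> g * M) $$ (k, l) = (M * \<rho> g) $$ (k, l)" unfolding mult_M[OF g kl] by simp
 qed (use M group_repD(1)[OF R g] in auto)
 obtain c where c: "M = c \<cdot>\<^sub>m 1\<^sub>m d"
  using complex_commutant_scalar[OF irr_repD(2)[OF r(1)] group_repD(1)[OF R] M comm] by blast
 have tr: "(\<Sum>w\<in>P. h w * \<psi> (w ** g)) = mat_trace (M * \<rho> g)" if g: "g : P" for g
 proof -
  have "mat_trace (M * \<rho> g) = (\<Sum>k<d. \<Sum>w\<in>P. h w * \<rho> (w ** g) $$ (k, k))"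
  unfolding mat_trace_def using M M_mult[OF g] by simp
  also have "... = (\<Sum>w\<in>P. h w * (\<Sum>k<d. \<rho> (w ** g) $$ (k, k)))"
  by (subst sum.swap) (simp add: sum_distrib_left)
  also have "... = (\<Sum>w\<in>P. h w * \<psi> (w ** g))"
  by (rule sum.cong[OF HOL.refl]) (use g mult_in group_repD(1)[OF R] in \<open>auto simp: r(2) char_of_def mat_trace_def\<close>)
  finally show ?thesis by simp
 qed
 have cg: "mat_trace (M * \<rho> g) = c * \<psi> g" if g: "g : P" for g
 proof -
  have "M * \<rho> g = c \<cdot>\<^sub>m \<rho> g"
  unfolding c mult_smult_assoc_mat[OF one_carrier_mat group_repD(1)[OF R g]] left_mult_one_mat[OF group_repD(1)[OF R g]] ..
  then show ?thesis using g group_repD(1)[OF R g] by (simp add: r(2) char_of_def mat_trace_def sum_distrib_left)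
 qed
 have "(\<Sum>w\<in>P. h w * \<psi> w) = c * \<psi> I1" using tr[OF one_in] cg[OF one_in] by simp
 then show ?thesis using tr[OF b] cg[OF b] by simp
qed

lemma Irr_I1_nonzero: "\<psi> : Irr P ==> \<psi> I1 ~= 0"
 using Irr_iff irr_repD(3,5) by fastforce

lemma regular_character:
 obtains xs where "set xs \<subseteq> Irr P" "!!w. w : P ==> (\<Sum>\<psi>\<leftarrow>xs. \<psi> w) = (if w = I1 then of_nat (card P) else 0)"
proof -
 let ?n = "card P"
 obtain f where f: "bij_betw f {..<?n} P" using finite_same_card_bij[of "{..<?n}" P] fin by auto
 define \<rho> :: "'n cmat => complex mat" where "\<rho> w = mat ?n ?n (%(i, j). if f i = w ** f j then 1 else 0)" for w
 have fP: "f i : P" if "i < ?n" for i using f that unfolding bij_betw_def by blast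
 have finj: "f i = f j \<longleftrightarrow> i = j" if "i < ?n" "j < ?n" for i j using f that unfolding bij_betw_def inj_on_def by blast
 have car: "\<rho> w : carrier_mat ?n ?n" for w unfolding \<rho>_def by simp
 have "group_rep (mat_group P) ?n \<rho>"
  unfolding group_rep_def mat_group_simps
 proof (intro conjI ballI)
  show "\<rho> I1 = 1\<^sub>m ?n" unfolding \<rho>_def by (intro eq_matI) (auto simp: finj)
  fix g h assume g: "g : P" and h: "h : P"
  show "\<rho> (g ** h) = \<rho> g * \<rho> h"
  proof (rule eq_matI)
  fix i k assume "i < dim_row (\<rho> g * \<rho> h)" "k < dim_col (\<rho> g * \<rho> h)"
  then have ik: "i < ?n" "k < ?n" using car[of g] car[of h] by auto
  obtain j where j: "j < ?n" "f j = h ** f k"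
  using f mult_in[OF h fP[OF ik(2)]] unfolding bij_betw_def by (metis (no_types, lifting) imageE lessThan_iff)
  have "(\<rho> g * \<rho> h) $$ (i, k) = (\<Sum>l<?n. \<rho> g $$ (i, l) * \<rho> h $$ (l, k))"
  using car[of g] car[of h] ik by (simp add: scalar_prod_def atLeast0LessThan)
  also have "... = (\<Sum>l<?n. if l = j then \<rho> g $$ (i, j) else 0)"
  by (rule sum.cong[OF HOL.refl]) (use ik j(1) finj in \<open>auto simp: \<rho>_def j(2)[symmetric]\<close>)
  also have "... = \<rho> (g ** h) $$ (i, k)" using ik j by (simp add: \<rho>_def matrix_mul_assoc)
  finally show "\<rho> (g ** h) $$ (i, k) = (\<rho> g * \<rho> h) $$ (i, k)" by simp
  qed (simp_all add: carrier_matD[OF car])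
 qed (use car in auto)
 then obtain xs where xs: "set xs \<subseteq> Irr P" "\<forall>w\<in>P. mat_trace (\<rho> w) = (\<Sum>\<psi>\<leftarrow>xs. \<psi> w)" using rep_constituents by blast
 have "mat_trace (\<rho> w) = (if w = I1 then of_nat ?n else 0)" if w: "w : P" for w
 proof -
  have "f i = w ** f i \<longleftrightarrow> w = I1" if i: "i < ?n" for i
  proof
  assume "f i = w ** f i"
  then have "f i ** matrix_inv (f i) = w ** (f i ** matrix_inv (f i))" by (simp add: matrix_mul_assoc)
  then show "w = I1" using inv_props[OF fP[OF i]] by simp
  qed simp
  then show ?thesis unfolding mat_trace_def \<rho>_def by simp
 qed
 then show ?thesis using xs that by simp
qed

text \<open>By \<open>class_function_convolution\<close>, \<open>h\<close> is orthogonal to all translates of irreducible characters, hence to those of the regular character, which are multiples of indicator functions of points.\<close>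

lemma characters_complete:
 assumes h: "!!g w. g : P ==> w : P ==> h (g ** w ** matrix_inv g) = h w"
  and orth: "!!\<psi>. \<psi> : Irr P ==> (\<Sum>w\<in>P. h w * \<psi> w) = 0" and w: "w : P"
 shows "h w = 0"
proof -
 obtain xs where xs: "set xs \<subseteq> Irr P" "!!w. w : P ==> (\<Sum>\<psi>\<leftarrow>xs. \<psi> w) = (if w = I1 then of_nat (card P) else 0)"
  using regular_character by blast
 let ?b = "matrix_inv w"
 have b: "?b : P" using inv_props w by blast
 have "(\<Sum>u\<in>P. h u * \<psi> (u ** ?b)) = 0" if "\<psi> : Irr P" for \<psi>
  using class_function_convolution[where h = h, OF that h b] orth[OF that] Irr_I1_nonzero[OF that] by simp
 then have "(\<Sum>\<psi>\<leftarrow>xs. \<Sum>u\<in>P. h u * \<psi> (u ** ?b)) = 0"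
  using xs(1) by (induction xs) auto
 also have "(\<Sum>\<psi>\<leftarrow>xs. \<Sum>u\<in>P. h u * \<psi> (u ** ?b)) = (\<Sum>u\<in>P. h u * (\<Sum>\<psi>\<leftarrow>xs. \<psi> (u ** ?b)))"
  by (induction xs) (simp_all add: sum.distrib distrib_left)
 also have "... = (\<Sum>u\<in>P. if u = w then h w * of_nat (card P) else 0)"
 proof (rule sum.cong[OF HOL.refl])
  fix u assume u: "u : P"
  have "u ** ?b = I1 \<longleftrightarrow> u = w"
  proof
  assume "u ** ?b = I1"
  then have "u ** (?b ** w) = w" by (simp add: matrix_mul_assoc)
  then show "u = w" using inv_props[OF w] by simp
  qed (simp add: inv_props w)
  then show "h u * (\<Sum>\<psi>\<leftarrow>xs. \<psi> (u ** ?b)) = (if u = w then h w * of_nat (card P) else 0)"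
  using xs(2)[OF mult_in[OF u b]] by simp
 qed
 also have "... = h w * of_nat (card P)" using fin w by simp
 finally show ?thesis using fin w by auto
qed

text \<open>Irreducible characters are constituents of the regular character, since one that is not would be orthogonal to it.\<close>

lemma finite_Irr: "finite (Irr P)"
proof -
 obtain xs where xs: "set xs \<subseteq> Irr P" "!!w. w : P ==> (\<Sum>\<psi>\<leftarrow>xs. \<psi> w) = (if w = I1 then of_nat (card P) else 0)"
  using regular_character by blast
 have "Irr P \<subseteq> set xs"
 proof
  fix \<eta> assume \<eta>: "\<eta> : Irr P"
  show "\<eta> : set xs"
  proof (rule ccontr)
  assume n: "\<eta> ~: set xs"
  have "(\<Sum>\<psi>\<leftarrow>xs. \<Sum>w\<in>P. \<psi> w * \<eta> (matrix_inv w)) = 0"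
  using xs(1) n by (induction xs) (auto simp: orthogonal_characters \<eta>)
  also have "(\<Sum>\<psi>\<leftarrow>xs. \<Sum>w\<in>P. \<psi> w * \<eta> (matrix_inv w)) = (\<Sum>w\<in>P. (\<Sum>\<psi>\<leftarrow>xs. \<psi> w) * \<eta> (matrix_inv w))"
  by (induction xs) (simp_all add: sum.distrib distrib_right)
  also have "... = (\<Sum>w\<in>P. if w = I1 then of_nat (card P) * \<eta> (matrix_inv I1) else 0)"
  by (rule sum.cong[OF HOL.refl]) (simp add: xs(2))
  also have "... = of_nat (card P) * \<eta> (matrix_inv I1)" using fin one_in by simp
  also have "matrix_inv (I1 :: 'n cmat) = I1" using inv_props[OF one_in] by simp
  finally show False using Irr_I1_nonzero[OF \<eta>] fin one_in by auto
  qed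
 qed
 then show ?thesis using finite_subset by blast
qed

lemma class_function_inverse:
 assumes "h : class_functions P" "g : P" "w : P"
 shows "h (matrix_inv (g ** w ** matrix_inv g)) = h (matrix_inv w)"
proof -
 note i = inv_props(1)[OF assms(2)]
 have "matrix_inv (g ** w ** matrix_inv g) = g ** matrix_inv w ** matrix_inv g"
  unfolding inverse_mult[OF mult_in[OF assms(2,3)] i] inverse_inverse[OF assms(2)] inverse_mult[OF assms(2,3)]
  by (simp only: matrix_mul_assoc)
 then show ?thesis using assms inv_props(1)[OF assms(3)] unfolding class_functions_def by simp
qed

lemma character_norm_nonzero:
 assumes \<eta>: "\<eta> : Irr P"
 shows "(\<Sum>w\<in>P. \<eta> w * \<eta> (matrix_inv w)) ~= 0"
proof
 assume z: "(\<Sum>w\<in>P. \<eta> w * \<eta> (matrix_inv w)) = 0"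
 have "\<eta> (matrix_inv I1) = 0"
 proof (rule characters_complete[where h = "%w. \<eta> (matrix_inv w)", OF _ _ one_in])
  fix \<psi> assume "\<psi> : Irr P"
  then show "(\<Sum>w\<in>P. \<eta> (matrix_inv w) * \<psi> w) = 0"
  using z orthogonal_characters[of \<psi> \<eta>] \<eta> by (cases "\<psi> = \<eta>") (simp_all add: mult.commute)
 qed (use class_function_inverse \<eta> Irr_class_function in blast)
 moreover have "matrix_inv (I1 :: 'n cmat) = I1" using inv_props[OF one_in] by simp
 ultimately show False using Irr_I1_nonzero[OF \<eta>] by simp
qed

lemma class_function_expansion:
 assumes g: "g : class_functions P"
 obtains c where "g = (%w. \<Sum>\<psi>\<in>Irr P. c \<psi> * \<psi> w)"
proof -
 let ?ip = "%f \<eta>. \<Sum>w\<in>P. f w * \<eta> (matrix_inv w)"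
 define c where "c \<eta> = ?ip g \<eta> / ?ip \<eta> \<eta>" for \<eta>
 define g' where "g' w = g w - (\<Sum>\<psi>\<in>Irr P. c \<psi> * \<psi> w)" for w
 have g'c: "g' : class_functions P"
  using g Irr_class_function unfolding class_functions_def g'_def by (auto intro!: sum.neutral arg_cong2[of _ _ _ _ "(-)"] sum.cong)
 have orth: "?ip g' \<eta> = 0" if \<eta>: "\<eta> : Irr P" for \<eta>
 proof -
  have "?ip g' \<eta> = ?ip g \<eta> - (\<Sum>w\<in>P. \<Sum>\<psi>\<in>Irr P. c \<psi> * (\<psi> w * \<eta> (matrix_inv w)))"
  unfolding g'_def by (simp add: left_diff_distrib sum_subtractf sum_distrib_right mult.assoc)
  also have "(\<Sum>w\<in>P. \<Sum>\<psi>\<in>Irr P. c \<psi> * (\<psi> w * \<eta> (matrix_inv w))) = (\<Sum>\<psi>\<in>Irr P. c \<psi> * ?ip \<psi> \<eta>)"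
  by (subst sum.swap) (simp add: sum_distrib_left)
  also have "... = (\<Sum>\<psi>\<in>Irr P. if \<psi> = \<eta> then c \<eta> * ?ip \<eta> \<eta> else 0)"
  by (rule sum.cong[OF HOL.refl]) (simp add: orthogonal_characters \<eta>)
  also have "... = c \<eta> * ?ip \<eta> \<eta>" using finite_Irr \<eta> by simp
  also have "... = ?ip g \<eta>" unfolding c_def using character_norm_nonzero[OF \<eta>] by simp
  finally show ?thesis by simp
 qed
 have "g' w = 0" if w: "w : P" for w
 proof -
  have "g' (matrix_inv (matrix_inv w)) = 0"
  proof (rule characters_complete[where h = "%w. g' (matrix_inv w)", OF _ _ inv_props(1)[OF w]])
  fix \<psi> assume "\<psi> : Irr P"
  have "(\<Sum>w\<in>P. g' (matrix_inv w) * \<psi> w) = (\<Sum>w\<in>P. g' (matrix_inv w) * \<psi> (matrix_inv (matrix_inv w)))"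
  by (rule sum.cong) (simp_all add: inverse_inverse)
  also have "... = ?ip g' \<psi>"
  by (rule sum.reindex_bij_betw[OF inverse_bij, of "%w. g' w * \<psi> (matrix_inv w)"])
  finally show "(\<Sum>w\<in>P. g' (matrix_inv w) * \<psi> w) = 0" using orth[OF \<open>\<psi> : Irr P\<close>] by simp
  qed (use class_function_inverse g'c in blast)
  then show ?thesis using inverse_inverse[OF w] by simp
 qed
 moreover have "g' w = 0" if "w ~: P" for w using g'c that unfolding class_functions_def by blast
 ultimately have "g = (%w. \<Sum>\<psi>\<in>Irr P. c \<psi> * \<psi> w)" unfolding g'_def by (metis (no_types, lifting) eq_iff_diff_eq_0 ext)
 then show ?thesis by (rule that)
qed

end

lemma restriction_constituents:
 assumes "reflection_arrangement P x0" "reflection_arrangement P' x0" "P' \<subseteq> P" "\<psi> : Irr P"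
 shows "\<exists>k :: _ => nat. \<forall>w\<in>P'. \<psi> w = (\<Sum>\<eta>\<in>Irr P'. of_nat (k \<eta>) * \<eta> w)"
proof -
 interpret P: reflection_arrangement P x0 by fact
 interpret P': reflection_arrangement P' x0 by fact
 obtain d \<rho> where r: "P.irr_rep d \<rho>" "\<psi> = P.char_of \<rho>" using assms(4) P.Irr_iff by blast
 have "group_rep (mat_group P') d \<rho>"
  using P.irr_repD(1)[OF r(1)] assms(3) unfolding group_rep_def by auto
 then obtain xs where xs: "set xs \<subseteq> Irr P'" "\<forall>w\<in>P'. mat_trace (\<rho> w) = (\<Sum>\<psi>\<leftarrow>xs. \<psi> w)"
  using P'.rep_constituents by blast
 have "\<psi> w = (\<Sum>\<eta>\<in>Irr P'. of_nat (count_list xs \<eta>) * \<eta> w)" if w: "w : P'" for w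
 proof -
  have "\<psi> w = mat_trace (\<rho> w)" using w assms(3) by (auto simp: r(2) P.char_of_def)
  also have "... = (\<Sum>\<eta>\<leftarrow>xs. \<eta> w)" using xs(2) w by blast
  also have "... = (\<Sum>\<eta>\<in>Irr P'. of_nat (count_list xs \<eta>) * \<eta> w)" by (rule sum_list_count[OF P'.finite_Irr xs(1)])
  finally show ?thesis .
 qed
 then show ?thesis by blast
qed

section \<open>Subrings of coefficients\<close>

lemma is_subringD:
 assumes "is_subring R"
 shows "1 : R" "0 : R" "x : R ==> y : R ==> x - y : R" "x : R ==> y : R ==> x * y : R"
  "x : R ==> - x : R" "x : R ==> y : R ==> x + y : R"
proof -
 show 1: "1 : R" and d: "x : R ==> y : R ==> x - y : R" and "x : R ==> y : R ==> x * y : R" for x y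
  using assms unfolding is_subring_def by blast+
 show 0: "0 : R" using d[OF 1 1] by simp
 show neg: "x : R ==> - x : R" for x using d[OF 0, of x] by simp
 show "x : R ==> y : R ==> x + y : R" using d[OF _ neg, of x y] by simp
qed

lemma is_subring_sum: "is_subring R ==> (!!x. x : A ==> f x : R) ==> sum f A : R"
 by (induction A rule: infinite_finite_induct) (auto intro: is_subringD)

lemma is_subring_prod: "is_subring R ==> (!!x. x : A ==> f x : R) ==> prod f A : R"
 by (induction A rule: infinite_finite_induct) (auto intro: is_subringD)

lemma is_subring_power: "is_subring R ==> x : R ==> x ^ n : R"
 by (induction n) (auto intro: is_subringD)

lemma is_subring_UNIV: "is_subring UNIV" unfolding is_subring_def by simp

lemma is_subring_of_nat: "is_subring R ==> of_nat n : R"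
 by (induction n) (auto intro: is_subringD)

lemma is_subring_of_int: "is_subring R ==> of_int n : R"
 by (cases n) (auto intro: is_subringD is_subring_of_nat simp del: of_nat_Suc)

section \<open>Linear extension of functions on a group\<close>

abbreviation fin_supp :: "('b => 'k::zero) => bool" where "fin_supp f \<equiv> finite {b. f b ~= 0}"

lemma lin_ext_sum:
 assumes "finite S" "{b. f b ~= 0} \<subseteq> S"
 shows "lin_ext \<theta> f = (\<Sum>b\<in>S. f b * \<theta> b)"
 unfolding lin_ext_def by (rule sum.mono_neutral_left) (use assms in auto)

lemma lin_ext_add:
 assumes "fin_supp f" "fin_supp g"
 shows "lin_ext \<theta> (%z. f z + g z) = lin_ext \<theta> f + lin_ext \<theta> g"
proof -
 let ?S = "{b. f b ~= 0} \<union> {b. g b ~= 0}"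
 have S: "finite ?S" using assms by simp
 have "lin_ext \<theta> (%z. f z + g z) = (\<Sum>b\<in>?S. (f b + g b) * \<theta> b)" by (rule lin_ext_sum[OF S]) auto
 also have "... = (\<Sum>b\<in>?S. f b * \<theta> b) + (\<Sum>b\<in>?S. g b * \<theta> b)" by (simp add: distrib_right sum.distrib)
 also have "... = lin_ext \<theta> f + lin_ext \<theta> g"
  using lin_ext_sum[OF S, of f \<theta>] lin_ext_sum[OF S, of g \<theta>] by auto
 finally show ?thesis .
qed

lemma lin_ext_scale: "lin_ext \<theta> (%z. c * f z) = c * lin_ext \<theta> f" if "fin_supp f"
proof -
 have "lin_ext \<theta> (%z. c * f z) = (\<Sum>b | f b ~= 0. c * f b * \<theta> b)" by (rule lin_ext_sum[OF that]) auto
 then show ?thesis unfolding lin_ext_def by (simp add: sum_distrib_left mult.assoc)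
qed

lemma lin_ext_single [simp]: "lin_ext \<theta> (single_elt c b) = c * \<theta> b"
proof -
 have "lin_ext \<theta> (single_elt c b) = (\<Sum>x\<in>{b}. single_elt c b x * \<theta> x)"
  by (rule lin_ext_sum) (auto simp: single_elt_def)
 then show ?thesis by (simp add: single_elt_def)
qed

lemma lin_ext_cong: "(!!b. f b ~= 0 ==> \<theta> b = \<theta>' b) ==> lin_ext \<theta> f = lin_ext \<theta>' f"
 unfolding lin_ext_def by (rule sum.cong) auto

lemma lin_ext_zero_fun [simp]: "lin_ext (%b. 0) f = 0"
 unfolding lin_ext_def by simp

lemma lin_ext_zero [simp]: "lin_ext \<theta> (%b. 0) = 0"
 unfolding lin_ext_def by simp

lemma lin_ext_sum_fun: "lin_ext (%b. \<Sum>i\<in>I. \<theta> i b) f = (\<Sum>i\<in>I. lin_ext (\<theta> i) f)"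
 unfolding lin_ext_def sum_distrib_left by (rule sum.swap)

lemma lin_ext_mult_fun_left: "lin_ext (%b. c * \<theta> b) f = c * lin_ext \<theta> f"
 unfolding lin_ext_def sum_distrib_left by (simp add: mult.left_commute)

lemma lin_ext_indicator: "fin_supp f ==> lin_ext (%b. if b = z then 1 else 0) f = f z"
 using lin_ext_sum[of "insert z {b. f b ~= 0}" f "%b. if b = z then 1 else 0"]
 by (simp add: subset_insertI if_distrib cong: if_cong)

text \<open>Identities in the group algebra are tested by all linear forms; this avoids manipulations of the double sums in products.\<close>

lemma fin_supp_eqI:
 assumes "fin_supp f" "fin_supp g" "!!\<theta>. lin_ext \<theta> f = lin_ext \<theta> g"
 shows "f = g"
 using lin_ext_indicator[OF assms(1)] lin_ext_indicator[OF assms(2)] assms(3) by (metis ext)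

lemma fin_supp_add: "fin_supp f ==> fin_supp g ==> fin_supp (%z. f z + g z :: 'k::comm_ring_1)"
 by (rule finite_subset[of _ "{b. f b ~= 0} \<union> {b. g b ~= 0}"]) auto

section \<open>The group algebra\<close>

lemma fin_supp_single: "fin_supp (single_elt c b)"
 unfolding single_elt_def by simp

text \<open>The product of the group algebra as a function of its own: it depends only on the multiplication of the group, so that group algebras over different rings share it.\<close>

definition conv :: "('b, 'z) monoid_scheme => ('b => 'k::comm_ring_1) => ('b => 'k) => 'b => 'k" where
 "conv G f g = (%z. \<Sum>(x, y) | f x ~= 0 & g y ~= 0 & x \<otimes>\<^bsub>G\<^esub> y = z. f x * g y)"

lemma group_algebra_simps [simp]:
 "mult (group_algebra R G) = conv G"
 "f \<oplus>\<^bsub>group_algebra R G\<^esub> g = (%z. f z + g z)"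
 "\<zero>\<^bsub>group_algebra R G\<^esub> = (%z. 0)"
 "\<one>\<^bsub>group_algebra R G\<^esub> = single_elt 1 \<one>\<^bsub>G\<^esub>"
 by (simp_all add: group_algebra_def single_elt_def conv_def fun_eq_iff)

lemma conv_support: 
 assumes "fin_supp f" "fin_supp g"
 shows "fin_supp (conv G f g)" "conv G f g z ~= 0 ==> \<exists>x y. f x ~= 0 & g y ~= 0 & z = x \<otimes>\<^bsub>G\<^esub> y"
  "{z. conv G f g z ~= 0} \<subseteq> (%(x, y). x \<otimes>\<^bsub>G\<^esub> y) ` ({x. f x ~= 0} \<times> {y. g y ~= 0})"
proof -
 show *: "conv G f g z ~= 0 ==> \<exists>x y. f x ~= 0 & g y ~= 0 & z = x \<otimes>\<^bsub>G\<^esub> y" for z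
 proof (rule ccontr)
  assume nz: "conv G f g z ~= 0" and "\<not> (\<exists>x y. f x ~= 0 & g y ~= 0 & z = x \<otimes>\<^bsub>G\<^esub> y)"
  then have e: "{(x, y). f x ~= 0 & g y ~= 0 & x \<otimes>\<^bsub>G\<^esub> y = z} = {}" by blast
  have "conv G f g z = (\<Sum>(x, y) | f x ~= 0 & g y ~= 0 & x \<otimes>\<^bsub>G\<^esub> y = z. f x * g y)"
  unfolding conv_def ..
  then show False using nz unfolding e by simp
 qed
 show "{z. conv G f g z ~= 0} \<subseteq> (%(x, y). x \<otimes>\<^bsub>G\<^esub> y) ` ({x. f x ~= 0} \<times> {y. g y ~= 0})"
 proof
  fix z assume "z : {z. conv G f g z ~= 0}"
  then have "conv G f g z ~= 0" by simp
  from *[OF this] obtain x y where "f x ~= 0" "g y ~= 0" "z = x \<otimes>\<^bsub>G\<^esub> y" by blast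
  then show "z : (%(x, y). x \<otimes>\<^bsub>G\<^esub> y) ` ({x. f x ~= 0} \<times> {y. g y ~= 0})"
  by (intro image_eqI[of _ _ "(x, y)"]) simp_all
 qed
 then show "fin_supp (conv G f g)" by (rule finite_subset) (use assms in auto)
qed

lemma lin_ext_conv:
 assumes "fin_supp f" "fin_supp g"
 shows "lin_ext \<theta> (conv G f g) = lin_ext (%x. lin_ext (%y. \<theta> (x \<otimes>\<^bsub>G\<^esub> y)) g) f"
proof -
 let ?S = "{x. f x ~= 0}" and ?T = "{y. g y ~= 0}"
 let ?m = "%(x, y). x \<otimes>\<^bsub>G\<^esub> y"
 let ?Z = "?m ` (?S \<times> ?T)"
 have fin: "finite (?S \<times> ?T)" using assms by simp
 have c: "conv G f g z = (\<Sum>p\<in>{p : ?S \<times> ?T. ?m p = z}. f (fst p) * g (snd p))" for z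
  unfolding conv_def by (auto intro!: sum.cong)
 have "lin_ext \<theta> (conv G f g) = (\<Sum>z\<in>?Z. conv G f g z * \<theta> z)"
  by (rule lin_ext_sum[OF finite_imageI[OF fin] conv_support(3)[OF assms]])
 also have "... = (\<Sum>z\<in>?Z. \<Sum>p\<in>{p : ?S \<times> ?T. ?m p = z}. f (fst p) * g (snd p) * \<theta> (?m p))"
  by (rule sum.cong[OF HOL.refl]) (auto simp: c sum_distrib_right)
 also have "... = (\<Sum>p\<in>?S \<times> ?T. f (fst p) * g (snd p) * \<theta> (?m p))"
  by (rule sum.image_gen[OF fin, symmetric])
 also have "... = (\<Sum>x\<in>?S. \<Sum>y\<in>?T. f x * g y * \<theta> (x \<otimes>\<^bsub>G\<^esub> y))"
  by (simp add: sum.cartesian_product case_prod_beta)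
 finally show ?thesis unfolding lin_ext_def by (simp add: sum_distrib_left mult.assoc)
qed

lemma group_algebra_carrier:
 "f : carrier (group_algebra R G) \<longleftrightarrow> fin_supp f & (\<forall>b. f b ~= 0 --> b : carrier G) & (\<forall>b. f b : R)"
 unfolding group_algebra_def by auto

lemma conv_closed:
 assumes R: "is_subring R" and G: "group G" and f: "f : carrier (group_algebra R G)" and g: "g : carrier (group_algebra R G)"
 shows "conv G f g : carrier (group_algebra R G)"
 unfolding group_algebra_carrier
proof (intro conjI allI impI)
 have s: "fin_supp f" "fin_supp g" using f g unfolding group_algebra_carrier by blast+
 show "fin_supp (conv G f g)" by (rule conv_support(1)[OF s])
 show "b : carrier G" if nz: "conv G f g b ~= 0" for b
 proof -
  obtain x y where "f x ~= 0" "g y ~= 0" "b = x \<otimes>\<^bsub>G\<^esub> y" using conv_support(2)[OF s nz] by blast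
  then show ?thesis using f g monoid.m_closed[OF group.is_monoid[OF G]] unfolding group_algebra_carrier by blast
 qed
 show "conv G f g b : R" for b
 proof -
  have "conv G f g b = (\<Sum>(x, y) | f x ~= 0 & g y ~= 0 & x \<otimes>\<^bsub>G\<^esub> y = b. f x * g y)"
  unfolding conv_def ..
  also have "... : R" by (rule is_subring_sum[OF R]) (use f g is_subringD[OF R] in \<open>auto simp: group_algebra_carrier\<close>)
  finally show ?thesis .
 qed
qed

lemma single_closed: "is_subring R ==> c : R ==> b : carrier G ==> single_elt c b : carrier (group_algebra R G)"
 unfolding group_algebra_carrier single_elt_def by (auto intro: is_subringD)

lemma add_closed: "is_subring R ==> f : carrier (group_algebra R G) ==> g : carrier (group_algebra R G) ==>
  (%z. f z + g z) : carrier (group_algebra R G)"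
 unfolding group_algebra_carrier
proof (elim conjE, intro conjI)
 assume R: "is_subring R" and f: "fin_supp f" "\<forall>b. f b ~= 0 --> b : carrier G" "\<forall>b. f b : R"
  and g: "fin_supp g" "\<forall>b. g b ~= 0 --> b : carrier G" "\<forall>b. g b : R"
 show "fin_supp (%z. f z + g z)" by (rule fin_supp_add[OF f(1) g(1)])
 show "\<forall>b. f b + g b ~= 0 --> b : carrier G" using f(2) g(2) by (metis add.right_neutral)
 show "\<forall>b. f b + g b : R" using f(3) g(3) is_subringD(6)[OF R] by blast
qed

lemma scale_closed: "is_subring R ==> c : R ==> f : carrier (group_algebra R G) ==>
  (%z. c * f z) : carrier (group_algebra R G)"
 unfolding group_algebra_carrier
proof (elim conjE, intro conjI)
 assume R: "is_subring R" "c : R" and f: "fin_supp f" "\<forall>b. f b ~= 0 --> b : carrier G" "\<forall>b. f b : R"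
 show "fin_supp (%z. c * f z)" by (rule finite_subset[OF _ f(1)]) auto
 show "\<forall>b. c * f b ~= 0 --> b : carrier G" using f(2) by (metis mult_zero_right)
 show "\<forall>b. c * f b : R" using f(3) R is_subringD(4) by blast
qed

lemma zero_closed: "is_subring R ==> (%z. 0) : carrier (group_algebra R G)"
 unfolding group_algebra_carrier by (auto intro: is_subringD)

lemma sum_closed: "is_subring R ==> (!!i. i : I ==> f i : carrier (group_algebra R G)) ==>
  (%z. \<Sum>i\<in>I. f i z) : carrier (group_algebra R G)"
 by (induction I rule: infinite_finite_induct) (auto intro: zero_closed add_closed)

lemma group_algebra_mono: "R \<subseteq> R' ==> f : carrier (group_algebra R G) ==> f : carrier (group_algebra R' G)"
 unfolding group_algebra_carrier by blast

lemma conv_assoc: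
 assumes G: "group G" and "f : carrier (group_algebra UNIV G)" "g : carrier (group_algebra UNIV G)" "h : carrier (group_algebra UNIV G)"
 shows "conv G (conv G f g) h = conv G f (conv G g h)"
proof (rule fin_supp_eqI)
 have s: "fin_supp f" "fin_supp g" "fin_supp h" and c: "!!b. f b ~= 0 ==> b : carrier G" "!!b. g b ~= 0 ==> b : carrier G" "!!b. h b ~= 0 ==> b : carrier G"
  using assms unfolding group_algebra_carrier by blast+
 note s2 = conv_support(1)[OF s(1,2)] conv_support(1)[OF s(2,3)]
 show "fin_supp (conv G (conv G f g) h)" "fin_supp (conv G f (conv G g h))" by (intro conv_support s s2)+
 fix \<theta>
 have "lin_ext \<theta> (conv G (conv G f g) h) = lin_ext (%x. lin_ext (%y. lin_ext (%z. \<theta> (x \<otimes>\<^bsub>G\<^esub> y \<otimes>\<^bsub>G\<^esub> z)) h) g) f"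
  by (simp add: lin_ext_conv s s2)
 also have "... = lin_ext (%x. lin_ext (%y. lin_ext (%z. \<theta> (x \<otimes>\<^bsub>G\<^esub> (y \<otimes>\<^bsub>G\<^esub> z))) h) g) f"
  by (intro lin_ext_cong) (simp add: c monoid.m_assoc[OF group.is_monoid[OF G]])
 also have "... = lin_ext \<theta> (conv G f (conv G g h))" by (simp add: lin_ext_conv s s2)
 finally show "lin_ext \<theta> (conv G (conv G f g) h) = lin_ext \<theta> (conv G f (conv G g h))" .
qed

lemma conv_add:
 assumes "fin_supp f" "fin_supp g" "fin_supp h"
 shows "conv G (%z. f z + g z) h = (%z. conv G f h z + conv G g h z)"
  "conv G h (%z. f z + g z) = (%z. conv G h f z + conv G h g z)"
proof -
 have add_fun: "lin_ext (%b. \<theta> b + \<theta>' b) f = lin_ext \<theta> f + lin_ext \<theta>' f" for \<theta> \<theta>' f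
  unfolding lin_ext_def by (simp add: distrib_left sum.distrib)
 show "conv G (%z. f z + g z) h = (%z. conv G f h z + conv G g h z)"
  by (rule fin_supp_eqI) (simp_all add: assms fin_supp_add conv_support lin_ext_add lin_ext_conv)
 show "conv G h (%z. f z + g z) = (%z. conv G h f z + conv G h g z)"
  by (rule fin_supp_eqI) (simp_all add: assms fin_supp_add conv_support lin_ext_add lin_ext_conv add_fun)
qed

lemma conv_one:
 assumes G: "group G" and "f : carrier (group_algebra UNIV G)"
 shows "conv G (single_elt 1 \<one>\<^bsub>G\<^esub>) f = f" "conv G f (single_elt 1 \<one>\<^bsub>G\<^esub>) = f"
proof -
 have s: "fin_supp f" and c: "!!b. f b ~= 0 ==> b : carrier G" using assms unfolding group_algebra_carrier by blast+
 note s1 = fin_supp_single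
 show "conv G (single_elt 1 \<one>\<^bsub>G\<^esub>) f = f"
  by (rule fin_supp_eqI) (simp_all add: s s1 conv_support lin_ext_conv, rule lin_ext_cong,
  simp add: c monoid.l_one[OF group.is_monoid[OF G]])
 show "conv G f (single_elt 1 \<one>\<^bsub>G\<^esub>) = f"
  by (rule fin_supp_eqI) (simp_all add: s s1 conv_support lin_ext_conv, rule lin_ext_cong,
  simp add: c monoid.r_one[OF group.is_monoid[OF G]])
qed

lemma carrier_UNIV: "f : carrier (group_algebra R G) ==> f : carrier (group_algebra UNIV G)"
 by (rule group_algebra_mono) auto

lemma carrierD:
 assumes "f : carrier (group_algebra R G)"
 shows "fin_supp f" "f b ~= 0 ==> b : carrier G" "f b : R"
 using assms unfolding group_algebra_carrier by blast+

lemma group_algebra_ring: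
 assumes R: "is_subring R" and G: "group G"
 shows "ring (group_algebra R G)"
proof (rule ringI)
 let ?A = "group_algebra R G"
 show "abelian_group ?A"
 proof (rule abelian_groupI)
  fix f assume f: "f : carrier ?A"
  show "\<exists>g\<in>carrier ?A. g \<oplus>\<^bsub>?A\<^esub> f = \<zero>\<^bsub>?A\<^esub>"
  by (rule bexI[OF _ scale_closed[OF R _ f, of "- 1"]]) (use is_subringD[OF R] in auto)
 qed (simp_all add: add_closed[OF R] zero_closed[OF R] add.assoc add.commute add.left_commute)
 show "monoid ?A"
  by (rule monoidI) (simp_all add: conv_closed[OF R G] single_closed[OF R] is_subringD[OF R]
  monoid.one_closed[OF group.is_monoid[OF G]] conv_assoc[OF G] conv_one[OF G] carrier_UNIV)
qed (simp_all add: conv_add carrierD(1))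

lemma group_algebra_minus:
 assumes R: "is_subring R" and G: "group G" and f: "f : carrier (group_algebra R G)" and g: "g : carrier (group_algebra R G)"
 shows "f \<ominus>\<^bsub>group_algebra R G\<^esub> g = (%z. f z - g z)"
proof -
 interpret ring "group_algebra R G" by (rule group_algebra_ring[OF R G])
 have m: "(%z. - 1 * g z) : carrier (group_algebra R G)" by (rule scale_closed[OF R _ g]) (use is_subringD[OF R] in auto)
 have "\<ominus>\<^bsub>group_algebra R G\<^esub> g = (%z. - 1 * g z)"
  by (rule minus_equality[OF _ g m]) simp
 then show ?thesis unfolding a_minus_def by simp
qed

lemma group_algebra_induct:
 assumes f: "f : carrier (group_algebra R G)" and R: "is_subring R"
  and 0: "Q (%z. 0)" and single: "!!c b. c : R ==> b : carrier G ==> Q (single_elt c b)"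
  and add: "!!f g. f : carrier (group_algebra R G) ==> g : carrier (group_algebra R G) ==> Q f ==> Q g ==> Q (%z. f z + g z)"
 shows "Q f"
proof -
 have "Q (%z. \<Sum>b\<in>S. single_elt (f b) b z) & (%z. \<Sum>b\<in>S. single_elt (f b) b z) : carrier (group_algebra R G)"
  if "finite S" "S \<subseteq> {b. f b ~= 0}" for S
  using that
 proof (induction S rule: finite_induct)
  case (insert b S)
  have b: "f b : R" "b : carrier G" using carrierD[OF f] insert by auto
  note s = single_closed[OF R b]
  show ?case using insert add[OF s _ single[OF b]] add_closed[OF R s] by simp
 qed (simp add: 0 zero_closed[OF R])
 from this[OF carrierD(1)[OF f]] have "Q (%z. \<Sum>b | f b ~= 0. single_elt (f b) b z)" by simp
 moreover have "(%z. \<Sum>b | f b ~= 0. single_elt (f b) b z) = f"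
  using carrierD(1)[OF f] by (auto simp: single_elt_def fun_eq_iff)
 ultimately show ?thesis by simp
qed

text \<open>Additive maps that are homogeneous on the basis are linear extensions; coordinates and traces are brought into this form.\<close>

lemma linear_on_group_algebra:
 assumes f: "f : carrier (group_algebra R G)" and R: "is_subring R"
  and 0: "F (%z. 0) = (0 :: 'k::comm_ring_1)" and single: "!!c b. c : R ==> b : carrier G ==> F (single_elt c b) = c * \<kappa> b"
  and add: "!!f g. f : carrier (group_algebra R G) ==> g : carrier (group_algebra R G) ==> F (%z. f z + g z) = F f + F g"
 shows "F f = lin_ext \<kappa> f"
 by (rule group_algebra_induct[OF f R]) (simp_all add: 0 single add lin_ext_add carrierD(1))

lemma conv_single: "conv G (single_elt c x) (single_elt d y) = single_elt (c * d) (x \<otimes>\<^bsub>G\<^esub> y)"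
 by (rule fin_supp_eqI) (simp_all add: fin_supp_single conv_support lin_ext_conv mult.assoc)

lemma conv_single_one:
 assumes G: "group G" and "f : carrier (group_algebra UNIV G)"
 shows "conv G (single_elt c \<one>\<^bsub>G\<^esub>) f = (%z. c * f z)" "conv G f (single_elt c \<one>\<^bsub>G\<^esub>) = (%z. c * f z)"
proof -
 have s: "fin_supp f" and c: "!!b. f b ~= 0 ==> b : carrier G" using assms unfolding group_algebra_carrier by blast+
 have sc: "fin_supp (%z. c * f z)" by (rule finite_subset[OF _ s]) auto
 have s1: "fin_supp (single_elt c \<one>\<^bsub>G\<^esub>)" unfolding single_elt_def by simp
 show "conv G (single_elt c \<one>\<^bsub>G\<^esub>) f = (%z. c * f z)"
 proof (rule fin_supp_eqI)
  fix \<theta>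
  have "lin_ext (%y. \<theta> (\<one>\<^bsub>G\<^esub> \<otimes>\<^bsub>G\<^esub> y)) f = lin_ext \<theta> f"
  by (rule lin_ext_cong) (simp add: c monoid.l_one[OF group.is_monoid[OF G]])
  then show "lin_ext \<theta> (conv G (single_elt c \<one>\<^bsub>G\<^esub>) f) = lin_ext \<theta> (%z. c * f z)"
  by (simp add: lin_ext_conv s s1 lin_ext_scale)
 qed (simp_all add: sc conv_support s s1)
 show "conv G f (single_elt c \<one>\<^bsub>G\<^esub>) = (%z. c * f z)"
 proof (rule fin_supp_eqI)
  fix \<theta>
  have "lin_ext (%x. c * \<theta> (x \<otimes>\<^bsub>G\<^esub> \<one>\<^bsub>G\<^esub>)) f = lin_ext (%x. c * \<theta> x) f"
  by (rule lin_ext_cong) (simp add: c monoid.r_one[OF group.is_monoid[OF G]])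
  then show "lin_ext \<theta> (conv G f (single_elt c \<one>\<^bsub>G\<^esub>)) = lin_ext \<theta> (%z. c * f z)"
  by (simp add: lin_ext_conv s s1 lin_ext_scale lin_ext_mult_fun_left)
 qed (simp_all add: sc conv_support s s1)
qed

section \<open>Change of coefficients\<close>

definition map_coeffs :: "('k => 'l) => ('b => 'k) => 'b => 'l" where
 "map_coeffs h f = (%b. h (f b))"

definition coeff_hom :: "('k::comm_ring_1 => 'l::comm_ring_1) => bool" where
 "coeff_hom h \<longleftrightarrow> h 1 = 1 & (\<forall>x y. h (x + y) = h x + h y) & (\<forall>x y. h (x * y) = h x * h y)"

lemma coeff_homD:
 assumes "coeff_hom h"
 shows "h 1 = 1" "h (x + y) = h x + h y" "h (x * y) = h x * h y" "h 0 = 0" "h (- x) = - h x" "h (x - y) = h x - h y" "h (sum f A) = (\<Sum>a\<in>A. h (f a))"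
proof -
 show a: "h (x + y) = h x + h y" for x y using assms unfolding coeff_hom_def by blast
 show "h 1 = 1" "h (x * y) = h x * h y" using assms unfolding coeff_hom_def by blast+
 show z: "h 0 = 0" using a[of 0 0] by simp
 show m: "h (- x) = - h x" for x using a[of x "- x"] z by (simp add: eq_neg_iff_add_eq_0 add.commute)
 show "h (x - y) = h x - h y" using a[of x "- y"] m[of y] by simp
 show "h (sum f A) = (\<Sum>a\<in>A. h (f a))" by (induction A rule: infinite_finite_induct) (simp_all add: z a)
qed

lemma map_coeffs_support: "coeff_hom h ==> fin_supp f ==> fin_supp (map_coeffs h f)"
 unfolding map_coeffs_def by (rule rev_finite_subset) (use coeff_homD(4) in fastforce)+

lemma lin_ext_map_coeffs:
 assumes h: "coeff_hom h" and f: "fin_supp f"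
 shows "lin_ext (%b. h (\<theta> b)) (map_coeffs h f) = h (lin_ext \<theta> f)"
proof -
 have "lin_ext (%b. h (\<theta> b)) (map_coeffs h f) = (\<Sum>b | f b ~= 0. map_coeffs h f b * h (\<theta> b))"
  by (rule lin_ext_sum[OF f]) (auto simp: map_coeffs_def coeff_homD(4)[OF h])
 then show ?thesis unfolding lin_ext_def by (simp add: map_coeffs_def coeff_homD(3,7)[OF h])
qed

lemma map_coeffs_conv:
 fixes h :: "'k::comm_ring_1 => 'l::comm_ring_1" and f g :: "'b => 'k" and G :: "('b, 'z) monoid_scheme"
 assumes h: "coeff_hom h" and f: "fin_supp f" "fin_supp g"
 shows "map_coeffs h (conv G f g) = conv G (map_coeffs h f) (map_coeffs h g)"
proof (rule ext)
 fix z :: 'b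
 note m = map_coeffs_support[OF h f(1)] map_coeffs_support[OF h f(2)]
 have e: "lin_ext (%b. if b = z then 1 else 0) (map_coeffs h F) = h (lin_ext (%b. if b = z then 1 else 0) F)" if "fin_supp F" for F :: "'b => 'k"
  using lin_ext_map_coeffs[OF h that, of "%b. if b = z then 1 else 0"]
  by (simp add: if_distrib[of h] coeff_homD(1,4)[OF h] cong: if_cong)
 have "map_coeffs h (conv G f g) z = h (lin_ext (%b. if b = z then 1 else 0) (conv G f g))"
  unfolding map_coeffs_def lin_ext_indicator[OF conv_support(1)[OF f]] ..
 also have "... = h (lin_ext (%x. lin_ext (%y. if x \<otimes>\<^bsub>G\<^esub> y = z then 1 else 0) g) f)"
  unfolding lin_ext_conv[OF f] ..
 also have "... = lin_ext (%x. lin_ext (%y. h (if x \<otimes>\<^bsub>G\<^esub> y = z then 1 else 0)) (map_coeffs h g)) (map_coeffs h f)"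
  by (simp only: lin_ext_map_coeffs[OF h f(1), symmetric] lin_ext_map_coeffs[OF h f(2), symmetric])
 also have "... = lin_ext (%b. if b = z then 1 else 0) (conv G (map_coeffs h f) (map_coeffs h g))"
  unfolding lin_ext_conv[OF m] by (simp add: if_distrib[of h] coeff_homD(1,4)[OF h] cong: if_cong)
 also have "... = conv G (map_coeffs h f) (map_coeffs h g) z" by (rule lin_ext_indicator[OF conv_support(1)[OF m]])
 finally show "map_coeffs h (conv G f g) z = conv G (map_coeffs h f) (map_coeffs h g) z" .
qed

section \<open>Evaluation of Laurent polynomials\<close>

context
 fixes v :: "'i => 'k::field"
 assumes v: "!!i. v i ~= 0"
begin

definition monomial_eval :: "('i \<Rightarrow>\<^sub>0 int) => 'k" where
 "monomial_eval k = (\<Prod>i\<in>Poly_Mapping.keys k. v i powi Poly_Mapping.lookup k i)"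

lemma monomial_eval_superset:
 "finite S ==> Poly_Mapping.keys k \<subseteq> S ==> monomial_eval k = (\<Prod>i\<in>S. v i powi Poly_Mapping.lookup k i)"
 unfolding monomial_eval_def by (rule prod.mono_neutral_left) (auto simp: in_keys_iff)

lemma monomial_eval_add: "monomial_eval (k + l) = monomial_eval k * monomial_eval l"
proof -
 let ?S = "Poly_Mapping.keys k \<union> Poly_Mapping.keys l"
 have "monomial_eval (k + l) = (\<Prod>i\<in>?S. v i powi Poly_Mapping.lookup (k + l) i)"
  by (rule monomial_eval_superset[OF _ Poly_Mapping.keys_add]) simp
 also have "... = (\<Prod>i\<in>?S. v i powi Poly_Mapping.lookup k i * v i powi Poly_Mapping.lookup l i)"
  by (simp add: lookup_add power_int_add v)
 also have "... = monomial_eval k * monomial_eval l"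
  unfolding prod.distrib by (simp add: monomial_eval_superset[of ?S])
 finally show ?thesis .
qed

lemma laurent_eval_superset:
 "finite S ==> Poly_Mapping.keys p \<subseteq> S ==> laurent_eval v p = (\<Sum>k\<in>S. of_int (Poly_Mapping.lookup p k) * monomial_eval k)"
 unfolding laurent_eval_def monomial_eval_def by (rule sum.mono_neutral_left) (auto simp: in_keys_iff)

lemma laurent_eval_add: "laurent_eval v (p + q) = laurent_eval v p + laurent_eval v q"
proof -
 let ?S = "Poly_Mapping.keys p \<union> Poly_Mapping.keys q"
 have "laurent_eval v (p + q) = (\<Sum>k\<in>?S. of_int (Poly_Mapping.lookup (p + q) k) * monomial_eval k)"
  by (rule laurent_eval_superset[OF _ Poly_Mapping.keys_add]) simp
 also have "... = laurent_eval v p + laurent_eval v q"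
  by (simp add: laurent_eval_superset[of ?S] lookup_add distrib_right sum.distrib)
 finally show ?thesis .
qed

lemma laurent_eval_single: "laurent_eval v (Poly_Mapping.single k c) = of_int c * monomial_eval k"
 using laurent_eval_superset[of "{k}" "Poly_Mapping.single k c"] by simp

text \<open>Induction over sums of monomials.\<close>

lemma laurent_induct:
 assumes "Q (0 :: 'b \<Rightarrow>\<^sub>0 int)" "!!k c. Q (Poly_Mapping.single k c)" "!!p q. Q p ==> Q q ==> Q (p + q)"
 shows "Q p"
proof (induction p rule: update_induct)
 case (update f a b)
 have "Poly_Mapping.update a b f = f + Poly_Mapping.single a b"
  using update(1) by (intro poly_mapping_eqI) (auto simp: lookup_update lookup_add lookup_single in_keys_iff when_def)
 then show ?case using assms(2,3) update by simp
qed (rule assms(1))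

lemma laurent_eval_mult: "laurent_eval v (p * q) = laurent_eval v p * laurent_eval v q"
proof (induction p rule: laurent_induct)
 case 1 then show ?case by (simp add: laurent_eval_def)
next
 case (2 k c)
 show ?case
  by (induction q rule: laurent_induct)
  (simp_all add: laurent_eval_add mult_single laurent_eval_single monomial_eval_add distrib_left, simp add: laurent_eval_def)
next
 case (3 p q) then show ?case by (simp add: distrib_right laurent_eval_add)
qed

lemma laurent_eval_hom: "coeff_hom (laurent_eval v)"
proof -
 have "laurent_eval v 1 = 1"
  using laurent_eval_single[of 0 1] by (simp add: monomial_eval_def single_one)
 then show ?thesis unfolding coeff_hom_def using laurent_eval_add laurent_eval_mult by blast
qed

lemma laurent_eval_var: "laurent_eval v (laurent_var i) = v i"
 unfolding laurent_var_def using laurent_eval_single[of "Poly_Mapping.single i 1" 1] by (simp add: monomial_eval_def)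

lemma laurent_eval_in_subring:
 assumes R: "is_subring R" and vi: "!!i. i : S ==> v i : R & inverse (v i) : R" and p: "p : laurent_ring S"
 shows "laurent_eval v p : R"
 unfolding laurent_eval_def
proof (rule is_subring_sum[OF R], rule is_subringD(4)[OF R is_subring_of_int[OF R]], rule is_subring_prod[OF R])
 fix k i assume "k : Poly_Mapping.keys p" "i : Poly_Mapping.keys k"
 then have "i : S" using p unfolding laurent_ring_def by blast
 then show "v i powi Poly_Mapping.lookup k i : R"
  using vi is_subring_power[OF R] by (auto simp: power_int_def)
qed

end

lemma laurent_ring_subring: "is_subring (laurent_ring S)"
 unfolding is_subring_def
proof (intro conjI ballI)
 show "1 : laurent_ring S" unfolding laurent_ring_def by (simp add: Poly_Mapping.keys_one)
 fix p q assume p: "p : laurent_ring S" and q: "q : laurent_ring S"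
 show "p - q : laurent_ring S" using p q unfolding laurent_ring_def by (auto dest!: subsetD[OF Poly_Mapping.keys_diff])
 show "p * q : laurent_ring S"
  unfolding laurent_ring_def
 proof (intro CollectI ballI)
  fix k assume "k : Poly_Mapping.keys (p * q)"
  then obtain a b where "k = a + b" "a : Poly_Mapping.keys p" "b : Poly_Mapping.keys q"
  using Poly_Mapping.keys_mult by blast
  then show "Poly_Mapping.keys k \<subseteq> S"
  using p q Poly_Mapping.keys_add[of a b] unfolding laurent_ring_def by blast
 qed
qed

lemma laurent_var_in_ring: "i : S ==> laurent_var i : laurent_ring S"
 unfolding laurent_var_def laurent_ring_def by simp

section \<open>Hecke algebras as quotients of group algebras\<close>

context reflection_arrangement
begin

lemma braid_reflection_carrier:
 assumes "braid_reflection P x0 H b"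
 shows "H : hyperplanes P" "b : carrier (braid_group P x0)"
proof -
 obtain s \<gamma> y v where H: "H : hyperplanes P" and s: "s : fixator P H" "s *v v = zeta (hyp_order P H) *s v"
  and y: "y : H" "\<forall>z. 0 < cmod z & cmod z \<le> 1 --> y + z *s v : regular P"
  and \<gamma>: "path \<gamma>" "path_image \<gamma> \<subseteq> regular P" "pathstart \<gamma> = x0" "pathfinish \<gamma> = y + v"
  and b: "b = (s, path_class P (\<gamma> +++ (%t. y + cis (2 * pi * t / of_nat (hyp_order P H)) *s v) +++ reversepath (%t. s *v \<gamma> t)))"
  using assms unfolding braid_reflection_def by (elim conjE exE) (rule that; assumption)
 show "H : hyperplanes P" by (rule H)
 let ?e = "hyp_order P H"
 define arc where "arc t = y + cis (2 * pi * t / of_nat ?e) *s v" for t :: real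
 have sP: "s : P" using s unfolding fixator_def by blast
 have sy: "s *v y = y" using s(1) y(1) unfolding fixator_def by blast
 have arc: "path arc" "path_image arc \<subseteq> regular P" "pathstart arc = y + v"
 proof -
  show "path arc" unfolding path_def arc_def divide_inverse by (intro continuous_intros)
  have "arc t : regular P" for t unfolding arc_def using y(2) by simp
  then show "path_image arc \<subseteq> regular P" unfolding path_image_def by blast
  show "pathstart arc = y + v" unfolding pathstart_def arc_def by simp
 qed
 have z: "zeta ?e = cis (2 * pi / real ?e)" unfolding zeta_def cis_conv_exp by (simp add: mult_ac)
 have fin: "pathfinish arc = s *v (y + v)"
  unfolding pathfinish_def arc_def matrix_vector_right_distrib sy s(2) z by simp
 have "braid_path s (\<gamma> +++ arc +++ reversepath (%t. s *v \<gamma> t))"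
  unfolding braid_path_def using sP \<gamma> arc fin action_path[OF sP \<gamma>(1,2)] by (auto simp: subset_path_image_join)
 from braid_pathD(6)[OF this] show "b : carrier (braid_group P x0)" unfolding b arc_def .
qed

abbreviation "B \<equiv> braid_group P x0"

text \<open>The defining relator in terms of \<open>conv\<close>, the same expression over every coefficient ring.\<close>

definition relator :: "('n hidx => 'k::comm_ring_1) => (complex ^ 'n) set => 'n braid => 'n braid => 'k" where
 "relator u H b = foldr (%j a. conv B (%z. single_elt 1 b z - single_elt (u (hyp_orbit P H, j)) \<one>\<^bsub>B\<^esub> z) a)
  [0..<hyp_order P H] (single_elt 1 \<one>\<^bsub>B\<^esub>)"

lemma one_braid: "\<one>\<^bsub>B\<^esub> : carrier B"
 using monoid.one_closed[OF group.is_monoid[OF braid_group_is_group]] .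

lemma mult_braid: "x : carrier B ==> y : carrier B ==> x \<otimes>\<^bsub>B\<^esub> y : carrier B"
 using monoid.m_closed[OF group.is_monoid[OF braid_group_is_group]] .

lemma relator_props:
 assumes R: "is_subring R" and u: "!!i. i : hidx_set P ==> u i : R" and b: "braid_reflection P x0 H b"
 shows "hecke_relator R u P x0 H b = relator u H b" "relator u H b : carrier (group_algebra R B)"
proof -
 note H = braid_reflection_carrier[OF b]
 have uj: "u (hyp_orbit P H, j) : R" if "j < hyp_order P H" for j
  by (rule u) (use H(1) that in \<open>auto simp: hidx_set_def\<close>)
 have "foldr (%j a. (single_elt 1 b \<ominus>\<^bsub>group_algebra R B\<^esub> single_elt (u (hyp_orbit P H, j)) \<one>\<^bsub>B\<^esub>) \<otimes>\<^bsub>group_algebra R B\<^esub> a) js (single_elt 1 \<one>\<^bsub>B\<^esub>)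
  = foldr (%j a. conv B (%z. single_elt 1 b z - single_elt (u (hyp_orbit P H, j)) \<one>\<^bsub>B\<^esub> z) a) js (single_elt 1 \<one>\<^bsub>B\<^esub>) &
  foldr (%j a. conv B (%z. single_elt 1 b z - single_elt (u (hyp_orbit P H, j)) \<one>\<^bsub>B\<^esub> z) a) js (single_elt 1 \<one>\<^bsub>B\<^esub>) : carrier (group_algebra R B)"
  if "set js \<subseteq> {..<hyp_order P H}" for js
  using that
 proof (induction js)
  case Nil
  then show ?case by (simp add: single_closed[OF R] is_subringD[OF R] one_braid)
 next
  case (Cons j js)
  have c: "single_elt 1 b : carrier (group_algebra R B)" "single_elt (u (hyp_orbit P H, j)) \<one>\<^bsub>B\<^esub> : carrier (group_algebra R B)"
  using Cons.prems uj by (auto intro!: single_closed[OF R] is_subringD[OF R] one_braid H)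
  have m: "single_elt 1 b \<ominus>\<^bsub>group_algebra R B\<^esub> single_elt (u (hyp_orbit P H, j)) \<one>\<^bsub>B\<^esub> = (%z. single_elt 1 b z - single_elt (u (hyp_orbit P H, j)) \<one>\<^bsub>B\<^esub> z)"
  by (rule group_algebra_minus[OF R braid_group_is_group c])
  have "(%z. single_elt 1 b z - single_elt (u (hyp_orbit P H, j)) \<one>\<^bsub>B\<^esub> z) : carrier (group_algebra R B)"
  using ring.ring_simprules(4)[OF group_algebra_ring[OF R braid_group_is_group] c] unfolding m .
  then show ?case using Cons m conv_closed[OF R braid_group_is_group] by simp
 qed
 from this[of "[0..<hyp_order P H]"]
 show "hecke_relator R u P x0 H b = relator u H b" "relator u H b : carrier (group_algebra R B)"
  unfolding hecke_relator_def relator_def Let_def by (simp_all add: atLeast_upt[symmetric] lessThan_atLeast0)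
qed

end

text \<open>The parameters are required to lie in the coefficient ring, so that the defining relations do.\<close>

locale hecke_alg = reflection_arrangement P x0 for P :: "('n::finite) cmat set" and x0 +
 fixes R :: "'k::comm_ring_1 set" and u :: "'n hidx => 'k"
 assumes R: "is_subring R" and u: "!!i. i : hidx_set P ==> u i : R"
begin

abbreviation "A \<equiv> group_algebra R B"
abbreviation "I \<equiv> hecke_ideal R u P x0"
abbreviation "HA \<equiv> hecke R u P x0"
abbreviation "cls \<equiv> hecke_class R u P x0"

lemma A_ring: "ring A" by (rule group_algebra_ring[OF R braid_group_is_group])

lemma relator_in: "braid_reflection P x0 H b ==> relator u H b : carrier A"
 by (rule relator_props(2)[where u = u, OF R u])

lemma I_eq: "I = Idl\<^bsub>A\<^esub> {relator u H b | H b. braid_reflection P x0 H b}"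
proof -
 have "{hecke_relator R u P x0 H b | H b. braid_reflection P x0 H b} = {relator u H b | H b. braid_reflection P x0 H b}"
 proof (intro Collect_cong ex_cong1)
  fix f H b
  show "(f = hecke_relator R u P x0 H b & braid_reflection P x0 H b) = (f = relator u H b & braid_reflection P x0 H b)"
  using relator_props(1)[where u = u, OF R u, of H b] by (cases "braid_reflection P x0 H b") simp_all
 qed
 then show ?thesis unfolding hecke_ideal_def by simp
qed

lemma relators_subset: "{relator u H b | H b. braid_reflection P x0 H b} \<subseteq> carrier A"
proof
 fix f assume "f : {relator u H b | H b. braid_reflection P x0 H b}"
 then obtain H b where "f = relator u H b" "braid_reflection P x0 H b" by blast
 then show "f : carrier A" using relator_in by simp
qed

lemma I_ideal: "ideal I A"
 unfolding I_eq by (rule ring.genideal_ideal[OF A_ring relators_subset])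

lemma I_relator: assumes "braid_reflection P x0 H b" shows "relator u H b : I"
proof -
 have "relator u H b : {relator u H b | H b. braid_reflection P x0 H b}" using assms by blast
 then show ?thesis unfolding I_eq by (rule subsetD[OF ring.genideal_self[OF A_ring relators_subset]])
qed

lemma I_minimal: assumes "ideal J A" "!!H b. braid_reflection P x0 H b ==> relator u H b : J" shows "I \<subseteq> J"
proof -
 have "{relator u H b | H b. braid_reflection P x0 H b} \<subseteq> J"
 proof
  fix f assume "f : {relator u H b | H b. braid_reflection P x0 H b}"
  then obtain H b where "f = relator u H b" "braid_reflection P x0 H b" by blast
  then show "f : J" using assms(2) by simp
 qed
 then show ?thesis unfolding I_eq by (rule ring.genideal_minimal[OF A_ring assms(1)])
qed

lemma I_carrier: "a : I ==> a : carrier A" by (rule ideal.Icarr[OF I_ideal])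

lemma I_add: "a : I ==> b : I ==> (%z. a z + b z) : I"
 using additive_subgroup.a_closed[OF ideal.axioms(1)[OF I_ideal]] by simp

lemma I_zero: "(%z. 0) : I"
 using additive_subgroup.zero_closed[OF ideal.axioms(1)[OF I_ideal]] by simp

lemma I_conv: "a : I ==> x : carrier A ==> conv B x a : I" "a : I ==> x : carrier A ==> conv B a x : I"
 using ideal.I_l_closed[OF I_ideal] ideal.I_r_closed[OF I_ideal] by simp_all

lemma I_scale: assumes a: "a : I" and c: "c : R" shows "(%z. c * a z) : I"
proof -
 have "conv B (single_elt c \<one>\<^bsub>B\<^esub>) a : I" by (rule I_conv(1)[OF a single_closed[OF R c one_braid]])
 then show ?thesis using conv_single_one(1)[OF braid_group_is_group carrier_UNIV[OF I_carrier[OF a]]] by simp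
qed

lemma H_ring: "ring HA" unfolding hecke_def by (rule ideal.quotient_is_ring[OF I_ideal])

lemma cls_hom: "cls : Ring.ring_hom A HA"
 unfolding hecke_def using ideal.rcos_ring_hom[OF I_ideal] by (simp add: hecke_class_def[abs_def])

lemma cls_closed: "a : carrier A ==> cls a : carrier HA" using ring_hom_closed[OF cls_hom] .
lemma cls_mult: "a : carrier A ==> b : carrier A ==> cls a \<otimes>\<^bsub>HA\<^esub> cls b = cls (conv B a b)" using ring_hom_mult[OF cls_hom] by simp
lemma cls_add: "a : carrier A ==> b : carrier A ==> cls a \<oplus>\<^bsub>HA\<^esub> cls b = cls (%z. a z + b z)" using ring_hom_add[OF cls_hom] by simp
lemma cls_one: "cls (single_elt 1 \<one>\<^bsub>B\<^esub>) = \<one>\<^bsub>HA\<^esub>" using ring_hom_one[OF cls_hom] by simp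

lemma cls_surj: assumes "x : carrier HA" obtains a where "a : carrier A" "x = cls a"
 using assms unfolding hecke_def FactRing_def A_RCOSETS_def' hecke_class_def by auto

lemma cls_eq: "a : carrier A ==> b : carrier A ==> cls a = cls b \<longleftrightarrow> (%z. a z - b z) : I"
 unfolding hecke_class_def using ring.quotient_eq_iff_same_a_r_cos[OF A_ring I_ideal, of a b]
 by (simp add: group_algebra_minus[OF R braid_group_is_group])

lemma cls_zero_fun: "cls (%z. 0) = \<zero>\<^bsub>HA\<^esub>"
proof -
 have "cls (%z. 0) \<oplus>\<^bsub>HA\<^esub> cls (%z. 0) = cls (%z. 0)"
  using cls_add[OF zero_closed[OF R] zero_closed[OF R]] by simp
 then show ?thesis using ring.ring_simprules(2)[OF H_ring] cls_closed[OF zero_closed[OF R]]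
  by (metis abelian_group.r_neg1 abelian_group.l_neg H_ring ring.is_abelian_group)
qed

lemma cls_zero: "a : carrier A ==> cls a = \<zero>\<^bsub>HA\<^esub> \<longleftrightarrow> a : I"
 using cls_eq[OF _ zero_closed[OF R], of a] cls_zero_fun by simp

lemma cls_memD: assumes "a : cls b" "b : carrier A" shows "a : carrier A" "cls a = cls b"
proof -
 obtain i where i: "i : I" "a = (%z. i z + b z)"
  using assms unfolding hecke_class_def a_r_coset_def' by auto
 show a: "a : carrier A" unfolding i(2) by (rule add_closed[OF R I_carrier[OF i(1)] assms(2)])
 show "cls a = cls b" unfolding cls_eq[OF a assms(2)] using i by simp
qed

lemma scal_eq: "hecke_scal R u P x0 c = cls (single_elt c \<one>\<^bsub>B\<^esub>)" unfolding hecke_scal_def ..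
lemma T_eq: "hecke_T R u P x0 b = cls (single_elt 1 b)" unfolding hecke_T_def ..

lemma scal_mult: 
 assumes "c : R" "a : carrier A"
 shows "hecke_scal R u P x0 c \<otimes>\<^bsub>HA\<^esub> cls a = cls (%z. c * a z)" "cls a \<otimes>\<^bsub>HA\<^esub> hecke_scal R u P x0 c = cls (%z. c * a z)"
 unfolding scal_eq using cls_mult[OF single_closed[OF R assms(1) one_braid] assms(2)] cls_mult[OF assms(2) single_closed[OF R assms(1) one_braid]]
 by (simp_all add: conv_single_one[OF braid_group_is_group carrier_UNIV[OF assms(2)]])

end

section \<open>Base change\<close>

text \<open>A specialization of the parameters: \<open>h\<close> is a ring homomorphism that carries the first parameters to the second.\<close>

locale hecke_base_change = hecke_alg P x0 R u + target: hecke_alg P x0 R' u'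
 for P :: "('n::finite) cmat set" and x0 and R :: "'k::comm_ring_1 set" and u and R' :: "'l::comm_ring_1 set" and u' +
 fixes h :: "'k => 'l"
 assumes hom: "coeff_hom h" and hR: "!!x. x : R ==> h x : R'" and hu: "!!i. i : hidx_set P ==> h (u i) = u' i"
begin

lemma map_coeffs_closed:
 assumes a: "a : carrier A" shows "map_coeffs h a : carrier target.A"
 unfolding group_algebra_carrier
proof (intro conjI allI impI)
 show "fin_supp (map_coeffs h a)" by (rule map_coeffs_support[OF hom carrierD(1)[OF a]])
 show "map_coeffs h a b : R'" for b unfolding map_coeffs_def by (rule hR[OF carrierD(3)[OF a]])
 show "b : carrier B" if "map_coeffs h a b ~= 0" for b
  by (rule carrierD(2)[OF a]) (use that coeff_homD(4)[OF hom] in \<open>auto simp: map_coeffs_def\<close>)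
qed

lemma map_coeffs_single: "map_coeffs h (single_elt c b) = single_elt (h c) b"
 unfolding map_coeffs_def single_elt_def by (auto simp: coeff_homD(4)[OF hom])

lemma map_coeffs_relator:
 assumes b: "braid_reflection P x0 H b"
 shows "map_coeffs h (relator u H b) = relator u' H b"
proof -
 note H = braid_reflection_carrier[OF b]
 have "map_coeffs h (foldr (%j a. conv B (%z. single_elt 1 b z - single_elt (u (hyp_orbit P H, j)) \<one>\<^bsub>B\<^esub> z) a) js (single_elt 1 \<one>\<^bsub>B\<^esub>))
  = foldr (%j a. conv B (%z. single_elt 1 b z - single_elt (u' (hyp_orbit P H, j)) \<one>\<^bsub>B\<^esub> z) a) js (single_elt 1 \<one>\<^bsub>B\<^esub>) &
  fin_supp (foldr (%j a. conv B (%z. single_elt 1 b z - single_elt (u (hyp_orbit P H, j)) \<one>\<^bsub>B\<^esub> z) a) js (single_elt 1 \<one>\<^bsub>B\<^esub>))"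
  if "set js \<subseteq> {..<hyp_order P H}" for js
  using that
 proof (induction js)
  case Nil
  then show ?case by (simp add: map_coeffs_single coeff_homD(1)[OF hom] fin_supp_single)
 next
  case (Cons j js)
  have "(hyp_orbit P H, j) : hidx_set P" using H(1) Cons.prems unfolding hidx_set_def by auto
  then have m: "map_coeffs h (%z. single_elt 1 b z - single_elt (u (hyp_orbit P H, j)) \<one>\<^bsub>B\<^esub> z) = (%z. single_elt 1 b z - single_elt (u' (hyp_orbit P H, j)) \<one>\<^bsub>B\<^esub> z)"
  using hu unfolding map_coeffs_def single_elt_def by (auto simp: coeff_homD[OF hom])
  have s: "fin_supp (%z. single_elt 1 b z - single_elt (u (hyp_orbit P H, j)) \<one>\<^bsub>B\<^esub> z)"
  by (rule finite_subset[of _ "{b, \<one>\<^bsub>B\<^esub>}"]) (auto simp: single_elt_def)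
  have js: "set js \<subseteq> {..<hyp_order P H}" using Cons.prems by simp
  note IH = conjunct1[OF Cons.IH[OF js]] conjunct2[OF Cons.IH[OF js]]
  show ?case
  unfolding foldr.simps comp_def map_coeffs_conv[OF hom s IH(2)] m IH(1)
  by (rule conjI[OF HOL.refl conv_support(1)[OF s IH(2)]])
 qed
 from this[of "[0..<hyp_order P H]"] show ?thesis unfolding relator_def by (simp add: lessThan_atLeast0)
qed

lemma map_coeffs_ideal: 
 assumes "a : I" shows "map_coeffs h a : target.I"
proof -
 let ?J = "{a : carrier A. map_coeffs h a : target.I}"
 have "ideal ?J A"
 proof (rule idealI[OF A_ring])
  show "subgroup ?J (add_monoid A)"
  proof (rule group.subgroupI)
  show "group (add_monoid A)" using abelian_group.a_group[OF ring.is_abelian_group[OF A_ring]] .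
  show "?J \<subseteq> carrier (add_monoid A)" by auto
  have "map_coeffs h (%z :: 'n braid. 0) = (%z. 0)" unfolding map_coeffs_def by (simp add: coeff_homD(4)[OF hom])
  then have "(%z. 0) : ?J" using zero_closed[OF R, of B] target.I_zero by simp
  then show "?J ~= {}" by blast
  fix a assume a: "a : ?J"
  have m1: "- 1 : R" "- 1 : R'" using is_subringD[OF R] is_subringD[OF target.R] by auto
  have n: "(%z. - 1 * a z) : carrier A" by (rule scale_closed[OF R m1(1)]) (use a in simp)
  have "inv\<^bsub>add_monoid A\<^esub> a = (%z. - 1 * a z)"
  proof -
  have "\<ominus>\<^bsub>A\<^esub> a = (%z. - 1 * a z)"
  by (rule abelian_group.minus_equality[OF ring.is_abelian_group[OF A_ring] _ _ n]) (use a in simp_all)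
  then show ?thesis unfolding a_inv_def .
  qed
  moreover have "map_coeffs h (%z. - 1 * a z) = (%z. - 1 * map_coeffs h a z)"
  unfolding map_coeffs_def by (simp add: coeff_homD(5)[OF hom])
  ultimately show "inv\<^bsub>add_monoid A\<^esub> a : ?J" using target.I_scale[OF _ m1(2), of "map_coeffs h a"] a n by simp
  fix b assume b: "b : ?J"
  have "map_coeffs h (%z. a z + b z) = (%z. map_coeffs h a z + map_coeffs h b z)"
  unfolding map_coeffs_def by (simp add: coeff_homD(2)[OF hom])
  moreover have "a : carrier A" "b : carrier A" using a b by auto
  moreover have "(%z. map_coeffs h a z + map_coeffs h b z) : target.I" by (rule target.I_add) (use a b in auto)
  ultimately show "a \<otimes>\<^bsub>add_monoid A\<^esub> b : ?J" using add_closed[OF R, of a B b] by simp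
  qed
  fix a x assume a: "a : ?J" and x: "x : carrier A"
  have aA: "a : carrier A" and aI: "map_coeffs h a : target.I" using a by auto
  note m = map_coeffs_conv[OF hom carrierD(1)[OF aA] carrierD(1)[OF x], where G = B] map_coeffs_conv[OF hom carrierD(1)[OF x] carrierD(1)[OF aA], where G = B]
  show "x \<otimes>\<^bsub>A\<^esub> a : ?J" "a \<otimes>\<^bsub>A\<^esub> x : ?J"
  using m conv_closed[OF R braid_group_is_group aA x] conv_closed[OF R braid_group_is_group x aA]
  target.I_conv[OF aI map_coeffs_closed[OF x]] by simp_all
 qed
 moreover have "relator u H b : ?J" if "braid_reflection P x0 H b" for H b
  using relator_in[OF that] map_coeffs_relator[OF that] target.I_relator[OF that] by simp
 ultimately have "I \<subseteq> ?J" by (rule I_minimal)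
 then show ?thesis using assms by blast
qed

end

section \<open>Coordinates of a free Hecke algebra\<close>

context hecke_alg
begin

text \<open>A basis of the quotient algebra, seen from the group algebra: the vectors \<open>bv i\<close> represent the basis, and the functions \<open>co i\<close> are coordinate forms on the group algebra that vanish on the ideal. In this form a basis can be transported along base change.\<close>

definition coordinate_system :: "nat => (nat => 'n braid => 'k) => (nat => 'n braid => 'k) => bool" where
 "coordinate_system N co bv \<longleftrightarrow>
  (\<forall>i<N. bv i : carrier A & (\<forall>b\<in>carrier B. co i b : R) & (\<forall>a\<in>I. lin_ext (co i) a = 0)) &
  (\<forall>i<N. \<forall>j<N. lin_ext (co i) (bv j) = (if i = j then 1 else 0)) &
  (\<forall>a\<in>carrier A. (%z. a z - (\<Sum>i<N. lin_ext (co i) a * bv i z)) : I)"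

lemma coordinate_systemD:
 assumes "coordinate_system N co bv"
 shows "i < N ==> bv i : carrier A" "i < N ==> b : carrier B ==> co i b : R" "i < N ==> a : I ==> lin_ext (co i) a = 0"
  "i < N ==> j < N ==> lin_ext (co i) (bv j) = (if i = j then 1 else 0)"
  "a : carrier A ==> (%z. a z - (\<Sum>i<N. lin_ext (co i) a * bv i z)) : I"
proof -
 note c = assms[unfolded coordinate_system_def]
 note c1 = mp[OF spec[OF conjunct1[OF c]]] and c2 = mp[OF spec[OF mp[OF spec[OF conjunct1[OF conjunct2[OF c]]]]]]
  and c3 = bspec[OF conjunct2[OF conjunct2[OF c]]]
 show "i < N ==> bv i : carrier A" by (rule conjunct1[OF c1])
 show "i < N ==> b : carrier B ==> co i b : R" by (rule bspec[OF conjunct1[OF conjunct2[OF c1]]])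
 show "i < N ==> a : I ==> lin_ext (co i) a = 0" by (rule bspec[OF conjunct2[OF conjunct2[OF c1]]])
 show "i < N ==> j < N ==> lin_ext (co i) (bv j) = (if i = j then 1 else 0)" by (rule c2)
 show "a : carrier A ==> (%z. a z - (\<Sum>i<N. lin_ext (co i) a * bv i z)) : I" by (rule c3)
qed

lemma cls_finsum:
 assumes "finite S" "!!i. i : S ==> f i : carrier A"
 shows "(\<Oplus>\<^bsub>HA\<^esub>i\<in>S. cls (f i)) = cls (%z. \<Sum>i\<in>S. f i z)"
 using assms
proof (induction S rule: finite_induct)
 case empty
 then show ?case using cls_zero_fun ring.is_abelian_group[OF H_ring]
  by (simp add: abelian_monoid.finsum_empty[OF abelian_group.axioms(1)])
next
 case (insert i S)
 interpret HA: ring HA by (rule H_ring)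
 have s: "(%z. \<Sum>i\<in>S. f i z) : carrier A" by (rule sum_closed[OF R]) (use insert in simp)
 have f: "f i : carrier A" using insert.prems by simp
 have m: "(%i. cls (f i)) : S \<rightarrow> carrier HA" using insert.prems cls_closed by auto
 have IH: "(\<Oplus>\<^bsub>HA\<^esub>i\<in>S. cls (f i)) = cls (%z. \<Sum>i\<in>S. f i z)" by (rule insert.IH) (use insert.prems in simp)
 show ?case unfolding HA.finsum_insert[OF insert.hyps m cls_closed[OF f]] IH cls_add[OF f s] sum.insert[OF insert.hyps] ..
qed

lemma free_imp_coordinate_system:
 assumes "free_fg R HA (hecke_scal R u P x0)"
 shows "\<exists>N co bv. coordinate_system N co bv"
proof -
 let ?sc = "hecke_scal R u P x0"
 from assms obtain E where E0: "finite E & E \<subseteq> carrier HA & (\<forall>x\<in>carrier HA. \<exists>!c. c : E \<rightarrow>\<^sub>E R & x = (\<Oplus>\<^bsub>HA\<^esub>e\<in>E. ?sc (c e) \<otimes>\<^bsub>HA\<^esub> e))"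
  unfolding free_fg_def ..
 note E = conjunct1[OF E0] conjunct1[OF conjunct2[OF E0]]
 note ex1 = bspec[OF conjunct2[OF conjunct2[OF E0]]]
 have "\<exists>a. a : carrier A & e = cls a" if "e : E" for e
  by (rule cls_surj[OF subsetD[OF E(2) that]]) (rule exI, rule conjI)
 then obtain lift where lift: "!!e. e : E ==> lift e : carrier A & e = cls (lift e)" by metis
 define comb where "comb c = (%z. \<Sum>e\<in>E. c e * lift e z)" for c
 have combA: "comb c : carrier A" if "!!e. e : E ==> c e : R" for c
  unfolding comb_def by (rule sum_closed[OF R scale_closed[OF R]]) (use that lift in auto)
 have comb: "(\<Oplus>\<^bsub>HA\<^esub>e\<in>E. ?sc (c e) \<otimes>\<^bsub>HA\<^esub> e) = cls (comb c)" if c: "!!e. e : E ==> c e : R" for c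
 proof -
  interpret HA: ring HA by (rule H_ring)
  have t: "?sc (c e) \<otimes>\<^bsub>HA\<^esub> e = cls (%z. c e * lift e z)" if e: "e : E" for e
  proof -
  have "?sc (c e) \<otimes>\<^bsub>HA\<^esub> cls (lift e) = cls (%z. c e * lift e z)"
  by (rule scal_mult(1)[OF c[OF e]]) (use lift[OF e] in blast)
  then show ?thesis using lift[OF e] by simp
  qed
  have l: "(%z. c e * lift e z) : carrier A" if "e : E" for e by (rule scale_closed[OF R c[OF that]]) (use lift[OF that] in blast)
  have "(\<Oplus>\<^bsub>HA\<^esub>e\<in>E. ?sc (c e) \<otimes>\<^bsub>HA\<^esub> e) = (\<Oplus>\<^bsub>HA\<^esub>e\<in>E. cls (%z. c e * lift e z))"
  by (rule HA.finsum_cong') (use t cls_closed[OF l] in auto)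
  also have "... = cls (comb c)" unfolding comb_def by (rule cls_finsum[OF E(1) l])
  finally show ?thesis .
 qed
 have ex: "\<exists>c. c : E \<rightarrow>\<^sub>E R & cls a = cls (comb c)" if a: "a : carrier A" for a
 proof -
  obtain c where c0: "c : E \<rightarrow>\<^sub>E R & cls a = (\<Oplus>\<^bsub>HA\<^esub>e\<in>E. ?sc (c e) \<otimes>\<^bsub>HA\<^esub> e)" using ex1_implies_ex[OF ex1[OF cls_closed[OF a]]] ..
  note c = conjunct1[OF c0] conjunct2[OF c0]
  have "(\<Oplus>\<^bsub>HA\<^esub>e\<in>E. ?sc (c e) \<otimes>\<^bsub>HA\<^esub> e) = cls (comb c)" by (rule comb) (use c(1) in auto)
  from c(2)[unfolded this] c(1) show ?thesis by (intro exI conjI)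
 qed
 have uniq: "c e = c' e" if c: "!!e. e : E ==> c e : R" "!!e. e : E ==> c' e : R" and eq: "cls (comb c) = cls (comb c')" and e: "e : E" for c c' e
 proof -
  let ?c = "restrict c E" and ?c' = "restrict c' E"
  have r: "comb ?c = comb c" "comb ?c' = comb c'" unfolding comb_def by (auto intro!: ext sum.cong)
  have m: "?c : E \<rightarrow>\<^sub>E R" "?c' : E \<rightarrow>\<^sub>E R" using c by auto
  have cr: "?c e : R" "?c' e : R" if "e : E" for e using c that by simp_all
  have x: "cls (comb c) = (\<Oplus>\<^bsub>HA\<^esub>e\<in>E. ?sc (?c e) \<otimes>\<^bsub>HA\<^esub> e)" "cls (comb c) = (\<Oplus>\<^bsub>HA\<^esub>e\<in>E. ?sc (?c' e) \<otimes>\<^bsub>HA\<^esub> e)"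
  by (rule comb[of ?c, OF cr(1), unfolded r(1), symmetric], assumption,
  rule trans[OF eq comb[of ?c', OF cr(2), unfolded r(2), symmetric]], assumption)
  have "?c = ?c'"
  proof (rule alt_ex1E[OF ex1[OF cls_closed[OF combA[OF c(1)]]]])
  show "e : E" if "e : E" for e using that .
  assume u: "\<forall>y y'. (y : E \<rightarrow>\<^sub>E R & cls (comb c) = (\<Oplus>\<^bsub>HA\<^esub>e\<in>E. ?sc (y e) \<otimes>\<^bsub>HA\<^esub> e)) &
  (y' : E \<rightarrow>\<^sub>E R & cls (comb c) = (\<Oplus>\<^bsub>HA\<^esub>e\<in>E. ?sc (y' e) \<otimes>\<^bsub>HA\<^esub> e)) --> y = y'"
  from mp[OF spec[OF spec[OF u, of ?c], of ?c'] conjI[OF conjI[OF m(1) x(1)] conjI[OF m(2) x(2)]]] show "?c = ?c'" .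
  qed
  from fun_cong[OF this, of e] show ?thesis using e by simp
 qed
 define coord where "coord a = (SOME c. c : E \<rightarrow>\<^sub>E R & cls a = cls (comb c))" for a
 have cE: "coord a : E \<rightarrow>\<^sub>E R" and cc: "cls a = cls (comb (coord a))" if "a : carrier A" for a
  using someI_ex[OF ex[OF that]] unfolding coord_def by blast+
 have cR: "coord a e : R" if "a : carrier A" "e : E" for a e using cE[OF that(1)] that(2) by auto
 have coord_eq: "coord a e = c e" if a: "a : carrier A" and c: "!!e. e : E ==> c e : R" and eq: "cls a = cls (comb c)" and e: "e : E" for a c e
  by (rule uniq[OF cR[OF a] c _ e]) (use cc[OF a] eq in auto)
 have comb_minus: "(%z. a z - comb (coord a) z) : I" if a: "a : carrier A" for a
  using iffD1[OF cls_eq[OF a combA[of "coord a", OF cR[OF a]]] cc[OF a]] by simp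
 have coord_add: "coord (%z. f z + g z) e = coord f e + coord g e" if f: "f : carrier A" and g: "g : carrier A" and e: "e : E" for f g e
 proof (rule coord_eq[OF add_closed[OF R f g] _ _ e])
  show "coord f e + coord g e : R" if "e : E" for e using cR[OF f that] cR[OF g that] is_subringD(6)[OF R] by blast
  then have s: "comb (%e. coord f e + coord g e) : carrier A" by (rule combA)
  have "(%z. (f z - comb (coord f) z) + (g z - comb (coord g) z)) : I" by (rule I_add[OF comb_minus[OF f] comb_minus[OF g]])
  moreover have "(%z. (f z - comb (coord f) z) + (g z - comb (coord g) z)) = (%z. (f z + g z) - comb (%e. coord f e + coord g e) z)"
  unfolding comb_def by (rule ext) (simp add: distrib_right sum.distrib)
  ultimately show "cls (%z. f z + g z) = cls (comb (%e. coord f e + coord g e))"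
  using cls_eq[OF add_closed[OF R f g] s] by simp
 qed
 have coord_scale: "coord (%z. r * f z) e = r * coord f e" if f: "f : carrier A" and r: "r : R" and e: "e : E" for f r e
 proof (rule coord_eq[OF scale_closed[OF R r f] _ _ e])
  show "r * coord f e : R" if "e : E" for e using cR[OF f that] r is_subringD(4)[OF R] by blast
  then have s: "comb (%e. r * coord f e) : carrier A" by (rule combA)
  have "(%z. r * (f z - comb (coord f) z)) : I" by (rule I_scale[OF comb_minus[OF f] r])
  moreover have "(%z. r * (f z - comb (coord f) z)) = (%z. r * f z - comb (%e. r * coord f e) z)"
  unfolding comb_def by (rule ext) (simp add: right_diff_distrib sum_distrib_left mult.assoc)
  ultimately show "cls (%z. r * f z) = cls (comb (%e. r * coord f e))"
  using cls_eq[OF scale_closed[OF R r f] s] by simp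
 qed
 have coord_I: "coord a e = 0" if a: "a : I" and e: "e : E" for a e
 proof (rule coord_eq[OF I_carrier[OF a] _ _ e])
  show "0 : R" by (rule is_subringD(2)[OF R])
  have "comb (%e. 0) = (%z. 0)" unfolding comb_def by simp
  then show "cls a = cls (comb (%e. 0))" using cls_zero[OF I_carrier[OF a]] a cls_zero_fun by simp
 qed
 have coord_lift: "coord (lift e') e = (if e = e' then 1 else 0)" if e: "e : E" "e' : E" for e e'
 proof (rule coord_eq[OF _ _ _ e(1)])
  show "lift e' : carrier A" using lift e by blast
  show "(if e = e' then 1 else 0) : R" for e using is_subringD(1,2)[OF R] by simp
  have "comb (%e. if e = e' then 1 else 0) = lift e'" unfolding comb_def using E(1) e(2) by (simp add: if_distrib if_distribR sum.delta cong: if_cong)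
  then show "cls (lift e') = cls (comb (%e. if e = e' then 1 else 0))" by simp
 qed
 define k where "k e b = coord (single_elt 1 b) e" for e b
 have lin: "coord f e = lin_ext (k e) f" if f: "f : carrier A" and e: "e : E" for f e
 proof (rule linear_on_group_algebra[where F = "%f. coord f e", OF f R])
  show "coord (%z. 0) e = 0" by (rule coord_I[OF I_zero e])
  fix c b assume c: "c : R" and b: "b : carrier B"
  have "single_elt c b = (%z. c * single_elt 1 b z)" unfolding single_elt_def by auto
  then show "coord (single_elt c b) e = c * k e b" unfolding k_def
  using coord_scale[OF single_closed[OF R is_subringD(1)[OF R] b] c e] by simp
 qed (rule coord_add[OF _ _ e])
 obtain N and v :: "nat => _" where v: "bij_betw v {..<N} E"
  using ex_bij_betw_nat_finite[OF E(1)] by (metis lessThan_atLeast0)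
 have vE: "v i : E" if "i < N" for i using bij_betwE[OF v] that by blast
 have "coordinate_system N (%i. k (v i)) (%i. lift (v i))"
  unfolding coordinate_system_def
 proof (intro conjI allI impI ballI)
  fix i assume i: "i < N"
  note e = vE[OF i]
  show "lift (v i) : carrier A" using lift[OF e] by blast
  show "k (v i) b : R" if "b : carrier B" for b
  unfolding k_def by (rule cR[OF single_closed[OF R is_subringD(1)[OF R] that] e])
  show "lin_ext (k (v i)) a = 0" if a: "a : I" for a using lin[OF I_carrier[OF a] e] coord_I[OF a e] by simp
  fix j assume j: "j < N"
  have "v i = v j \<longleftrightarrow> i = j" using v i j unfolding bij_betw_def inj_on_def by auto
  then show "lin_ext (k (v i)) (lift (v j)) = (if i = j then 1 else 0)"
  using lin[OF _ e, of "lift (v j)"] coord_lift[OF e vE[OF j]] lift[OF vE[OF j]] by auto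
 next
  fix a assume a: "a : carrier A"
  have "comb (coord a) z = (\<Sum>i<N. lin_ext (k (v i)) a * lift (v i) z)" for z
  proof -
  have "comb (coord a) z = (\<Sum>i<N. coord a (v i) * lift (v i) z)"
  unfolding comb_def by (rule sum.reindex_bij_betw[OF v, symmetric])
  also have "... = (\<Sum>i<N. lin_ext (k (v i)) a * lift (v i) z)" using lin[OF a vE] by simp
  finally show ?thesis .
  qed
  then show "(%z. a z - (\<Sum>i<N. lin_ext (k (v i)) a * lift (v i) z)) : I" using comb_minus[OF a] by simp
 qed
 then show ?thesis by blast
qed

lemma lin_ext_translate:
 assumes f: "fin_supp f"
 shows "lin_ext (%b. \<theta> (x \<otimes>\<^bsub>B\<^esub> b)) f = lin_ext \<theta> (conv B (single_elt 1 x) f)"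
  "lin_ext (%b. \<theta> (b \<otimes>\<^bsub>B\<^esub> x)) f = lin_ext \<theta> (conv B f (single_elt 1 x))"
 using lin_ext_conv[OF fin_supp_single f, of \<theta> B 1 x] lin_ext_conv[OF f fin_supp_single, of \<theta> B 1 x] by simp_all

text \<open>The elements all of whose two-sided translates are killed by \<open>\<theta>\<close> form an ideal, so it is enough to test the relators.\<close>

lemma vanishes_on_ideal:
 assumes rel: "!!H b x y. braid_reflection P x0 H b ==> x : carrier B ==> y : carrier B ==>
  lin_ext (%c. \<theta> (x \<otimes>\<^bsub>B\<^esub> (c \<otimes>\<^bsub>B\<^esub> y))) (relator u H b) = 0"
  and a: "a : I"
 shows "lin_ext \<theta> a = 0"
proof -
 let ?J = "{a : carrier A. \<forall>x\<in>carrier B. \<forall>y\<in>carrier B. lin_ext (%c. \<theta> (x \<otimes>\<^bsub>B\<^esub> (c \<otimes>\<^bsub>B\<^esub> y))) a = 0}"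
 note assoc = monoid.m_assoc[OF group.is_monoid[OF braid_group_is_group]]
 have "ideal ?J A"
 proof (rule idealI[OF A_ring])
  show "subgroup ?J (add_monoid A)"
  proof (rule group.subgroupI)
  show "group (add_monoid A)" using abelian_group.a_group[OF ring.is_abelian_group[OF A_ring]] .
  show "?J \<subseteq> carrier (add_monoid A)" by auto
  have "(%z. 0) : ?J" using zero_closed[OF R, of B] by simp
  then show "?J ~= {}" by blast
  fix a assume a: "a : ?J"
  have m1: "- 1 : R" using is_subringD[OF R] by auto
  have n: "(%z. - 1 * a z) : carrier A" by (rule scale_closed[OF R m1]) (use a in simp)
  have "\<ominus>\<^bsub>A\<^esub> a = (%z. - 1 * a z)"
  by (rule abelian_group.minus_equality[OF ring.is_abelian_group[OF A_ring] _ _ n]) (use a in simp_all)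
  then have "inv\<^bsub>add_monoid A\<^esub> a = (%z. - 1 * a z)" unfolding a_inv_def .
  moreover have "(%z. - 1 * a z) : ?J"
  proof -
  have aA: "a : carrier A" using a by auto
  show ?thesis using n a lin_ext_scale[OF carrierD(1)[OF aA], of _ "- 1"] by (simp del: mult_minus1)
  qed
  ultimately show "inv\<^bsub>add_monoid A\<^esub> a : ?J" by simp
  fix b assume b: "b : ?J"
  have ab: "a : carrier A" "b : carrier A" using a b by auto
  have "(%z. a z + b z) : ?J" using a b add_closed[OF R ab] lin_ext_add[OF carrierD(1)[OF ab(1)] carrierD(1)[OF ab(2)]] by simp
  then show "a \<otimes>\<^bsub>add_monoid A\<^esub> b : ?J" by simp
  qed
  fix a z assume a: "a : ?J" and z: "z : carrier A"
  have aA: "a : carrier A" using a by blast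
  note s = carrierD(1)[OF aA] carrierD(1)[OF z]
  have "lin_ext (%c. \<theta> (x \<otimes>\<^bsub>B\<^esub> (c \<otimes>\<^bsub>B\<^esub> y))) (conv B z a) = 0" if x: "x : carrier B" and y: "y : carrier B" for x y
  proof -
  have "lin_ext (%q. \<theta> (x \<otimes>\<^bsub>B\<^esub> ((p \<otimes>\<^bsub>B\<^esub> q) \<otimes>\<^bsub>B\<^esub> y))) a = 0" if p: "z p ~= 0" for p
  proof -
  have pc: "p : carrier B" by (rule carrierD(2)[OF z p])
  have "lin_ext (%q. \<theta> (x \<otimes>\<^bsub>B\<^esub> ((p \<otimes>\<^bsub>B\<^esub> q) \<otimes>\<^bsub>B\<^esub> y))) a = lin_ext (%q. \<theta> ((x \<otimes>\<^bsub>B\<^esub> p) \<otimes>\<^bsub>B\<^esub> (q \<otimes>\<^bsub>B\<^esub> y))) a"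
  by (rule lin_ext_cong) (use carrierD(2)[OF aA] in \<open>simp add: assoc x y pc mult_braid\<close>)
  also have "... = 0" using a mult_braid[OF x pc] y by blast
  finally show ?thesis .
  qed
  then have "lin_ext (%p. lin_ext (%q. \<theta> (x \<otimes>\<^bsub>B\<^esub> ((p \<otimes>\<^bsub>B\<^esub> q) \<otimes>\<^bsub>B\<^esub> y))) a) z = lin_ext (%p. 0) z" by (rule lin_ext_cong)
  then show ?thesis unfolding lin_ext_conv[OF s(2) s(1)] by simp
  qed
  then show "z \<otimes>\<^bsub>A\<^esub> a : ?J" using conv_closed[OF R braid_group_is_group z aA] by simp
  have "lin_ext (%c. \<theta> (x \<otimes>\<^bsub>B\<^esub> (c \<otimes>\<^bsub>B\<^esub> y))) (conv B a z) = 0" if x: "x : carrier B" and y: "y : carrier B" for x y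
  proof -
  have "lin_ext (%q. \<theta> (x \<otimes>\<^bsub>B\<^esub> ((q \<otimes>\<^bsub>B\<^esub> p) \<otimes>\<^bsub>B\<^esub> y))) a = 0" if p: "z p ~= 0" for p
  proof -
  have pc: "p : carrier B" by (rule carrierD(2)[OF z p])
  have "lin_ext (%q. \<theta> (x \<otimes>\<^bsub>B\<^esub> ((q \<otimes>\<^bsub>B\<^esub> p) \<otimes>\<^bsub>B\<^esub> y))) a = lin_ext (%q. \<theta> (x \<otimes>\<^bsub>B\<^esub> (q \<otimes>\<^bsub>B\<^esub> (p \<otimes>\<^bsub>B\<^esub> y)))) a"
  by (rule lin_ext_cong) (use carrierD(2)[OF aA] in \<open>simp add: assoc x y pc mult_braid\<close>)
  also have "... = 0" using a mult_braid[OF pc y] x by blast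
  finally show ?thesis .
  qed
  then have "lin_ext (%p. lin_ext (%q. \<theta> (x \<otimes>\<^bsub>B\<^esub> ((q \<otimes>\<^bsub>B\<^esub> p) \<otimes>\<^bsub>B\<^esub> y))) a) z = lin_ext (%p. 0) z" by (rule lin_ext_cong)
  moreover have "lin_ext (%q. lin_ext (%p. \<theta> (x \<otimes>\<^bsub>B\<^esub> ((q \<otimes>\<^bsub>B\<^esub> p) \<otimes>\<^bsub>B\<^esub> y))) z) a = lin_ext (%p. lin_ext (%q. \<theta> (x \<otimes>\<^bsub>B\<^esub> ((q \<otimes>\<^bsub>B\<^esub> p) \<otimes>\<^bsub>B\<^esub> y))) a) z"
  unfolding lin_ext_def sum_distrib_left by (subst sum.swap) (simp add: mult.left_commute)
  ultimately show ?thesis unfolding lin_ext_conv[OF s(1) s(2)] by simp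
  qed
  then show "a \<otimes>\<^bsub>A\<^esub> z : ?J" using conv_closed[OF R braid_group_is_group aA z] by simp
 qed
 moreover have "relator u H b : ?J" if "braid_reflection P x0 H b" for H b
  using relator_in[OF that] rel[OF that] by simp
 ultimately have "I \<subseteq> ?J" by (rule I_minimal)
 then have "a : ?J" using a by blast
 then have "lin_ext (%c. \<theta> (\<one>\<^bsub>B\<^esub> \<otimes>\<^bsub>B\<^esub> (c \<otimes>\<^bsub>B\<^esub> \<one>\<^bsub>B\<^esub>))) a = 0" using one_braid by blast
 moreover have "lin_ext (%c. \<theta> (\<one>\<^bsub>B\<^esub> \<otimes>\<^bsub>B\<^esub> (c \<otimes>\<^bsub>B\<^esub> \<one>\<^bsub>B\<^esub>))) a = lin_ext \<theta> a"
  by (rule lin_ext_cong) (use carrierD(2)[OF I_carrier[OF a]] group.is_monoid[OF braid_group_is_group] in \<open>simp add: monoid.l_one monoid.r_one\<close>)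
 ultimately show ?thesis by simp
qed

end

context hecke_base_change
begin

text \<open>The coordinate forms still kill the relators after specialization, by \<open>vanishes_on_ideal\<close>; single group elements are still expanded in the basis, because their expansions are specialized from the source.\<close>

lemma coordinate_system_base_change:
 assumes c: "coordinate_system N co bv"
 shows "target.coordinate_system N (%i b. h (co i b)) (%i. map_coeffs h (bv i))"
proof -
 note bv = coordinate_systemD(1)[OF c] and co = coordinate_systemD(2)[OF c] and coI = coordinate_systemD(3)[OF c]
  and dual = coordinate_systemD(4)[OF c] and span = coordinate_systemD(5)[OF c]
 let ?co = "%i b. h (co i b)" and ?bv = "%i. map_coeffs h (bv i)"
 show ?thesis unfolding target.coordinate_system_def
 proof (intro conjI allI impI ballI)
  fix i assume i: "i < N"
  show "?bv i : carrier target.A" by (rule map_coeffs_closed[OF bv[OF i]])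
  show "?co i b : R'" if "b : carrier B" for b by (rule hR[OF co[OF i that]])
  show "lin_ext (?co i) a = 0" if a: "a : target.I" for a
  proof (rule target.vanishes_on_ideal[OF _ a])
  fix H b x y assume b: "braid_reflection P x0 H b" and x: "x : carrier B" and y: "y : carrier B"
  note r = relator_in[OF b]
  note s = carrierD(1)[OF r]
  have sy: "single_elt 1 y : carrier A" "single_elt 1 x : carrier A"
  by (rule single_closed[OF R is_subringD(1)[OF R] y], rule single_closed[OF R is_subringD(1)[OF R] x])
  have "lin_ext (%c. ?co i (x \<otimes>\<^bsub>B\<^esub> (c \<otimes>\<^bsub>B\<^esub> y))) (relator u' H b)
  = h (lin_ext (%c. co i (x \<otimes>\<^bsub>B\<^esub> (c \<otimes>\<^bsub>B\<^esub> y))) (relator u H b))"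
  unfolding map_coeffs_relator[OF b, symmetric] by (rule lin_ext_map_coeffs[OF hom s])
  also have "lin_ext (%c. co i (x \<otimes>\<^bsub>B\<^esub> (c \<otimes>\<^bsub>B\<^esub> y))) (relator u H b)
  = lin_ext (co i) (conv B (single_elt 1 x) (conv B (relator u H b) (single_elt 1 y)))"
  using lin_ext_translate(2)[OF s, of "%c. co i (x \<otimes>\<^bsub>B\<^esub> c)" y]
  lin_ext_translate(1)[OF conv_support(1)[OF s fin_supp_single], of "co i" x B 1 y] by simp
  also have "... = 0" by (rule coI[OF i I_conv(1)[OF I_conv(2)[OF I_relator[OF b] sy(1)] sy(2)]])
  finally show "lin_ext (%c. ?co i (x \<otimes>\<^bsub>B\<^esub> (c \<otimes>\<^bsub>B\<^esub> y))) (relator u' H b) = 0" by (simp add: coeff_homD(4)[OF hom])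
  qed
  fix j assume j: "j < N"
  show "lin_ext (?co i) (?bv j) = (if i = j then 1 else 0)"
  unfolding lin_ext_map_coeffs[OF hom carrierD(1)[OF bv[OF j]]] dual[OF i j] by (simp add: coeff_homD(1,4)[OF hom])
 next
  fix a assume a: "a : carrier target.A"
  show "(%z. a z - (\<Sum>i<N. lin_ext (?co i) a * ?bv i z)) : target.I"
  proof (rule group_algebra_induct[OF a target.R])
  show "(%z. 0 - (\<Sum>i<N. lin_ext (?co i) (%z. 0) * ?bv i z)) : target.I" using target.I_zero by simp
  fix c b assume cR: "c : R'" and b: "b : carrier B"
  have "map_coeffs h (%z. single_elt 1 b z - (\<Sum>i<N. lin_ext (co i) (single_elt 1 b) * bv i z)) : target.I"
  by (rule map_coeffs_ideal[OF span[OF single_closed[OF R is_subringD(1)[OF R] b]]])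
  then have "(%z. c * map_coeffs h (%z. single_elt 1 b z - (\<Sum>i<N. lin_ext (co i) (single_elt 1 b) * bv i z)) z) : target.I"
  by (rule target.I_scale[OF _ cR])
  moreover have "c * map_coeffs h (%z. single_elt 1 b z - (\<Sum>i<N. lin_ext (co i) (single_elt 1 b) * bv i z)) z
  = single_elt c b z - (\<Sum>i<N. lin_ext (?co i) (single_elt c b) * ?bv i z)" for z
  unfolding map_coeffs_def by (simp add: coeff_homD[OF hom] right_diff_distrib sum_distrib_left mult.assoc)
  (simp add: single_elt_def coeff_homD[OF hom])
  ultimately show "(%z. single_elt c b z - (\<Sum>i<N. lin_ext (?co i) (single_elt c b) * ?bv i z)) : target.I" by simp
  next
  fix f g assume f: "f : carrier target.A" "g : carrier target.A"
  and I: "(%z. f z - (\<Sum>i<N. lin_ext (?co i) f * ?bv i z)) : target.I" "(%z. g z - (\<Sum>i<N. lin_ext (?co i) g * ?bv i z)) : target.I"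
  have "f z + g z - (\<Sum>i<N. lin_ext (?co i) (%z. f z + g z) * ?bv i z)
  = (f z - (\<Sum>i<N. lin_ext (?co i) f * ?bv i z)) + (g z - (\<Sum>i<N. lin_ext (?co i) g * ?bv i z))" for z
  by (simp add: lin_ext_add carrierD(1)[OF f(1)] carrierD(1)[OF f(2)] distrib_right sum.distrib)
  then show "(%z. f z + g z - (\<Sum>i<N. lin_ext (?co i) (%z. f z + g z) * ?bv i z)) : target.I"
  using target.I_add[OF I] by (simp only:)
  qed
 qed
qed

end

section \<open>The regular representation\<close>

context hecke_alg
begin

text \<open>Left multiplication in coordinates is a faithful matrix representation of the quotient. For a ring and an overring with the same coordinates, the two representations agree; this is what compares the two quotients.\<close>

definition regular_rep :: "nat => (nat => 'n braid => 'k) => (nat => 'n braid => 'k) => ('n braid => 'k) => 'k mat" where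
 "regular_rep N co bv a = mat N N (%(i, j). lin_ext (co i) (conv B a (bv j)))"

lemma regular_rep:
 assumes c: "coordinate_system N co bv"
 defines "L \<equiv> regular_rep N co bv"
 shows "L a : carrier_mat N N"
  "a : carrier A ==> b : carrier A ==> L (conv B a b) = L a * L b"
  "a : carrier A ==> b : carrier A ==> L (%z. a z + b z) = L a + L b"
  "L (single_elt r \<one>\<^bsub>B\<^esub>) = r \<cdot>\<^sub>m 1\<^sub>m N"
  "a : carrier A ==> L a = 0\<^sub>m N N \<longleftrightarrow> a : I"
proof -
 note bv = coordinate_systemD(1)[OF c] and co = coordinate_systemD(2)[OF c] and coI = coordinate_systemD(3)[OF c]
  and dual = coordinate_systemD(4)[OF c] and span = coordinate_systemD(5)[OF c]
 have coR: "lin_ext (co i) a : R" if "i < N" "a : carrier A" for i a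
  unfolding lin_ext_def by (intro is_subring_sum[OF R] is_subringD(4)[OF R]) (use carrierD[OF that(2)] co[OF that(1)] in auto)
 have fs: "fin_supp (bv i)" if "i < N" for i by (rule carrierD(1)[OF bv[OF that]])
 have cA: "conv B a b : carrier A" if "a : carrier A" "b : carrier A" for a b by (rule conv_closed[OF R braid_group_is_group that])
 have comb: "(%z. \<Sum>k<N. r k * bv k z) : carrier A" if "!!k. k < N ==> r k : R" for r
  by (rule sum_closed[OF R scale_closed[OF R]]) (use that bv in auto)
 have scale_conv: "conv B a (%z. r * b z) = (%z. r * conv B a b z)" if a: "a : carrier A" and b: "b : carrier A" for a b r
 proof (rule fin_supp_eqI)
  note s = carrierD(1)[OF a] carrierD(1)[OF b]
  have sr: "fin_supp (%z. r * b z)" by (rule finite_subset[OF _ s(2)]) auto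
  show "fin_supp (conv B a (%z. r * b z))" by (rule conv_support(1)[OF s(1) sr])
  show "fin_supp (%z. r * conv B a b z)" by (rule finite_subset[OF _ conv_support(1)[OF s, where G = B]]) auto
  show "lin_ext \<theta> (conv B a (%z. r * b z)) = lin_ext \<theta> (%z. r * conv B a b z)" for \<theta>
  by (simp add: lin_ext_conv[OF s(1) sr] lin_ext_scale[OF conv_support(1)[OF s, where G = B]] lin_ext_conv[OF s] lin_ext_scale[OF s(2)] lin_ext_mult_fun_left)
 qed
 have conv_comb: "lin_ext (co i) (conv B a (%z. \<Sum>k\<in>S. r k * bv k z)) = (\<Sum>k\<in>S. r k * lin_ext (co i) (conv B a (bv k)))"
  if a: "a : carrier A" and r: "!!k. k < N ==> r k : R" and S: "S \<subseteq> {..<N}" for a i r S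
 proof -
  have "finite S" using S finite_subset by blast
  then show ?thesis using S
  proof (induction S rule: finite_induct)
  case empty
  have "conv B a (%z. 0) = (%z. 0)"
  using ring.ring_simprules(24)[OF A_ring a] scale_conv[OF a zero_closed[OF R], of 0] by simp
  then show ?case by simp
  next
  case (insert k S)
  have kA: "(%z. r k * bv k z) : carrier A" by (rule scale_closed[OF R]) (use insert.prems r bv in auto)
  have sA: "(%z. \<Sum>k\<in>S. r k * bv k z) : carrier A"
  by (rule sum_closed[OF R scale_closed[OF R]]) (use insert.prems r bv in auto)
  have e: "bv k : carrier A" using insert.prems bv by auto
  have "lin_ext (co i) (conv B a (%z. r k * bv k z + (\<Sum>k\<in>S. r k * bv k z)))
  = lin_ext (co i) (conv B a (%z. r k * bv k z)) + lin_ext (co i) (conv B a (%z. \<Sum>k\<in>S. r k * bv k z))"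
  unfolding conv_add(2)[OF carrierD(1)[OF kA] carrierD(1)[OF sA] carrierD(1)[OF a]]
  by (rule lin_ext_add) (use carrierD(1)[OF cA[OF a kA]] carrierD(1)[OF cA[OF a sA]] in auto)
  then show ?case using insert scale_conv[OF a e, of "r k"] lin_ext_scale[OF carrierD(1)[OF cA[OF a e]], of "co i" "r k"] by simp
  qed
 qed
 have key: "lin_ext (co i) (conv B a f) = (\<Sum>k<N. lin_ext (co k) f * lin_ext (co i) (conv B a (bv k)))"
  if i: "i < N" and a: "a : carrier A" and f: "f : carrier A" for i a f
 proof -
  let ?s = "%z. \<Sum>k<N. lin_ext (co k) f * bv k z" and ?d = "%z. f z - (\<Sum>k<N. lin_ext (co k) f * bv k z)"
  have s: "?s : carrier A" by (rule comb) (use coR f in blast)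
  have d: "?d : I" by (rule span[OF f])
  have "conv B a f = conv B a (%z. ?d z + ?s z)" by simp
  also have "... = (%z. conv B a ?d z + conv B a ?s z)"
  by (rule conv_add(2)[OF carrierD(1)[OF I_carrier[OF d]] carrierD(1)[OF s] carrierD(1)[OF a]])
  finally have "lin_ext (co i) (conv B a f) = lin_ext (co i) (conv B a ?d) + lin_ext (co i) (conv B a ?s)"
  using lin_ext_add[OF carrierD(1)[OF cA[OF a I_carrier[OF d]]] carrierD(1)[OF cA[OF a s]], of "co i"] by simp
  also have "lin_ext (co i) (conv B a ?d) = 0" by (rule coI[OF i I_conv(1)[OF d a]])
  also have "lin_ext (co i) (conv B a ?s) = (\<Sum>k<N. lin_ext (co k) f * lin_ext (co i) (conv B a (bv k)))"
  by (rule conv_comb[OF a]) (use coR f in auto)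
  finally show ?thesis by simp
 qed
 show Lc: "L a : carrier_mat N N" for a unfolding L_def regular_rep_def by simp
 have Lij: "L a $$ (i, j) = lin_ext (co i) (conv B a (bv j))" if "i < N" "j < N" for a i j
  unfolding L_def regular_rep_def using that by simp
 show "L (conv B a b) = L a * L b" if a: "a : carrier A" and b: "b : carrier A" for a b
 proof (rule eq_matI)
  fix i j assume "i < dim_row (L a * L b)" "j < dim_col (L a * L b)"
  then have i: "i < N" and j: "j < N" using Lc[of a] Lc[of b] by auto
  have "L (conv B a b) $$ (i, j) = lin_ext (co i) (conv B a (conv B b (bv j)))"
  unfolding Lij[OF i j] conv_assoc[OF braid_group_is_group carrier_UNIV[OF a] carrier_UNIV[OF b] carrier_UNIV[OF bv[OF j]]] ..
  also have "... = (\<Sum>k<N. L b $$ (k, j) * L a $$ (i, k))"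
  unfolding key[OF i a cA[OF b bv[OF j]]] using Lij i j by (intro sum.cong) auto
  also have "... = (L a * L b) $$ (i, j)" using Lc[of a] Lc[of b] i j
  by (simp add: scalar_prod_def lessThan_atLeast0 mult.commute)
  finally show "L (conv B a b) $$ (i, j) = (L a * L b) $$ (i, j)" .
 qed (use Lc[of a] Lc[of b] Lc[of "conv B a b"] in auto)
 show "L (%z. a z + b z) = L a + L b" if a: "a : carrier A" and b: "b : carrier A" for a b
 proof (rule eq_matI)
  fix i j assume "i < dim_row (L a + L b)" "j < dim_col (L a + L b)"
  then have i: "i < N" and j: "j < N" using Lc[of b] by auto
  show "L (%z. a z + b z) $$ (i, j) = (L a + L b) $$ (i, j)"
  using i j Lc[of a] Lc[of b] Lij[OF i j]
  by (simp add: conv_add(1)[OF carrierD(1)[OF a] carrierD(1)[OF b] fs[OF j]]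
  lin_ext_add[OF carrierD(1)[OF cA[OF a bv[OF j]]] carrierD(1)[OF cA[OF b bv[OF j]]]])
 qed (use Lc[of a] Lc[of b] Lc[of "%z. a z + b z"] in auto)
 show "L (single_elt r \<one>\<^bsub>B\<^esub>) = r \<cdot>\<^sub>m 1\<^sub>m N"
 proof (rule eq_matI)
  fix i j assume "i < dim_row (r \<cdot>\<^sub>m 1\<^sub>m N)" "j < dim_col (r \<cdot>\<^sub>m 1\<^sub>m N)"
  then have i: "i < N" and j: "j < N" by auto
  show "L (single_elt r \<one>\<^bsub>B\<^esub>) $$ (i, j) = (r \<cdot>\<^sub>m 1\<^sub>m N) $$ (i, j)"
  unfolding Lij[OF i j] conv_single_one(1)[OF braid_group_is_group carrier_UNIV[OF bv[OF j]]] lin_ext_scale[OF fs[OF j]] dual[OF i j]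
  using i j by simp
 qed (use Lc[of "single_elt r \<one>\<^bsub>B\<^esub>"] in auto)
 show "L a = 0\<^sub>m N N \<longleftrightarrow> a : I" if a: "a : carrier A" for a
 proof
  assume aI: "a : I"
  show "L a = 0\<^sub>m N N"
  proof (rule eq_matI)
  fix i j assume "i < dim_row (0\<^sub>m N N :: 'k mat)" "j < dim_col (0\<^sub>m N N :: 'k mat)"
  then have i: "i < N" and j: "j < N" by auto
  show "L a $$ (i, j) = 0\<^sub>m N N $$ (i, j)" unfolding Lij[OF i j] using coI[OF i I_conv(2)[OF aI bv[OF j]]] i j by simp
  qed (use Lc[of a] in auto)
 next
  assume z: "L a = 0\<^sub>m N N"
  let ?one = "single_elt 1 \<one>\<^bsub>B\<^esub> :: _ => 'k"
  have oneA: "?one : carrier A" by (rule single_closed[OF R is_subringD(1)[OF R] one_braid])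
  have a1: "conv B a ?one = a" by (rule conv_one(2)[OF braid_group_is_group carrier_UNIV[OF a]])
  have "lin_ext (co i) a = 0" if i: "i < N" for i
  proof -
  have "lin_ext (co i) (conv B a (bv k)) = 0" if k: "k < N" for k
  using Lij[OF i k, of a] z i k by simp
  then show ?thesis using key[OF i a oneA] unfolding a1 by simp
  qed
  then show "a : I" using span[OF a] by simp
 qed
qed

end

section \<open>Matrix representations of an algebra\<close>

locale scalar_algebra = ring A for A (structure) +
 fixes sc :: "'k::field => 'a"
 assumes sc_closed: "sc c : carrier A"
  and sc_central: "x : carrier A ==> sc c \<otimes> x = x \<otimes> sc c"
begin

abbreviation rep_on :: "'a set => nat => ('a => 'k mat) => bool" where
 "rep_on G d \<phi> \<equiv> algebra_rep (A\<lparr>carrier := G\<rparr>) sc d \<phi>"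

lemma rep_onD:
 assumes "rep_on G d \<phi>"
 shows "x : G ==> \<phi> x : carrier_mat d d" "\<phi> \<one> = 1\<^sub>m d" "x : G ==> y : G ==> \<phi> (x \<oplus> y) = \<phi> x + \<phi> y"
  "x : G ==> y : G ==> \<phi> (x \<otimes> y) = \<phi> x * \<phi> y" "\<phi> (sc c) = c \<cdot>\<^sub>m 1\<^sub>m d"
 using assms unfolding algebra_rep_def by simp_all

lemma rep_onI:
 assumes "!!x. x : G ==> \<phi> x : carrier_mat d d" "\<phi> \<one> = 1\<^sub>m d" "!!x y. x : G ==> y : G ==> \<phi> (x \<oplus> y) = \<phi> x + \<phi> y"
  "!!x y. x : G ==> y : G ==> \<phi> (x \<otimes> y) = \<phi> x * \<phi> y" "!!c. \<phi> (sc c) = c \<cdot>\<^sub>m 1\<^sub>m d"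
 shows "rep_on G d \<phi>"
 using assms unfolding algebra_rep_def by simp

definition scalar_closed :: "'a set => bool" where
 "scalar_closed G \<longleftrightarrow> G \<subseteq> carrier A & \<one> : G & (\<forall>x\<in>G. \<forall>y\<in>G. x \<oplus> y : G & x \<otimes> y : G) & (\<forall>c. sc c : G)"

lemma scalar_closedD:
 assumes "scalar_closed G"
 shows "x : G ==> x : carrier A" "\<one> : G" "x : G ==> y : G ==> x \<oplus> y : G" "x : G ==> y : G ==> x \<otimes> y : G" "sc c : G"
 using assms unfolding scalar_closed_def by blast+

lemma extension_rep_on:
 assumes G: "scalar_closed G" and ext: "triangular_extension G r s \<phi>1 \<phi>2 \<phi>" and rep: "rep_on G (r + s) \<phi>"
 shows "rep_on G r \<phi>1" "rep_on G s \<phi>2"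
proof -
 note GD = scalar_closedD[OF G] and RD = rep_onD[OF rep]
 have one: "\<phi> \<one> = 1 \<cdot>\<^sub>m 1\<^sub>m (r + s)" unfolding RD(2) one_smult_one_mat ..
 have "\<phi>1 \<one> = 1\<^sub>m r" "\<phi>2 \<one> = 1\<^sub>m s" using extension_scalar[OF ext GD(2) one] by (simp_all only: one_smult_one_mat)
 moreover have "\<phi>1 (sc c) = c \<cdot>\<^sub>m 1\<^sub>m r" "\<phi>2 (sc c) = c \<cdot>\<^sub>m 1\<^sub>m s" for c using extension_scalar[OF ext GD(5) RD(5)] .
 moreover have "\<phi>1 (x \<oplus> y) = \<phi>1 x + \<phi>1 y" "\<phi>2 (x \<oplus> y) = \<phi>2 x + \<phi>2 y" if "x : G" "y : G" for x y
  using extension_add[OF ext that GD(3)[OF that] RD(3)[OF that]] .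
 moreover have "\<phi>1 (x \<otimes> y) = \<phi>1 x * \<phi>1 y" "\<phi>2 (x \<otimes> y) = \<phi>2 x * \<phi>2 y" if "x : G" "y : G" for x y
  using extension_mult[OF ext that GD(4)[OF that] RD(4)[OF that]] .
 ultimately show "rep_on G r \<phi>1" "rep_on G s \<phi>2" using extension_dims[OF ext] by (intro rep_onI; blast)+
qed

lemma rep_pow:
 assumes rep: "algebra_rep A sc d \<phi>" and x: "x : carrier A"
 shows "\<phi> (x [^] (n::nat)) = \<phi> x ^\<^sub>m n"
proof (induction n)
 case 0
 have "\<phi> x : carrier_mat d d" "\<phi> \<one> = 1\<^sub>m d" using rep x unfolding algebra_rep_def by blast+
 then show ?case by simp
next
 case (Suc n)
 have "\<phi> (x [^] n \<otimes> x) = \<phi> (x [^] n) * \<phi> x" using rep x unfolding algebra_rep_def by simp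
 then show ?case using Suc by simp
qed

text \<open>In a block triangular form with irreducible diagonal blocks, such an element is strictly triangular.\<close>

lemma nilpotent_if_irreducibles_vanish:
 assumes y: "y : carrier A"
  and irr: "!!d \<phi>. algebra_rep A sc d \<phi> ==> irreducible_mats d (\<phi> ` carrier A) ==> \<phi> y = 0\<^sub>m d d"
  and rep: "algebra_rep A sc d \<phi>"
 shows "\<exists>n. \<phi> y ^\<^sub>m n = 0\<^sub>m d d"
proof -
 have G: "scalar_closed (carrier A)" unfolding scalar_closed_def using sc_closed by simp
 have "rep_on (carrier A) d \<phi> --> (\<exists>n. \<phi> y ^\<^sub>m n = 0\<^sub>m d d)"
 proof (rule matrix_family_induct[where G = "carrier A" and R = "%d \<phi>. rep_on (carrier A) d \<phi> --> (\<exists>n. \<phi> y ^\<^sub>m n = 0\<^sub>m d d)"])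
  show "\<phi> g : carrier_mat d d" if "g : carrier A" for g using rep that unfolding algebra_rep_def by blast
 next
  fix \<phi> :: "'a => 'k mat" assume c: "!!g. g : carrier A ==> \<phi> g : carrier_mat 0 0"
  have "\<phi> y ^\<^sub>m 0 = 0\<^sub>m 0 0" using c[OF y] by (intro eq_matI) auto
  then show "rep_on (carrier A) 0 \<phi> --> (\<exists>n. \<phi> y ^\<^sub>m n = 0\<^sub>m 0 0)" by blast
 next
  fix d and \<phi> :: "'a => 'k mat" assume c: "!!g. g : carrier A ==> \<phi> g : carrier_mat d d" and i: "irreducible_mats d (\<phi> ` carrier A)"
  show "rep_on (carrier A) d \<phi> --> (\<exists>n. \<phi> y ^\<^sub>m n = 0\<^sub>m d d)"
  proof
  assume "rep_on (carrier A) d \<phi>"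
  then have "\<phi> y = 0\<^sub>m d d" using irr[OF _ i] by simp
  then have "\<phi> y ^\<^sub>m 1 = 0\<^sub>m d d" by simp
  then show "\<exists>n. \<phi> y ^\<^sub>m n = 0\<^sub>m d d" ..
  qed
 next
  fix r s and \<phi>1 \<phi>2 \<phi> :: "'a => 'k mat"
  assume ext: "triangular_extension (carrier A) r s \<phi>1 \<phi>2 \<phi>"
  and 1: "rep_on (carrier A) r \<phi>1 --> (\<exists>n. \<phi>1 y ^\<^sub>m n = 0\<^sub>m r r)" and 2: "rep_on (carrier A) s \<phi>2 --> (\<exists>n. \<phi>2 y ^\<^sub>m n = 0\<^sub>m s s)"
  show "rep_on (carrier A) (r + s) \<phi> --> (\<exists>n. \<phi> y ^\<^sub>m n = 0\<^sub>m (r + s) (r + s))"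
  proof
  assume rep: "rep_on (carrier A) (r + s) \<phi>"
  obtain n1 where n1: "\<phi>1 y ^\<^sub>m n1 = 0\<^sub>m r r" using mp[OF 1 extension_rep_on(1)[OF G ext rep]] ..
  obtain n2 where n2: "\<phi>2 y ^\<^sub>m n2 = 0\<^sub>m s s" using mp[OF 2 extension_rep_on(2)[OF G ext rep]] ..
  show "\<exists>n. \<phi> y ^\<^sub>m n = 0\<^sub>m (r + s) (r + s)" using extension_nilpotent[OF ext y n1 n2] ..
  qed
 qed
 then show ?thesis using rep by simp
qed

text \<open>The polynomial with roots \<open>us\<close> at \<open>b\<close>, written as in the defining relation of a Hecke algebra.\<close>

definition product_at :: "'a => 'k list => 'a" where
 "product_at b us = foldr (%u a. (b \<ominus> sc u) \<otimes> a) us \<one>"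

lemma singular_factor:
 assumes G: "scalar_closed G" and m: "!!u. b \<ominus> sc u : G" and b: "b : G" and rep: "rep_on G d \<phi>"
  and v: "v : carrier_vec d" "v ~= 0\<^sub>v d" "\<phi> (product_at b us) *\<^sub>v v = 0\<^sub>v d"
 shows "\<exists>j<length us. \<exists>w\<in>carrier_vec d. w ~= 0\<^sub>v d & \<phi> b *\<^sub>v w = us ! j \<cdot>\<^sub>v w"
 using v(3)
proof (induction us)
 case Nil
 then have "1\<^sub>m d *\<^sub>v v = 0\<^sub>v d" using rep_onD(2)[OF rep] by (simp add: product_at_def)
 then show ?case using v by simp
next
 case (Cons u us)
 note GD = scalar_closedD[OF G] and RD = rep_onD[OF rep]
 have p: "product_at b us : G" unfolding product_at_def by (induction us) (auto intro: GD m)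
 define w where "w = \<phi> (product_at b us) *\<^sub>v v"
 have w: "w : carrier_vec d" unfolding w_def using RD(1)[OF p] v(1) by simp
 show ?case
 proof (cases "w = 0\<^sub>v d")
  case True
  then obtain j w' where "j < length us" "w' : carrier_vec d" "w' ~= 0\<^sub>v d" "\<phi> b *\<^sub>v w' = us ! j \<cdot>\<^sub>v w'"
  using Cons.IH unfolding w_def by blast
  then show ?thesis by (intro exI[of _ "Suc j"]) auto
 next
  case False
  have "\<phi> (product_at b (u # us)) = \<phi> (b \<ominus> sc u) * \<phi> (product_at b us)"
  using RD(4)[OF m p] by (simp add: product_at_def)
  then have z: "\<phi> (b \<ominus> sc u) *\<^sub>v w = 0\<^sub>v d"
  using Cons.prems RD(1)[OF m] RD(1)[OF p] v(1) unfolding w_def by (simp add: assoc_mult_mat_vec[of _ d d])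
  have "b = (b \<ominus> sc u) \<oplus> sc u" using GD(1)[OF b] sc_closed[of u] by (simp add: a_minus_def a_assoc l_neg)
  then have "\<phi> b = \<phi> (b \<ominus> sc u) + u \<cdot>\<^sub>m 1\<^sub>m d" using RD(3)[OF m GD(5), of u u] RD(5) by simp
  then have "\<phi> b *\<^sub>v w = \<phi> (b \<ominus> sc u) *\<^sub>v w + (u \<cdot>\<^sub>m 1\<^sub>m d) *\<^sub>v w"
  using RD(1)[OF m] w by (simp add: add_mult_distrib_mat_vec[of _ d d])
  also have "(u \<cdot>\<^sub>m 1\<^sub>m d) *\<^sub>v w = u \<cdot>\<^sub>v w" using w by (intro eq_vecI) auto
  finally have "\<phi> b *\<^sub>v w = u \<cdot>\<^sub>v w" unfolding z using w by simp
  then show ?thesis using w False by (intro exI[of _ 0]) auto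
 qed
qed

text \<open>Over a field that need not be algebraically closed, the eigenvalues of \<open>b\<close> are among the given scalars. The induction runs over the family of all matrices of elements commuting with \<open>b\<close>: an eigenspace of \<open>b\<close> is invariant under them, so on irreducible pieces \<open>b\<close> is a scalar.\<close>

lemma eigenvalue_multiplicities:
 assumes rep: "algebra_rep A sc d \<phi>" and b: "b : carrier A" and rel: "\<phi> (product_at b us) = 0\<^sub>m d d"
 shows "\<exists>k :: nat => nat. det (\<phi> b) = (\<Prod>j<length us. us ! j ^ k j) &
  (\<forall>i::nat. mat_trace (\<phi> (b [^] i)) = (\<Sum>j<length us. of_nat (k j) * us ! j ^ i))"
proof -
 let ?G = "{x : carrier A. x \<otimes> b = b \<otimes> x}"
 have G: "scalar_closed ?G" unfolding scalar_closed_def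
  using b sc_closed sc_central[OF b] by (auto simp: l_distr r_distr m_assoc) (metis m_assoc)
 have bG: "b : ?G" using b by simp
 have m: "b \<ominus> sc u : ?G" for u
  using b sc_closed sc_central[OF b, of u] by (simp add: a_minus_def l_distr r_distr l_minus r_minus)
 note GD = scalar_closedD[OF G]
 have pG: "b [^] i : ?G" for i :: nat by (induction i) (use GD(2,4) bG in \<open>auto simp del: mem_Collect_eq\<close>)
 have prodG: "product_at b us : ?G" unfolding product_at_def
 proof (induction us)
  case (Cons u us) then show ?case using GD(4)[OF m] by (simp del: mem_Collect_eq)
 qed (use GD(2) in \<open>simp del: mem_Collect_eq\<close>)
 let ?Q = "%\<phi>. \<exists>k :: nat => nat. det (\<phi> b) = (\<Prod>j<length us. us ! j ^ k j) &
  (\<forall>i::nat. mat_trace (\<phi> (b [^] i)) = (\<Sum>j<length us. of_nat (k j) * us ! j ^ i))"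
 have "rep_on ?G d \<phi> --> \<phi> (product_at b us) = 0\<^sub>m d d --> ?Q \<phi>"
 proof (rule matrix_family_induct[where G = ?G and R = "%d \<phi>. rep_on ?G d \<phi> --> \<phi> (product_at b us) = 0\<^sub>m d d --> ?Q \<phi>"])
  show "\<phi> g : carrier_mat d d" if "g : ?G" for g using rep that unfolding algebra_rep_def by blast
 next
  fix \<phi> :: "'a => 'k mat" assume c: "!!g. g : ?G ==> \<phi> g : carrier_mat 0 0"
  have "det (\<phi> b) = 1" using c[OF bG] by (simp add: det_def)
  moreover have "mat_trace (\<phi> (b [^] i)) = 0" for i :: nat using c[OF pG[of i]] by (simp add: mat_trace_def)
  ultimately have "?Q \<phi>" by (intro exI[of _ "%j. 0"]) simp
  then show "rep_on ?G 0 \<phi> --> \<phi> (product_at b us) = 0\<^sub>m 0 0 --> ?Q \<phi>" by blast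
 next
  fix d and \<phi> :: "'a => 'k mat" assume c: "!!g. g : ?G ==> \<phi> g : carrier_mat d d" and irr: "irreducible_mats d (\<phi> ` ?G)"
  show "rep_on ?G d \<phi> --> \<phi> (product_at b us) = 0\<^sub>m d d --> ?Q \<phi>"
  proof (intro impI)
  assume rep: "rep_on ?G d \<phi>" and z: "\<phi> (product_at b us) = 0\<^sub>m d d"
  have d: "d > 0" using irr unfolding irreducible_mats_def by blast
  have "unit_vec d 0 $ 0 ~= (0\<^sub>v d :: 'k vec) $ 0" using d by simp
  then have "unit_vec d 0 ~= (0\<^sub>v d :: 'k vec)" by metis
  moreover have "\<phi> (product_at b us) *\<^sub>v unit_vec d 0 = 0\<^sub>v d" unfolding z by (intro eq_vecI) auto
  ultimately obtain j w where j: "j < length us" and w: "w : carrier_vec d" "w ~= 0\<^sub>v d" "\<phi> b *\<^sub>v w = us ! j \<cdot>\<^sub>v w"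
  using singular_factor[OF G m bG rep unit_vec_carrier] by blast
  let ?u = "us ! j"
  \<comment> \<open>this eigenspace is invariant under everything that commutes with \<open>b\<close>\<close>
  define U where "U = {v : carrier_vec d. \<phi> b *\<^sub>v v = ?u \<cdot>\<^sub>v v}"
  note cb = c[OF bG]
  have "vec_subspace d U" unfolding vec_subspace_def U_def
  using cb by (auto simp: mult_add_distrib_mat_vec[of _ d d] smult_add_distrib_vec[of _ d] mult_mat_vec[of _ d d] smult_smult_assoc mult.commute mult_mat_zero_vec)
  moreover have "M *\<^sub>v v : U" if M: "M : \<phi> ` ?G" and v: "v : U" for M v
  proof -
  obtain g where g: "g : ?G" "M = \<phi> g" using M by blast
  have vc: "v : carrier_vec d" and ev: "\<phi> b *\<^sub>v v = ?u \<cdot>\<^sub>v v" using v unfolding U_def by blast+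
  note cg = c[OF g(1)]
  have "\<phi> b * \<phi> g = \<phi> g * \<phi> b"
  using rep_onD(4)[OF rep bG g(1)] rep_onD(4)[OF rep g(1) bG] g(1) by simp
  then have "\<phi> b *\<^sub>v (\<phi> g *\<^sub>v v) = \<phi> g *\<^sub>v (\<phi> b *\<^sub>v v)"
  using cb cg vc by (metis assoc_mult_mat_vec)
  also have "... = ?u \<cdot>\<^sub>v (\<phi> g *\<^sub>v v)" unfolding ev by (rule mult_mat_vec[OF cg vc])
  finally show ?thesis unfolding U_def g(2) using cg vc by simp
  qed
  ultimately have "U = {0\<^sub>v d} \<or> U = carrier_vec d" by (rule irreducibleD[OF irr])
  moreover have "w : U" unfolding U_def using w by simp
  ultimately have U: "U = carrier_vec d" using w(2) by blast
  have scal: "\<phi> b = ?u \<cdot>\<^sub>m 1\<^sub>m d"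
  proof (rule eq_matI)
  fix i k assume "i < dim_row (?u \<cdot>\<^sub>m 1\<^sub>m d)" "k < dim_col (?u \<cdot>\<^sub>m 1\<^sub>m d)"
  then have i: "i < d" and k: "k < d" by auto
  have "unit_vec d k : U" unfolding U by simp
  then have "col (\<phi> b) k = ?u \<cdot>\<^sub>v unit_vec d k" unfolding U_def using mult_mat_unit_vec[OF cb k] by simp
  then have "col (\<phi> b) k $ i = (?u \<cdot>\<^sub>v unit_vec d k) $ i" by simp
  then show "\<phi> b $$ (i, k) = (?u \<cdot>\<^sub>m 1\<^sub>m d) $$ (i, k)" using cb i k by (auto simp: unit_vec_def)
  qed (use cb in auto)
  have pow: "\<phi> (b [^] i) = (?u ^ i) \<cdot>\<^sub>m 1\<^sub>m d" for i :: nat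
  proof (induction i)
  case 0 then show ?case using rep_onD(2)[OF rep] by (simp add: one_smult_one_mat)
  next
  case (Suc i)
  have "\<phi> (b [^] i \<otimes> b) = \<phi> (b [^] i) * \<phi> b" by (rule rep_onD(4)[OF rep pG bG])
  also have "... = ?u ^ i \<cdot>\<^sub>m (1\<^sub>m d * (?u \<cdot>\<^sub>m 1\<^sub>m d))" unfolding Suc scal
  by (rule mult_smult_assoc_mat[of _ d d _ d]) simp_all
  also have "1\<^sub>m d * (?u \<cdot>\<^sub>m 1\<^sub>m d) = ?u \<cdot>\<^sub>m 1\<^sub>m d" by (rule left_mult_one_mat[of _ d d]) simp
  also have "?u ^ i \<cdot>\<^sub>m (?u \<cdot>\<^sub>m 1\<^sub>m d) = (?u ^ Suc i) \<cdot>\<^sub>m 1\<^sub>m d" by (rule eq_matI) auto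
  finally show ?case by simp
  qed
  have "det (\<phi> b) = (\<Prod>i<length us. us ! i ^ (if i = j then d else 0))"
  unfolding scal using j by (simp add: det_smult power_0 if_distrib prod.delta cong: if_cong)
  moreover have "mat_trace (\<phi> (b [^] i)) = (\<Sum>l<length us. of_nat (if l = j then d else 0) * us ! l ^ i)" for i :: nat
  unfolding pow mat_trace_def using j by (simp add: if_distrib if_distribR cong: if_cong)
  ultimately show "?Q \<phi>" by (intro exI[of _ "%i. if i = j then d else 0"]) blast
  qed
 next
  fix r s and \<phi>1 \<phi>2 \<phi> :: "'a => 'k mat"
  assume ext: "triangular_extension ?G r s \<phi>1 \<phi>2 \<phi>"
  and 1: "rep_on ?G r \<phi>1 --> \<phi>1 (product_at b us) = 0\<^sub>m r r --> ?Q \<phi>1"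
  and 2: "rep_on ?G s \<phi>2 --> \<phi>2 (product_at b us) = 0\<^sub>m s s --> ?Q \<phi>2"
  show "rep_on ?G (r + s) \<phi> --> \<phi> (product_at b us) = 0\<^sub>m (r + s) (r + s) --> ?Q \<phi>"
  proof (intro impI)
  assume rep: "rep_on ?G (r + s) \<phi>" and z: "\<phi> (product_at b us) = 0\<^sub>m (r + s) (r + s)"
  have "\<phi> (product_at b us) = 0 \<cdot>\<^sub>m 1\<^sub>m (r + s)" unfolding z by (intro eq_matI) auto
  note e = extension_scalar[OF ext prodG this]
  have z1: "\<phi>1 (product_at b us) = 0\<^sub>m r r" unfolding e(1) by (intro eq_matI) auto
  have z2: "\<phi>2 (product_at b us) = 0\<^sub>m s s" unfolding e(2) by (intro eq_matI) auto
  obtain k1 :: "nat => nat" where k1: "det (\<phi>1 b) = (\<Prod>j<length us. us ! j ^ k1 j) &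
  (\<forall>i::nat. mat_trace (\<phi>1 (b [^] i)) = (\<Sum>j<length us. of_nat (k1 j) * us ! j ^ i))"
  using mp[OF mp[OF 1 extension_rep_on(1)[OF G ext rep]] z1] ..
  obtain k2 :: "nat => nat" where k2: "det (\<phi>2 b) = (\<Prod>j<length us. us ! j ^ k2 j) &
  (\<forall>i::nat. mat_trace (\<phi>2 (b [^] i)) = (\<Sum>j<length us. of_nat (k2 j) * us ! j ^ i))"
  using mp[OF mp[OF 2 extension_rep_on(2)[OF G ext rep]] z2] ..
  have "det (\<phi> b) = (\<Prod>j<length us. us ! j ^ (k1 j + k2 j))"
  using extension_det[OF ext bG] k1 k2 by (simp add: power_add prod.distrib)
  moreover have "mat_trace (\<phi> (b [^] i)) = (\<Sum>j<length us. of_nat (k1 j + k2 j) * us ! j ^ i)" for i :: nat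
  using extension_trace[OF ext pG[of i]] k1 k2 by (simp add: distrib_right sum.distrib)
  ultimately show "?Q \<phi>" by (intro exI[of _ "%j. k1 j + k2 j"]) blast
  qed
 qed
 moreover have "rep_on ?G d \<phi>" using rep unfolding algebra_rep_def by simp
 ultimately show ?thesis using rel by blast
qed

end

section \<open>Primitive idempotents and comaximal elements\<close>

context cring
begin

definition comaximal :: "'a => 'a => bool" where
 "comaximal x y \<longleftrightarrow> (\<exists>r\<in>carrier R. \<exists>t\<in>carrier R. r \<otimes> x \<oplus> t \<otimes> y = \<one>)"

lemma comaximal_sym: "x : carrier R ==> y : carrier R ==> comaximal x y ==> comaximal y x"
 unfolding comaximal_def by (metis a_comm m_closed)

lemma comaximal_mult:
 assumes c: "x : carrier R" "y : carrier R" "y' : carrier R" and 1: "comaximal x y" and 2: "comaximal x y'"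
 shows "comaximal x (y \<otimes> y')"
proof -
 obtain r t where r: "r : carrier R" "t : carrier R" "r \<otimes> x \<oplus> t \<otimes> y = \<one>" using 1 unfolding comaximal_def by blast
 obtain r' t' where r': "r' : carrier R" "t' : carrier R" "r' \<otimes> x \<oplus> t' \<otimes> y' = \<one>" using 2 unfolding comaximal_def by blast
 have "(r \<oplus> t \<otimes> y \<otimes> r') \<otimes> x \<oplus> (t \<otimes> t') \<otimes> (y \<otimes> y') = r \<otimes> x \<oplus> t \<otimes> y \<otimes> (r' \<otimes> x \<oplus> t' \<otimes> y')"
  using c r(1,2) r'(1,2) by (simp add: l_distr r_distr a_assoc m_assoc m_lcomm)
 also have "... = \<one>" using c r r' by simp
 finally show ?thesis unfolding comaximal_def using c r(1,2) r'(1,2) by (metis a_closed m_closed)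
qed

lemma comaximal_one: "x : carrier R ==> comaximal x \<one>"
 unfolding comaximal_def by (rule bexI[of _ \<zero>], rule bexI[of _ \<one>]) simp_all

lemma comaximal_pow:
 assumes "x : carrier R" "y : carrier R" "comaximal x y"
 shows "comaximal (x [^] (n::nat)) (y [^] n)"
proof -
 have p: "comaximal x (y [^] (n::nat))" if "x : carrier R" "y : carrier R" "comaximal x y" for x y n
  by (induction n) (use that in \<open>simp_all add: comaximal_one comaximal_mult\<close>)
 show ?thesis
  by (rule comaximal_sym, simp_all add: assms, rule p, simp_all add: assms, rule comaximal_sym, simp_all add: assms, rule p[OF assms])
qed

lemma comaximal_finprod:
 assumes "finite S" "x : carrier R" "f : S \<rightarrow> carrier R" "!!b. b : S ==> comaximal x (f b)"
 shows "comaximal x (finprod R f S)"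
 using assms(1,3,4)
proof (induction S rule: finite_induct)
 case empty then show ?case using comaximal_one[OF assms(2)] by simp
next
 case (insert b S)
 have "f : S \<rightarrow> carrier R" "f b : carrier R" using insert.prems by auto
 then show ?case using insert by (simp add: comaximal_mult assms(2))
qed

lemma comaximal_if_unit_difference:
 assumes "x : carrier R" "y : carrier R" "c : carrier R" "c \<otimes> (x \<ominus> y) = \<one>"
 shows "comaximal x y"
proof -
 have "c \<otimes> x \<oplus> (\<ominus> c) \<otimes> y = c \<otimes> (x \<ominus> y)" using assms(1-3) by (simp add: a_minus_def r_distr l_minus r_minus)
 then show ?thesis unfolding comaximal_def using assms by (metis a_inv_closed)
qed

lemma finprod_pow:
 assumes "finite S" "f : S \<rightarrow> carrier R"
 shows "finprod R f S [^] (n::nat) = finprod R (%a. f a [^] n) S"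
 using assms
proof (induction S rule: finite_induct)
 case (insert b S)
 have f: "f : S \<rightarrow> carrier R" "f b : carrier R" using insert.prems by auto
 then have "(%a. f a [^] n) : S \<rightarrow> carrier R" by auto
 then show ?case using insert f by (simp add: nat_pow_distrib)
qed simp

text \<open>If \<open>r X + t Y = 1\<close> and \<open>e X Y = 0\<close>, then \<open>e r X\<close> and \<open>e t Y\<close> are orthogonal idempotents with sum \<open>e\<close>.\<close>

lemma primitive_comaximal:
 assumes e: "e : carrier R" "e \<otimes> e = e"
  and prim: "!!e1 e2. e1 : carrier R ==> e2 : carrier R ==> e1 \<otimes> e1 = e1 ==> e2 \<otimes> e2 = e2 ==> e1 \<otimes> e2 = \<zero> ==> e = e1 \<oplus> e2 ==> e1 = \<zero> \<or> e2 = \<zero>"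
  and X: "X : carrier R" "Y : carrier R" "comaximal X Y" and z: "e \<otimes> (X \<otimes> Y) = \<zero>"
 shows "e \<otimes> X = \<zero> \<or> e \<otimes> Y = \<zero>"
proof -
 obtain r t where r: "r : carrier R" "t : carrier R" "r \<otimes> X \<oplus> t \<otimes> Y = \<one>" using X(3) unfolding comaximal_def by blast
 define e1 where "e1 = e \<otimes> (r \<otimes> X)"
 define e2 where "e2 = e \<otimes> (t \<otimes> Y)"
 have c: "e1 : carrier R" "e2 : carrier R" unfolding e1_def e2_def using e r X by simp_all
 have s: "e = e1 \<oplus> e2" unfolding e1_def e2_def using e r X by (simp add: r_distr[symmetric])
 have "e1 \<otimes> e2 = (e \<otimes> (X \<otimes> Y)) \<otimes> (e \<otimes> r \<otimes> t)" unfolding e1_def e2_def using e(1) r(1,2) X(1,2) by (simp add: m_ac)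
 then have o: "e1 \<otimes> e2 = \<zero>" unfolding z using e r by simp
 have m: "e1 \<otimes> e = e1" "e2 \<otimes> e = e2" unfolding e1_def e2_def using e r X by (simp_all add: m_ac) (metis e m_assoc m_closed m_lcomm)+
 have i1: "e1 \<otimes> e1 = e1"
 proof -
  have "e1 = e1 \<otimes> (e1 \<oplus> e2)" using m(1) s by simp
  also have "... = e1 \<otimes> e1" using c o by (simp add: r_distr)
  finally show ?thesis by simp
 qed
 have i2: "e2 \<otimes> e2 = e2"
 proof -
  have "e2 = e2 \<otimes> (e1 \<oplus> e2)" using m(2) s by simp
  also have "... = e2 \<otimes> e2" using c o m_comm[OF c] by (simp add: r_distr)
  finally show ?thesis by simp
 qed
 from prim[OF c i1 i2 o s] show ?thesis
 proof
  assume "e1 = \<zero>"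
  then have "e = e \<otimes> (t \<otimes> Y)" using s c e2_def by simp
  then have "e \<otimes> X = (e \<otimes> (t \<otimes> Y)) \<otimes> X" by simp
  also have "... = t \<otimes> (e \<otimes> (X \<otimes> Y))" using e(1) r(1,2) X(1,2) by (simp add: m_ac)
  finally show ?thesis unfolding z using r by simp
 next
  assume "e2 = \<zero>"
  then have "e = e \<otimes> (r \<otimes> X)" using s c e1_def by simp
  then have "e \<otimes> Y = (e \<otimes> (r \<otimes> X)) \<otimes> Y" by simp
  also have "... = r \<otimes> (e \<otimes> (X \<otimes> Y))" using e(1) r(1,2) X(1,2) by (simp add: m_ac)
  finally show ?thesis unfolding z using r by simp
 qed
qed

lemma primitive_annihilates_factor:
 assumes e: "e : carrier R" "e \<otimes> e = e" "e ~= \<zero>"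
  and prim: "!!e1 e2. e1 : carrier R ==> e2 : carrier R ==> e1 \<otimes> e1 = e1 ==> e2 \<otimes> e2 = e2 ==> e1 \<otimes> e2 = \<zero> ==> e = e1 \<oplus> e2 ==> e1 = \<zero> \<or> e2 = \<zero>"
  and S: "finite S" "f : S \<rightarrow> carrier R" "!!a b. a : S ==> b : S ==> a ~= b ==> comaximal (f a) (f b)"
  and z: "e \<otimes> finprod R f S = \<zero>"
 shows "\<exists>a\<in>S. e \<otimes> f a = \<zero>"
 using S z
proof (induction S rule: finite_induct)
 case empty then show ?case using e by simp
next
 case (insert b S)
 have f: "f : S \<rightarrow> carrier R" "f b : carrier R" using insert.prems by auto
 have "comaximal (f b) (finprod R f S)"
  by (rule comaximal_finprod[OF insert.hyps(1) f(2,1)]) (use insert in auto)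
 moreover have "e \<otimes> (f b \<otimes> finprod R f S) = \<zero>" using insert f by simp
 ultimately have "e \<otimes> f b = \<zero> \<or> e \<otimes> finprod R f S = \<zero>"
  using primitive_comaximal[OF e(1,2) prim f(2)] finprod_closed[OF f(1)] by blast
 then show ?case using insert.IH[OF f(1)] insert.prems by blast
qed

end

section \<open>Block idempotents\<close>

lemma center_cring:
 assumes "ring A"
 shows "cring (A\<lparr>carrier := {x : carrier A. \<forall>y\<in>carrier A. x \<otimes>\<^bsub>A\<^esub> y = y \<otimes>\<^bsub>A\<^esub> x}\<rparr>)" (is "cring (A\<lparr>carrier := ?C\<rparr>)")
proof -
 interpret ring A by fact
 have "subring ?C A"
 proof (rule subringI)
  show "\<ominus>\<^bsub>A\<^esub> h : ?C" if "h : ?C" for h using that by (simp add: l_minus r_minus)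
  show "h1 \<otimes>\<^bsub>A\<^esub> h2 : ?C" if "h1 : ?C" "h2 : ?C" for h1 h2
  proof -
  have "h1 \<otimes>\<^bsub>A\<^esub> h2 \<otimes>\<^bsub>A\<^esub> y = y \<otimes>\<^bsub>A\<^esub> (h1 \<otimes>\<^bsub>A\<^esub> h2)" if y: "y : carrier A" for y
  proof -
  have c: "h1 : carrier A" "h2 : carrier A" and z: "h1 \<otimes>\<^bsub>A\<^esub> y = y \<otimes>\<^bsub>A\<^esub> h1" "h2 \<otimes>\<^bsub>A\<^esub> y = y \<otimes>\<^bsub>A\<^esub> h2"
  using \<open>h1 : ?C\<close> \<open>h2 : ?C\<close> y by auto
  have "h1 \<otimes>\<^bsub>A\<^esub> h2 \<otimes>\<^bsub>A\<^esub> y = h1 \<otimes>\<^bsub>A\<^esub> (y \<otimes>\<^bsub>A\<^esub> h2)" using c y z(2) by (simp add: m_assoc)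
  also have "... = y \<otimes>\<^bsub>A\<^esub> h1 \<otimes>\<^bsub>A\<^esub> h2" using c y z(1) by (simp add: m_assoc[symmetric])
  finally show ?thesis using c y by (simp add: m_assoc)
  qed
  moreover have "h1 \<otimes>\<^bsub>A\<^esub> h2 : carrier A" using that by blast
  ultimately show ?thesis by blast
  qed
  show "h1 \<oplus>\<^bsub>A\<^esub> h2 : ?C" if h: "h1 : ?C" "h2 : ?C" for h1 h2
  proof -
  have c: "h1 : carrier A" "h2 : carrier A" using h by blast+
  have "(h1 \<oplus>\<^bsub>A\<^esub> h2) \<otimes>\<^bsub>A\<^esub> y = y \<otimes>\<^bsub>A\<^esub> (h1 \<oplus>\<^bsub>A\<^esub> h2)" if y: "y : carrier A" for y
  proof -
  have z: "h1 \<otimes>\<^bsub>A\<^esub> y = y \<otimes>\<^bsub>A\<^esub> h1" "h2 \<otimes>\<^bsub>A\<^esub> y = y \<otimes>\<^bsub>A\<^esub> h2" using h y by blast+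
  show ?thesis unfolding l_distr[OF c y] r_distr[OF c y] z ..
  qed
  moreover have "h1 \<oplus>\<^bsub>A\<^esub> h2 : carrier A" using c by blast
  ultimately show ?thesis by blast
  qed
  show "?C \<subseteq> carrier A" by blast
  show "\<one>\<^bsub>A\<^esub> : ?C" by simp
 qed
 then have "subcring ?C A" by (rule subcringI) blast
 moreover have "?C \<subseteq> carrier A" by blast
 ultimately show ?thesis using subcring_iff by blast
qed

text \<open>The product of all \<open>x a\<close> acts by zero in every irreducible representation of \<open>B\<close>, so it is nilpotent there and also in the subring \<open>A\<close>. In the centre of \<open>A\<close> its factors are comaximal, and \<open>primitive_annihilates_factor\<close> applies.\<close>

lemma block_idempotent_annihilates_factor:
 fixes A :: "('a, 'z) ring_scheme" and B :: "('b, 'y) ring_scheme" and x :: "'i => 'a" and sc :: "'k::field => 'b"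
 assumes A: "ring A" and B: "scalar_algebra B sc" and \<iota>: "\<iota> : Ring.ring_hom A B" "inj_on \<iota> (carrier A)"
  and rep: "algebra_rep B sc N \<Lambda>" and faithful: "!!y. y : carrier B ==> \<Lambda> y = 0\<^sub>m N N ==> y = \<zero>\<^bsub>B\<^esub>"
  and S: "finite S" and xC: "!!a. a : S ==> x a : {x : carrier A. \<forall>y\<in>carrier A. x \<otimes>\<^bsub>A\<^esub> y = y \<otimes>\<^bsub>A\<^esub> x}"
  and unit: "!!a b. a : S ==> b : S ==> a ~= b ==>
  \<exists>c\<in>{x : carrier A. \<forall>y\<in>carrier A. x \<otimes>\<^bsub>A\<^esub> y = y \<otimes>\<^bsub>A\<^esub> x}. c \<otimes>\<^bsub>A\<^esub> (x a \<ominus>\<^bsub>A\<^esub> x b) = \<one>\<^bsub>A\<^esub>"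
  and irr: "!!d \<phi>. algebra_rep B sc d \<phi> ==> irreducible_mats d (\<phi> ` carrier B) ==> \<exists>a\<in>S. \<phi> (\<iota> (x a)) = 0\<^sub>m d d"
  and e: "block_idempotent A e"
 shows "\<exists>a\<in>S. \<exists>n::nat. e \<otimes>\<^bsub>A\<^esub> x a [^]\<^bsub>A\<^esub> n = \<zero>\<^bsub>A\<^esub>"
proof -
 interpret A: ring A by fact
 interpret B: scalar_algebra B sc by fact
 define C where "C = {x : carrier A. \<forall>y\<in>carrier A. x \<otimes>\<^bsub>A\<^esub> y = y \<otimes>\<^bsub>A\<^esub> x}"
 define Z where "Z = A\<lparr>carrier := C\<rparr>"
 interpret Z: cring Z unfolding Z_def C_def by (rule center_cring[OF A])
 have CA: "C \<subseteq> carrier A" unfolding C_def by blast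
 have Zs: "carrier Z = C" "mult Z = mult A" "add Z = add A" "one Z = one A" "zero Z = zero A" unfolding Z_def by simp_all
 have pow: "y [^]\<^bsub>Z\<^esub> n = y [^]\<^bsub>A\<^esub> n" for y and n :: nat unfolding Z_def by (rule A.nat_pow_consistent[symmetric])
 have xC': "x a : C" if "a : S" for a using xC[OF that] unfolding C_def .
 then have xP: "x : S \<rightarrow> carrier Z" unfolding Zs by blast
 define y where "y = finprod Z x S"
 have yC: "y : C" using Z.finprod_closed[OF xP] unfolding y_def Zs .
 then have yA: "y : carrier A" using CA by blast
 have \<iota>c: "\<iota> z : carrier B" if "z : carrier A" for z using ring_hom_closed[OF \<iota>(1) that] .
 have "\<phi> (\<iota> y) = 0\<^sub>m d d" if \<phi>: "algebra_rep B sc d \<phi>" and i: "irreducible_mats d (\<phi> ` carrier B)" for d \<phi>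
 proof -
  obtain a where a: "a : S" "\<phi> (\<iota> (x a)) = 0\<^sub>m d d" using irr[OF \<phi> i] ..
  have xr: "x : (S - {a}) \<rightarrow> carrier Z" using xP by auto
  have "finprod Z x (insert a (S - {a})) = x a \<otimes>\<^bsub>A\<^esub> finprod Z x (S - {a})"
  using Z.finprod_insert[OF _ _ xr, of a] S xC'[OF a(1)] unfolding Zs by simp
  moreover have "insert a (S - {a}) = S" using a(1) by blast
  ultimately have y: "y = x a \<otimes>\<^bsub>A\<^esub> finprod Z x (S - {a})" unfolding y_def by simp
  have c: "x a : carrier A" "finprod Z x (S - {a}) : carrier A" using xC'[OF a(1)] Z.finprod_closed[OF xr] CA unfolding Zs by auto
  have cB: "\<phi> (\<iota> (finprod Z x (S - {a}))) : carrier_mat d d" using \<phi> \<iota>c[OF c(2)] unfolding algebra_rep_def by blast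
  have "\<phi> (\<iota> (x a) \<otimes>\<^bsub>B\<^esub> \<iota> (finprod Z x (S - {a}))) = \<phi> (\<iota> (x a)) * \<phi> (\<iota> (finprod Z x (S - {a})))"
  using \<phi> \<iota>c[OF c(1)] \<iota>c[OF c(2)] unfolding algebra_rep_def by blast
  then have "\<phi> (\<iota> y) = \<phi> (\<iota> (x a)) * \<phi> (\<iota> (finprod Z x (S - {a})))"
  unfolding y ring_hom_mult[OF \<iota>(1) c] .
  then show ?thesis unfolding a(2) left_mult_zero_mat[OF cB] .
 qed
 then obtain n where n: "\<Lambda> (\<iota> y) ^\<^sub>m n = 0\<^sub>m N N"
  using B.nilpotent_if_irreducibles_vanish[OF \<iota>c[OF yA] _ rep] by blast
 have hp: "\<iota> (z [^]\<^bsub>A\<^esub> k) = \<iota> z [^]\<^bsub>B\<^esub> k" if "z : carrier A" for z and k :: nat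
  by (induction k) (use that in \<open>simp_all add: ring_hom_one[OF \<iota>(1)] ring_hom_mult[OF \<iota>(1)]\<close>)
 have "\<iota> (y [^]\<^bsub>A\<^esub> n) = \<zero>\<^bsub>B\<^esub>"
  by (rule faithful) (use B.rep_pow[OF rep \<iota>c[OF yA], of n] n yA \<iota>c in \<open>simp_all add: hp\<close>)
 moreover have "\<iota> \<zero>\<^bsub>A\<^esub> = \<zero>\<^bsub>B\<^esub>" by (rule ring_hom_zero[OF \<iota>(1) A B.ring_axioms])
 ultimately have "y [^]\<^bsub>A\<^esub> n = \<zero>\<^bsub>A\<^esub>" using inj_onD[OF \<iota>(2), of "y [^]\<^bsub>A\<^esub> n" "\<zero>\<^bsub>A\<^esub>"] yA by simp
 then have yn: "finprod Z (%a. x a [^]\<^bsub>Z\<^esub> n) S = \<zero>\<^bsub>A\<^esub>"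
  using Z.finprod_pow[OF S xP, of n] unfolding y_def[symmetric] pow by simp
 have central: "central_idempotent A z \<longleftrightarrow> z : C & z \<otimes>\<^bsub>A\<^esub> z = z" for z unfolding central_idempotent_def C_def by blast
 have eC: "e : C" and ee: "e \<otimes>\<^bsub>A\<^esub> e = e" and e0: "e ~= \<zero>\<^bsub>A\<^esub>" using e unfolding block_idempotent_def central by blast+
 have "\<exists>a\<in>S. e \<otimes>\<^bsub>Z\<^esub> x a [^]\<^bsub>Z\<^esub> n = \<zero>\<^bsub>Z\<^esub>"
 proof (rule Z.primitive_annihilates_factor[OF _ _ _ _ S])
  show "e : carrier Z" "e \<otimes>\<^bsub>Z\<^esub> e = e" "e ~= \<zero>\<^bsub>Z\<^esub>" using eC ee e0 unfolding Zs by auto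
  show "e1 = \<zero>\<^bsub>Z\<^esub> \<or> e2 = \<zero>\<^bsub>Z\<^esub>" if "e1 : carrier Z" "e2 : carrier Z" "e1 \<otimes>\<^bsub>Z\<^esub> e1 = e1" "e2 \<otimes>\<^bsub>Z\<^esub> e2 = e2"
  "e1 \<otimes>\<^bsub>Z\<^esub> e2 = \<zero>\<^bsub>Z\<^esub>" "e = e1 \<oplus>\<^bsub>Z\<^esub> e2" for e1 e2
  proof -
  have "central_idempotent A e1" "central_idempotent A e2" using that(1-4) unfolding Zs central by blast+
  then show ?thesis using e that(5,6) unfolding Zs block_idempotent_def by blast
  qed
  show "(%a. x a [^]\<^bsub>Z\<^esub> n) : S \<rightarrow> carrier Z" using xP Z.nat_pow_closed by auto
  show "Z.comaximal (x a [^]\<^bsub>Z\<^esub> n) (x b [^]\<^bsub>Z\<^esub> n)" if ab: "a : S" "b : S" "a ~= b" for a b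
  proof -
  obtain c where c: "c : C" "c \<otimes>\<^bsub>A\<^esub> (x a \<ominus>\<^bsub>A\<^esub> x b) = \<one>\<^bsub>A\<^esub>" using unit[OF ab] unfolding C_def by blast
  have xz: "x a : carrier Z" "x b : carrier Z" using xC' ab unfolding Zs by auto
  have "\<ominus>\<^bsub>Z\<^esub> x b = \<ominus>\<^bsub>A\<^esub> x b"
  proof -
  have "\<ominus>\<^bsub>Z\<^esub> x b : carrier A" "\<ominus>\<^bsub>Z\<^esub> x b \<oplus>\<^bsub>A\<^esub> x b = \<zero>\<^bsub>A\<^esub>" using Z.a_inv_closed[OF xz(2)] Z.l_neg[OF xz(2)] CA unfolding Zs by auto
  moreover have "x b : carrier A" using xz CA unfolding Zs by auto
  ultimately show ?thesis using A.minus_equality by metis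
  qed
  then have "c \<otimes>\<^bsub>Z\<^esub> (x a \<ominus>\<^bsub>Z\<^esub> x b) = \<one>\<^bsub>Z\<^esub>" using c(2) unfolding a_minus_def Zs by simp
  then have "Z.comaximal (x a) (x b)" using Z.comaximal_if_unit_difference[OF xz] c(1) unfolding Zs by blast
  then show ?thesis by (rule Z.comaximal_pow[OF xz])
  qed
  show "e \<otimes>\<^bsub>Z\<^esub> finprod Z (%a. x a [^]\<^bsub>Z\<^esub> n) S = \<zero>\<^bsub>Z\<^esub>" unfolding yn using eC CA unfolding Zs by auto
 qed
 then show ?thesis unfolding Zs pow by blast
qed

section \<open>The coefficient rings\<close>

lemma Ct_const_simps: "Ct_const 0 = 0" "Ct_const 1 = 1" "Ct_const (a * b) = Ct_const a * Ct_const b"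
 unfolding Ct_const_def by (simp_all add: to_fract_mult[symmetric] one_pCons[symmetric] del: to_fract_mult)

lemma Ct_const_power: "Ct_const (a ^ n) = Ct_const a ^ n"
 by (induction n) (simp_all add: Ct_const_simps)

lemma to_fract_power: "to_fract (p ^ n) = to_fract p ^ n"
 by (induction n) simp_all

lemma to_fract_of_nat: "to_fract (of_nat n) = of_nat n"
 by (induction n) simp_all

lemma Ct_q_power: "Ct_q m ^ n = to_fract (Polynomial.monom 1 (m * n))"
 unfolding Ct_q_def to_fract_power[symmetric] by (simp add: monom_power)

lemma Ct_q_nonzero: "Ct_q m ~= 0"
 unfolding Ct_q_def by simp

lemma Ct_q_power_inj: assumes "m \<ge> 1" "Ct_q m ^ a = Ct_q m ^ b" shows "a = b"
proof -
 have "Polynomial.monom (1 :: complex) (m * a) = Polynomial.monom 1 (m * b)" using assms(2) unfolding Ct_q_power by simp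
 then have "Polynomial.degree (Polynomial.monom (1 :: complex) (m * a)) = Polynomial.degree (Polynomial.monom (1 :: complex) (m * b))" by simp
 then show ?thesis using assms(1) by (simp add: degree_monom_eq)
qed

text \<open>The value at \<open>t = 1\<close> does not depend on how a Laurent polynomial is written as a fraction.\<close>

lemma evaluation_at_1:
 assumes "to_fract p / to_fract (Polynomial.monom (1 :: complex) k) = to_fract Q"
 shows "poly p 1 = poly Q 1"
proof -
 have "to_fract p = to_fract (Q * Polynomial.monom 1 k)" using assms by (simp add: field_simps)
 then have "p = Q * Polynomial.monom 1 k" unfolding to_fract_eq_iff .
 then show ?thesis by (simp add: poly_monom)
qed

lemma rouquier_ring_subring: "is_subring (rouquier_ring m W)"
 unfolding rouquier_ring_def is_subring_def by blast

lemma rouquier_ring_members: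
 shows "c : trace_field W ==> algebraic_int c ==> Ct_const c : rouquier_ring m W"
  "Ct_q m : rouquier_ring m W" "inverse (Ct_q m) : rouquier_ring m W" "n \<ge> 1 ==> inverse (Ct_q m ^ n - 1) : rouquier_ring m W"
 unfolding rouquier_ring_def ring_of_integers_def by blast+

lemma algebraic_int_root_of_unity: assumes "(z :: complex) ^ n = 1" "n > 0" shows "algebraic_int z"
proof (rule algebraic_int_root)
 show "algebraic_int (1 :: complex)" by (rule int_imp_algebraic_int) simp
 show "poly (Polynomial.monom 1 n) z = 1" using assms by (simp add: poly_monom)
 show "\<forall>i. Polynomial.coeff (Polynomial.monom (1 :: complex) n) i : \<int>" by simp
qed (use assms in \<open>simp_all add: degree_monom_eq\<close>)

lemma trace_field_subring: "is_subring (trace_field W)"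
 unfolding trace_field_def is_subfield_def is_subring_def by blast

context reflection_arrangement
begin

text \<open>An element of a fixator differs from the identity by a matrix of rank at most one.\<close>

lemma trace_fixator:
 assumes H: "H : hyperplanes P" and s: "s : fixator P H"
 shows "trace s = of_nat CARD('n) + normal_eigenvalue H s - 1"
proof -
 let ?v = "s *v x0 - x0"
 have e: "Finite_Cartesian_Product.vec_nth (Finite_Cartesian_Product.vec_nth s i) i = 1 + Finite_Cartesian_Product.vec_nth ?v i * height x0 H (axis i 1)" for i
 proof -
  have "Finite_Cartesian_Product.vec_nth (s *v axis i 1) i = Finite_Cartesian_Product.vec_nth (axis i 1 + height x0 H (axis i 1) *s ?v) i"
  using fixator_formula[OF H s, of "axis i 1"] by simp
  moreover have "Finite_Cartesian_Product.vec_nth (s *v axis i 1) i = Finite_Cartesian_Product.vec_nth (Finite_Cartesian_Product.vec_nth s i) i"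
  by (simp add: matrix_vector_mult_def axis_def if_distrib cong: if_cong)
  ultimately show ?thesis by (simp add: axis_def algebra_simps)
 qed
 have hs: "height x0 H (\<Sum>i\<in>I. f i) = (\<Sum>i\<in>I. height x0 H (f i))" for I :: "'n set" and f
  using linear_sum[OF height_linear[OF H], of f I] .
 have "height x0 H ?v = height x0 H (\<Sum>i\<in>UNIV. Finite_Cartesian_Product.vec_nth ?v i *s axis i 1)" by (simp only: basis_expansion)
 also have "... = (\<Sum>i\<in>UNIV. Finite_Cartesian_Product.vec_nth ?v i * height x0 H (axis i 1))"
  unfolding hs height_scale[OF H] ..
 finally have "height x0 H ?v = (\<Sum>i\<in>UNIV. Finite_Cartesian_Product.vec_nth ?v i * height x0 H (axis i 1))" .
 moreover have "height x0 H ?v = normal_eigenvalue H s - 1"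
  unfolding height_diff[OF H] height_x0[OF H] normal_eigenvalue_def ..
 ultimately show ?thesis unfolding trace_def e by (simp add: sum.distrib)
qed

lemma zeta_in_trace_field:
 assumes H: "H : hyperplanes P"
 shows "zeta (hyp_order P H) : trace_field P"
proof -
 obtain s where s: "s : fixator P H" "normal_eigenvalue H s = zeta (hyp_order P H)" by (rule distinguished_reflection[OF H])
 have "trace s : trace_field P" using s(1) unfolding trace_field_def fixator_def by blast
 then have "trace s - of_nat CARD('n) + 1 : trace_field P"
  by (rule is_subringD(6)[OF trace_field_subring is_subringD(3)[OF trace_field_subring _ is_subring_of_nat[OF trace_field_subring]] is_subringD(1)[OF trace_field_subring]])
 then show ?thesis unfolding trace_fixator[OF H s(1)] s(2) by simp
qed

lemma spetsial_param_at:
 "spetsial_param m P (hyp_orbit P H, j) = (if j = 0 then Ct_q m else Ct_const (zeta (hyp_order P H) ^ j))"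
 unfolding spetsial_param_def by (simp add: orbit_order_hyp_orbit)

lemma spetsial_param_nonzero: "spetsial_param m P i ~= 0"
proof -
 have "Ct_const (zeta e ^ j) ~= 0" for e j unfolding Ct_const_def zeta_def by simp
 then show ?thesis unfolding spetsial_param_def using Ct_q_nonzero by (simp add: case_prod_beta)
qed

text \<open>The root of unity of order \<open>e\<^sub>H\<close> lies in the trace field, because the distinguished reflection has trace \<open>dim V - 1 + \<zeta>\<close>.\<close>

lemma spetsial_param_in_ring:
 assumes "i : hidx_set P"
 shows "spetsial_param m P i : rouquier_ring m P" "inverse (spetsial_param m P i) : rouquier_ring m P"
proof -
 obtain H j where i: "i = (hyp_orbit P H, j)" "H : hyperplanes P" "j < hyp_order P H"
  using assms unfolding hidx_set_def by blast
 let ?e = "hyp_order P H"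
 have e: "?e > 0" using hyp_order_ge_2[OF i(2)] by simp
 have z: "Ct_const (zeta ?e ^ k) : rouquier_ring m P" for k
 proof (rule rouquier_ring_members(1))
  show "zeta ?e ^ k : trace_field P" by (rule is_subring_power[OF trace_field_subring zeta_in_trace_field[OF i(2)]])
  have "(zeta ?e ^ k) ^ ?e = 1" using zeta_power_eq_1[OF e] by (simp add: power_mult[symmetric])
  then show "algebraic_int (zeta ?e ^ k)" by (rule algebraic_int_root_of_unity[OF _ e])
 qed
 have "Ct_const (zeta ?e ^ j) * Ct_const (zeta ?e ^ (?e - j)) = 1"
  unfolding Ct_const_simps(3)[symmetric] power_add[symmetric] using i(3) zeta_power_eq_1[OF e, of ?e] by (simp add: Ct_const_simps)
 then have inv: "inverse (Ct_const (zeta ?e ^ j)) = Ct_const (zeta ?e ^ (?e - j))" by (rule inverse_unique)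
 show "spetsial_param m P i : rouquier_ring m P" "inverse (spetsial_param m P i) : rouquier_ring m P"
  unfolding i(1) spetsial_param_at using z[of j] z[of "?e - j"] inv rouquier_ring_members(2,3)[of m P] by simp_all
qed

end

section \<open>Representatives in the group algebra\<close>

context hecke_alg
begin

definition lift :: "('n braid => 'k) set => 'n braid => 'k" where
 "lift x = (SOME a. a : carrier A & x = cls a)"

lemma lift: assumes "x : carrier HA" shows "lift x : carrier A" "cls (lift x) = x"
proof -
 have "\<exists>a. a : carrier A & x = cls a" by (rule cls_surj[OF assms]) (rule exI, rule conjI)
 then have "lift x : carrier A & x = cls (lift x)" unfolding lift_def by (rule someI_ex)
 then show "lift x : carrier A" "cls (lift x) = x" by simp_all
qed

lemma lift_cls: assumes "a : carrier A" shows "lift (cls a) : carrier A" "(%z. lift (cls a) z - a z) : I"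
 using lift[OF cls_closed[OF assms]] cls_eq[OF _ assms, of "lift (cls a)"] by simp_all

abbreviation "T \<equiv> hecke_T R u P x0"
abbreviation "scal \<equiv> hecke_scal R u P x0"

lemma single_A: "b : carrier B ==> single_elt 1 b : carrier A" "c : R ==> single_elt c \<one>\<^bsub>B\<^esub> : carrier A"
 by (rule single_closed[OF R is_subringD(1)[OF R]], assumption, rule single_closed[OF R _ one_braid], assumption)

lemma T_closed: "b : carrier B ==> T b : carrier HA" unfolding T_eq by (rule cls_closed[OF single_A(1)])
lemma scal_closed: "c : R ==> scal c : carrier HA" unfolding scal_eq by (rule cls_closed[OF single_A(2)])

lemma T_mult: assumes "x : carrier B" "y : carrier B" shows "T x \<otimes>\<^bsub>HA\<^esub> T y = T (x \<otimes>\<^bsub>B\<^esub> y)"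
 unfolding T_eq cls_mult[OF single_A(1)[OF assms(1)] single_A(1)[OF assms(2)]] conv_single by simp

lemma T_one: "T \<one>\<^bsub>B\<^esub> = \<one>\<^bsub>HA\<^esub>" unfolding T_eq by (rule cls_one)

lemma pow_braid: "b : carrier B ==> b [^]\<^bsub>B\<^esub> (n::nat) : carrier B"
 by (rule monoid.nat_pow_closed[OF group.is_monoid[OF braid_group_is_group]])

lemma T_pow: assumes "b : carrier B" shows "T b [^]\<^bsub>HA\<^esub> (n::nat) = T (b [^]\<^bsub>B\<^esub> n)"
proof (induction n)
 case 0 show ?case using T_one by simp
next
 case (Suc n) then show ?case using T_mult[OF pow_braid[OF assms] assms] by simp
qed

lemma scal_T: assumes "c : R" "b : carrier B" shows "scal c \<otimes>\<^bsub>HA\<^esub> T b = cls (single_elt c b)"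
proof -
 have "(%z. c * single_elt 1 b z) = single_elt c b" unfolding single_elt_def by auto
 then show ?thesis unfolding T_eq scal_mult(1)[OF assms(1) single_A(1)[OF assms(2)]] by simp
qed

lemma scal_central: assumes "c : R" "x : carrier HA" shows "scal c \<otimes>\<^bsub>HA\<^esub> x = x \<otimes>\<^bsub>HA\<^esub> scal c"
 using scal_mult[OF assms(1) lift(1)[OF assms(2)]] unfolding lift(2)[OF assms(2)] by simp

lemma cls_diff: assumes "a : carrier A" "b : carrier A" shows "cls (%z. a z - b z) = cls a \<ominus>\<^bsub>HA\<^esub> cls b"
proof -
 interpret HA: ring HA by (rule H_ring)
 have d: "(%z. a z - b z) : carrier A"
  using ring.ring_simprules(4)[OF A_ring assms] unfolding group_algebra_minus[OF R braid_group_is_group assms] .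
 have "cls (%z. a z - b z) \<oplus>\<^bsub>HA\<^esub> cls b = cls a" unfolding cls_add[OF d assms(2)] by simp
 note e = this
 show ?thesis unfolding e[symmetric] a_minus_def using cls_closed[OF d] cls_closed[OF assms(2)] by (simp add: HA.a_assoc HA.r_neg)
qed

lemma central_if_commutes:
 assumes x: "x : carrier HA" and T: "!!b. b : carrier B ==> x \<otimes>\<^bsub>HA\<^esub> T b = T b \<otimes>\<^bsub>HA\<^esub> x" and y: "y : carrier HA"
 shows "x \<otimes>\<^bsub>HA\<^esub> y = y \<otimes>\<^bsub>HA\<^esub> x"
proof -
 interpret HA: ring HA by (rule H_ring)
 have "x \<otimes>\<^bsub>HA\<^esub> cls a = cls a \<otimes>\<^bsub>HA\<^esub> x" if a: "a : carrier A" for a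
 proof (rule group_algebra_induct[OF a R, of "%a. x \<otimes>\<^bsub>HA\<^esub> cls a = cls a \<otimes>\<^bsub>HA\<^esub> x"])
  show "x \<otimes>\<^bsub>HA\<^esub> cls (%z. 0) = cls (%z. 0) \<otimes>\<^bsub>HA\<^esub> x" unfolding cls_zero_fun using x by simp
  show "x \<otimes>\<^bsub>HA\<^esub> cls (single_elt c b) = cls (single_elt c b) \<otimes>\<^bsub>HA\<^esub> x" if c: "c : R" and b: "b : carrier B" for c b
  proof -
  have "x \<otimes>\<^bsub>HA\<^esub> (scal c \<otimes>\<^bsub>HA\<^esub> T b) = scal c \<otimes>\<^bsub>HA\<^esub> (x \<otimes>\<^bsub>HA\<^esub> T b)"
  using HA.m_assoc[OF x scal_closed[OF c] T_closed[OF b]] HA.m_assoc[OF scal_closed[OF c] x T_closed[OF b]] scal_central[OF c x] by simp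
  also have "... = scal c \<otimes>\<^bsub>HA\<^esub> T b \<otimes>\<^bsub>HA\<^esub> x" unfolding T[OF b] by (rule HA.m_assoc[OF scal_closed[OF c] T_closed[OF b] x, symmetric])
  finally show ?thesis unfolding scal_T[OF c b] .
  qed
  fix f g assume fg: "f : carrier A" "g : carrier A" and h: "x \<otimes>\<^bsub>HA\<^esub> cls f = cls f \<otimes>\<^bsub>HA\<^esub> x" "x \<otimes>\<^bsub>HA\<^esub> cls g = cls g \<otimes>\<^bsub>HA\<^esub> x"
  show "x \<otimes>\<^bsub>HA\<^esub> cls (%z. f z + g z) = cls (%z. f z + g z) \<otimes>\<^bsub>HA\<^esub> x"
  unfolding cls_add[OF fg, symmetric] HA.r_distr[OF cls_closed[OF fg(1)] cls_closed[OF fg(2)] x] HA.l_distr[OF cls_closed[OF fg(1)] cls_closed[OF fg(2)] x] h ..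
 qed
 from this[OF lift(1)[OF y]] show ?thesis unfolding lift(2)[OF y] .
qed

lemma relator_class:
 assumes b: "braid_reflection P x0 H b"
 shows "foldr (%c a. (T b \<ominus>\<^bsub>HA\<^esub> scal c) \<otimes>\<^bsub>HA\<^esub> a) (map (%j. u (hyp_orbit P H, j)) [0..<hyp_order P H]) \<one>\<^bsub>HA\<^esub> = \<zero>\<^bsub>HA\<^esub>"
proof -
 note Hb = braid_reflection_carrier[OF b]
 let ?f = "%js. foldr (%j a. conv B (%z. single_elt 1 b z - single_elt (u (hyp_orbit P H, j)) \<one>\<^bsub>B\<^esub> z) a) js (single_elt 1 \<one>\<^bsub>B\<^esub>)"
 have "?f js : carrier A & cls (?f js) = foldr (%c a. (T b \<ominus>\<^bsub>HA\<^esub> scal c) \<otimes>\<^bsub>HA\<^esub> a) (map (%j. u (hyp_orbit P H, j)) js) \<one>\<^bsub>HA\<^esub>"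
  if "set js \<subseteq> {..<hyp_order P H}" for js
  using that
 proof (induction js)
  case Nil
  show ?case using single_A(1)[OF one_braid] cls_one by simp
 next
  case (Cons j js)
  have j: "u (hyp_orbit P H, j) : R" by (rule u) (use Hb(1) Cons.prems in \<open>auto simp: hidx_set_def\<close>)
  have IH: "?f js : carrier A" "cls (?f js) = foldr (%c a. (T b \<ominus>\<^bsub>HA\<^esub> scal c) \<otimes>\<^bsub>HA\<^esub> a) (map (%j. u (hyp_orbit P H, j)) js) \<one>\<^bsub>HA\<^esub>"
  using Cons by simp_all
  note s = single_A(1)[OF Hb(2)] single_A(2)[OF j]
  have d: "(%z. single_elt 1 b z - single_elt (u (hyp_orbit P H, j)) \<one>\<^bsub>B\<^esub> z) : carrier A"
  using ring.ring_simprules(4)[OF A_ring s] unfolding group_algebra_minus[OF R braid_group_is_group s] .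
  have "cls (?f (j # js)) = (T b \<ominus>\<^bsub>HA\<^esub> scal (u (hyp_orbit P H, j))) \<otimes>\<^bsub>HA\<^esub> cls (?f js)"
  unfolding foldr.simps comp_def cls_mult[OF d IH(1), symmetric] cls_diff[OF s] T_eq scal_eq ..
  moreover have "?f (j # js) : carrier A" unfolding foldr.simps comp_def by (rule conv_closed[OF R braid_group_is_group d IH(1)])
  ultimately show ?case using IH(2) by simp
 qed
 from this[of "[0..<hyp_order P H]"]
 have "cls (relator u H b) = foldr (%c a. (T b \<ominus>\<^bsub>HA\<^esub> scal c) \<otimes>\<^bsub>HA\<^esub> a) (map (%j. u (hyp_orbit P H, j)) [0..<hyp_order P H]) \<one>\<^bsub>HA\<^esub>"
  unfolding relator_def by (simp add: lessThan_atLeast0)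
 moreover have "cls (relator u H b) = \<zero>\<^bsub>HA\<^esub>" using cls_zero[OF relator_in[OF b]] I_relator[OF b] by simp
 ultimately show ?thesis by simp
qed

end

section \<open>The spetsial algebra over a ring and over its field\<close>

text \<open>What the study of families requires of a single group: a free generic algebra and a splitting field.\<close>

locale spetsial_algebra = reflection_arrangement P x0 for P :: "('n::finite) cmat set" and x0 +
 fixes m :: nat
 assumes m: "m \<ge> 1"
  and free: "free_fg (laurent_ring (hidx_set P)) (generic_hecke P x0) (hecke_scal (laurent_ring (hidx_set P)) laurent_var P x0)"
  and splits: "spetsial_splits m P x0"
begin

sublocale int: hecke_alg P x0 "rouquier_ring m P" "spetsial_param m P"
 by unfold_locales (rule rouquier_ring_subring, rule spetsial_param_in_ring(1))

sublocale fld: hecke_alg P x0 "UNIV :: Ct set" "spetsial_param m P"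
 by unfold_locales (rule is_subring_UNIV, rule UNIV_I)

lemma generic: "hecke_alg P x0 (laurent_ring (hidx_set P)) laurent_var"
 by unfold_locales (rule laurent_ring_subring, rule laurent_var_in_ring)

text \<open>Both algebras are specializations of the generic algebra, with the same values of the parameters; hence the two bases have literally the same coordinates.\<close>

lemma common_coordinate_system: "\<exists>N co bv. int.coordinate_system N co bv & fld.coordinate_system N co bv"
proof -
 interpret gen: hecke_alg P x0 "laurent_ring (hidx_set P)" laurent_var by (rule generic)
 let ?h = "laurent_eval (spetsial_param m P)"
 have h: "coeff_hom ?h" by (rule laurent_eval_hom) (rule spetsial_param_nonzero)
 have v: "?h (laurent_var i) = spetsial_param m P i" for i by (rule laurent_eval_var) (rule spetsial_param_nonzero)
 interpret gi: hecke_base_change P x0 "laurent_ring (hidx_set P)" laurent_var "rouquier_ring m P" "spetsial_param m P" ?h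
 proof unfold_locales
  show "?h x : rouquier_ring m P" if "x : laurent_ring (hidx_set P)" for x
  by (rule laurent_eval_in_subring[OF _ rouquier_ring_subring _ that]) (simp_all add: spetsial_param_nonzero spetsial_param_in_ring)
 qed (rule h, rule v)
 interpret gf: hecke_base_change P x0 "laurent_ring (hidx_set P)" laurent_var "UNIV :: Ct set" "spetsial_param m P" ?h
  by unfold_locales (rule h, rule UNIV_I, rule v)
 obtain N co bv where c: "gen.coordinate_system N co bv" using gen.free_imp_coordinate_system[OF free] by (elim exE)
 from conjI[OF gi.coordinate_system_base_change[OF c] gf.coordinate_system_base_change[OF c]] show ?thesis by (intro exI)
qed

lemma int_carrier: "a : carrier int.A ==> a : carrier fld.A"
 by (rule carrier_UNIV)

text \<open>Membership in either ideal means that the regular representation vanishes, and the two regular representations are given by the same matrices.\<close>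

lemma ideal_iff: assumes a: "a : carrier int.A" shows "a : int.I \<longleftrightarrow> a : fld.I"
proof -
 obtain N co bv where c: "int.coordinate_system N co bv & fld.coordinate_system N co bv" using common_coordinate_system by (elim exE)
 show ?thesis using int.regular_rep(5)[OF conjunct1[OF c] a] fld.regular_rep(5)[OF conjunct2[OF c] int_carrier[OF a]] by simp
qed

text \<open>The canonical map from the algebra over the ring to the algebra over the field, which is injective by \<open>ideal_iff\<close>.\<close>

definition extend :: "('n braid => Ct) set => ('n braid => Ct) set" where
 "extend x = fld.cls (int.lift x)"

lemma extend_cls: assumes a: "a : carrier int.A" shows "extend (int.cls a) = fld.cls a"
proof -
 note l = int.lift_cls[OF a]
 have "(%z. int.lift (int.cls a) z - a z) : fld.I" using ideal_iff[OF int.I_carrier[OF l(2)]] l(2) by simp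
 then show ?thesis unfolding extend_def using fld.cls_eq[OF int_carrier[OF l(1)] int_carrier[OF a]] by simp
qed

lemma extend_hom: "extend : Ring.ring_hom int.HA fld.HA"
proof (rule ring_hom_memI)
 fix x y assume x: "x : carrier int.HA" and y: "y : carrier int.HA"
 note lx = int.lift[OF x] and ly = int.lift[OF y]
 note fx = int_carrier[OF lx(1)] and fy = int_carrier[OF ly(1)]
 show "extend x : carrier fld.HA" unfolding extend_def by (rule fld.cls_closed[OF fx])
 have "extend (int.cls (int.lift x) \<otimes>\<^bsub>int.HA\<^esub> int.cls (int.lift y)) = extend x \<otimes>\<^bsub>fld.HA\<^esub> extend y"
  unfolding int.cls_mult[OF lx(1) ly(1)] extend_cls[OF conv_closed[OF int.R braid_group_is_group lx(1) ly(1)]]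
  unfolding extend_def by (rule fld.cls_mult[OF fx fy, symmetric])
 then show "extend (x \<otimes>\<^bsub>int.HA\<^esub> y) = extend x \<otimes>\<^bsub>fld.HA\<^esub> extend y" unfolding lx(2) ly(2) .
 have "extend (int.cls (int.lift x) \<oplus>\<^bsub>int.HA\<^esub> int.cls (int.lift y)) = extend x \<oplus>\<^bsub>fld.HA\<^esub> extend y"
  unfolding int.cls_add[OF lx(1) ly(1)] extend_cls[OF add_closed[OF int.R lx(1) ly(1)]]
  unfolding extend_def by (rule fld.cls_add[OF fx fy, symmetric])
 then show "extend (x \<oplus>\<^bsub>int.HA\<^esub> y) = extend x \<oplus>\<^bsub>fld.HA\<^esub> extend y" unfolding lx(2) ly(2) .
next
 show "extend \<one>\<^bsub>int.HA\<^esub> = \<one>\<^bsub>fld.HA\<^esub>"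
  unfolding int.cls_one[symmetric] fld.cls_one[symmetric] by (rule extend_cls[OF int.single_A(1)[OF one_braid]])
qed

lemma extend_inj: "inj_on extend (carrier int.HA)"
proof (rule inj_onI)
 fix x y assume x: "x : carrier int.HA" and y: "y : carrier int.HA" and e: "extend x = extend y"
 note lx = int.lift[OF x] and ly = int.lift[OF y]
 have d: "(%z. int.lift x z - int.lift y z) : carrier int.A"
  using ring.ring_simprules(4)[OF int.A_ring lx(1) ly(1)] unfolding group_algebra_minus[OF int.R braid_group_is_group lx(1) ly(1)] .
 have "(%z. int.lift x z - int.lift y z) : int.I"
  using e unfolding extend_def fld.cls_eq[OF int_carrier[OF lx(1)] int_carrier[OF ly(1)]] ideal_iff[OF d] .
 then have "int.cls (int.lift x) = int.cls (int.lift y)" unfolding int.cls_eq[OF lx(1) ly(1)] .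
 then show "x = y" unfolding lx(2) ly(2) .
qed

lemma field_algebra: "scalar_algebra fld.HA fld.scal"
 by (rule scalar_algebra.intro[OF fld.H_ring], unfold_locales) (rule fld.scal_closed[OF UNIV_I], rule fld.scal_central[OF UNIV_I])

lemma faithful_rep: "\<exists>N \<Lambda>. algebra_rep fld.HA fld.scal N \<Lambda> & (\<forall>y\<in>carrier fld.HA. \<Lambda> y = 0\<^sub>m N N --> y = \<zero>\<^bsub>fld.HA\<^esub>)"
proof -
 obtain N co bv where c: "int.coordinate_system N co bv & fld.coordinate_system N co bv" using common_coordinate_system by (elim exE)
 define L where "L = fld.regular_rep N co bv"
 note L = fld.regular_rep[OF conjunct2[OF c], folded L_def]
 define \<Lambda> where "\<Lambda> x = L (fld.lift x)" for x
 have Lcls: "\<Lambda> (fld.cls a) = L a" if a: "a : carrier fld.A" for a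
 proof -
  let ?l = "fld.lift (fld.cls a)"
  note l = fld.lift_cls[OF a]
  have "L ?l = L (%z. (?l z - a z) + a z)" by simp
  also have "... = L (%z. ?l z - a z) + L a" by (rule L(3)[OF fld.I_carrier[OF l(2)] a])
  also have "L (%z. ?l z - a z) = 0\<^sub>m N N" using L(5)[OF fld.I_carrier[OF l(2)]] l(2) by simp
  finally show ?thesis unfolding \<Lambda>_def using L(1)[of a] by simp
 qed
 have "algebra_rep fld.HA fld.scal N \<Lambda>"
  unfolding algebra_rep_def
 proof (intro conjI ballI allI)
  show "\<Lambda> x : carrier_mat N N" for x unfolding \<Lambda>_def by (rule L(1))
  show sc: "\<Lambda> (fld.scal r) = r \<cdot>\<^sub>m 1\<^sub>m N" for r
  unfolding fld.scal_eq Lcls[OF fld.single_A(2)[OF UNIV_I]] by (rule L(4))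
  show "\<Lambda> \<one>\<^bsub>fld.HA\<^esub> = 1\<^sub>m N" using sc[of 1] unfolding fld.scal_eq fld.cls_one by (simp add: one_smult_one_mat)
  fix x y assume x: "x : carrier fld.HA" and y: "y : carrier fld.HA"
  note lx = fld.lift[OF x] and ly = fld.lift[OF y]
  have "\<Lambda> (fld.cls (fld.lift x) \<oplus>\<^bsub>fld.HA\<^esub> fld.cls (fld.lift y)) = \<Lambda> x + \<Lambda> y"
  unfolding fld.cls_add[OF lx(1) ly(1)] Lcls[OF add_closed[OF fld.R lx(1) ly(1)]] L(3)[OF lx(1) ly(1)] unfolding \<Lambda>_def ..
  then show "\<Lambda> (x \<oplus>\<^bsub>fld.HA\<^esub> y) = \<Lambda> x + \<Lambda> y" unfolding lx(2) ly(2) .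
  have "\<Lambda> (fld.cls (fld.lift x) \<otimes>\<^bsub>fld.HA\<^esub> fld.cls (fld.lift y)) = \<Lambda> x * \<Lambda> y"
  unfolding fld.cls_mult[OF lx(1) ly(1)] Lcls[OF conv_closed[OF fld.R braid_group_is_group lx(1) ly(1)]] L(2)[OF lx(1) ly(1)] unfolding \<Lambda>_def ..
  then show "\<Lambda> (x \<otimes>\<^bsub>fld.HA\<^esub> y) = \<Lambda> x * \<Lambda> y" unfolding lx(2) ly(2) .
 qed
 moreover have "y = \<zero>\<^bsub>fld.HA\<^esub>" if y: "y : carrier fld.HA" and z: "\<Lambda> y = 0\<^sub>m N N" for y
 proof -
  note ly = fld.lift[OF y]
  have "fld.lift y : fld.I" using L(5)[OF ly(1)] z unfolding \<Lambda>_def by simp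
  then have "fld.cls (fld.lift y) = \<zero>\<^bsub>fld.HA\<^esub>" using fld.cls_zero[OF ly(1)] by simp
  then show ?thesis unfolding ly(2) .
 qed
 ultimately show ?thesis by (intro exI[of _ N] exI[of _ \<Lambda>]) blast
qed

end

section \<open>Irreducible representations of the spetsial algebra\<close>

lemma algebra_repD:
 assumes "algebra_rep A sc d \<phi>"
 shows "x : carrier A ==> \<phi> x : carrier_mat d d" "\<phi> \<one>\<^bsub>A\<^esub> = 1\<^sub>m d"
  "x : carrier A ==> y : carrier A ==> \<phi> (x \<oplus>\<^bsub>A\<^esub> y) = \<phi> x + \<phi> y"
  "x : carrier A ==> y : carrier A ==> \<phi> (x \<otimes>\<^bsub>A\<^esub> y) = \<phi> x * \<phi> y" "\<phi> (sc c) = c \<cdot>\<^sub>m 1\<^sub>m d"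
 using assms unfolding algebra_rep_def by blast+

lemma scalar_mat_mult: assumes "(M :: 'k::comm_ring_1 mat) : carrier_mat d d" shows "(c \<cdot>\<^sub>m 1\<^sub>m d) * M = c \<cdot>\<^sub>m M"
proof -
 have "(c \<cdot>\<^sub>m 1\<^sub>m d) * M = c \<cdot>\<^sub>m (1\<^sub>m d * M)" by (rule mult_smult_assoc_mat[OF one_carrier_mat assms])
 then show ?thesis unfolding left_mult_one_mat[OF assms] .
qed

lemma mat_trace_smult: "mat_trace (c \<cdot>\<^sub>m (M :: 'k::comm_ring_1 mat)) = c * mat_trace M" if "M : carrier_mat d d"
 using that unfolding mat_trace_def by (simp add: sum_distrib_left)

lemma mat_trace_add: "mat_trace (M + N) = mat_trace M + mat_trace (N :: 'k::comm_ring_1 mat)" if "M : carrier_mat d d" "N : carrier_mat d d"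
 using that unfolding mat_trace_def by (simp add: sum.distrib)

lemma scalar_mat_pow: "((c :: 'k::comm_ring_1) \<cdot>\<^sub>m 1\<^sub>m d) ^\<^sub>m n = c ^ n \<cdot>\<^sub>m 1\<^sub>m d"
proof (induction n)
 case 0 show ?case by (simp add: one_smult_one_mat)
next
 case (Suc n)
 have "(c ^ n \<cdot>\<^sub>m 1\<^sub>m d) * (c \<cdot>\<^sub>m 1\<^sub>m d) = c ^ n \<cdot>\<^sub>m (c \<cdot>\<^sub>m 1\<^sub>m d)" by (rule scalar_mat_mult) simp
 also have "... = c ^ Suc n \<cdot>\<^sub>m 1\<^sub>m d" by (rule eq_matI) (auto simp: mult.commute)
 finally show ?case using Suc by simp
qed

context spetsial_algebra
begin

sublocale FA: scalar_algebra fld.HA fld.scal by (rule field_algebra)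

abbreviation "irrep \<equiv> spetsial_irrep m P x0"
abbreviation "q \<equiv> Ct_q m"

definition rep_char :: "(('n braid => Ct) set => Ct mat) => 'n braid => Ct" where
 "rep_char \<phi> b = (if b : carrier B then mat_trace (\<phi> (fld.T b)) else 0)"

lemma irrepD:
 assumes "irrep d \<phi>"
 shows "algebra_rep fld.HA fld.scal d \<phi>" "irreducible_mats d (\<phi> ` carrier fld.HA)" "d > 0"
proof -
 show "algebra_rep fld.HA fld.scal d \<phi>" and i: "irreducible_mats d (\<phi> ` carrier fld.HA)"
  using assms unfolding spetsial_irrep_def by simp_all
 show "d > 0" using i unfolding irreducible_mats_def by (rule conjunct1)
qed

lemma rep_zero: assumes "irrep d \<phi>" shows "\<phi> \<zero>\<^bsub>fld.HA\<^esub> = 0\<^sub>m d d"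
proof -
 have "single_elt (0 :: Ct) \<one>\<^bsub>B\<^esub> = (%z. 0)" unfolding single_elt_def by auto
 then have "fld.scal 0 = \<zero>\<^bsub>fld.HA\<^esub>" unfolding fld.scal_eq using fld.cls_zero_fun by simp
 then have "\<phi> \<zero>\<^bsub>fld.HA\<^esub> = 0 \<cdot>\<^sub>m 1\<^sub>m d" using algebra_repD(5)[OF irrepD(1)[OF assms], of 0] by simp
 then show ?thesis by (intro eq_matI) auto
qed

lemma rep_T:
 assumes "irrep d \<phi>"
 shows "x : carrier B ==> \<phi> (fld.T x) : carrier_mat d d" "\<phi> (fld.T \<one>\<^bsub>B\<^esub>) = 1\<^sub>m d"
  "x : carrier B ==> y : carrier B ==> \<phi> (fld.T (x \<otimes>\<^bsub>B\<^esub> y)) = \<phi> (fld.T x) * \<phi> (fld.T y)"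
proof -
 note r = algebra_repD[OF irrepD(1)[OF assms]]
 show "x : carrier B ==> \<phi> (fld.T x) : carrier_mat d d" by (rule r(1)[OF fld.T_closed])
 show "\<phi> (fld.T \<one>\<^bsub>B\<^esub>) = 1\<^sub>m d" unfolding fld.T_one by (rule r(2))
 show "\<phi> (fld.T (x \<otimes>\<^bsub>B\<^esub> y)) = \<phi> (fld.T x) * \<phi> (fld.T y)" if "x : carrier B" "y : carrier B"
  unfolding fld.T_mult[OF that, symmetric] by (rule r(4)[OF fld.T_closed fld.T_closed, OF that])
qed

text \<open>The value of a character of the algebra on the class of \<open>a\<close> is the linear extension of its values on braids.\<close>

lemma trace_cls:
 assumes \<phi>: "irrep d \<phi>" and a: "a : carrier fld.A"
 shows "mat_trace (\<phi> (fld.cls a)) = lin_ext (rep_char \<phi>) a"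
proof (rule linear_on_group_algebra[where F = "%a. mat_trace (\<phi> (fld.cls a))", OF a fld.R])
 note r = algebra_repD[OF irrepD(1)[OF \<phi>]]
 show "mat_trace (\<phi> (fld.cls (%z. 0))) = 0" unfolding fld.cls_zero_fun rep_zero[OF \<phi>] by (simp add: mat_trace_def)
 show "mat_trace (\<phi> (fld.cls (single_elt c b))) = c * rep_char \<phi> b" if b: "b : carrier B" for c b
  unfolding fld.scal_T[OF UNIV_I b, symmetric] r(4)[OF fld.scal_closed[OF UNIV_I] fld.T_closed[OF b]] r(5)
  scalar_mat_mult[OF rep_T(1)[OF \<phi> b]] mat_trace_smult[OF rep_T(1)[OF \<phi> b]] rep_char_def using b by simp
 show "mat_trace (\<phi> (fld.cls (%z. f z + g z))) = mat_trace (\<phi> (fld.cls f)) + mat_trace (\<phi> (fld.cls g))"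
  if "f : carrier fld.A" "g : carrier fld.A" for f g
  unfolding fld.cls_add[OF that, symmetric] r(3)[OF fld.cls_closed[OF that(1)] fld.cls_closed[OF that(2)]]
  by (rule mat_trace_add[OF r(1)[OF fld.cls_closed[OF that(1)]] r(1)[OF fld.cls_closed[OF that(2)]]])
qed

lemma rep_char_in: assumes "irrep d \<phi>" shows "rep_char \<phi> : spetsial_Irr m P x0"
proof -
 have "rep_char \<phi> = (%b. if b : carrier B then mat_trace (\<phi> (fld.T b)) else 0)" by (rule ext) (rule rep_char_def)
 then show ?thesis unfolding spetsial_Irr_def using assms by (intro CollectI exI conjI)
qed

lemma specialized_character: assumes "irrep d \<phi>" shows "\<exists>\<theta>. \<theta> : Irr P & specializes P x0 (rep_char \<phi>) \<theta>"
 using splits rep_char_in[OF assms] unfolding spetsial_splits_def by (elim conjE ballE[of _ _ "rep_char \<phi>"]) (rule ex1_implies_ex, assumption, blast+)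

lemma character_lifts:
 assumes \<theta>: "\<theta> : Irr P"
 shows "\<exists>d \<phi>. irrep d \<phi> & specializes P x0 (rep_char \<phi>) \<theta> & char_t m P x0 \<theta> = rep_char \<phi>"
proof -
 have "\<exists>!\<theta>t. \<theta>t : spetsial_Irr m P x0 & specializes P x0 \<theta>t \<theta>" using splits \<theta> unfolding spetsial_splits_def by simp
 from theI'[OF this] have c: "char_t m P x0 \<theta> : spetsial_Irr m P x0" "specializes P x0 (char_t m P x0 \<theta>) \<theta>"
  unfolding char_t_def by simp_all
 obtain d \<phi> where \<phi>: "irrep d \<phi>" "char_t m P x0 \<theta> = (%b. if b : carrier B then mat_trace (\<phi> (fld.T b)) else 0)"
  using c(1) unfolding spetsial_Irr_def by (elim CollectE exE conjE) (rule that; assumption)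
 have e: "char_t m P x0 \<theta> = rep_char \<phi>" unfolding \<phi>(2) by (rule ext) (rule rep_char_def[symmetric])
 show ?thesis by (rule exI[of _ d], rule exI[of _ \<phi>]) (use \<phi>(1) c(2) e in simp)
qed

lemma specialized_value:
 assumes s: "specializes P x0 \<theta>t \<theta>" and b: "b : carrier B" and v: "\<theta>t b = to_fract Q"
 shows "\<theta> (fst b) = poly Q 1"
proof -
 obtain p k where p: "\<theta>t b = to_fract p / to_fract (Polynomial.monom 1 k) & poly p 1 = \<theta> (fst b)"
  using s b unfolding specializes_def by blast
 then have "to_fract p / to_fract (Polynomial.monom 1 k) = to_fract Q" using v by simp
 from evaluation_at_1[OF this] p show ?thesis by simp
qed

lemma specialized_degree:
 assumes \<phi>: "irrep d \<phi>" and s: "specializes P x0 (rep_char \<phi>) \<theta>"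
 shows "\<theta> I1 = of_nat d"
proof -
 have "rep_char \<phi> \<one>\<^bsub>B\<^esub> = to_fract (of_nat d)"
  unfolding rep_char_def rep_T(2)[OF \<phi>] to_fract_of_nat using one_braid by (simp add: mat_trace_def)
 from specialized_value[OF s one_braid this] show ?thesis by (simp add: braid_group_def)
qed

lemma fst_pow: "fst (b [^]\<^bsub>B\<^esub> (n::nat)) = fst b [^]\<^bsub>mat_group P\<^esub> n"
proof (induction n)
 case 0 show ?case by (simp add: braid_group_def mat_group_def)
next
 case (Suc n) then show ?case by (simp add: braid_fst_mult mat_group_simps)
qed

lemma sum_powers_zeta:
 assumes "j < e"
 shows "(\<Sum>i<e. (zeta e ^ j) ^ i) = (if j = 0 then of_nat e else 0)"
proof (cases "j = 0")
 case False
 have e: "e > 0" using assms by simp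
 have "\<not> e dvd j" using assms False by (simp add: nat_dvd_not_less)
 then have ne: "zeta e ^ j ~= 1" using zeta_power_eq_1[OF e] by simp
 have "(zeta e ^ j) ^ e = (zeta e ^ e) ^ j" by (simp add: power_mult[symmetric] mult.commute)
 also have "... = 1" using zeta_power_eq_1[OF e, of e] by simp
 finally show ?thesis using geometric_sum[OF ne, of e] False by simp
qed simp

text \<open>The eigenvalues of \<open>b\<close> are \<open>q\<close> and powers of a root of unity \<open>\<zeta>\<close>. At \<open>t = 1\<close> the traces of the powers of \<open>b\<close> become the values of \<open>\<theta>\<close> on the fixator, and summing over the fixator isolates the multiplicity of \<open>q\<close>. The power \<open>e\<^sub>H\<close> of the determinant removes the roots of unity.\<close>

lemma reflection_determinant:
 assumes \<phi>: "irrep d \<phi>" and s: "specializes P x0 (rep_char \<phi>) \<theta>"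
  and b: "braid_reflection P x0 H b" "fst b : fixator P H" "normal_eigenvalue H (fst b) = zeta (hyp_order P H)"
 shows "\<exists>k. det (\<phi> (fld.T b)) ^ hyp_order P H = q ^ k & of_nat k = (\<Sum>w\<in>fixator P H. \<theta> w)"
proof -
 let ?e = "hyp_order P H"
 let ?us = "map (%j. spetsial_param m P (hyp_orbit P H, j)) [0..<?e]"
 note Hb = braid_reflection_carrier[OF b(1)]
 have e: "?e > 0" using hyp_order_ge_2[OF Hb(1)] by simp
 have "FA.product_at (fld.T b) ?us = \<zero>\<^bsub>fld.HA\<^esub>" unfolding FA.product_at_def by (rule fld.relator_class[OF b(1)])
 then have rel: "\<phi> (FA.product_at (fld.T b) ?us) = 0\<^sub>m d d" using rep_zero[OF \<phi>] by simp
 from FA.eigenvalue_multiplicities[OF irrepD(1)[OF \<phi>] fld.T_closed[OF Hb(2)] rel]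
 obtain k :: "nat => nat" where k0: "det (\<phi> (fld.T b)) = (\<Prod>j<length ?us. ?us ! j ^ k j) &
  (\<forall>i::nat. mat_trace (\<phi> (fld.T b [^]\<^bsub>fld.HA\<^esub> i)) = (\<Sum>j<length ?us. of_nat (k j) * ?us ! j ^ i))" by (elim exE)
 let ?z = "zeta ?e"
 \<comment> \<open>the eigenvalues as polynomials in \<open>t\<close>, so that they can be evaluated at \<open>1\<close>\<close>
 define v where "v j = (if j = 0 then Polynomial.monom 1 m else [:?z ^ j:])" for j :: nat
 have us: "?us ! j = to_fract (v j)" if "j < ?e" for j
  using that unfolding v_def by (simp add: spetsial_param_at Ct_q_def Ct_const_def)
 have v1: "poly (v j) 1 = ?z ^ j" for j unfolding v_def by (simp add: poly_monom)
 have pow_value: "\<theta> (fst b [^]\<^bsub>mat_group P\<^esub> i) = (\<Sum>j<?e. of_nat (k j) * (?z ^ j) ^ i)" for i :: nat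
 proof -
  have "rep_char \<phi> (b [^]\<^bsub>B\<^esub> i) = mat_trace (\<phi> (fld.T b [^]\<^bsub>fld.HA\<^esub> i))"
  unfolding rep_char_def fld.T_pow[OF Hb(2)] using fld.pow_braid[OF Hb(2)] by simp
  also have "... = (\<Sum>j<?e. of_nat (k j) * to_fract (v j) ^ i)" using conjunct2[OF k0] us by simp
  also have "... = to_fract (\<Sum>j<?e. of_nat (k j) * v j ^ i)" by (simp add: to_fract_power to_fract_of_nat)
  finally have "\<theta> (fst (b [^]\<^bsub>B\<^esub> i)) = poly (\<Sum>j<?e. of_nat (k j) * v j ^ i) 1"
  by (rule specialized_value[OF s fld.pow_braid[OF Hb(2)]])
  then show ?thesis unfolding fst_pow by (simp add: poly_sum v1)
 qed
 have "(\<Sum>w\<in>fixator P H. \<theta> w) = (\<Sum>i<?e. \<theta> (fst b [^]\<^bsub>mat_group P\<^esub> i))"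
  by (rule sum.reindex_bij_betw[OF fixator_powers[OF Hb(1) b(2,3)], symmetric])
 also have "... = (\<Sum>j<?e. \<Sum>i<?e. of_nat (k j) * (?z ^ j) ^ i)" unfolding pow_value by (rule sum.swap)
 also have "... = (\<Sum>j<?e. of_nat (k j) * (if j = 0 then of_nat ?e else 0))"
  by (rule sum.cong) (simp_all add: sum_distrib_left[symmetric] sum_powers_zeta)
 also have "... = of_nat (k 0 * ?e)" using e by (simp add: if_distrib sum.delta cong: if_cong)
 finally have sum: "(\<Sum>w\<in>fixator P H. \<theta> w) = of_nat (k 0 * ?e)" .
 have "det (\<phi> (fld.T b)) ^ ?e = (\<Prod>j<?e. (to_fract (v j) ^ k j) ^ ?e)" using conjunct1[OF k0] us by (simp add: prod_power_distrib)
 also have "... = (\<Prod>j<?e. if j = 0 then q ^ (k 0 * ?e) else 1)"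
 proof (rule prod.cong[OF HOL.refl])
  fix j assume "j : {..<?e}"
  show "(to_fract (v j) ^ k j) ^ ?e = (if j = 0 then q ^ (k 0 * ?e) else 1)"
  proof (cases "j = 0")
  case True then show ?thesis by (simp add: v_def Ct_q_def power_mult)
  next
  case False
  have "(?z ^ j) ^ (k j * ?e) = (?z ^ ?e) ^ (j * k j)" by (simp add: power_mult[symmetric] mult_ac)
  also have "... = 1" using zeta_power_eq_1[OF e, of ?e] by simp
  finally have "Ct_const (?z ^ j) ^ (k j * ?e) = 1" unfolding Ct_const_power[symmetric] by (simp add: Ct_const_simps)
  then show ?thesis using False by (simp add: v_def Ct_const_def power_mult)
  qed
 qed
 also have "... = q ^ (k 0 * ?e)" using e by (simp add: prod.delta)
 finally show ?thesis using sum by (intro exI[of _ "k 0 * ?e"]) simp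
qed

abbreviation "\<pi> \<equiv> full_twist P x0"

definition reflection_sum :: "('n cmat => complex) => complex" where
 "reflection_sum \<theta> = (\<Sum>s\<in>refl P. \<theta> s)"

lemma T_central:
 assumes "z : carrier B" "!!b. b : carrier B ==> z \<otimes>\<^bsub>B\<^esub> b = b \<otimes>\<^bsub>B\<^esub> z"
 shows "x : carrier fld.HA ==> fld.T z \<otimes>\<^bsub>fld.HA\<^esub> x = x \<otimes>\<^bsub>fld.HA\<^esub> fld.T z"
  "y : carrier int.HA ==> int.T z \<otimes>\<^bsub>int.HA\<^esub> y = y \<otimes>\<^bsub>int.HA\<^esub> int.T z"
 by (rule fld.central_if_commutes[OF fld.T_closed[OF assms(1)]], simp add: fld.T_mult assms, assumption)
  (rule int.central_if_commutes[OF int.T_closed[OF assms(1)]], simp add: int.T_mult assms, assumption)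

text \<open>Apply \<open>full_twist_product\<close> to the determinant of the representation.\<close>

lemma full_twist_scalar:
 assumes \<phi>: "irrep d \<phi>" and s: "specializes P x0 (rep_char \<phi>) \<theta>"
 shows "\<exists>\<omega> M. \<phi> (fld.T \<pi>) = \<omega> \<cdot>\<^sub>m 1\<^sub>m d & \<omega> ^ d = q ^ M & of_nat M = of_nat (card (hyperplanes P)) * \<theta> I1 + reflection_sum \<theta>"
proof -
 note r = algebra_repD[OF irrepD(1)[OF \<phi>]]
 define \<delta> where "\<delta> b = det (\<phi> (fld.T b))" for b
 have mult: "\<delta> (a \<otimes>\<^bsub>B\<^esub> b) = \<delta> a * \<delta> b" if "a : carrier B" "b : carrier B" for a b
  unfolding \<delta>_def rep_T(3)[OF \<phi> that] by (rule det_mult[OF rep_T(1)[OF \<phi> that(1)] rep_T(1)[OF \<phi> that(2)]])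
 have one: "\<delta> \<one>\<^bsub>B\<^esub> = 1" unfolding \<delta>_def rep_T(2)[OF \<phi>] by simp
 have nz: "\<delta> a ~= 0" if a: "a : carrier B" for a
  using mult[OF a group.inv_closed[OF braid_group_is_group a]] one unfolding group.r_inv[OF braid_group_is_group a] by auto
 have \<delta>: "braid_character \<delta>" unfolding braid_character_def using mult nz by simp
 obtain t b where tb: "(\<forall>H\<in>hyperplanes P. t H : fixator P H & normal_eigenvalue H (t H) = zeta (hyp_order P H) &
  fst (b H) = t H & braid_reflection P x0 H (b H) & b H : carrier B) &
  (\<forall>\<delta> :: 'n braid => Ct. braid_character \<delta> --> \<delta> \<pi> = (\<Prod>H\<in>hyperplanes P. \<delta> (b H) ^ hyp_order P H))"
  using full_twist_product by (elim exE)
 have "\<exists>k. \<delta> (b H) ^ hyp_order P H = q ^ k & of_nat k = (\<Sum>w\<in>fixator P H. \<theta> w)" if H: "H : hyperplanes P" for H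
  unfolding \<delta>_def by (rule reflection_determinant[OF \<phi> s]) (use bspec[OF conjunct1[OF tb] H] in simp_all)
 then have "\<forall>H\<in>hyperplanes P. \<exists>k. \<delta> (b H) ^ hyp_order P H = q ^ k & of_nat k = (\<Sum>w\<in>fixator P H. \<theta> w)" by blast
 from bchoice[OF this] obtain k where k: "\<forall>H\<in>hyperplanes P. \<delta> (b H) ^ hyp_order P H = q ^ k H & of_nat (k H) = (\<Sum>w\<in>fixator P H. \<theta> w)" ..
 have "\<delta> \<pi> = (\<Prod>H\<in>hyperplanes P. \<delta> (b H) ^ hyp_order P H)" using conjunct2[OF tb] \<delta> by blast
 also have "... = (\<Prod>H\<in>hyperplanes P. q ^ k H)" using k by (intro prod.cong) simp_all
 also have "... = q ^ (\<Sum>H\<in>hyperplanes P. k H)" by (rule power_sum[symmetric])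
 finally have dp: "\<delta> \<pi> = q ^ (\<Sum>H\<in>hyperplanes P. k H)" .
 have "(of_nat (\<Sum>H\<in>hyperplanes P. k H) :: complex) = (\<Sum>H\<in>hyperplanes P. \<Sum>w\<in>fixator P H. \<theta> w)" using k by simp
 then have M: "(of_nat (\<Sum>H\<in>hyperplanes P. k H) :: complex) = of_nat (card (hyperplanes P)) * \<theta> I1 + reflection_sum \<theta>"
  unfolding sum_over_fixators reflection_sum_def .
 let ?X = "\<phi> (fld.T \<pi>)"
 have "?X * \<phi> x = \<phi> x * ?X" if x: "x : carrier fld.HA" for x
 proof -
  have "\<phi> (fld.T \<pi> \<otimes>\<^bsub>fld.HA\<^esub> x) = \<phi> (x \<otimes>\<^bsub>fld.HA\<^esub> fld.T \<pi>)"
  by (rule arg_cong[where f = \<phi>], rule T_central(1)[OF full_twist_carrier full_twist_central x])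
  then show ?thesis unfolding r(4)[OF fld.T_closed[OF full_twist_carrier] x] r(4)[OF x fld.T_closed[OF full_twist_carrier]] .
 qed
 then obtain \<omega> where \<omega>: "?X = \<omega> \<cdot>\<^sub>m 1\<^sub>m d"
  using splits \<phi> rep_T(1)[OF \<phi> full_twist_carrier] unfolding spetsial_splits_def by blast
 have "\<omega> ^ d = q ^ (\<Sum>H\<in>hyperplanes P. k H)" using dp unfolding \<delta>_def \<omega> by (simp add: det_smult)
 then show ?thesis using \<omega> M by blast
qed

definition char_degree :: "('n cmat => complex) => nat" where
 "char_degree \<theta> = (THE d. \<theta> I1 = of_nat d)"

definition twist_degree :: "('n cmat => complex) => nat" where
 "twist_degree \<theta> = (THE M. of_nat M = of_nat (card (hyperplanes P)) * \<theta> I1 + reflection_sum \<theta>)"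

text \<open>The scalar of the full twist is only known up to a root of unity of order the degree of the representation; this power is a multiple of all degrees.\<close>

definition common_degree :: nat where
 "common_degree = (\<Prod>\<theta>\<in>Irr P. char_degree \<theta>)"

text \<open>The exponent of \<open>q\<close> in the scalar by which the power \<open>common_degree\<close> of the full twist acts.\<close>

definition twist_exponent :: "('n cmat => complex) => nat" where
 "twist_exponent \<theta> = twist_degree \<theta> * (common_degree div char_degree \<theta>)"

lemma char_degree_eq: "\<theta> I1 = of_nat d ==> char_degree \<theta> = d"
 unfolding char_degree_def by (rule the_equality) simp_all

lemma twist_degree_eq: "of_nat M = of_nat (card (hyperplanes P)) * \<theta> I1 + reflection_sum \<theta> ==> twist_degree \<theta> = M"
 unfolding twist_degree_def by (rule the_equality) (assumption, metis of_nat_eq_iff)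

lemma character_degrees:
 assumes \<theta>: "\<theta> : Irr P"
 shows "\<theta> I1 = of_nat (char_degree \<theta>)" "char_degree \<theta> > 0"
  "of_nat (twist_degree \<theta>) = of_nat (card (hyperplanes P)) * \<theta> I1 + reflection_sum \<theta>"
  "common_degree div char_degree \<theta> * char_degree \<theta> = common_degree"
proof -
 obtain d \<phi> where "irrep d \<phi> & specializes P x0 (rep_char \<phi>) \<theta> & char_t m P x0 \<theta> = rep_char \<phi>"
  using character_lifts[OF \<theta>] by (elim exE)
 then have \<phi>: "irrep d \<phi>" and s: "specializes P x0 (rep_char \<phi>) \<theta>" by blast+
 note d = specialized_degree[OF \<phi> s]
 show "\<theta> I1 = of_nat (char_degree \<theta>)" "char_degree \<theta> > 0" unfolding char_degree_eq[of \<theta> d, OF d] using d irrepD(3)[OF \<phi>] .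
 obtain \<omega> M where "\<phi> (fld.T \<pi>) = \<omega> \<cdot>\<^sub>m 1\<^sub>m d & \<omega> ^ d = q ^ M & of_nat M = of_nat (card (hyperplanes P)) * \<theta> I1 + reflection_sum \<theta>"
  using full_twist_scalar[OF \<phi> s] by (elim exE)
 then have M: "of_nat M = of_nat (card (hyperplanes P)) * \<theta> I1 + reflection_sum \<theta>" by blast
 show "of_nat (twist_degree \<theta>) = of_nat (card (hyperplanes P)) * \<theta> I1 + reflection_sum \<theta>" unfolding twist_degree_eq[of M \<theta>, OF M] by (rule M)
 have "char_degree \<theta> dvd common_degree" unfolding common_degree_def by (rule dvd_prodI[OF finite_Irr \<theta>])
 then show "common_degree div char_degree \<theta> * char_degree \<theta> = common_degree" by simp
qed

lemma common_degree_pos: "common_degree > 0"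
 unfolding common_degree_def by (rule prod_pos) (use character_degrees(2) in simp)

abbreviation "z0 \<equiv> \<pi> [^]\<^bsub>B\<^esub> common_degree"

lemma twist_power_acts:
 assumes \<phi>: "irrep d \<phi>" and s: "specializes P x0 (rep_char \<phi>) \<theta>"
 shows "\<phi> (fld.T z0) = q ^ twist_exponent \<theta> \<cdot>\<^sub>m 1\<^sub>m d"
proof -
 obtain \<omega> M where 1: "\<phi> (fld.T \<pi>) = \<omega> \<cdot>\<^sub>m 1\<^sub>m d & \<omega> ^ d = q ^ M & of_nat M = of_nat (card (hyperplanes P)) * \<theta> I1 + reflection_sum \<theta>"
  using full_twist_scalar[OF \<phi> s] by (elim exE)
 note \<omega> = conjunct1[OF 1] and \<omega>d = conjunct1[OF conjunct2[OF 1]] and M = conjunct2[OF conjunct2[OF 1]]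
 note d = char_degree_eq[of \<theta> d, OF specialized_degree[OF \<phi> s]]
 obtain \<theta>' where \<theta>': "\<theta>' : Irr P & specializes P x0 (rep_char \<phi>) \<theta>'" using specialized_character[OF \<phi>] ..
 have "d dvd common_degree"
  using char_degree_eq[of \<theta>' d, OF specialized_degree[OF \<phi> conjunct2[OF \<theta>']]] dvd_prodI[OF finite_Irr conjunct1[OF \<theta>'], of char_degree]
  unfolding common_degree_def by simp
 then have "\<omega> ^ common_degree = (\<omega> ^ d) ^ (common_degree div d)" by (simp add: power_mult[symmetric])
 also have "... = q ^ twist_exponent \<theta>" unfolding \<omega>d twist_exponent_def d twist_degree_eq[of M \<theta>, OF M] by (rule power_mult[symmetric])
 finally have "\<omega> ^ common_degree = q ^ twist_exponent \<theta>" .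
 then show ?thesis
  unfolding fld.T_pow[OF full_twist_carrier, symmetric] FA.rep_pow[OF irrepD(1)[OF \<phi>] fld.T_closed[OF full_twist_carrier]] \<omega> scalar_mat_pow by simp
qed

lemma twist_exponent_determines_ratio:
 assumes "\<theta> : Irr P" "\<psi> : Irr P" "twist_exponent \<theta> = twist_exponent \<psi>"
 shows "reflection_sum \<theta> / \<theta> I1 = reflection_sum \<psi> / \<psi> I1"
proof -
 have r: "(of_nat (twist_exponent \<theta>) :: complex) = (of_nat (card (hyperplanes P)) + reflection_sum \<theta> / \<theta> I1) * of_nat common_degree" if \<theta>: "\<theta> : Irr P" for \<theta>
 proof -
  note c = character_degrees[OF \<theta>]
  have nz: "\<theta> I1 ~= 0" using c(1,2) by simp
  have k: "(of_nat common_degree :: complex) = of_nat (common_degree div char_degree \<theta>) * \<theta> I1"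
  unfolding c(1) of_nat_mult[symmetric] c(4) ..
  have "(of_nat (card (hyperplanes P)) + reflection_sum \<theta> / \<theta> I1) * of_nat common_degree
  = (of_nat (card (hyperplanes P)) * \<theta> I1 + reflection_sum \<theta>) * of_nat (common_degree div char_degree \<theta>)"
  unfolding k using nz by (simp add: field_simps)
  then show ?thesis unfolding twist_exponent_def of_nat_mult c(3) by simp
 qed
 have "of_nat common_degree ~= (0 :: complex)" using common_degree_pos by simp
 then show ?thesis using r[OF assms(1)] r[OF assms(2)] assms(3) by simp
qed

section \<open>Families and the full twist\<close>

text \<open>This is where the denominators \<open>q ^ n - 1\<close> in the ring defining the families are used.\<close>

lemma difference_of_powers_unit:
 assumes "a ~= b"
 shows "inverse (q ^ b - q ^ a) : rouquier_ring m P" "q ^ b - q ^ a ~= 0"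
proof -
 show "q ^ b - q ^ a ~= 0" using Ct_q_power_inj[OF m, of b a] assms by auto
 note O = rouquier_ring_subring[of m P]
 have lt: "inverse (q ^ b - q ^ a) : rouquier_ring m P" if "a < b" for a b
 proof -
  have "q ^ b - q ^ a = q ^ a * (q ^ (b - a) - 1)" using that by (simp add: right_diff_distrib power_add[symmetric])
  then have "inverse (q ^ b - q ^ a) = inverse q ^ a * inverse (q ^ (b - a) - 1)" by (simp add: power_inverse)
  moreover have "inverse q ^ a * inverse (q ^ (b - a) - 1) : rouquier_ring m P"
  by (rule is_subringD(4)[OF O is_subring_power[OF O rouquier_ring_members(3)] rouquier_ring_members(4)]) (use that in simp)
  ultimately show ?thesis by simp
 qed
 show "inverse (q ^ b - q ^ a) : rouquier_ring m P"
 proof (cases "a < b")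
  case True then show ?thesis by (rule lt)
 next
  case False
  then have "b < a" using assms by simp
  from is_subringD(5)[OF O lt[OF this]] have "- inverse (q ^ a - q ^ b) : rouquier_ring m P" .
  moreover have "- inverse (q ^ a - q ^ b) = inverse (q ^ b - q ^ a)" by (simp add: inverse_minus_eq[symmetric])
  ultimately show ?thesis by simp
 qed
qed

lemma z0_props: "z0 : carrier B" "b : carrier B ==> z0 \<otimes>\<^bsub>B\<^esub> b = b \<otimes>\<^bsub>B\<^esub> z0"
proof -
 show "z0 : carrier B" by (rule fld.pow_braid[OF full_twist_carrier])
 interpret G: group B by (rule braid_group_is_group)
 assume b: "b : carrier B"
 have "\<pi> [^]\<^bsub>B\<^esub> n \<otimes>\<^bsub>B\<^esub> b = b \<otimes>\<^bsub>B\<^esub> \<pi> [^]\<^bsub>B\<^esub> n" for n :: nat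
 proof (induction n)
  case 0 then show ?case using b by simp
 next
  case (Suc n)
  note c = fld.pow_braid[OF full_twist_carrier, of n] and p = full_twist_carrier
  have "\<pi> [^]\<^bsub>B\<^esub> n \<otimes>\<^bsub>B\<^esub> \<pi> \<otimes>\<^bsub>B\<^esub> b = \<pi> [^]\<^bsub>B\<^esub> n \<otimes>\<^bsub>B\<^esub> (b \<otimes>\<^bsub>B\<^esub> \<pi>)" unfolding G.m_assoc[OF c p b] full_twist_central[OF b] ..
  also have "... = \<pi> [^]\<^bsub>B\<^esub> n \<otimes>\<^bsub>B\<^esub> b \<otimes>\<^bsub>B\<^esub> \<pi>" by (rule G.m_assoc[OF c b p, symmetric])
  also have "... = b \<otimes>\<^bsub>B\<^esub> \<pi> [^]\<^bsub>B\<^esub> n \<otimes>\<^bsub>B\<^esub> \<pi>" by (rule arg_cong[where f = "%x. x \<otimes>\<^bsub>B\<^esub> \<pi>"], rule Suc.IH)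
  also have "... = b \<otimes>\<^bsub>B\<^esub> (\<pi> [^]\<^bsub>B\<^esub> n \<otimes>\<^bsub>B\<^esub> \<pi>)" by (rule G.m_assoc[OF b c p])
  finally show ?case by simp
 qed
 then show "z0 \<otimes>\<^bsub>B\<^esub> b = b \<otimes>\<^bsub>B\<^esub> z0" .
qed

definition shifted_twist :: "nat => 'n braid => Ct" where
 "shifted_twist a = (%z. single_elt 1 z0 z - single_elt (q ^ a) \<one>\<^bsub>B\<^esub> z)"

lemma shifted_twist_int: "shifted_twist a : carrier int.A" "int.cls (shifted_twist a) = int.T z0 \<ominus>\<^bsub>int.HA\<^esub> int.scal (q ^ a)"
proof -
 have "q ^ a : rouquier_ring m P" by (rule is_subring_power[OF rouquier_ring_subring rouquier_ring_members(2)])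
 note s = int.single_A(1)[OF z0_props(1)] int.single_A(2)[OF this]
 show "shifted_twist a : carrier int.A" unfolding shifted_twist_def
  using ring.ring_simprules(4)[OF int.A_ring s] unfolding group_algebra_minus[OF int.R braid_group_is_group s] .
 show "int.cls (shifted_twist a) = int.T z0 \<ominus>\<^bsub>int.HA\<^esub> int.scal (q ^ a)"
  unfolding shifted_twist_def int.cls_diff[OF s] int.T_eq int.scal_eq ..
qed

lemma shifted_twist_acts:
 assumes \<phi>: "irrep d \<phi>" and s: "specializes P x0 (rep_char \<phi>) \<theta>"
 shows "\<phi> (fld.cls (shifted_twist a)) = (q ^ twist_exponent \<theta> - q ^ a) \<cdot>\<^sub>m 1\<^sub>m d"
proof -
 note r = algebra_repD[OF irrepD(1)[OF \<phi>]]
 note y = int_carrier[OF shifted_twist_int(1)[of a]]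
 have "fld.cls (shifted_twist a) \<oplus>\<^bsub>fld.HA\<^esub> fld.scal (q ^ a) = fld.T z0"
  unfolding fld.scal_eq fld.T_eq fld.cls_add[OF y fld.single_A(2)[OF UNIV_I]] by (simp add: shifted_twist_def)
 then have "\<phi> (fld.cls (shifted_twist a)) + q ^ a \<cdot>\<^sub>m 1\<^sub>m d = q ^ twist_exponent \<theta> \<cdot>\<^sub>m 1\<^sub>m d"
  using r(3)[OF fld.cls_closed[OF y] fld.scal_closed[OF UNIV_I[of "q ^ a"]]] unfolding r(5) twist_power_acts[OF \<phi> s, symmetric] by simp
 note e = this
 note c = r(1)[OF fld.cls_closed[OF y]]
 show ?thesis
 proof (rule eq_matI)
  fix i j assume "i < dim_row ((q ^ twist_exponent \<theta> - q ^ a) \<cdot>\<^sub>m 1\<^sub>m d)" "j < dim_col ((q ^ twist_exponent \<theta> - q ^ a) \<cdot>\<^sub>m 1\<^sub>m d)"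
  then have ij: "i < d" "j < d" by auto
  have "(\<phi> (fld.cls (shifted_twist a)) + q ^ a \<cdot>\<^sub>m 1\<^sub>m d) $$ (i, j) = (q ^ twist_exponent \<theta> \<cdot>\<^sub>m 1\<^sub>m d) $$ (i, j)" using e by simp
  then show "\<phi> (fld.cls (shifted_twist a)) $$ (i, j) = ((q ^ twist_exponent \<theta> - q ^ a) \<cdot>\<^sub>m 1\<^sub>m d) $$ (i, j)"
  using ij c by (auto simp: algebra_simps split: if_splits)
 qed (use c in auto)
qed

lemma block_kills_shifted_twist:
 assumes e: "block_idempotent int.HA e"
 shows "\<exists>a. \<exists>n::nat. e \<otimes>\<^bsub>int.HA\<^esub> int.cls (shifted_twist a) [^]\<^bsub>int.HA\<^esub> n = \<zero>\<^bsub>int.HA\<^esub>"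
proof -
 interpret HI: ring int.HA by (rule int.H_ring)
 obtain N \<Lambda> where L: "algebra_rep fld.HA fld.scal N \<Lambda> & (\<forall>y\<in>carrier fld.HA. \<Lambda> y = 0\<^sub>m N N --> y = \<zero>\<^bsub>fld.HA\<^esub>)"
  using faithful_rep by (elim exE)
 let ?S = "twist_exponent ` Irr P"
 let ?x = "%a. int.cls (shifted_twist a)"
 have qO: "q ^ a : rouquier_ring m P" for a by (rule is_subring_power[OF rouquier_ring_subring rouquier_ring_members(2)])
 have xc: "?x a : carrier int.HA" for a by (rule int.cls_closed[OF shifted_twist_int(1)])
 have central: "?x a \<otimes>\<^bsub>int.HA\<^esub> y = y \<otimes>\<^bsub>int.HA\<^esub> ?x a" if y: "y : carrier int.HA" for a y
 proof -
  have c: "int.T z0 : carrier int.HA" "int.scal (q ^ a) : carrier int.HA" by (rule int.T_closed[OF z0_props(1)], rule int.scal_closed[OF qO])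
  have t: "int.T z0 \<otimes>\<^bsub>int.HA\<^esub> y = y \<otimes>\<^bsub>int.HA\<^esub> int.T z0" by (rule T_central(2)[OF z0_props y])
  have s: "int.scal (q ^ a) \<otimes>\<^bsub>int.HA\<^esub> y = y \<otimes>\<^bsub>int.HA\<^esub> int.scal (q ^ a)" by (rule int.scal_central[OF qO y])
  show ?thesis unfolding shifted_twist_int(2) a_minus_def HI.l_distr[OF c(1) HI.a_inv_closed[OF c(2)] y] HI.r_distr[OF c(1) HI.a_inv_closed[OF c(2)] y]
  HI.l_minus[OF c(2) y] HI.r_minus[OF y c(2)] t s ..
 qed
 have "\<exists>a\<in>?S. \<exists>n::nat. e \<otimes>\<^bsub>int.HA\<^esub> ?x a [^]\<^bsub>int.HA\<^esub> n = \<zero>\<^bsub>int.HA\<^esub>"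
 proof (rule block_idempotent_annihilates_factor[OF int.H_ring field_algebra extend_hom extend_inj conjunct1[OF L] _ _ _ _ _ e])
  show "!!y. y : carrier fld.HA ==> \<Lambda> y = 0\<^sub>m N N ==> y = \<zero>\<^bsub>fld.HA\<^esub>" using conjunct2[OF L] by blast
  show "finite ?S" using finite_Irr by simp
  show "!!a. ?x a : {x : carrier int.HA. \<forall>y\<in>carrier int.HA. x \<otimes>\<^bsub>int.HA\<^esub> y = y \<otimes>\<^bsub>int.HA\<^esub> x}" using xc central by blast
 next
  fix a b assume "a ~= (b :: nat)"
  note un = difference_of_powers_unit[OF this]
  let ?r = "inverse (q ^ b - q ^ a)"
  let ?d = "%z. shifted_twist a z - shifted_twist b z"
  have dA: "?d : carrier int.A"
  using ring.ring_simprules(4)[OF int.A_ring shifted_twist_int(1) shifted_twist_int(1), of a b]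
  unfolding group_algebra_minus[OF int.R braid_group_is_group shifted_twist_int(1) shifted_twist_int(1)] .
  have "(%z. ?r * ?d z) = single_elt 1 \<one>\<^bsub>B\<^esub>"
  unfolding shifted_twist_def single_elt_def using un(2) by (auto simp: left_inverse)
  then have "int.scal ?r \<otimes>\<^bsub>int.HA\<^esub> (?x a \<ominus>\<^bsub>int.HA\<^esub> ?x b) = \<one>\<^bsub>int.HA\<^esub>"
  unfolding int.cls_diff[OF shifted_twist_int(1) shifted_twist_int(1), symmetric] int.scal_mult(1)[OF un(1) dA] int.cls_one[symmetric] by simp
  moreover have "int.scal ?r : {x : carrier int.HA. \<forall>y\<in>carrier int.HA. x \<otimes>\<^bsub>int.HA\<^esub> y = y \<otimes>\<^bsub>int.HA\<^esub> x}"
  using int.scal_closed[OF un(1)] int.scal_central[OF un(1)] by blast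
  ultimately show "\<exists>c\<in>{x : carrier int.HA. \<forall>y\<in>carrier int.HA. x \<otimes>\<^bsub>int.HA\<^esub> y = y \<otimes>\<^bsub>int.HA\<^esub> x}. c \<otimes>\<^bsub>int.HA\<^esub> (?x a \<ominus>\<^bsub>int.HA\<^esub> ?x b) = \<one>\<^bsub>int.HA\<^esub>" ..
 next
  fix d \<phi> assume "algebra_rep fld.HA fld.scal d \<phi>" "irreducible_mats d (\<phi> ` carrier fld.HA)"
  then have \<phi>: "irrep d \<phi>" unfolding spetsial_irrep_def by simp
  obtain \<theta> where \<theta>: "\<theta> : Irr P & specializes P x0 (rep_char \<phi>) \<theta>" using specialized_character[OF \<phi>] ..
  have "\<phi> (extend (?x (twist_exponent \<theta>))) = 0\<^sub>m d d"
  unfolding extend_cls[OF shifted_twist_int(1)] shifted_twist_acts[OF \<phi> conjunct2[OF \<theta>]] by (intro eq_matI) auto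
  moreover have "twist_exponent \<theta> : ?S" using \<theta> by blast
  ultimately show "\<exists>a\<in>?S. \<phi> (extend (?x a)) = 0\<^sub>m d d" ..
 qed
 then show ?thesis by blast
qed

lemma same_block_same_twist_exponent:
 assumes e: "block_idempotent int.HA e" and z: "e \<otimes>\<^bsub>int.HA\<^esub> int.cls (shifted_twist a) [^]\<^bsub>int.HA\<^esub> (n::nat) = \<zero>\<^bsub>int.HA\<^esub>"
  and \<theta>: "\<theta> : Irr P" and b: "in_block m P x0 e \<theta>"
 shows "twist_exponent \<theta> = a"
proof (rule ccontr)
 assume ne: "twist_exponent \<theta> ~= a"
 interpret HI: ring int.HA by (rule int.H_ring)
 have ec: "e : carrier int.HA" using e unfolding block_idempotent_def central_idempotent_def by blast
 note le = int.lift[OF ec]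
 obtain g where g: "g : e" "lin_ext (char_t m P x0 \<theta>) g ~= 0" using b unfolding in_block_def by blast
 have gA: "g : carrier int.A" and ge: "int.cls g = e" using int.cls_memD[of g "int.lift e"] g(1) le by simp_all
 obtain d \<phi> where 1: "irrep d \<phi> & specializes P x0 (rep_char \<phi>) \<theta> & char_t m P x0 \<theta> = rep_char \<phi>"
  using character_lifts[OF \<theta>] by (elim exE)
 note \<phi> = conjunct1[OF 1] and s = conjunct1[OF conjunct2[OF 1]] and c = conjunct2[OF conjunct2[OF 1]]
 note r = algebra_repD[OF irrepD(1)[OF \<phi>]]
 let ?E = "fld.cls g" and ?Y = "fld.cls (shifted_twist a)"
 have E: "?E : carrier fld.HA" "?Y : carrier fld.HA" by (rule fld.cls_closed[OF int_carrier[OF gA]], rule fld.cls_closed[OF int_carrier[OF shifted_twist_int(1)]])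
 note xi = int.cls_closed[OF shifted_twist_int(1), of a]
 have ext_pow: "extend (int.cls (shifted_twist a) [^]\<^bsub>int.HA\<^esub> k) = ?Y [^]\<^bsub>fld.HA\<^esub> k" for k :: nat
 proof (induction k)
  case 0 show ?case using ring_hom_one[OF extend_hom] by simp
 next
  case (Suc k)
  show ?case using ring_hom_mult[OF extend_hom HI.nat_pow_closed[OF xi] xi, of k] Suc extend_cls[OF shifted_twist_int(1), of a] by simp
 qed
 have "extend e \<otimes>\<^bsub>fld.HA\<^esub> extend (int.cls (shifted_twist a) [^]\<^bsub>int.HA\<^esub> n) = extend \<zero>\<^bsub>int.HA\<^esub>"
  unfolding ring_hom_mult[OF extend_hom ec HI.nat_pow_closed[OF xi], symmetric] z ..
 moreover have "extend \<zero>\<^bsub>int.HA\<^esub> = \<zero>\<^bsub>fld.HA\<^esub>" by (rule ring_hom_zero[OF extend_hom int.H_ring fld.H_ring])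
 moreover have "extend e = ?E" unfolding ge[symmetric] by (rule extend_cls[OF gA])
 ultimately have "?E \<otimes>\<^bsub>fld.HA\<^esub> ?Y [^]\<^bsub>fld.HA\<^esub> n = \<zero>\<^bsub>fld.HA\<^esub>" unfolding ext_pow by simp
 then have "\<phi> ?E * \<phi> (?Y [^]\<^bsub>fld.HA\<^esub> n) = 0\<^sub>m d d"
  unfolding r(4)[OF E(1) FA.nat_pow_closed[OF E(2)], symmetric] using rep_zero[OF \<phi>] by simp
 then have z2: "\<phi> ?E * ((q ^ twist_exponent \<theta> - q ^ a) ^ n \<cdot>\<^sub>m 1\<^sub>m d) = 0\<^sub>m d d"
  unfolding FA.rep_pow[OF irrepD(1)[OF \<phi>] E(2)] shifted_twist_acts[OF \<phi> s] scalar_mat_pow .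
 let ?c = "(q ^ twist_exponent \<theta> - q ^ a) ^ n"
 have "\<phi> ?E * (?c \<cdot>\<^sub>m 1\<^sub>m d) = ?c \<cdot>\<^sub>m (\<phi> ?E * 1\<^sub>m d)" by (rule mult_smult_distrib[OF r(1)[OF E(1)] one_carrier_mat])
 then have "?c \<cdot>\<^sub>m \<phi> ?E = 0\<^sub>m d d" using z2 unfolding right_mult_one_mat[OF r(1)[OF E(1)]] by simp
 then have "mat_trace (?c \<cdot>\<^sub>m \<phi> ?E) = 0" by (simp add: mat_trace_def)
 moreover have "?c ~= 0" using difference_of_powers_unit(2)[OF ne[symmetric]] by simp
 ultimately have "mat_trace (\<phi> ?E) = 0" unfolding mat_trace_smult[OF r(1)[OF E(1)]] by (metis mult_eq_0_iff)
 then show False using g(2) unfolding trace_cls[OF \<phi> int_carrier[OF gA]] c by simp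
qed

text \<open>Characters in one block have the same twist exponent, by the two previous lemmas.\<close>

theorem same_family_same_ratio:
 assumes F: "F : rouquier_families m P x0" "\<theta> : F" "\<psi> : F"
 shows "reflection_sum \<theta> / \<theta> I1 = reflection_sum \<psi> / \<psi> I1"
proof -
 obtain e where e: "block_idempotent int.HA e" "F = {\<theta> : Irr P. in_block m P x0 e \<theta>}"
  using F(1) unfolding rouquier_families_def by blast
 obtain a n where z: "e \<otimes>\<^bsub>int.HA\<^esub> int.cls (shifted_twist a) [^]\<^bsub>int.HA\<^esub> (n::nat) = \<zero>\<^bsub>int.HA\<^esub>"
  using block_kills_shifted_twist[OF e(1)] by (elim exE)
 have "twist_exponent \<theta> = a" "twist_exponent \<psi> = a" using same_block_same_twist_exponent[OF e(1) z] F(2,3) unfolding e(2) by simp_all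
 then show ?thesis using F(2,3) unfolding e(2) by (intro twist_exponent_determines_ratio) simp_all
qed

end

section \<open>The transform and sums of reflections\<close>

context spetsial_algebra
begin

text \<open>The sum of all reflections is central and acts by a scalar.\<close>

lemma reflection_translate:
 assumes \<psi>: "\<psi> : Irr P" and w: "w : P"
 shows "(\<Sum>s\<in>refl P. \<psi> (s ** w)) = reflection_sum \<psi> / \<psi> I1 * \<psi> w"
proof -
 define h where "h s = (if s : refl P then 1 else 0 :: complex)" for s
 have "refl P \<subseteq> P" unfolding refl_def by blast
 then have e: "(\<Sum>v\<in>P. h v * f v) = (\<Sum>s\<in>refl P. f s)" for f
  unfolding h_def using fin by (simp add: if_distrib if_distribR sum.If_cases Int_absorb1 cong: if_cong)
 have "h (g ** v ** matrix_inv g) = h v" if g: "g : P" and v: "v : P" for g v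
 proof -
  have c: "matrix_inv g ** (g ** v ** matrix_inv g) ** g = v"
  proof -
  have "matrix_inv g ** (g ** v ** matrix_inv g) ** g = (matrix_inv g ** g) ** v ** (matrix_inv g ** g)" by (simp only: matrix_mul_assoc)
  then show ?thesis unfolding inv_props(2)[OF g] by simp
  qed
  have "g ** v ** matrix_inv g : refl P \<longleftrightarrow> v : refl P"
  using refl_conj[OF g, of v] refl_conj[OF inv_props(1)[OF g], of "g ** v ** matrix_inv g"]
  unfolding inverse_inverse[OF g] c by blast
  then show ?thesis unfolding h_def by simp
 qed
 from class_function_convolution[where h = h, OF \<psi> this w]
 have "(\<Sum>s\<in>refl P. \<psi> (s ** w)) * \<psi> I1 = reflection_sum \<psi> * \<psi> w" unfolding e reflection_sum_def .
 then show ?thesis using Irr_I1_nonzero[OF \<psi>] by (simp add: field_simps)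
qed

lemma refl_in: "s : refl P ==> s : P" unfolding refl_def by blast

lemma sum_reflections_conj:
 assumes k: "k : P" shows "(\<Sum>s\<in>refl P. f (k ** s ** matrix_inv k)) = (\<Sum>s\<in>refl P. f s)"
proof (rule sum.reindex_bij_witness[where j = "%s. k ** s ** matrix_inv k" and i = "%s. matrix_inv k ** s ** k"])
 fix s assume s: "s : refl P"
 show "k ** s ** matrix_inv k : refl P" by (rule refl_conj[OF k s])
 show "matrix_inv k ** s ** k : refl P" using refl_conj[OF inv_props(1)[OF k] s] unfolding inverse_inverse[OF k] .
 have "matrix_inv k ** (k ** s ** matrix_inv k) ** k = (matrix_inv k ** k) ** s ** (matrix_inv k ** k)" by (simp only: matrix_mul_assoc)
 then show "matrix_inv k ** (k ** s ** matrix_inv k) ** k = s" unfolding inv_props(2)[OF k] by simp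
 have "k ** (matrix_inv k ** s ** k) ** matrix_inv k = (k ** matrix_inv k) ** s ** (k ** matrix_inv k)" by (simp only: matrix_mul_assoc)
 then show "k ** (matrix_inv k ** s ** k) ** matrix_inv k = s" unfolding inv_props(3)[OF k] by simp
qed simp

lemma sum_reflections_inverse: "(\<Sum>s\<in>refl P. f (matrix_inv s)) = (\<Sum>s\<in>refl P. f s)"
 by (rule sum.reindex_bij_witness[where j = matrix_inv and i = matrix_inv]) (auto simp: refl_inv inverse_inverse refl_in)

definition transform :: "('n, 'u) unipotent_data => ('n cmat => complex) => 'n cmat => complex" where
 "transform D \<theta> w = of_int (pairing D P (U_elt D P \<theta>) (DL D P w))"

text \<open>The difference of the two sides is a class function of \<open>w\<close>. Its pairing with \<open>\<psi>\<close> is the Fourier coefficient of \<open>\<theta>\<close> at \<open>\<psi>\<close> times the difference of the two ratios; one of these factors is zero.\<close>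

lemma transform_translate:
 assumes data: "unipotent_data_for D P" and axioms: "fourier_axioms D m P x0" and \<theta>: "\<theta> : Irr P" and w: "w : P"
 shows "(\<Sum>s\<in>refl P. transform D \<theta> (s ** w)) = reflection_sum \<theta> / \<theta> I1 * transform D \<theta> w"
proof -
 let ?g = "transform D \<theta>" and ?c = "%\<psi>. reflection_sum \<psi> / \<psi> I1"
 have cl: "?g (k ** v ** matrix_inv k) = ?g v" if "k : P" "v : P" for k v
  using data that unfolding transform_def unipotent_data_for_def by simp
 define h where "h w = (\<Sum>s\<in>refl P. ?g (s ** w)) - ?c \<theta> * ?g w" for w
 have "h w = 0"
 proof (rule characters_complete[OF _ _ w])
  fix k v assume k: "k : P" and v: "v : P"
  have "(\<Sum>s\<in>refl P. ?g (s ** (k ** v ** matrix_inv k))) = (\<Sum>s\<in>refl P. ?g ((k ** s ** matrix_inv k) ** (k ** v ** matrix_inv k)))"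
  by (rule sum_reflections_conj[OF k, of "%s. ?g (s ** (k ** v ** matrix_inv k))", symmetric])
  also have "... = (\<Sum>s\<in>refl P. ?g (s ** v))"
  proof (rule sum.cong[OF HOL.refl])
  fix s assume s: "s : refl P"
  have "(k ** s ** matrix_inv k) ** (k ** v ** matrix_inv k) = k ** s ** (matrix_inv k ** k) ** v ** matrix_inv k" by (simp only: matrix_mul_assoc)
  also have "... = k ** (s ** v) ** matrix_inv k" unfolding inv_props(2)[OF k] by (simp add: matrix_mul_assoc)
  finally show "?g ((k ** s ** matrix_inv k) ** (k ** v ** matrix_inv k)) = ?g (s ** v)" using cl[OF k mult_in[OF refl_in[OF s] v]] by simp
  qed
  finally show "h (k ** v ** matrix_inv k) = h v" unfolding h_def cl[OF k v] by simp
 next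
  fix \<psi> assume \<psi>: "\<psi> : Irr P"
  let ?p = "\<Sum>v\<in>P. ?g v * \<psi> v"
  have "(\<Sum>v\<in>P. (\<Sum>s\<in>refl P. ?g (s ** v)) * \<psi> v) = (\<Sum>s\<in>refl P. \<Sum>v\<in>P. ?g (s ** v) * \<psi> v)"
  unfolding sum_distrib_right by (rule sum.swap)
  also have "... = (\<Sum>s\<in>refl P. \<Sum>v\<in>P. ?g v * \<psi> (matrix_inv s ** v))"
  proof (rule sum.cong[OF HOL.refl])
  fix s assume "s : refl P"
  then have s: "s : P" by (rule refl_in)
  have "(\<Sum>v\<in>P. ?g v * \<psi> (matrix_inv s ** v)) = (\<Sum>v\<in>P. ?g (s ** v) * \<psi> (matrix_inv s ** (s ** v)))"
  by (rule sum.reindex_bij_betw[OF left_translation[OF s], of "%v. ?g v * \<psi> (matrix_inv s ** v)", symmetric])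
  also have "... = (\<Sum>v\<in>P. ?g (s ** v) * \<psi> v)" by (simp add: matrix_mul_assoc inv_props(2)[OF s])
  finally show "(\<Sum>v\<in>P. ?g (s ** v) * \<psi> v) = (\<Sum>v\<in>P. ?g v * \<psi> (matrix_inv s ** v))" by simp
  qed
  also have "... = (\<Sum>v\<in>P. ?g v * (\<Sum>s\<in>refl P. \<psi> (matrix_inv s ** v)))" unfolding sum_distrib_left by (rule sum.swap)
  also have "... = (\<Sum>v\<in>P. ?c \<psi> * (?g v * \<psi> v))"
  proof (rule sum.cong[OF HOL.refl])
  fix v assume v: "v : P"
  show "?g v * (\<Sum>s\<in>refl P. \<psi> (matrix_inv s ** v)) = ?c \<psi> * (?g v * \<psi> v)"
  unfolding sum_reflections_inverse[of "%s. \<psi> (s ** v)"] reflection_translate[OF \<psi> v] by simp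
  qed
  also have "... = ?c \<psi> * ?p" by (rule sum_distrib_left[symmetric])
  finally have 1: "(\<Sum>v\<in>P. (\<Sum>s\<in>refl P. ?g (s ** v)) * \<psi> v) = ?c \<psi> * ?p" .
  have "(\<Sum>v\<in>P. h v * \<psi> v) = (?c \<psi> - ?c \<theta>) * ?p"
  unfolding h_def left_diff_distrib sum_subtractf 1 sum_distrib_left by (simp add: mult.assoc)
  also have "... = 0"
  proof (cases "?p = 0")
  case False
  have "fourier_matrix D P \<theta> \<psi> = ?p / of_nat (card P)" unfolding fourier_matrix_def transform_def by (simp add: mult.commute)
  moreover have "card P ~= 0" using fin one_in by auto
  ultimately have "fourier_matrix D P \<theta> \<psi> ~= 0" using False by simp
  then obtain F where "F : rouquier_families m P x0" "\<theta> : F" "\<psi> : F" using axioms \<theta> \<psi> unfolding fourier_axioms_def by blast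
  from same_family_same_ratio[OF this] show ?thesis by simp
  qed simp
  finally show "(\<Sum>v\<in>P. h v * \<psi> v) = 0" .
 qed
 then show ?thesis unfolding h_def by simp
qed

text \<open>Two-sided translates of the previous identities; class functions allow one factor to be moved to the other side.\<close>

lemma defect_translate:
 assumes data: "unipotent_data_for D P" and axioms: "fourier_axioms D m P x0" and \<theta>: "\<theta> : Irr P" and x: "x : P" and y: "y : P"
 defines "\<Delta> \<equiv> %w. \<theta> w - transform D \<theta> w"
 shows "(\<Sum>s\<in>refl P. \<Delta> (y ** s ** x)) = reflection_sum \<theta> / \<theta> I1 * \<Delta> (y ** x)"
proof -
 have cl: "\<Delta> (k ** v ** matrix_inv k) = \<Delta> v" if k: "k : P" and v: "v : P" for k v
 proof -
  have "\<theta> (k ** v ** matrix_inv k) = \<theta> v" using Irr_class_function \<theta> k v unfolding class_functions_def by blast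
  moreover have "transform D \<theta> (k ** v ** matrix_inv k) = transform D \<theta> v"
  using data k v unfolding transform_def unipotent_data_for_def by simp
  ultimately show ?thesis unfolding \<Delta>_def by simp
 qed
 have rot: "\<Delta> (y ** v) = \<Delta> (v ** y)" if v: "v : P" for v
 proof -
  have "y ** (v ** y) ** matrix_inv y = y ** v ** (y ** matrix_inv y)" by (simp only: matrix_mul_assoc)
  then have "y ** (v ** y) ** matrix_inv y = y ** v" unfolding inv_props(3)[OF y] by simp
  then show ?thesis using cl[OF y mult_in[OF v y]] by simp
 qed
 have "(\<Sum>s\<in>refl P. \<Delta> (y ** s ** x)) = (\<Sum>s\<in>refl P. \<Delta> (s ** (x ** y)))"
 proof (rule sum.cong[OF HOL.refl])
  fix s assume "s : refl P"
  from rot[OF mult_in[OF refl_in[OF this] x]] show "\<Delta> (y ** s ** x) = \<Delta> (s ** (x ** y))" by (simp add: matrix_mul_assoc)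
 qed
 also have "... = reflection_sum \<theta> / \<theta> I1 * \<Delta> (x ** y)"
  unfolding \<Delta>_def sum_subtractf reflection_translate[OF \<theta> mult_in[OF x y]] transform_translate[OF data axioms \<theta> mult_in[OF x y]]
  by (simp add: right_diff_distrib)
 also have "\<Delta> (x ** y) = \<Delta> (y ** x)" by (rule rot[OF x, symmetric])
 finally show ?thesis .
qed

end

text \<open>Restriction of the transform from \<open>P\<close> to \<open>P'\<close>: write \<open>R w\<close> as induced from \<open>P'\<close>, move the induction to \<open>U \<theta>\<close> by adjunction, and use that restriction of the principal series follows restriction of characters.\<close>

lemma transform_restrict:
 fixes P P' :: "('n::finite) cmat set"
 assumes P: "reflection_arrangement P x0" and P': "reflection_arrangement P' x0" and sub: "P' \<subseteq> P" and lus: "lusztig_axioms D P P'"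
  and data: "unipotent_data_for D P" and data': "unipotent_data_for D P'" and \<theta>: "\<theta> : Irr P"
 shows "\<exists>k :: _ => nat. \<forall>w\<in>P'. \<theta> w = (\<Sum>\<psi>\<in>Irr P'. of_nat (k \<psi>) * \<psi> w) &
  (of_int (pairing D P (U_elt D P \<theta>) (DL D P w)) :: complex)
  = (\<Sum>\<psi>\<in>Irr P'. of_nat (k \<psi>) * of_int (pairing D P' (U_elt D P' \<psi>) (DL D P' w)))"
proof -
 obtain k :: "('n cmat => complex) => nat" where k: "\<forall>w\<in>P'. \<theta> w = (\<Sum>\<psi>\<in>Irr P'. of_nat (k \<psi>) * \<psi> w)"
  using restriction_constituents[OF P P' sub \<theta>] by (elim exE)
 have UP: "U_elt D P \<theta> : ZUch D P"
  using data \<theta> unfolding unipotent_data_for_def ZUch_def U_elt_def single_elt_def by auto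
 have "(of_int (pairing D P (U_elt D P \<theta>) (DL D P w)) :: complex)
  = (\<Sum>\<psi>\<in>Irr P'. of_nat (k \<psi>) * of_int (pairing D P' (U_elt D P' \<psi>) (DL D P' w)))" if w: "w : P'" for w
 proof -
  have DLw: "DL D P' w : ZUch D P'" using data' w unfolding unipotent_data_for_def by blast
  have a: "Lind D P P' (DL D P' w) = DL D P w" using lus w unfolding lusztig_axioms_def by blast
  have b: "pairing D P (U_elt D P \<theta>) (Lind D P P' (DL D P' w)) = pairing D P' (Lres D P P' (U_elt D P \<theta>)) (DL D P' w)"
  using lus UP DLw unfolding lusztig_axioms_def by blast
  have c: "Lres D P P' (U_elt D P \<theta>) = (%\<rho>. \<Sum>\<psi>\<in>Irr P'. int (k \<psi>) * U_elt D P' \<psi> \<rho>)"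
  using lus \<theta> k unfolding lusztig_axioms_def by blast
  have "pairing D P (U_elt D P \<theta>) (DL D P w) = (\<Sum>\<rho>\<in>Uch D P'. \<Sum>\<psi>\<in>Irr P'. int (k \<psi>) * U_elt D P' \<psi> \<rho> * DL D P' w \<rho>)"
  using a b unfolding c pairing_def sum_distrib_right by simp
  also have "... = (\<Sum>\<psi>\<in>Irr P'. int (k \<psi>) * pairing D P' (U_elt D P' \<psi>) (DL D P' w))"
  unfolding pairing_def sum_distrib_left mult.assoc by (rule sum.swap)
  finally show ?thesis by simp
 qed
 then show ?thesis using k by blast
qed

section \<open>The trivial group\<close>

text \<open>Every matrix commutes with the identity matrix, so all matrices of that size are scalar and the degree is one.\<close>

lemma Irr_trivial_group:
 fixes x0 :: "complex ^ ('n::finite)" and \<theta> :: "'n cmat => complex"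
 assumes P: "reflection_arrangement {I1} x0" and \<theta>: "\<theta> : Irr {I1}"
 shows "\<theta> = triv_char {I1}"
proof -
 interpret reflection_arrangement "{I1}" x0 by fact
 obtain d \<rho> where \<rho>: "irr_rep d \<rho>" "\<theta> = char_of \<rho>" using \<theta> unfolding Irr_iff by (elim exE conjE)
 note r = irr_repD[OF \<rho>(1)]
 note g = group_repD[OF r(1)]
 have "d = 1"
 proof (rule ccontr)
  assume "d ~= 1"
  then have d: "0 < d" "1 < d" using r(3) by auto
  define X :: "complex mat" where "X = Matrix.mat d d (%(i, j). if i = 0 & j = 0 then 1 else 0)"
  have Xc: "X : carrier_mat d d" unfolding X_def by simp
  have "\<exists>c. X = c \<cdot>\<^sub>m 1\<^sub>m d"
  proof (rule complex_commutant_scalar[OF r(2) _ Xc])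
  show "\<rho> v : carrier_mat d d" if "v : {I1}" for v by (rule g(1)[OF that])
  show "\<rho> v * X = X * \<rho> v" if "v : {I1}" for v using that g(2) Xc by simp
  qed
  then obtain c where c: "X = c \<cdot>\<^sub>m 1\<^sub>m d" ..
  have "X $$ (0, 0) = c" "X $$ (1, 1) = c" unfolding c using d by simp_all
  moreover have "X $$ (0, 0) = 1" "X $$ (1, 1) = 0" unfolding X_def using d by simp_all
  ultimately show False by simp
 qed
 then have "\<theta> I1 = 1" using r(5) unfolding \<rho>(2) by simp
 then show ?thesis unfolding \<rho>(2) triv_char_def char_of_def by (intro ext) auto
qed

section \<open>Tower algebras\<close>

lemma tower_mono:
 fixes T :: "nat => 'a set"
 assumes step: "!!i. i < n ==> T i \<subset> T (Suc i)" and "i \<le> k" "k \<le> n"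
 shows "T i \<subseteq> T k"
 using assms(2,3)
proof (induction rule: dec_induct)
 case (step k) then show ?case using assms(1)[of k] by auto
qed simp

lemma conv_mat_group: "conv (mat_group W) = conv (mat_group P)"
 unfolding conv_def by (intro ext) (simp add: mat_group_def)

lemma tower_algebra_support:
 assumes a: "a : tower_algebra W k T" and inc: "!!i. i : {1..k} ==> T i \<subseteq> P" and P: "finite P" "group (mat_group P)"
 shows "a : carrier (group_algebra UNIV (mat_group P))"
 using a
proof (induction a rule: tower_algebra.induct)
 case (gen i)
 have "{w. tower_J T i w ~= 0} \<subseteq> P" using inc[OF gen] unfolding tower_J_def refl_def by auto
 then show ?case unfolding group_algebra_carrier using finite_subset[OF _ P(1)] by (auto simp: mat_group_def)
next
 case unit
 have "\<one>\<^bsub>mat_group P\<^esub> : carrier (mat_group P)" by (rule monoid.one_closed[OF group.is_monoid[OF P(2)]])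
 then have "single_elt 1 \<one>\<^bsub>mat_group P\<^esub> : carrier (group_algebra (UNIV :: complex set) (mat_group P))"
  by (rule single_closed[OF is_subring_UNIV UNIV_I])
 then show ?case by (simp add: mat_group_def)
next
 case (scale a c) then show ?case by (intro scale_closed[OF is_subring_UNIV UNIV_I])
next
 case (add a b) then show ?case using add_closed[OF is_subring_UNIV, of a "mat_group P" b] by simp
next
 case (mult a b)
 then show ?case using conv_closed[OF is_subring_UNIV P(2), of a b] unfolding group_algebra_simps conv_mat_group[of W P] by blast
qed

text \<open>Two-sided translates by \<open>x\<close> and \<open>y\<close> make the claim stable under products. For the top generator, the sum of all reflections of \<open>P\<close> contributes the scalar \<open>c\<close> and the lower generators are subtracted.\<close>

lemma tower_algebra_step:
 fixes \<Delta> :: "('n::finite) cmat => complex"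
 assumes P: "finite P" "group (mat_group P)" and mono: "!!i. i : {1..k} ==> T i \<subseteq> T (Suc k)" and TP: "T (Suc k) = P"
  and split: "!!f :: 'n cmat => complex. (\<Sum>s\<in>refl P. f s) = (\<Sum>i=1..Suc k. lin_ext f (tower_J T i))"
  and eig: "!!x y. x : P ==> y : P ==> (\<Sum>s\<in>refl P. \<Delta> (y ** s ** x)) = c * \<Delta> (y ** x)"
  and a: "a : tower_algebra W (Suc k) T"
 shows "\<exists>b\<in>tower_algebra W k T. \<forall>x\<in>P. \<forall>y\<in>P. lin_ext (%w. \<Delta> (y ** w ** x)) a = lin_ext (%w. \<Delta> (y ** w ** x)) b"
proof -
 have T': "T i \<subseteq> P" if "i : {1..Suc k}" for i using mono[of i] TP that by (cases "i = Suc k") auto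
 have car: "a : carrier (group_algebra UNIV (mat_group P))" if "a : tower_algebra W (Suc k) T" for a
  by (rule tower_algebra_support[OF that T' P])
 have car': "a : carrier (group_algebra UNIV (mat_group P))" if "a : tower_algebra W k T" for a
  by (rule tower_algebra_support[OF that _ P]) (use T' in simp)
 have mP: "x ** y : P" if "x : P" "y : P" for x y using monoid.m_closed[OF group.is_monoid[OF P(2)]] that by (simp add: mat_group_def)
 have I1P: "I1 : P" using monoid.one_closed[OF group.is_monoid[OF P(2)]] by (simp add: mat_group_def)
 have one: "\<one>\<^bsub>group_algebra UNIV (mat_group W)\<^esub> = single_elt (1 :: complex) I1" by (simp add: mat_group_def)
 have unit: "single_elt (1 :: complex) I1 : tower_algebra W k T" using tower_algebra.unit[of W k T] unfolding one .
 \<comment> \<open>the sum of the first \<open>l\<close> generators already lies in the smaller algebra\<close>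
 have sumJ: "\<exists>b\<in>tower_algebra W k T. \<forall>f. lin_ext f b = (\<Sum>i=1..l. lin_ext f (tower_J T i))" if "l \<le> k" for l
  using that
 proof (induction l)
  case 0
  have "(%w. 0 * single_elt (1 :: complex) I1 w) : tower_algebra W k T"
  by (rule tower_algebra.scale[OF unit])
  then show ?case by (intro bexI) auto
 next
  case (Suc l)
  then obtain b where b: "b : tower_algebra W k T" "\<forall>f. lin_ext f b = (\<Sum>i=1..l. lin_ext f (tower_J T i))" by auto
  have J: "tower_J T (Suc l) : tower_algebra W k T" by (rule tower_algebra.gen) (use Suc.prems in simp)
  from tower_algebra.add[OF b(1) J] have m: "(%w. b w + tower_J T (Suc l) w) : tower_algebra W k T" by simp
  have "lin_ext f (%w. b w + tower_J T (Suc l) w) = (\<Sum>i=1..Suc l. lin_ext f (tower_J T i))" for f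
  using lin_ext_add[OF carrierD(1)[OF car'[OF b(1)]] carrierD(1)[OF car'[OF J]], of f] b(2) by simp
  then show ?case by (intro bexI[OF _ m]) blast
 qed
 show ?thesis using a
 proof (induction a rule: tower_algebra.induct)
  case (gen i)
  show ?case
  proof (cases "i = Suc k")
  case False
  then have "tower_J T i : tower_algebra W k T" using gen by (intro tower_algebra.gen) auto
  then show ?thesis by (intro bexI[of _ "tower_J T i"]) auto
  next
  case True
  obtain b where b: "b : tower_algebra W k T" "\<forall>f. lin_ext f b = (\<Sum>i=1..k. lin_ext f (tower_J T i))" using sumJ[of k] by auto
  have u: "(%w. c * single_elt 1 I1 w) : tower_algebra W k T" by (rule tower_algebra.scale[OF unit])
  have nb: "(%w. - 1 * b w) : tower_algebra W k T" by (rule tower_algebra.scale[OF b(1)])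
  from tower_algebra.add[OF u nb] have m: "(%w. c * single_elt 1 I1 w + - 1 * b w) : tower_algebra W k T" by simp
  have "lin_ext (%w. \<Delta> (y ** w ** x)) (tower_J T i) = lin_ext (%w. \<Delta> (y ** w ** x)) (%w. c * single_elt 1 I1 w + - 1 * b w)"
  if x: "x : P" and y: "y : P" for x y
  proof -
  let ?f = "%w. \<Delta> (y ** w ** x)"
  have "lin_ext ?f (%w. c * single_elt 1 I1 w + - 1 * b w) = c * \<Delta> (y ** x) + - 1 * lin_ext ?f b"
  unfolding lin_ext_add[OF carrierD(1)[OF car'[OF u]] carrierD(1)[OF car'[OF nb]]] lin_ext_scale[OF carrierD(1)[OF car'[OF b(1)]]]
  lin_ext_scale[OF fin_supp_single] by simp
  also have "c * \<Delta> (y ** x) = (\<Sum>i=1..Suc k. lin_ext ?f (tower_J T i))" using eig[OF x y] split[of ?f] by simp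
  finally show ?thesis using b(2) True by simp
  qed
  then show ?thesis by (intro bexI[OF _ m]) blast
  qed
 next
  case unit show ?case by (rule bexI[OF _ tower_algebra.unit]) blast
 next
  case (scale a c')
  then obtain b where b: "b : tower_algebra W k T" "\<forall>x\<in>P. \<forall>y\<in>P. lin_ext (%w. \<Delta> (y ** w ** x)) a = lin_ext (%w. \<Delta> (y ** w ** x)) b" by blast
  show ?case
  by (rule bexI[OF _ tower_algebra.scale[OF b(1), of c']])
  (use b(2) in \<open>simp add: lin_ext_scale[OF carrierD(1)[OF car[OF scale.hyps]]] lin_ext_scale[OF carrierD(1)[OF car'[OF b(1)]]]\<close>)
 next
  case (add a a')
  obtain b where b: "b : tower_algebra W k T" "\<forall>x\<in>P. \<forall>y\<in>P. lin_ext (%w. \<Delta> (y ** w ** x)) a = lin_ext (%w. \<Delta> (y ** w ** x)) b" using add.IH(1) by blast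
  obtain b' where b': "b' : tower_algebra W k T" "\<forall>x\<in>P. \<forall>y\<in>P. lin_ext (%w. \<Delta> (y ** w ** x)) a' = lin_ext (%w. \<Delta> (y ** w ** x)) b'" using add.IH(2) by blast
  show ?case
  by (rule bexI[OF _ tower_algebra.add[OF b(1) b'(1)]])
  (use b(2) b'(2) in \<open>simp add: lin_ext_add[OF carrierD(1)[OF car[OF add.hyps(1)]] carrierD(1)[OF car[OF add.hyps(2)]]]
  lin_ext_add[OF carrierD(1)[OF car'[OF b(1)]] carrierD(1)[OF car'[OF b'(1)]]]\<close>)
 next
  case (mult a a')
  obtain b where b: "b : tower_algebra W k T" "\<forall>x\<in>P. \<forall>y\<in>P. lin_ext (%w. \<Delta> (y ** w ** x)) a = lin_ext (%w. \<Delta> (y ** w ** x)) b" using mult.IH(1) by blast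
  obtain b' where b': "b' : tower_algebra W k T" "\<forall>x\<in>P. \<forall>y\<in>P. lin_ext (%w. \<Delta> (y ** w ** x)) a' = lin_ext (%w. \<Delta> (y ** w ** x)) b'" using mult.IH(2) by blast
  note ca = car[OF mult.hyps(1)] and ca' = car[OF mult.hyps(2)] and cb = car'[OF b(1)] and cb' = car'[OF b'(1)]
  have memP: "w : P" if "g : carrier (group_algebra (UNIV :: complex set) (mat_group P))" "g w ~= 0" for g w
  using carrierD(2)[OF that] by (simp add: mat_group_def)
  have "lin_ext (%w. \<Delta> (y ** w ** x)) (conv (mat_group W) a a') = lin_ext (%w. \<Delta> (y ** w ** x)) (conv (mat_group W) b b')"
  if x: "x : P" and y: "y : P" for x y
  proof -
  have "lin_ext (%w. \<Delta> (y ** w ** x)) (conv (mat_group W) a a') = lin_ext (%s. lin_ext (%t. \<Delta> (y ** (s ** t) ** x)) a') a"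
  unfolding lin_ext_conv[OF carrierD(1)[OF ca] carrierD(1)[OF ca']] by (simp add: mat_group_def)
  also have "... = lin_ext (%s. lin_ext (%t. \<Delta> (y ** (s ** t) ** x)) b') a"
  proof (rule lin_ext_cong)
  fix s assume "a s ~= 0"
  then have "y ** s : P" using memP[OF ca] mP[OF y] by blast
  then have "lin_ext (%t. \<Delta> ((y ** s) ** t ** x)) a' = lin_ext (%t. \<Delta> ((y ** s) ** t ** x)) b'" using b'(2) x by blast
  then show "lin_ext (%t. \<Delta> (y ** (s ** t) ** x)) a' = lin_ext (%t. \<Delta> (y ** (s ** t) ** x)) b'" by (simp add: matrix_mul_assoc)
  qed
  also have "... = lin_ext (%t. lin_ext (%s. \<Delta> (y ** (s ** t) ** x)) a) b'"
  unfolding lin_ext_def sum_distrib_left by (subst sum.swap) (simp add: mult.left_commute)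
  also have "... = lin_ext (%t. lin_ext (%s. \<Delta> (y ** (s ** t) ** x)) b) b'"
  proof (rule lin_ext_cong)
  fix t assume "b' t ~= 0"
  then have "t ** x : P" using memP[OF cb'] mP[OF _ x] by blast
  then have "lin_ext (%s. \<Delta> (y ** s ** (t ** x))) a = lin_ext (%s. \<Delta> (y ** s ** (t ** x))) b" using b(2) y by blast
  then show "lin_ext (%s. \<Delta> (y ** (s ** t) ** x)) a = lin_ext (%s. \<Delta> (y ** (s ** t) ** x)) b" by (simp add: matrix_mul_assoc)
  qed
  also have "... = lin_ext (%s. lin_ext (%t. \<Delta> (y ** (s ** t) ** x)) b') b"
  unfolding lin_ext_def sum_distrib_left by (subst sum.swap) (simp add: mult.left_commute)
  also have "... = lin_ext (%w. \<Delta> (y ** w ** x)) (conv (mat_group W) b b')"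
  unfolding lin_ext_conv[OF carrierD(1)[OF cb] carrierD(1)[OF cb']] by (simp add: mat_group_def)
  finally show ?thesis .
  qed
  moreover have "conv (mat_group W) b b' : tower_algebra W k T" using tower_algebra.mult[OF b(1) b'(1)] by simp
  ultimately show ?case by (intro bexI[of _ "conv (mat_group W) b b'"]) simp_all
 qed
qed

text \<open>The reflections of \<open>T k\<close> are sorted by the step of the tower at which they appear.\<close>

lemma sum_tower_J:
 fixes f :: "('n::finite) cmat => complex"
 assumes T0: "T 0 = {I1}" and mono: "!!i. i < k ==> T i \<subseteq> T (Suc i)" and fin: "!!i. i \<le> k ==> finite (T i)" and no: "refl {I1} = ({} :: 'n cmat set)"
 shows "(\<Sum>s\<in>refl (T k). f s) = (\<Sum>i=1..k. lin_ext f (tower_J T i))"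
 using mono fin
proof (induction k)
 case 0 then show ?case using no unfolding T0 by simp
next
 case (Suc k)
 let ?A = "refl (T (Suc k))" and ?B = "refl (T k)"
 have BA: "?B \<subseteq> ?A" using Suc.prems(1)[of k] unfolding refl_def by auto
 have fA: "finite ?A" using Suc.prems(2)[of "Suc k"] unfolding refl_def by simp
 have "lin_ext f (tower_J T (Suc k)) = (\<Sum>s\<in>?A - ?B. tower_J T (Suc k) s * f s)"
  by (rule lin_ext_sum) (use fA in \<open>auto simp: tower_J_def\<close>)
 also have "... = (\<Sum>s\<in>?A - ?B. f s)" by (rule sum.cong) (auto simp: tower_J_def)
 finally have "lin_ext f (tower_J T (Suc k)) = (\<Sum>s\<in>?A - ?B. f s)" .
 moreover have "(\<Sum>s\<in>?A. f s) = (\<Sum>s\<in>?A - ?B. f s) + (\<Sum>s\<in>?B. f s)" by (rule sum.subset_diff[OF BA fA])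
 moreover have "(\<Sum>s\<in>?B. f s) = (\<Sum>i=1..k. lin_ext f (tower_J T i))" by (rule Suc.IH) (use Suc.prems in auto)
 ultimately show ?case by simp
qed

section \<open>Climbing a tower of parabolic subgroups\<close>

text \<open>A regular vector of \<open>W\<close> is regular for every parabolic subgroup, so one base point serves the whole tower.\<close>

lemma parabolic_arrangement:
 assumes W: "reflection_arrangement W x0" and P: "P : parabolics W"
 shows "reflection_arrangement P x0"
proof -
 interpret W: reflection_arrangement W x0 by fact
 obtain X where X: "P = fixator W X" using P unfolding parabolics_def by blast
 have PW: "P \<subseteq> W" unfolding X fixator_def by blast
 have "subgroup P (mat_group W)"
 proof (rule group.subgroupI[OF W.grp])
  show "P \<subseteq> carrier (mat_group W)" using PW by simp
  show "P ~= {}" unfolding X using W.fixator_I1 by blast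
  fix g assume g: "g : P"
  then have gW: "g : W" using PW by blast
  have "matrix_inv g *v x = x" if "x : X" for x
  proof -
  have "g *v x = x" using g that unfolding X fixator_def by blast
  then have "matrix_inv g *v x = matrix_inv g *v (g *v x)" by simp
  then show ?thesis unfolding W.matrix_cancel(1)[OF gW] .
  qed
  then show "inv\<^bsub>mat_group W\<^esub> g : P" unfolding W.inv_props(4)[OF gW] X fixator_def using W.inv_props(1)[OF gW] by blast
  show "g \<otimes>\<^bsub>mat_group W\<^esub> h : P" if "h : P" for h using W.fixator_mult g that unfolding X by simp
 qed
 from group.subgroup_imp_group[OF W.grp this] have "group (mat_group P)" by (simp add: mat_group_def)
 moreover have "hyperplanes P \<subseteq> hyperplanes W" using PW unfolding hyperplanes_def refl_def by blast
 then have "regular W \<subseteq> regular P" unfolding regular_def by blast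
 ultimately show ?thesis using W.reflection_arrangement_axioms PW finite_subset unfolding reflection_arrangement_def by blast
qed

text \<open>Induction along the tower: \<open>tower_algebra_step\<close> and \<open>transform_restrict\<close> express the difference at one step by the differences at the step below.\<close>

theorem characters_equal_transform_on_tower:
 fixes W :: "('n::finite) cmat set"
 assumes W: "reflection_arrangement W x0"
  and alg: "!!P. P : parabolics W ==> spetsial_algebra P x0 m"
  and ax: "spetses_axioms D m W x0" and tower: "tower W n T"
 shows "k \<le> n ==> \<theta> : Irr (T k) ==> a : tower_algebra W k T ==>
  lin_ext \<theta> a = lin_ext (%w. of_int (pairing D (T k) (U_elt D (T k) \<theta>) (DL D (T k) w))) a"
proof -
 have T0: "T 0 = {I1}" and step: "i < n ==> T i \<subset> T (Suc i)" and chain: "subset.maxchain (parabolics W) (T ` {..n})" for i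
  using tower unfolding tower_def by blast+
 have par: "T i : parabolics W" if "i \<le> n" for i
  using chain that unfolding pred_on.maxchain_def pred_on.chain_def by blast
 have arr: "reflection_arrangement (T i) x0" if "i \<le> n" for i by (rule parabolic_arrangement[OF W par[OF that]])
 note arrD = arr[unfolded reflection_arrangement_def]
 have inc: "T i \<subseteq> T k" if "i \<le> k" "k \<le> n" for i k
  by (rule tower_mono[where T = T, OF step that])
 have data: "unipotent_data_for D (T i)" "fourier_axioms D m (T i) x0" if "i \<le> n" for i
  using ax par[OF that] unfolding spetses_axioms_def by blast+
 show "k \<le> n ==> \<theta> : Irr (T k) ==> a : tower_algebra W k T ==>
  lin_ext \<theta> a = lin_ext (%w. of_int (pairing D (T k) (U_elt D (T k) \<theta>) (DL D (T k) w))) a"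
 proof (induction k arbitrary: \<theta> a)
  case 0
  have "a : carrier (group_algebra UNIV (mat_group {I1}))"
  by (rule tower_algebra_support[OF 0(3)]) (use arrD[of 0] T0 in auto)
  note supp = carrierD(2)[OF this]
  have t: "\<theta> = triv_char {I1}" using Irr_trivial_group[of x0 \<theta>] arr[of 0] 0(2) unfolding T0 by simp
  have "pairing D {I1} (U_elt D {I1} \<theta>) (DL D {I1} I1) = 1"
  using ax unfolding spetses_axioms_def trivial_normalization_def t pairing_def by (simp add: U_elt_def single_elt_def)
  then show ?case unfolding T0 by (intro lin_ext_cong) (use supp in \<open>auto simp: mat_group_def t triv_char_def\<close>)
 next
  case (Suc k)
  let ?P = "T (Suc k)" and ?Q = "T k"
  note le = Suc.prems(1)
  have le': "k \<le> n" using le by simp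
  interpret A: spetsial_algebra ?P x0 m by (rule alg[OF par[OF le]])
  let ?\<Delta> = "%w. \<theta> w - A.transform D \<theta> w"
  have no: "refl {I1} = ({} :: 'n cmat set)"
  proof -
  interpret B: reflection_arrangement "{I1}" x0 using arr[of 0] unfolding T0 by simp
  have "refl {I1} \<subseteq> ({I1} :: 'n cmat set)" unfolding refl_def by blast
  then show ?thesis using B.I1_not_refl by blast
  qed
  have "\<exists>b\<in>tower_algebra W k T. \<forall>x\<in>?P. \<forall>y\<in>?P. lin_ext (%w. ?\<Delta> (y ** w ** x)) a = lin_ext (%w. ?\<Delta> (y ** w ** x)) b"
  proof (rule tower_algebra_step[OF A.fin A.grp _ HOL.refl _ _ Suc.prems(3)])
  show "T i \<subseteq> T (Suc k)" if "i : {1..k}" for i by (rule inc) (use that le in auto)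
  show "(\<Sum>s\<in>refl ?P. f s) = (\<Sum>i=1..Suc k. lin_ext f (tower_J T i))" for f
  by (rule sum_tower_J[where T = T and k = "Suc k", OF T0 _ _ no]) (use psubset_imp_subset[OF step] le arrD in simp_all)
  show "(\<Sum>s\<in>refl ?P. ?\<Delta> (y ** s ** x)) = A.reflection_sum \<theta> / \<theta> I1 * ?\<Delta> (y ** x)" if "x : ?P" "y : ?P" for x y
  by (rule A.defect_translate[OF data[OF le] Suc.prems(2) that])
  qed
  then obtain b where b: "b : tower_algebra W k T"
  "\<forall>x\<in>?P. \<forall>y\<in>?P. lin_ext (%w. ?\<Delta> (y ** w ** x)) a = lin_ext (%w. ?\<Delta> (y ** w ** x)) b" by blast
  have ab: "lin_ext ?\<Delta> a = lin_ext ?\<Delta> b"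
  using bspec[OF bspec[OF b(2) A.one_in] A.one_in] by simp
  have bQ: "b : carrier (group_algebra UNIV (mat_group ?Q))"
  by (rule tower_algebra_support[OF b(1)]) (use arrD[OF le'] inc le' in auto)
  have QP: "?Q \<subseteq> ?P" by (rule inc) (use le in auto)
  have lus: "lusztig_axioms D ?P ?Q" using ax par[OF le] par[OF le'] QP unfolding spetses_axioms_def by blast
  obtain l :: "('n cmat => complex) => nat" where l: "\<forall>w\<in>?Q. \<theta> w = (\<Sum>\<psi>\<in>Irr ?Q. of_nat (l \<psi>) * \<psi> w) &
  (of_int (pairing D ?P (U_elt D ?P \<theta>) (DL D ?P w)) :: complex)
  = (\<Sum>\<psi>\<in>Irr ?Q. of_nat (l \<psi>) * of_int (pairing D ?Q (U_elt D ?Q \<psi>) (DL D ?Q w)))"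
  using transform_restrict[OF arr[OF le] arr[OF le'] QP lus data(1)[OF le] data(1)[OF le'] Suc.prems(2)] by (elim exE)
  have inQ: "w : ?Q" if "b w ~= 0" for w using carrierD(2)[OF bQ that] by (simp add: mat_group_def)
  have sub: "lin_ext (%w. f w - g w) c = lin_ext f c - lin_ext g c" for f g c :: "'n cmat => complex"
  unfolding lin_ext_def right_diff_distrib sum_subtractf ..
  have "lin_ext \<theta> b = (\<Sum>\<psi>\<in>Irr ?Q. of_nat (l \<psi>) * lin_ext \<psi> b)"
  proof -
  have "lin_ext \<theta> b = lin_ext (%w. \<Sum>\<psi>\<in>Irr ?Q. of_nat (l \<psi>) * \<psi> w) b" by (rule lin_ext_cong) (use l inQ in blast)
  then show ?thesis unfolding lin_ext_sum_fun lin_ext_mult_fun_left .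
  qed
  moreover have "lin_ext (A.transform D \<theta>) b = (\<Sum>\<psi>\<in>Irr ?Q. of_nat (l \<psi>) * lin_ext (%w. of_int (pairing D ?Q (U_elt D ?Q \<psi>) (DL D ?Q w))) b)"
  proof -
  have "lin_ext (A.transform D \<theta>) b = lin_ext (%w. \<Sum>\<psi>\<in>Irr ?Q. of_nat (l \<psi>) * of_int (pairing D ?Q (U_elt D ?Q \<psi>) (DL D ?Q w))) b"
  by (rule lin_ext_cong) (use l inQ in \<open>simp add: A.transform_def\<close>)
  then show ?thesis unfolding lin_ext_sum_fun lin_ext_mult_fun_left .
  qed
  moreover have "(\<Sum>\<psi>\<in>Irr ?Q. of_nat (l \<psi>) * lin_ext \<psi> b) = (\<Sum>\<psi>\<in>Irr ?Q. of_nat (l \<psi>) * lin_ext (%w. of_int (pairing D ?Q (U_elt D ?Q \<psi>) (DL D ?Q w))) b)"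
  by (rule sum.cong[OF HOL.refl]) (simp only: Suc.IH[OF le' _ b(1)])
  ultimately have "lin_ext ?\<Delta> b = 0" unfolding sub by simp
  then have "lin_ext \<theta> a = lin_ext (A.transform D \<theta>) a" using ab unfolding sub by simp
  then show ?case unfolding A.transform_def[abs_def] .
 qed
qed

theorem proposition6:
 fixes W :: "('n::finite) cmat set"
  and x0 :: "complex ^ 'n"
  and m :: nat
  and \<tau> :: "'n cmat set \<Rightarrow> ('n braid \<Rightarrow> 'n hidx laurent) set \<Rightarrow> 'n hidx laurent"
  and D :: "('n, 'u) unipotent_data"
  and f :: "('n cmat \<Rightarrow> complex) \<Rightarrow> 'n cmat \<Rightarrow> complex"
  and \<theta> :: "'n cmat \<Rightarrow> complex"
 assumes "complex_reflection_group W"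
  and "x0 \<in> regular W"
  and trace_conjecture: "\<forall>P\<in>parabolics W. bmm_trace P x0 (\<tau> P)"
  and "m \<ge> 1" and splitting: "\<forall>P\<in>parabolics W. spetsial_splits m P x0"
  and "spetsial m W x0 (\<tau> W)"
  and "spetses_axioms D m W x0"
  and "truncated_fourier D W f"
  and "\<theta> \<in> class_functions W"
 shows "tower_equivalent W \<theta> (f \<theta>)"
proof -
 have W: "reflection_arrangement W x0"
  using assms(1,2) unfolding reflection_arrangement_def complex_reflection_group_def by blast
 interpret W: reflection_arrangement W x0 by (rule W)
 have alg: "spetsial_algebra P x0 m" if P: "P : parabolics W" for P
 proof (rule spetsial_algebra.intro[OF parabolic_arrangement[OF W P]], rule spetsial_algebra_axioms.intro)
  show "m \<ge> 1" by fact
  show "free_fg (laurent_ring (hidx_set P)) (generic_hecke P x0) (hecke_scal (laurent_ring (hidx_set P)) laurent_var P x0)"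
  using bspec[OF trace_conjecture P] unfolding bmm_trace_def Let_def symmetrizing_trace_def by (elim conjE)
  show "spetsial_splits m P x0" by (rule bspec[OF splitting P])
 qed
 have f_add: "f (%w. \<eta> w + \<psi> w) = (%w. f \<eta> w + f \<psi> w)" if "\<eta> : class_functions W" "\<psi> : class_functions W" for \<eta> \<psi>
  using \<open>truncated_fourier D W f\<close> that unfolding truncated_fourier_def by (elim conjE) blast
 have f_scale: "f (%w. c * \<eta> w) = (%w. c * f \<eta> w)" if "\<eta> : class_functions W" for c \<eta>
  using \<open>truncated_fourier D W f\<close> that unfolding truncated_fourier_def by (elim conjE) blast
 have f_Irr: "f \<psi> w = of_int (pairing D W (U_elt D W \<psi>) (DL D W w))" if "\<psi> : Irr W" "w : W" for \<psi> w
  using \<open>truncated_fourier D W f\<close> that unfolding truncated_fourier_def by (elim conjE) blast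
 obtain c where c: "\<theta> = (%w. \<Sum>\<psi>\<in>Irr W. c \<psi> * \<psi> w)" by (rule W.class_function_expansion[OF \<open>\<theta> : class_functions W\<close>])
 have cf: "(%w. \<Sum>\<psi>\<in>S. c \<psi> * \<psi> w) : class_functions W & f (%w. \<Sum>\<psi>\<in>S. c \<psi> * \<psi> w) = (%w. \<Sum>\<psi>\<in>S. c \<psi> * f \<psi> w)"
  if "finite S" "S \<subseteq> Irr W" for S
  using that
 proof (induction S rule: finite_induct)
  case empty
  have z: "(%w. 0) : class_functions W" unfolding class_functions_def by simp
  show ?case using z f_scale[OF z, of 0] by simp
 next
  case (insert \<psi> S)
  have \<psi>: "\<psi> : class_functions W" using insert.prems W.Irr_class_function by blast
  then have c\<psi>: "(%w. c \<psi> * \<psi> w) : class_functions W" unfolding class_functions_def by simp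
  have IH: "(%w. \<Sum>\<psi>\<in>S. c \<psi> * \<psi> w) : class_functions W" "f (%w. \<Sum>\<psi>\<in>S. c \<psi> * \<psi> w) = (%w. \<Sum>\<psi>\<in>S. c \<psi> * f \<psi> w)"
  using insert by auto
  have s: "(%w. \<Sum>\<psi>\<in>insert \<psi> S. c \<psi> * \<psi> w) = (%w. c \<psi> * \<psi> w + (\<Sum>\<psi>\<in>S. c \<psi> * \<psi> w))" using insert.hyps by simp
  have "(%w. c \<psi> * \<psi> w + (\<Sum>\<psi>\<in>S. c \<psi> * \<psi> w)) : class_functions W" using c\<psi> IH(1) unfolding class_functions_def by simp
  then show ?case unfolding s f_add[OF c\<psi> IH(1)] f_scale[OF \<psi>] IH(2) using insert.hyps by simp
 qed
 have f\<theta>: "f \<theta> = (%w. \<Sum>\<psi>\<in>Irr W. c \<psi> * f \<psi> w)" unfolding c by (rule conjunct2[OF cf[OF W.finite_Irr subset_refl]])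
 show ?thesis unfolding tower_equivalent_def T_equivalent_def
 proof (intro allI impI ballI)
  fix n T a assume T: "tower W n T" and a: "a : tower_algebra W n T"
  have TW: "T n = W" using T unfolding tower_def by blast
  have step: "T i \<subset> T (Suc i)" if "i < n" for i using T that unfolding tower_def by blast
  have inc: "T i \<subseteq> T k" if "i \<le> k" "k \<le> n" for i k
  by (rule tower_mono[where T = T, OF step that])
  have "a : carrier (group_algebra UNIV (mat_group W))"
  by (rule tower_algebra_support[OF a _ W.fin W.grp]) (use inc[of _ n] TW in auto)
  note supp = carrierD(2)[OF this]
  have e: "lin_ext \<psi> a = lin_ext (f \<psi>) a" if \<psi>: "\<psi> : Irr W" for \<psi>
  proof -
  have "lin_ext \<psi> a = lin_ext (%w. of_int (pairing D W (U_elt D W \<psi>) (DL D W w))) a"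
  using characters_equal_transform_on_tower[OF W alg \<open>spetses_axioms D m W x0\<close> T le_refl _ a, of \<psi>] \<psi> unfolding TW by simp
  also have "... = lin_ext (f \<psi>) a" by (rule lin_ext_cong) (use f_Irr[OF \<psi>] supp in \<open>simp add: mat_group_def\<close>)
  finally show ?thesis .
  qed
  show "lin_ext \<theta> a = lin_ext (f \<theta>) a"
  unfolding f\<theta> by (subst c) (simp add: lin_ext_sum_fun lin_ext_mult_fun_left e)
 qed
qed

end
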